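(* Let $N\ge2$, let $b^-<b^+$ be real constants, let $\Omega=\{x\in\mathbb{R}^N : b^-<x_N<b^+\}$, and let $1<p<\infty$. Assume that $\Psi:\dot{W}^{1,p}(\Omega)\to\mathbb{R}$ and $\Lambda:\operatorname{Tr}(\dot{W}^{1,p}(\Omega))\to\mathbb{R}$ are linear functionals satisfying $\Psi(k)+\Lambda(k)=0$ for every constant $k\in\mathbb{R}$ (viewed as a constant function on $\Omega$ and on $\partial\Omega$ respectively). Suppose that $G:\Omega\times\mathbb{R}^N\to\mathbb{R}$ is a $p$-admissible Lagrangian. Set $\Lambda_1(v):=\Lambda(\operatorname{Tr}(v))$ for $v\in\dot{W}^{1,p}(\Omega)$. Then the quasilinear Neumann problem $$\begin{cases}-\operatorname{div}(\nabla_\xi G(\cdot,\nabla u))=\Psi&\text{in }\Omega,\\\nabla_\xi G(\cdot,\nabla u)\cdot\nu=\Lambda&\text{on }\partial\Omega\end{cases}$$ admits a weak solution in $\dot{W}^{1,p}(\Omega)$ if and only if there exists $c>0$ such that $$|\Psi(v)+\Lambda_1(v)|\le c\|\nabla v\|_{L^p(\Omega)}$$ for every $v\in\dot{W}^{1,p}(\Omega)$. In either case, there exists a constant $c=c(N,p,A_-)$ such that $$\int_\Omega|\nabla u(x)|^p\,dx\le c\int_\Omega\big[|G(x,0)|+|\psi_-(x)|\big]\,dx+c\,\|\Psi+\Lambda_1\|^{p'}_{(\dot{W}^{1,p}(\Omega))'},$$ and $u$ minimizes the energy functional $F:\dot{W}^{1,p}(\Omega)\to\mathbb{R}$ given by $$F(v)=\int_\Omega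 G(x,\nabla v(x))\,dx-\Psi(v)-\Lambda_1(v).$$
   Context: $1/p+1/p'=1$. A function $G:\Omega\times\mathbb{R}^N\to\mathbb{R}$ is a $p$-admissible Lagrangian if: (1) for each $\xi\in\mathbb{R}^N$, $G(\cdot,\xi)$ is measurable on $\Omega$, and for a.e. $x\in\Omega$, $G(x,\cdot)$ is continuously differentiable on $\mathbb{R}^N$; (2) for a.e. $x\in\Omega$, $G(x,\cdot)$ is convex; (3) there are $A_-\in(0,\infty)$ and $\psi_-\in L^1(\Omega)$ with $A_-|\xi|^p-\psi_-(x)\le G(x,\xi)$ for a.e. $x\in\Omega$ and every $\xi\in\mathbb{R}^N$; (4) there are $A_+\in(0,\infty)$ and $\psi_+\in L^{p'}(\Omega)$ with $|\nabla_\xi G(x,\xi)|\le\psi_+(x)+A_+|\xi|^{p-1}$ for a.e. $x\in\Omega$ and every $\xi\in\mathbb{R}^N$; (5) $G(\cdot,0)\in L^1(\Omega)$. $\dot{W}^{1,p}(\Omega)$ is the space of real-valued $u\in L^1_{\mathrm{loc}}(\Omega)$ whose first-order weak derivatives all belong to $L^p(\Omega)$, with seminorm $\|\nabla u\|_{L^p(\Omega)}$. $\operatorname{Tr}:\dot{W}^{1,p}(\Omega)\to L^p_{\mathrm{loc}}(\partial\Omega)$ is the usual Sobolev boundary trace ($u\in W^{1,p}$ on bounded Lipschitz subdomains of $\Omega$), and $\operatorname{Tr}(\dot{W}^{1,p}(\Omega))$ is its image. A weak solution of the Neumann problem is a $u\in\dot{W}^{1,p}(\Omega)$ with $$\int_\Omega\nabla_\xi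 G(x,\nabla u(x))\cdot\nabla v(x)\,dx=\Psi(v)+\Lambda(\operatorname{Tr}(v))\quad\text{for all }v\in\dot{W}^{1,p}(\Omega).$$ For a linear functional $T$ on $\dot{W}^{1,p}(\Omega)$, $\|T\|_{(\dot{W}^{1,p}(\Omega))'}:=\sup\{|T(v)| : \|\nabla v\|_{L^p(\Omega)}\le1\}$. $\nu$ is the outward unit normal. *)

theory Defs
  imports "HOL-Analysis.Analysis"
begin

text \<open>
  The space \<open>\<real>\<^sup>N\<close> is an arbitrary type \<open>'a\<close> of class \<open>euclidean_space\<close>, with \<open>N = DIM('a)\<close>;
  the last coordinate \<open>x\<^sub>N\<close> is \<open>x \<bullet> e\<close> for a fixed basis vector \<open>e\<close>.
  Elements of Lebesgue and Sobolev spaces are represented by functions;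
  functionals on these spaces are required to respect equality almost everywhere.
\<close>

section \<open>Gradients and smooth functions\<close>

definition grad :: "('a::euclidean_space \<Rightarrow> real) \<Rightarrow> 'a \<Rightarrow> 'a" where
  "grad f x = (THE D. GDERIV f x :> D)"

primrec Ck :: "nat \<Rightarrow> ('a::euclidean_space \<Rightarrow> real) \<Rightarrow> bool" where
  "Ck 0 f \<longleftrightarrow> continuous_on UNIV f"
| "Ck (Suc n) f \<longleftrightarrow> (\<forall>x. f differentiable (at x)) \<and> (\<forall>i\<in>Basis. Ck n (\<lambda>x. grad f x \<bullet> i))"

definition test_functions :: "'a::euclidean_space set \<Rightarrow> ('a \<Rightarrow> real) set" where
  "test_functions \<Omega> = {\<phi>. (\<forall>n. Ck n \<phi>) \<and> compact (closure {x. \<phi> x \<noteq> 0}) \<and> closure {x. \<phi> x \<noteq> 0} \<subseteq> \<Omega>}"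


section \<open>Lebesgue and homogeneous Sobolev spaces\<close>

definition in_Lp :: "'a measure \<Rightarrow> real \<Rightarrow> ('a \<Rightarrow> 'b::euclidean_space) \<Rightarrow> bool" where
  "in_Lp M p f \<longleftrightarrow> f \<in> borel_measurable M \<and> integrable M (\<lambda>x. norm (f x) powr p)"

definition Lp_norm :: "'a measure \<Rightarrow> real \<Rightarrow> ('a \<Rightarrow> 'b::euclidean_space) \<Rightarrow> real" where
  "Lp_norm M p f = (LINT x|M. norm (f x) powr p) powr (1 / p)"

definition conj_exp :: "real \<Rightarrow> real" where
  "conj_exp p = p / (p - 1)"

definition in_L1_loc :: "'a::euclidean_space set \<Rightarrow> ('a \<Rightarrow> 'b::euclidean_space) \<Rightarrow> bool" where
  "in_L1_loc \<Omega> u \<longleftrightarrow> u \<in> borel_measurable (lebesgue_on \<Omega>) \<and>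
     (\<forall>K. compact K \<and> K \<subseteq> \<Omega> \<longrightarrow> u absolutely_integrable_on K)"

definition is_weak_grad :: "'a::euclidean_space set \<Rightarrow> ('a \<Rightarrow> real) \<Rightarrow> ('a \<Rightarrow> 'a) \<Rightarrow> bool" where
  "is_weak_grad \<Omega> u D \<longleftrightarrow> in_L1_loc \<Omega> D \<and>
     (\<forall>\<phi>\<in>test_functions \<Omega>. \<forall>i\<in>Basis.
        (LINT x|lebesgue_on \<Omega>. u x * (grad \<phi> x \<bullet> i)) = - (LINT x|lebesgue_on \<Omega>. (D x \<bullet> i) * \<phi> x))"

definition weak_grad :: "'a::euclidean_space set \<Rightarrow> ('a \<Rightarrow> real) \<Rightarrow> 'a \<Rightarrow> 'a" where
  "weak_grad \<Omega> u = (SOME D. is_weak_grad \<Omega> u D)"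

definition hom_sobolev :: "'a::euclidean_space set \<Rightarrow> real \<Rightarrow> ('a \<Rightarrow> real) set" where
  "hom_sobolev \<Omega> p = {u. in_L1_loc \<Omega> u \<and> (\<exists>D. is_weak_grad \<Omega> u D \<and> in_Lp (lebesgue_on \<Omega>) p D)}"

definition hom_seminorm :: "'a::euclidean_space set \<Rightarrow> real \<Rightarrow> ('a \<Rightarrow> real) \<Rightarrow> real" where
  "hom_seminorm \<Omega> p u = Lp_norm (lebesgue_on \<Omega>) p (weak_grad \<Omega> u)"

text \<open>A real supremum, hence meaningful only for functionals bounded on the unit ball.\<close>

definition dual_norm :: "'a::euclidean_space set \<Rightarrow> real \<Rightarrow> (('a \<Rightarrow> real) \<Rightarrow> real) \<Rightarrow> real" where
  "dual_norm \<Omega> p T = (SUP v\<in>{v \<in> hom_sobolev \<Omega> p. hom_seminorm \<Omega> p v \<le> 1}. \<bar>T v\<bar>)"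

text \<open>Linear functionals on the space of classes of functions of \<open>V\<close> modulo equality
  \<open>M\<close>-almost everywhere.\<close>

definition linear_functional :: "'a measure \<Rightarrow> ('a \<Rightarrow> real) set \<Rightarrow> (('a \<Rightarrow> real) \<Rightarrow> real) \<Rightarrow> bool" where
  "linear_functional M V L \<longleftrightarrow>
     (\<forall>u\<in>V. \<forall>v\<in>V. L (\<lambda>x. u x + v x) = L u + L v) \<and>
     (\<forall>a. \<forall>u\<in>V. L (\<lambda>x. a * u x) = a * L u) \<and>
     (\<forall>u\<in>V. \<forall>v\<in>V. (AE x in M. u x = v x) \<longrightarrow> L u = L v)"


section \<open>The slab, its boundary and the trace operator\<close>

definition slab :: "'a::euclidean_space \<Rightarrow> real \<Rightarrow> real \<Rightarrow> 'a set" where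
  "slab e b1 b2 = {x. b1 < x \<bullet> e \<and> x \<bullet> e < b2}"

text \<open>Surface measure on the boundary \<open>{b1, b2} \<times> \<real>\<^bsup>N-1\<^esup>\<close> of the slab: \<open>(N-1)\<close>-dimensional
  Lebesgue measure on each of the two hyperplanes \<open>x \<bullet> e = b1\<close> and \<open>x \<bullet> e = b2\<close>, completed,
  and regarded as a measure on the whole space.\<close>

definition slab_surface :: "'a::euclidean_space \<Rightarrow> real \<Rightarrow> real \<Rightarrow> 'a measure" where
  "slab_surface e b1 b2 = completion (distr
     (count_space {b1, b2} \<Otimes>\<^sub>M (\<Pi>\<^sub>M b\<in>Basis - {e}. lborel)) borel
     (\<lambda>(t, y). t *\<^sub>R e + (\<Sum>b\<in>Basis - {e}. y b *\<^sub>R b)))"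

definition in_Lp_loc_bdry :: "'a::euclidean_space \<Rightarrow> real \<Rightarrow> real \<Rightarrow> real \<Rightarrow> ('a \<Rightarrow> real) \<Rightarrow> bool" where
  "in_Lp_loc_bdry e b1 b2 p g \<longleftrightarrow> g \<in> borel_measurable (slab_surface e b1 b2) \<and>
     (\<forall>K. compact K \<longrightarrow> set_integrable (slab_surface e b1 b2) K (\<lambda>x. \<bar>g x\<bar> powr p))"

text \<open>The trace is the continuous extension of the restriction \<open>U \<mapsto> U|\<partial>\<Omega>\<close> of functions \<open>U\<close> that are
  continuously differentiable up to the boundary: \<open>g\<close> is the trace of \<open>u\<close> if such functions converge
  to \<open>u\<close> in \<open>W\<^bsup>1,p\<^esup>\<close> on all bounded pieces of the slab and their restrictions converge to \<open>g\<close> in \<open>L\<^bsup>p\<^esup>\<close> on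
  all bounded pieces of the boundary.\<close>

definition is_trace :: "'a::euclidean_space \<Rightarrow> real \<Rightarrow> real \<Rightarrow> real \<Rightarrow> ('a \<Rightarrow> real) \<Rightarrow> ('a \<Rightarrow> real) \<Rightarrow> bool" where
  "is_trace e b1 b2 p u g \<longleftrightarrow> in_Lp_loc_bdry e b1 b2 p g \<and>
     (\<exists>U::nat \<Rightarrow> 'a \<Rightarrow> real. (\<forall>j. Ck 1 (U j)) \<and>
       (\<forall>R>0.
         (\<lambda>j. \<integral>\<^sup>+x\<in>ball 0 R. ennreal (\<bar>U j x - u x\<bar> powr p) \<partial>lebesgue_on (slab e b1 b2)) \<longlonglongrightarrow> 0 \<and>
         (\<lambda>j. \<integral>\<^sup>+x\<in>ball 0 R. ennreal (norm (grad (U j) x - weak_grad (slab e b1 b2) u x) powr p)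
                \<partial>lebesgue_on (slab e b1 b2)) \<longlonglongrightarrow> 0 \<and>
         (\<lambda>j. \<integral>\<^sup>+x\<in>ball 0 R. ennreal (\<bar>U j x - g x\<bar> powr p) \<partial>slab_surface e b1 b2) \<longlonglongrightarrow> 0))"

definition Tr :: "'a::euclidean_space \<Rightarrow> real \<Rightarrow> real \<Rightarrow> real \<Rightarrow> ('a \<Rightarrow> real) \<Rightarrow> 'a \<Rightarrow> real" where
  "Tr e b1 b2 p u = (SOME g. is_trace e b1 b2 p u g)"

definition trace_space :: "'a::euclidean_space \<Rightarrow> real \<Rightarrow> real \<Rightarrow> real \<Rightarrow> ('a \<Rightarrow> real) set" where
  "trace_space e b1 b2 p = {g. \<exists>u\<in>hom_sobolev (slab e b1 b2) p. is_trace e b1 b2 p u g}"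


section \<open>Admissible Lagrangians, weak solutions and the energy\<close>

text \<open>The constant \<open>A\<close> and the function \<open>\<psi>\<close> of the lower growth bound are parameters, because the a priori
  estimate refers to them; the data of the upper growth bound are existentially quantified.\<close>

definition admissible_Lagrangian ::
  "'a::euclidean_space set \<Rightarrow> real \<Rightarrow> ('a \<Rightarrow> 'a \<Rightarrow> real) \<Rightarrow> real \<Rightarrow> ('a \<Rightarrow> real) \<Rightarrow> bool" where
  "admissible_Lagrangian \<Omega> p G A \<psi> \<longleftrightarrow>
     (\<forall>\<xi>. (\<lambda>x. G x \<xi>) \<in> borel_measurable (lebesgue_on \<Omega>)) \<and>
     (AE x in lebesgue_on \<Omega>. Ck 1 (G x)) \<and>
     (AE x in lebesgue_on \<Omega>. convex_on UNIV (G x)) \<and>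
     (0 < A \<and> in_Lp (lebesgue_on \<Omega>) 1 \<psi> \<and>
       (AE x in lebesgue_on \<Omega>. \<forall>\<xi>. A * norm \<xi> powr p - \<psi> x \<le> G x \<xi>)) \<and>
     (\<exists>B \<psi>'. 0 < B \<and> in_Lp (lebesgue_on \<Omega>) (conj_exp p) \<psi>' \<and>
       (AE x in lebesgue_on \<Omega>. \<forall>\<xi>. norm (grad (G x) \<xi>) \<le> \<psi>' x + B * norm \<xi> powr (p - 1))) \<and>
     in_Lp (lebesgue_on \<Omega>) 1 (\<lambda>x. G x 0)"

definition neumann_weak_solution ::
  "'a::euclidean_space \<Rightarrow> real \<Rightarrow> real \<Rightarrow> real \<Rightarrow> ('a \<Rightarrow> 'a \<Rightarrow> real) \<Rightarrow>
   (('a \<Rightarrow> real) \<Rightarrow> real) \<Rightarrow> (('a \<Rightarrow> real) \<Rightarrow> real) \<Rightarrow> ('a \<Rightarrow> real) \<Rightarrow> bool" where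
  "neumann_weak_solution e b1 b2 p G \<Psi> \<Lambda> u \<longleftrightarrow>
     u \<in> hom_sobolev (slab e b1 b2) p \<and>
     (\<forall>v\<in>hom_sobolev (slab e b1 b2) p.
        (LINT x|lebesgue_on (slab e b1 b2).
           grad (G x) (weak_grad (slab e b1 b2) u x) \<bullet> weak_grad (slab e b1 b2) v x)
        = \<Psi> v + \<Lambda> (Tr e b1 b2 p v))"

definition energy ::
  "'a::euclidean_space \<Rightarrow> real \<Rightarrow> real \<Rightarrow> real \<Rightarrow> ('a \<Rightarrow> 'a \<Rightarrow> real) \<Rightarrow>
   (('a \<Rightarrow> real) \<Rightarrow> real) \<Rightarrow> (('a \<Rightarrow> real) \<Rightarrow> real) \<Rightarrow> ('a \<Rightarrow> real) \<Rightarrow> real" where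
  "energy e b1 b2 p G \<Psi> \<Lambda> v =
     (LINT x|lebesgue_on (slab e b1 b2). G x (weak_grad (slab e b1 b2) v x)) - \<Psi> v - \<Lambda> (Tr e b1 b2 p v)"

end

theory Submission
  imports Defs "HOL-Computational_Algebra.Polynomial"
begin

text \<open>
  A weak solution is a critical point of the convex energy. Its gradient is found directly in the
  closed subspace of gradients in \<open>L\<^sup>p\<close>: elements of almost minimal \<open>L\<^sup>p\<close> norm in the nested convex
  sublevel sets of the energy form a Cauchy sequence by uniform convexity, and by Fatou's lemma
  their limit is a minimizer; differentiating the energy along lines gives the Neumann problem.
  Conversely, for a weak solution the functional is represented by \<open>\<nabla>\<^sub>\<xi>G(x, \<nabla>u) \<in> L\<^sup>p\<^sup>'\<close>, hence bounded;
  testing with the solution itself gives the a priori estimate, and convexity gives minimality.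

  That gradients form a closed subspace, and that the boundary functional composed with the trace is
  linear, rests on smooth approximation: contracting the variable slightly towards a point of the
  middle hyperplane and mollifying turns a Sobolev function into functions that are continuously
  differentiable up to the boundary. The Poincare and trace inequalities are proved for these and
  passed to the limit.
\<close>

section \<open>Convexity inequalities and completeness of Lebesgue spaces\<close>

text \<open>Two obstacles shape the proof. First, \<open>hom_sobolev\<close> has only a seminorm and
  the slab is unbounded: a function need not be p-integrable, and Poincare's inequality is available
  on bounded pieces only. Minimization is therefore carried out among gradients, where additive
  constants have disappeared; the seminorm bound is exactly what lets the functional depend on the
  gradient alone. To recover a function from a limit of gradients, the approximating functions are
  normalised by their mean over one fixed piece; without this, their free constants would prevent
  convergence. Second, \<open>weak_grad\<close> and \<open>Tr\<close> are choices, determined only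
  almost everywhere, so each linearity statement about them rests on an almost-everywhere uniqueness
  theorem. The constant of the estimate comes from \<open>A * s powr p \<le> I + K * s\<close>,
  where \<open>s\<close> is the seminorm of the solution and \<open>K\<close> the dual norm: Young's
  inequality absorbs \<open>K * s\<close> into half of the left side, which leaves
  \<open>2 / A\<close> and \<open>2 / A * (2 / A) powr (1 / (p - 1))\<close>.\<close>

lemma powr_tangent_strict:
  fixes p x m :: real
  assumes "1 < p" "0 < m" "0 \<le> x" "x \<noteq> m"
  shows "m powr p + p * m powr (p - 1) * (x - m) < x powr p"
proof -
  \<comment> \<open>Up to a constant, \<open>\<phi>\<close> is the gap between the power and its
    tangent at \<open>m\<close>; its derivative has the sign of \<open>t - m\<close>, so
    \<open>m\<close> is the strict minimum. The derivative is taken at positive \<open>t\<close>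
    only, and continuity covers the endpoint \<open>x = 0\<close>.\<close>
  define \<phi> where "\<phi> t = t powr p - p * m powr (p - 1) * t" for t
  have cont: "continuous_on {a..b} \<phi>" if "0 \<le> a" for a b
    unfolding \<phi>_def using that assms by (intro continuous_intros continuous_on_powr') auto
  have der: "(\<phi> has_real_derivative p * (t powr (p - 1) - m powr (p - 1))) (at t)" if "0 < t" for t
    unfolding \<phi>_def using that by (auto intro!: derivative_eq_intros simp: algebra_simps)
  have "\<phi> m < \<phi> x"
  proof (cases "x < m")
    case True
    have "\<exists>y. (\<phi> has_real_derivative y) (at t) \<and> y < 0" if "x < t" "t < m" for t
      using der[of t] that assms
      by (intro exI[of _ "p * (t powr (p - 1) - m powr (p - 1))"]) (auto intro!: mult_pos_neg simp: powr_less_mono2)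
    from DERIV_neg_imp_decreasing_open[OF True this] show ?thesis
      using cont[of x m] assms by auto
  next
    case False
    then have "m < x" using assms by auto
    have "\<exists>y. (\<phi> has_real_derivative y) (at t) \<and> y > 0" if "m < t" "t < x" for t
      using der[of t] that assms
      by (intro exI[of _ "p * (t powr (p - 1) - m powr (p - 1))"]) (auto intro!: mult_pos_pos simp: powr_less_mono2)
    from DERIV_pos_imp_increasing_open[OF \<open>m < x\<close> this] show ?thesis
      using cont[of m x] assms by auto
  qed
  then show ?thesis
    by (simp add: \<phi>_def algebra_simps)
qed

text \<open>The non-strict form admits the exponent 1, which Jensen's inequality needs when
  mollification is studied in \<open>L^1\<close>.\<close>

lemma powr_tangent:
  fixes q x m :: real
  assumes "1 \<le> q" "0 < m" "0 \<le> x"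
  shows "m powr q + q * m powr (q - 1) * (x - m) \<le> x powr q"
proof (cases "q = 1 \<or> x = m")
  case True
  then show ?thesis using assms by auto
next
  case False
  then show ?thesis using powr_tangent_strict[of q m x] assms by auto
qed

text \<open>A sum is at most twice the larger norm. This crude bound serves throughout as a triangle
  inequality for integrals of q-th powers, so that no roots have to be taken.\<close>

lemma powr_norm_add_le:
  fixes a b :: "'a::real_normed_vector"
  assumes "0 \<le> q"
  shows "norm (a + b) powr q \<le> 2 powr q * (norm a powr q + norm b powr q)"
proof -
  have "norm (a + b) \<le> 2 * max (norm a) (norm b)"
    using norm_triangle_ineq[of a b] by auto
  then have "norm (a + b) powr q \<le> (2 * max (norm a) (norm b)) powr q"
    using assms by (intro powr_mono2) auto
  also have "\<dots> = 2 powr q * max (norm a) (norm b) powr q"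
    by (auto simp: powr_mult)
  also have "\<dots> \<le> 2 powr q * (norm a powr q + norm b powr q)"
    by (auto simp: max_def)
  finally show ?thesis .
qed

text \<open>Strictness has two sources: for equal norms the parallelogram law, for different norms
  the strict convexity of the real power.\<close>

lemma powr_norm_midpoint_less:
  fixes a b :: "'a::euclidean_space"
  assumes "1 < p" "a \<noteq> b"
  shows "norm ((1/2) *\<^sub>R (a + b)) powr p < (norm a powr p + norm b powr p) / 2"
proof (cases "norm a = norm b")
  case True
  then have "0 < norm a" using assms by auto
  have "(norm ((1/2) *\<^sub>R (a + b)))\<^sup>2 < (norm a)\<^sup>2"
  proof -
    have "(norm ((1/2) *\<^sub>R (a + b)))\<^sup>2 + (norm ((1/2) *\<^sub>R (a - b)))\<^sup>2 = ((norm a)\<^sup>2 + (norm b)\<^sup>2) / 2"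
      by (simp add: power2_norm_eq_inner inner_simps field_simps inner_commute)
    moreover have "(norm ((1/2) *\<^sub>R (a - b)))\<^sup>2 > 0"
      using assms by simp
    moreover have "X < Z" if "X + Y = (Z + Z) / 2" "0 < Y" for X Y Z :: real
      using that by (simp add: mult_2[symmetric])
    ultimately show ?thesis unfolding True by blast
  qed
  then have "norm ((1/2) *\<^sub>R (a + b)) < norm a"
    by (meson norm_ge_zero not_less power_mono)
  then have "norm ((1/2) *\<^sub>R (a + b)) powr p < norm a powr p"
    using assms by (intro powr_less_mono2) auto
  then show ?thesis using True by auto
next
  case False
  \<comment> \<open>Both tangents are taken at the mean of the norms, so that their linear terms
    cancel in the sum; the mean is positive because the norms differ.\<close>
  define m where "m = (norm a + norm b) / 2"
  have "m > 0" unfolding m_def using False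
    by (cases "a = 0") (auto intro: add_pos_nonneg)
  have "m powr p + p * m powr (p - 1) * (norm a - m) < norm a powr p"
    "m powr p + p * m powr (p - 1) * (norm b - m) < norm b powr p"
    using powr_tangent_strict[of p m "norm a"] powr_tangent_strict[of p m "norm b"] assms \<open>m > 0\<close> False
    by (auto simp: m_def)
  then have "2 * m powr p + p * m powr (p - 1) * ((norm a - m) + (norm b - m)) < norm a powr p + norm b powr p"
    by (simp add: algebra_simps)
  moreover have "(norm a - m) + (norm b - m) = 0" by (simp add: m_def)
  ultimately have "m powr p < (norm a powr p + norm b powr p) / 2" by simp
  moreover have "norm ((1/2) *\<^sub>R (a + b)) \<le> m"
    using norm_triangle_ineq[of a b] by (simp add: m_def)
  then have "norm ((1/2) *\<^sub>R (a + b)) powr p \<le> m powr p"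
    using assms by (intro powr_mono2) auto
  ultimately show ?thesis by simp
qed

text \<open>A pointwise form of the uniform convexity of \<open>L\<^sup>p\<close>: by homogeneity it suffices to compare
  both sides on a compact set, where strict convexity gives a positive lower bound.\<close>

lemma powr_norm_uniform_convexity:
  assumes "1 < p" "0 < \<epsilon>"
  shows "\<exists>K\<ge>0. \<forall>a b::'a::euclidean_space. norm (a - b) powr p \<le> \<epsilon> * (norm a powr p + norm b powr p)
    + K * ((norm a powr p + norm b powr p) / 2 - norm ((1/2) *\<^sub>R (a + b)) powr p)"
proof -
  define h where "h z = (norm (fst z) powr p + norm (snd z) powr p) / 2 - norm ((1/2) *\<^sub>R (fst z + snd z)) powr p"
    for z :: "'a \<times> 'a"
  \<comment> \<open>Normalised pairs whose distance is not yet controlled by the term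
    \<open>\<epsilon>\<close>. Outside this set that term alone bounds the left side.\<close>
  define S where "S = {z::'a\<times>'a. norm (fst z) powr p + norm (snd z) powr p = 1 \<and> \<epsilon> \<le> norm (fst z - snd z) powr p}"
  have h0: "0 \<le> h z" for z
    using powr_norm_midpoint_less[OF assms(1), of "fst z" "snd z"] unfolding h_def
    by (cases "fst z = snd z") (auto simp: scaleR_2[symmetric])
  have "closed S"
    unfolding S_def
    using assms by (intro closed_Collect_conj closed_Collect_eq closed_Collect_le continuous_intros continuous_on_powr') auto
  moreover have "bounded S"
  proof -
    have "norm (fst z) \<le> 1 \<and> norm (snd z) \<le> 1" if "z \<in> S" for z
    proof -
      have "norm (fst z) powr p \<le> 1 powr p" "norm (snd z) powr p \<le> 1 powr p"
        using that powr_ge_zero[of "norm (fst z)" p] powr_ge_zero[of "norm (snd z)" p]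
        unfolding S_def powr_one_eq_one mem_Collect_eq by linarith+
      then show ?thesis
        using assms powr_less_mono2[of p 1 "norm (fst z)"] powr_less_mono2[of p 1 "norm (snd z)"] by fastforce
    qed
    then have "norm z \<le> 2" if "z \<in> S" for z
      using that norm_Pair_le[of "fst z" "snd z"] by fastforce
    then show ?thesis unfolding bounded_iff by blast
  qed
  ultimately have "compact S" by (simp add: compact_eq_bounded_closed)
  have conth: "continuous_on S h"
    unfolding h_def using assms by (intro continuous_intros continuous_on_powr') auto
  obtain m where m: "0 < m" "\<And>z. z \<in> S \<Longrightarrow> m \<le> h z"
  proof (cases "S = {}")
    case True
    then show ?thesis using that[of 1] by auto
  next
    case False
    obtain z where z: "z \<in> S" "\<And>y. y \<in> S \<Longrightarrow> h z \<le> h y"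
      using continuous_attains_inf[OF \<open>compact S\<close> False conth] by auto
    have "fst z \<noteq> snd z" using z(1) assms by (auto simp: S_def)
    then have "0 < h z" using powr_norm_midpoint_less[OF assms(1), of "fst z" "snd z"] by (simp add: h_def)
    then show ?thesis using that z by auto
  qed
  \<comment> \<open>On \<open>S\<close> the crude bound \<open>2 powr p\<close> is paid for by
    \<open>m\<close>, the positive lower bound of the convexity gap \<open>h\<close>.\<close>
  have norm1: "norm (a - b) powr p \<le> \<epsilon> + (2 * 2 powr p / m) * h (a, b)"
    if "norm a powr p + norm b powr p = 1" for a b
  proof (cases "(a, b) \<in> S")
    case True
    have "norm (a - b) powr p \<le> 2 powr p * 1"
      using powr_norm_add_le[of p a "-b"] that assms by auto
    also have "\<dots> \<le> (2 powr p / m) * h (a, b)"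
      using m(2)[OF True] m(1) by (auto simp: field_simps)
    also have "\<dots> \<le> (2 * 2 powr p / m) * h (a, b)"
      using m(1) h0[of "(a,b)"] by (intro mult_right_mono divide_right_mono) auto
    finally show ?thesis using assms by auto
  next
    case False
    then show ?thesis using that h0[of "(a,b)"] m(1) by (auto simp: S_def intro: add_increasing2)
  qed
  have "norm (a - b) powr p \<le> \<epsilon> * (norm a powr p + norm b powr p)
    + (2 * 2 powr p / m) * ((norm a powr p + norm b powr p) / 2 - norm ((1/2) *\<^sub>R (a + b)) powr p)" for a b :: 'a
  proof (cases "norm a powr p + norm b powr p = 0")
    case True
    then have "a = 0" "b = 0"
      using powr_ge_zero[of "norm a" p] powr_ge_zero[of "norm b" p] by (auto simp: add_nonneg_eq_0_iff)
    then show ?thesis by simp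
  next
    case False
    define s where "s = norm a powr p + norm b powr p"
    have s: "0 < s" using False powr_ge_zero[of "norm a" p] powr_ge_zero[of "norm b" p]
      unfolding s_def by linarith
    \<comment> \<open>The scaling that normalises the sum of the p-th powers to 1; both sides of the
      claim are homogeneous of degree \<open>p\<close>.\<close>
    define t where "t = s powr (-1/p)"
    have t: "0 < t" "t powr p * s = 1"
    proof -
    have "t powr p = s powr (-1)" unfolding t_def powr_powr using assms by simp
    then show "t powr p * s = 1" using s by (simp add: powr_minus)
  qed (use s in \<open>simp add: t_def\<close>)
    have sc: "norm (t *\<^sub>R w) powr p = t powr p * norm w powr p" for w :: 'a
      using t by (simp add: powr_mult)
    have "norm (t *\<^sub>R a) powr p + norm (t *\<^sub>R b) powr p = 1"
      unfolding sc using t by (simp add: s_def algebra_simps)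
    from norm1[OF this] have 1: "norm (t *\<^sub>R (a - b)) powr p \<le> \<epsilon> + (2 * 2 powr p / m) * h (t *\<^sub>R a, t *\<^sub>R b)"
      by (simp add: algebra_simps)
    have "h (t *\<^sub>R a, t *\<^sub>R b) = t powr p * h (a, b)"
    proof -
      have "norm ((1/2) *\<^sub>R (t *\<^sub>R a + t *\<^sub>R b)) powr p = norm (t *\<^sub>R ((1/2) *\<^sub>R (a + b))) powr p"
        by (simp add: algebra_simps)
      then show ?thesis unfolding h_def fst_conv snd_conv sc by (simp add: algebra_simps)
    qed
    with 1 have "t powr p * norm (a - b) powr p \<le> t powr p * (\<epsilon> * s + (2 * 2 powr p / m) * h (a, b))"
      unfolding sc using t by (simp add: algebra_simps)
    then have "norm (a - b) powr p \<le> \<epsilon> * s + (2 * 2 powr p / m) * h (a, b)"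
      using t by (simp add: mult_le_cancel_left)
    then show ?thesis by (simp add: h_def s_def)
  qed
  then show ?thesis using m(1) by (intro exI[of _ "2 * 2 powr p / m"]) auto
qed

text \<open>The Riesz-Fischer theorem for convergence on each set of an exhaustion. With all sets
  equal to the space it gives completeness of \<open>L^p\<close>, with bounded sets that of local
  \<open>L^p\<close>; integrals of p-th powers replace norms and quotient spaces.\<close>

lemma Lp_complete_local:
  fixes f :: "nat \<Rightarrow> 'x \<Rightarrow> 'b::euclidean_space"
  assumes p: "0 < p"
    and f[measurable]: "\<And>n. f n \<in> borel_measurable M"
    and B[measurable]: "\<And>n. B n \<in> sets M" and inc: "incseq B" and cover: "(\<Union>n. B n) = space M"
    and cauchy: "\<And>n \<delta>::real. 0 < \<delta> \<Longrightarrow> \<exists>N. \<forall>i\<ge>N. \<forall>j\<ge>N.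
       (\<integral>\<^sup>+x\<in>B n. ennreal (norm (f i x - f j x) powr p) \<partial>M) \<le> ennreal \<delta>"
  shows "\<exists>g\<in>borel_measurable M. (\<exists>r::nat \<Rightarrow> nat. strict_mono r \<and> (AE x in M. (\<lambda>k. f (r k) x) \<longlonglongrightarrow> g x)) \<and>
     (\<forall>n. (\<lambda>i. \<integral>\<^sup>+x\<in>B n. ennreal (norm (f i x - g x) powr p) \<partial>M) \<longlonglongrightarrow> 0)"
proof -
  \<comment> \<open>The factor \<open>(1/2) powr (n * p)\<close> in the tolerance cancels the weight
    \<open>2 powr (n * p)\<close> used below, and \<open>(1/2) ^ n\<close> keeps the weighted
    integrals summable.\<close>
  obtain N where N: "\<And>n i j. N n \<le> i \<Longrightarrow> N n \<le> j \<Longrightarrow>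
      (\<integral>\<^sup>+x\<in>B n. ennreal (norm (f i x - f j x) powr p) \<partial>M) \<le> ennreal ((1/2) powr (n * p) * (1/2) ^ n)"
  proof -
    have "\<forall>n. \<exists>N. \<forall>i\<ge>N. \<forall>j\<ge>N. (\<integral>\<^sup>+x\<in>B n. ennreal (norm (f i x - f j x) powr p) \<partial>M)
        \<le> ennreal ((1/2) powr (n * p) * (1/2) ^ n)"
      by (intro allI cauchy) simp
    from choice[OF this] show ?thesis using that by blast
  qed
  define r where "r = rec_nat (N 0) (\<lambda>n s. max (Suc s) (N (Suc n)))"
  have r_Suc: "r (Suc n) = max (Suc (r n)) (N (Suc n))" and r_0: "r 0 = N 0" for n
    by (auto simp: r_def)
  have r: "strict_mono r" by (auto simp: strict_mono_Suc_iff r_Suc)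
  have rN: "N n \<le> r n" for n by (cases n) (auto simp: r_0 r_Suc)
  have rN': "N n \<le> r (Suc n)" for n using rN[of n] r by (meson le_trans lessI less_imp_le strict_monoD)
  define D where "D k x = norm (f (r (Suc k)) x - f (r k) x)" for k x
  have [measurable]: "D k \<in> borel_measurable M" for k unfolding D_def by measurable
  have "(\<integral>\<^sup>+x. (\<Sum>k. ennreal (2 powr (k * p) * D k x powr p) * indicator (B k) x) \<partial>M)
    = (\<Sum>k. (\<integral>\<^sup>+x. ennreal (2 powr (k * p) * D k x powr p) * indicator (B k) x \<partial>M))"
    by (intro nn_integral_suminf) measurable
  also have "\<dots> \<le> (\<Sum>k. ennreal ((1/2) ^ k))"
  proof (intro suminf_le allI)
    fix k
    have "(\<integral>\<^sup>+x. ennreal (2 powr (k * p) * D k x powr p) * indicator (B k) x \<partial>M)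
      = (\<integral>\<^sup>+x. ennreal (2 powr (k * p)) * (ennreal (D k x powr p) * indicator (B k) x) \<partial>M)"
      by (simp add: ennreal_mult mult.assoc)
    also have "\<dots> = ennreal (2 powr (k * p)) * (\<integral>\<^sup>+x\<in>B k. ennreal (D k x powr p) \<partial>M)"
      by (intro nn_integral_cmult) measurable
    also have "\<dots> \<le> ennreal (2 powr (k * p)) * ennreal ((1/2) powr (k * p) * (1/2) ^ k)"
      unfolding D_def by (intro mult_left_mono N rN rN') auto
    also have "\<dots> = ennreal ((1/2) ^ k)"
      by (simp add: ennreal_mult[symmetric] powr_mult[symmetric] mult.assoc[symmetric])
    finally show "(\<integral>\<^sup>+x. ennreal (2 powr (k * p) * D k x powr p) * indicator (B k) x \<partial>M) \<le> ennreal ((1/2) ^ k)" .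
  qed auto
  also have "\<dots> < \<infinity>"
  proof -
    have "(\<lambda>k. (1/2::real) ^ k) sums (1 / (1 - 1/2))" by (intro geometric_sums) simp
    then have "(\<Sum>k. ennreal ((1/2) ^ k)) = ennreal (1 / (1 - 1/2))"
      by (subst suminf_ennreal2) (auto simp: sums_iff)
    then show ?thesis by simp
  qed
  finally have "AE x in M. (\<Sum>k. ennreal (2 powr (k * p) * D k x powr p) * indicator (B k) x) \<noteq> \<infinity>"
    by (intro nn_integral_PInf_AE) auto
  with AE_space have conv: "AE x in M. convergent (\<lambda>k. f (r k) x)"
  proof eventually_elim
    case (elim x)
    show ?case
    proof -
      have "x \<in> space M" by fact
      then obtain n0 where "x \<in> B n0" using cover by auto
      then have xB: "x \<in> B k" if "n0 \<le> k" for k using inc that by (auto simp: incseq_def)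
      obtain S where S: "(\<Sum>k. ennreal (2 powr (k * p) * D k x powr p) * indicator (B k) x) = ennreal S" "0 \<le> S"
        using elim by (cases "(\<Sum>k. ennreal (2 powr (k * p) * D k x powr p) * indicator (B k) x)") auto
      \<comment> \<open>A single term is at most the sum \<open>S\<close> of the series; its p-th
        root is a geometric bound on the increment.\<close>
      have DS: "D k x \<le> S powr (1/p) * (1/2) ^ k" if "n0 \<le> k" for k
      proof -
        have "ennreal (2 powr (k * p) * D k x powr p) * indicator (B k) x \<le> ennreal S"
          unfolding S(1)[symmetric] by (rule sum_le_suminf[of _ "{k}", simplified]) auto
        then have "2 powr (k * p) * D k x powr p \<le> S"
          using xB[OF that] S(2) by (simp add: ennreal_le_iff)
        then have "(2 powr (k * p) * D k x powr p) powr (1/p) \<le> S powr (1/p)"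
          using p by (intro powr_mono2) auto
        then have "2 ^ k * D k x \<le> S powr (1/p)"
          using p by (simp add: powr_mult powr_powr powr_realpow D_def)
        then show ?thesis by (simp add: field_simps)
      qed
      have "summable (\<lambda>k. f (r (Suc k)) x - f (r k) x)"
        by (rule summable_comparison_test_ev[where g = "\<lambda>k. S powr (1/p) * (1/2) ^ k"])
          (use DS in \<open>auto simp: D_def eventually_sequentially intro!: summable_mult summable_geometric\<close>)
      then have "convergent (\<lambda>n. \<Sum>k<n. f (r (Suc k)) x - f (r k) x)"
        by (simp add: summable_iff_convergent)
      then have "convergent (\<lambda>n. f (r n) x - f (r 0) x)"
        by (subst (asm) sum_lessThan_telescope[where f = "\<lambda>n. f (r n) x"])
      then have "convergent (\<lambda>n. (f (r n) x - f (r 0) x) + f (r 0) x)"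
        by (intro convergent_add convergent_const)
      then show ?thesis by simp
    qed
  qed
  \<comment> \<open>\<open>lim\<close> is total, hence \<open>g\<close> is measurable without
    removing the null set on which the subsequence diverges.\<close>
  define g where "g x = lim (\<lambda>k. f (r k) x)" for x
  have g[measurable]: "g \<in> borel_measurable M"
    unfolding g_def by (intro borel_measurable_lim_metric) measurable
  have lim: "AE x in M. (\<lambda>k. f (r k) x) \<longlonglongrightarrow> g x"
    using conv by eventually_elim (simp add: g_def convergent_LIMSEQ_iff)
  have "(\<lambda>i. \<integral>\<^sup>+x\<in>B n. ennreal (norm (f i x - g x) powr p) \<partial>M) \<longlonglongrightarrow> 0" for n
  proof (rule tendsto_0_if_Limsup_eq_0_ennreal)
    show "limsup (\<lambda>i. \<integral>\<^sup>+x\<in>B n. ennreal (norm (f i x - g x) powr p) \<partial>M) = 0"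
    proof (rule antisym[OF ennreal_le_epsilon zero_le])
      fix \<delta> :: real assume "0 < \<delta>"
      from cauchy[OF this, of n] obtain N' where N': "\<And>i j. N' \<le> i \<Longrightarrow> N' \<le> j \<Longrightarrow>
        (\<integral>\<^sup>+x\<in>B n. ennreal (norm (f i x - f j x) powr p) \<partial>M) \<le> ennreal \<delta>" by auto
      have "(\<integral>\<^sup>+x\<in>B n. ennreal (norm (f i x - g x) powr p) \<partial>M) \<le> ennreal \<delta>" if "N' \<le> i" for i
      proof -
        \<comment> \<open>Fatou's lemma in the inner index, along the almost everywhere convergent
          subsequence, turns the Cauchy bound into a bound on the distance to the limit.\<close>
        have "(\<integral>\<^sup>+x\<in>B n. ennreal (norm (f i x - g x) powr p) \<partial>M)
          = (\<integral>\<^sup>+x. liminf (\<lambda>k. ennreal (norm (f i x - f (r k) x) powr p) * indicator (B n) x) \<partial>M)"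
        proof (rule nn_integral_cong_AE)
          show "AE x in M. ennreal (norm (f i x - g x) powr p) * indicator (B n) x
            = liminf (\<lambda>k. ennreal (norm (f i x - f (r k) x) powr p) * indicator (B n) x)"
            using lim
          proof eventually_elim
            case (elim x)
            have "(\<lambda>k. ennreal (norm (f i x - f (r k) x) powr p)) \<longlonglongrightarrow> ennreal (norm (f i x - g x) powr p)"
              using p by (intro tendsto_ennrealI tendsto_powr' tendsto_intros elim) auto
            then have "(\<lambda>k. ennreal (norm (f i x - f (r k) x) powr p) * indicator (B n) x)
               \<longlonglongrightarrow> ennreal (norm (f i x - g x) powr p) * indicator (B n) x"
              by (auto simp: indicator_def)
            then show ?case by (simp add: lim_imp_Liminf)
          qed
        qed
        also have "\<dots> \<le> liminf (\<lambda>k. \<integral>\<^sup>+x. ennreal (norm (f i x - f (r k) x) powr p) * indicator (B n) x \<partial>M)"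
          by (intro nn_integral_liminf) measurable
        also have "\<dots> \<le> ennreal \<delta>"
        proof (rule order_trans[OF Liminf_le_Limsup Limsup_bounded])
          show "\<forall>\<^sub>F k in sequentially. (\<integral>\<^sup>+x. ennreal (norm (f i x - f (r k) x) powr p) * indicator (B n) x \<partial>M) \<le> ennreal \<delta>"
            using N' that seq_suble[OF r] unfolding eventually_sequentially by (meson le_trans)
        qed auto
        finally show ?thesis .
      qed
      then show "limsup (\<lambda>i. \<integral>\<^sup>+x\<in>B n. ennreal (norm (f i x - g x) powr p) \<partial>M) \<le> 0 + ennreal \<delta>"
        by (intro Limsup_bounded) (auto simp: eventually_sequentially)
    qed
  qed
  then show ?thesis using g lim r by blast
qed

section \<open>Integral functionals with convex integrands\<close>

text \<open>Makes the definite description in \<open>grad\<close> computable: inner products against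
  all vectors determine the gradient.\<close>

lemma grad_eqI:
  assumes "GDERIV f x :> D"
  shows "grad f x = D"
  unfolding grad_def
proof (rule the_equality[where P = "\<lambda>D. GDERIV f x :> D", OF assms])
  fix E assume "GDERIV f x :> E"
  then have "(\<lambda>h. h \<bullet> E) = (\<lambda>h. h \<bullet> D)"
    using assms unfolding gderiv_def by (rule has_derivative_unique)
  then show "E = D" by (metis vector_eq_ldot)
qed

lemma GDERIV_grad:
  fixes f :: "'a::euclidean_space \<Rightarrow> real"
  assumes "f differentiable (at x)"
  shows "GDERIV f x :> grad f x"
proof -
  obtain F where F: "(f has_derivative F) (at x)"
    using assms by (auto simp: differentiable_def)
  then interpret bounded_linear F by (rule has_derivative_bounded_linear)
  have "F h = h \<bullet> (\<Sum>b\<in>Basis. F b *\<^sub>R b)" for h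
  proof -
    have "F h = F (\<Sum>b\<in>Basis. (h \<bullet> b) *\<^sub>R b)" by (simp add: euclidean_representation)
    also have "\<dots> = h \<bullet> (\<Sum>b\<in>Basis. F b *\<^sub>R b)"
      by (simp add: sum scaleR inner_sum_right mult.commute)
    finally show ?thesis .
  qed
  then have "GDERIV f x :> (\<Sum>b\<in>Basis. F b *\<^sub>R b)"
    using F unfolding gderiv_def by (metis (no_types, lifting) ext)
  then show ?thesis using grad_eqI by metis
qed

lemma Ck_1_GDERIV: "Ck 1 f \<Longrightarrow> GDERIV f x :> grad f x"
  by (simp add: GDERIV_grad)

lemma Ck_1_continuous: "Ck 1 f \<Longrightarrow> continuous_on S f"
  by (auto simp: continuous_on_eq_continuous_at differentiable_imp_continuous_within
      intro: continuous_on_subset[of UNIV])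

lemma GDERIV_line:
  fixes f :: "'a::euclidean_space \<Rightarrow> real"
  assumes "GDERIV f (x + t *\<^sub>R v) :> D"
  shows "((\<lambda>s. f (x + s *\<^sub>R v)) has_real_derivative v \<bullet> D) (at t)"
proof -
  have "((\<lambda>s. f (x + s *\<^sub>R v)) has_derivative (\<lambda>h. (h *\<^sub>R v) \<bullet> D)) (at t)"
    by (rule has_derivative_compose[where g = f and f = "\<lambda>s. x + s *\<^sub>R v"])
      (use assms in \<open>auto simp: gderiv_def intro!: derivative_eq_intros\<close>)
  then show ?thesis
    unfolding has_field_derivative_def by (rule has_derivative_eq_rhs) (auto simp: fun_eq_iff)
qed

text \<open>On the segment from \<open>x\<close> to \<open>y\<close> the difference quotients at 0
  with step in (0,1) are at most \<open>f y - f x\<close> by convexity; the limit from the right is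
  the directional derivative.\<close>

lemma convex_on_gradient_ineq:
  fixes f :: "'a::euclidean_space \<Rightarrow> real"
  assumes "convex_on UNIV f" "GDERIV f x :> D"
  shows "f x + D \<bullet> (y - x) \<le> f y"
proof -
  define \<phi> where "\<phi> t = f (x + t *\<^sub>R (y - x))" for t :: real
  have "(\<phi> has_real_derivative (y - x) \<bullet> D) (at 0)"
    unfolding \<phi>_def by (rule GDERIV_line) (use assms in simp)
  then have lim: "((\<lambda>h. (\<phi> h - \<phi> 0) / h) \<longlongrightarrow> (y - x) \<bullet> D) (at_right 0)"
    by (auto simp: DERIV_def intro: filterlim_mono[OF _ order_refl at_le])
  have "(y - x) \<bullet> D \<le> f y - f x"
  proof (rule tendsto_upperbound[OF lim])
    show "\<forall>\<^sub>F h in at_right 0. (\<phi> h - \<phi> 0) / h \<le> f y - f x"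
    proof (rule eventually_mono)
      show "\<forall>\<^sub>F h in at_right (0::real). h \<in> {0<..<1}" by (rule eventually_at_right_real) simp
      fix h :: real assume h: "h \<in> {0<..<1}"
      have "x + h *\<^sub>R (y - x) = (1 - h) *\<^sub>R x + h *\<^sub>R y" by (simp add: algebra_simps)
      then have "\<phi> h \<le> (1 - h) * f x + h * f y"
        using h convex_onD[OF assms(1), of h x y] by (simp add: \<phi>_def)
      then show "(\<phi> h - \<phi> 0) / h \<le> f y - f x" using h by (simp add: \<phi>_def field_simps)
    qed
  qed simp
  then show ?thesis by (simp add: inner_commute)
qed

text \<open>Needed because smoothness of the integrand in its second argument holds only almost
  everywhere, so the limits below identify compositions only up to a null set.\<close>

lemma (in complete_measure) borel_measurable_cong_AE:
  fixes f g :: "'a \<Rightarrow> 'b::topological_space"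
  assumes f: "f \<in> borel_measurable M" and ae: "AE x in M. f x = g x"
  shows "g \<in> borel_measurable M"
proof (rule measurableI)
  fix S :: "'b set" assume S: "S \<in> sets borel"
  show "g -` S \<inter> space M \<in> sets M"
  proof (rule in_sets_AE)
    show "f -` S \<inter> space M \<in> sets M" using f S by (rule measurable_sets)
    show "AE x in M. x \<in> f -` S \<inter> space M \<longleftrightarrow> x \<in> g -` S \<inter> space M"
      using ae by eventually_elim auto
  qed auto
qed auto

lemma in_LpD: assumes "in_Lp M p f" shows "f \<in> borel_measurable M" "integrable M (\<lambda>x. norm (f x) powr p)"
  using assms by (auto simp: in_Lp_def)

lemma in_Lp_iff_nn_integral:
  "in_Lp M p f \<longleftrightarrow> f \<in> borel_measurable M \<and> (\<integral>\<^sup>+x. ennreal (norm (f x) powr p) \<partial>M) < \<infinity>"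
  by (auto simp: in_Lp_def integrable_iff_bounded)

lemma in_Lp_add_scaleR:
  assumes "0 \<le> p" "in_Lp M p f" "in_Lp M p g"
  shows "in_Lp M p (\<lambda>x. s *\<^sub>R f x + t *\<^sub>R g x)"
proof -
  note [measurable] = in_LpD(1)[OF assms(2)] in_LpD(1)[OF assms(3)]
  have "integrable M (\<lambda>x. norm (s *\<^sub>R f x + t *\<^sub>R g x) powr p)"
  proof (rule Bochner_Integration.integrable_bound)
    show "integrable M (\<lambda>x. 2 powr p * (\<bar>s\<bar> powr p * norm (f x) powr p + \<bar>t\<bar> powr p * norm (g x) powr p))"
      using in_LpD(2)[OF assms(2)] in_LpD(2)[OF assms(3)] by auto
    show "AE x in M. norm (norm (s *\<^sub>R f x + t *\<^sub>R g x) powr p) \<le>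
      norm (2 powr p * (\<bar>s\<bar> powr p * norm (f x) powr p + \<bar>t\<bar> powr p * norm (g x) powr p))"
    proof (rule AE_I2)
      fix x
      show "norm (norm (s *\<^sub>R f x + t *\<^sub>R g x) powr p) \<le>
        norm (2 powr p * (\<bar>s\<bar> powr p * norm (f x) powr p + \<bar>t\<bar> powr p * norm (g x) powr p))"
        using powr_norm_add_le[OF assms(1), of "s *\<^sub>R f x" "t *\<^sub>R g x"]
        by (simp add: powr_mult)
    qed
  qed measurable
  then show ?thesis by (auto simp: in_Lp_def)
qed

text \<open>Young's inequality with an explicit, not optimised constant. Either \<open>K\<close> is
  at most \<open>A * s powr (p - 1)\<close> and the first term suffices, or \<open>s\<close> is at
  most \<open>(K / A) powr (1/(p-1))\<close> and the second one does.\<close>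

lemma Young_absorb:
  fixes A p s K :: real
  assumes "0 < A" "1 < p" "0 \<le> s" "0 \<le> K"
  shows "K * s \<le> A * s powr p + (1/A) powr (1/(p-1)) * K powr conj_exp p"
proof (cases "K \<le> A * s powr (p - 1)")
  case True
  then have "K * s \<le> A * s powr (p - 1) * s" using assms by (intro mult_right_mono) auto
  also have "\<dots> = A * s powr p"
    using assms powr_mult_base[of s "p - 1"] by (simp add: mult.commute)
  finally show ?thesis by (simp add: add_increasing2)
next
  case False
  then have K: "0 < K" using assms by (smt (verit) mult_nonneg_nonneg powr_ge_zero)
  have "s powr (p - 1) \<le> K / A" using False assms by (simp add: field_simps)
  then have "(s powr (p - 1)) powr (1/(p-1)) \<le> (K / A) powr (1/(p-1))"
    using assms by (intro powr_mono2) auto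
  then have "s \<le> (K / A) powr (1/(p-1))"
    using assms by (simp add: powr_powr)
  then have "K * s \<le> K * (K / A) powr (1/(p-1))" using K by simp
  also have "\<dots> = (1/A) powr (1/(p-1)) * (K * K powr (1/(p-1)))"
    using K assms powr_mult[of K "1/A" "1/(p-1)"] by simp
  also have "K * K powr (1/(p-1)) = K powr conj_exp p"
    using K assms powr_mult_base[of K "1/(p-1)"] by (simp add: conj_exp_def field_simps)
  finally show ?thesis using assms by (simp add: add_increasing)
qed

text \<open>Both factors are replaced by the larger of \<open>a\<close> and
  \<open>b\<close>.\<close>

lemma powr_pm1_mult_le:
  fixes a b p :: real
  assumes "1 \<le> p" "0 \<le> a" "0 \<le> b"
  shows "a powr (p - 1) * b \<le> a powr p + b powr p"
proof -
  define m where "m = max a b"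
  have "a powr (p - 1) * b \<le> m powr (p - 1) * m"
    using assms by (intro mult_mono powr_mono2) (auto simp: m_def)
  also have "\<dots> = m powr p"
    using assms powr_mult_base[of m "p - 1"] by (simp add: mult.commute m_def)
  also have "\<dots> \<le> a powr p + b powr p"
    by (auto simp: m_def max_def)
  finally show ?thesis .
qed

text \<open>Admissibility over an abstract complete measure space, with the data of the upper growth
  bound given names. Completeness is demanded because the conditions on \<open>G x\<close> hold
  almost everywhere while measurability of compositions has to be derived from them.\<close>

locale Lagrangian = complete_measure M for M :: "'x measure" +
  fixes p :: real and G :: "'x \<Rightarrow> 'a::euclidean_space \<Rightarrow> real" and A B :: real and \<psi> \<psi>' :: "'x \<Rightarrow> real"
  assumes p: "1 < p" and A: "0 < A" and B: "0 < B"
    and G_meas: "\<And>\<xi>. (\<lambda>x. G x \<xi>) \<in> borel_measurable M"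
    and C1: "AE x in M. Ck 1 (G x)"
    and conv: "AE x in M. convex_on UNIV (G x)"
    and \<psi>: "integrable M \<psi>"
    and lower: "AE x in M. \<forall>\<xi>. A * norm \<xi> powr p - \<psi> x \<le> G x \<xi>"
    and \<psi>': "in_Lp M (conj_exp p) \<psi>'"
    and upper: "AE x in M. \<forall>\<xi>. norm (grad (G x) \<xi>) \<le> \<psi>' x + B * norm \<xi> powr (p - 1)"
    and G0: "integrable M (\<lambda>x. G x 0)"
begin

lemma above_tangent: "AE x in M. \<forall>\<xi> \<eta>. G x \<xi> + grad (G x) \<xi> \<bullet> (\<eta> - \<xi>) \<le> G x \<eta>"
  using C1 conv by eventually_elim (auto intro!: convex_on_gradient_ineq Ck_1_GDERIV)

text \<open>The Caratheodory argument: for simple functions the composition is a finite sum of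
  measurable terms, and continuity in the second argument passes to the limit.\<close>

lemma G_comp_measurable:
  assumes D[measurable]: "D \<in> borel_measurable M"
  shows "(\<lambda>x. G x (D x)) \<in> borel_measurable M"
proof -
  obtain s where s: "\<And>i. simple_function M (s i)" "\<And>x. x \<in> space M \<Longrightarrow> (\<lambda>i. s i x) \<longlonglongrightarrow> D x"
    using borel_measurable_implies_sequence_metric[OF D, of 0] by metis
  have meas: "(\<lambda>x. G x (s i x)) \<in> borel_measurable M" for i
  proof -
    have fin: "finite (s i ` space M)" using s(1)[of i] by (simp add: simple_function_def)
    have [measurable]: "s i \<in> borel_measurable M" using s(1) by (rule borel_measurable_simple_function)
    note G_meas[measurable]
    have "(\<lambda>x. \<Sum>y\<in>s i ` space M. indicator (s i -` {y} \<inter> space M) x * G x y) \<in> borel_measurable M"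
      by measurable
    then show ?thesis
    proof (rule measurable_cong[THEN iffD1, rotated])
      fix x assume x: "x \<in> space M"
      have "(\<Sum>y\<in>s i ` space M. indicator (s i -` {y} \<inter> space M) x * G x y) = (\<Sum>y\<in>s i ` space M. if y = s i x then G x y else 0)"
        using x by (intro sum.cong) (auto simp: indicator_def)
      then show "(\<Sum>y\<in>s i ` space M. indicator (s i -` {y} \<inter> space M) x * G x y) = G x (s i x)"
        using x fin by simp
    qed
  qed
  have "AE x in M. (\<lambda>i. G x (s i x)) \<longlonglongrightarrow> G x (D x)"
    using C1 AE_space
  proof eventually_elim
    case (elim x)
    have "isCont (G x) (D x)" using Ck_1_continuous[OF elim(1), of UNIV] by (simp add: continuous_on_eq_continuous_at)
    then show ?case using s(2)[OF elim(2)] by (rule isCont_tendsto_compose)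
  qed
  then have "AE x in M. lim (\<lambda>i. G x (s i x)) = G x (D x)"
    by eventually_elim (rule limI)
  moreover have "(\<lambda>x. lim (\<lambda>i. G x (s i x))) \<in> borel_measurable M"
    using meas by (rule borel_measurable_lim_metric)
  ultimately show ?thesis by (rule borel_measurable_cong_AE[rotated])
qed

text \<open>Each component of the gradient is a limit of difference quotients, which are measurable
  by the previous lemma.\<close>

lemma grad_comp_measurable:
  assumes D[measurable]: "D \<in> borel_measurable M"
  shows "(\<lambda>x. grad (G x) (D x)) \<in> borel_measurable M"
proof (rule borel_measurable_euclidean_space[THEN iffD2], intro ballI)
  fix i :: 'a assume "i \<in> Basis"
  define h where "h n = 1 / real (Suc n)" for n
  have h: "h \<longlonglongrightarrow> 0" "\<And>n. h n \<noteq> 0" unfolding h_def using LIMSEQ_inverse_real_of_nat by (auto simp: inverse_eq_divide)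
  define q where "q n x = (G x (D x + h n *\<^sub>R i) - G x (D x)) / h n" for n x
  have [measurable]: "q n \<in> borel_measurable M" for n
  proof -
    have [measurable]: "(\<lambda>x. G x (D x)) \<in> borel_measurable M" "(\<lambda>x. G x (D x + h n *\<^sub>R i)) \<in> borel_measurable M"
      by (intro G_comp_measurable; measurable)+
    show ?thesis unfolding q_def by measurable
  qed
  have "AE x in M. lim (\<lambda>n. q n x) = grad (G x) (D x) \<bullet> i"
    using C1
  proof eventually_elim
    case (elim x)
    have "((\<lambda>t. G x (D x + t *\<^sub>R i)) has_real_derivative i \<bullet> grad (G x) (D x)) (at 0)"
      using Ck_1_GDERIV[OF elim, of "D x"] by (intro GDERIV_line) simp
    then have "((\<lambda>t. (G x (D x + t *\<^sub>R i) - G x (D x)) / t) \<longlongrightarrow> i \<bullet> grad (G x) (D x)) (at 0)"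
      by (simp add: DERIV_def)
    then have "(\<lambda>n. q n x) \<longlonglongrightarrow> i \<bullet> grad (G x) (D x)"
      unfolding q_def using h by (auto simp: tendsto_at_iff_sequentially comp_def)
    then show ?case by (simp add: limI inner_commute)
  qed
  moreover have "(\<lambda>x. lim (\<lambda>n. q n x)) \<in> borel_measurable M"
    by (rule borel_measurable_lim_metric) measurable
  ultimately show "(\<lambda>x. grad (G x) (D x) \<bullet> i) \<in> borel_measurable M"
    by (rule borel_measurable_cong_AE[rotated])
qed

text \<open>Young's inequality applied pointwise to the two terms of the growth bound; it takes the
  place of Hoelder's inequality for the pairing of the gradient with a p-integrable field.\<close>

lemma grad_inner_bound:
  "AE x in M. \<forall>\<xi> \<eta>::'a. \<bar>grad (G x) \<xi> \<bullet> \<eta>\<bar> \<le> norm (\<psi>' x) powr conj_exp p + norm \<eta> powr p + B * (norm \<xi> powr p + norm \<eta> powr p)"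
  using upper
proof eventually_elim
  case (elim x)
  show ?case
  proof (intro allI)
    fix \<xi> \<eta> :: 'a
    have 1: "norm (\<psi>' x) * norm \<eta> \<le> norm (\<psi>' x) powr conj_exp p + norm \<eta> powr p"
      using Young_absorb[of 1 p "norm \<eta>" "norm (\<psi>' x)"] p by simp
    have "\<bar>grad (G x) \<xi> \<bullet> \<eta>\<bar> \<le> norm (grad (G x) \<xi>) * norm \<eta>" by (rule Cauchy_Schwarz_ineq2)
    also have "\<dots> \<le> (norm (\<psi>' x) + B * norm \<xi> powr (p - 1)) * norm \<eta>"
      using elim[rule_format, of \<xi>] by (intro mult_right_mono) auto
    also have "\<dots> = norm (\<psi>' x) * norm \<eta> + B * (norm \<xi> powr (p - 1) * norm \<eta>)"
      by (simp add: algebra_simps)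
    also have "\<dots> \<le> norm (\<psi>' x) powr conj_exp p + norm \<eta> powr p + B * (norm \<xi> powr p + norm \<eta> powr p)"
      using B p powr_pm1_mult_le[of p "norm \<xi>" "norm \<eta>"] by (intro add_mono 1 mult_left_mono) auto
    finally show "\<bar>grad (G x) \<xi> \<bullet> \<eta>\<bar> \<le> norm (\<psi>' x) powr conj_exp p + norm \<eta> powr p + B * (norm \<xi> powr p + norm \<eta> powr p)" .
  qed
qed

lemma grad_inner_integrable:
  assumes D: "in_Lp M p D" and E: "in_Lp M p E"
  shows "integrable M (\<lambda>x. grad (G x) (D x) \<bullet> E x)"
proof (rule Bochner_Integration.integrable_bound)
  show "integrable M (\<lambda>x. norm (\<psi>' x) powr conj_exp p + norm (E x) powr p + B * (norm (D x) powr p + norm (E x) powr p))"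
    using in_LpD(2)[OF \<psi>'] in_LpD(2)[OF D] in_LpD(2)[OF E] by auto
  have [measurable]: "(\<lambda>x. grad (G x) (D x)) \<in> borel_measurable M" "E \<in> borel_measurable M"
    using grad_comp_measurable in_LpD(1)[OF D] in_LpD(1)[OF E] by auto
  show "(\<lambda>x. grad (G x) (D x) \<bullet> E x) \<in> borel_measurable M" by measurable
  show "AE x in M. norm (grad (G x) (D x) \<bullet> E x)
    \<le> norm (norm (\<psi>' x) powr conj_exp p + norm (E x) powr p + B * (norm (D x) powr p + norm (E x) powr p))"
    using grad_inner_bound
    by eventually_elim (auto intro: order_trans[OF _ abs_ge_self])
qed

text \<open>The integrand lies above \<open>- \<psi> x\<close> by the lower growth bound and below
  \<open>G x 0 + grad (G x) (D x) \<bullet> D x\<close> by the tangent at \<open>D x\<close>,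
  evaluated at 0.\<close>

lemma G_comp_integrable:
  assumes D: "in_Lp M p D"
  shows "integrable M (\<lambda>x. G x (D x))"
proof (rule Bochner_Integration.integrable_bound)
  show "integrable M (\<lambda>x. \<bar>\<psi> x\<bar> + \<bar>G x 0\<bar> + \<bar>grad (G x) (D x) \<bullet> D x\<bar>)"
    using \<psi> G0 grad_inner_integrable[OF D D] by auto
  show "(\<lambda>x. G x (D x)) \<in> borel_measurable M" using G_comp_measurable in_LpD(1)[OF D] .
  show "AE x in M. norm (G x (D x)) \<le> norm (\<bar>\<psi> x\<bar> + \<bar>G x 0\<bar> + \<bar>grad (G x) (D x) \<bullet> D x\<bar>)"
    using lower above_tangent
  proof eventually_elim
    case (elim x)
    have "0 \<le> A * norm (D x) powr p" using A by simp
    then have "- \<psi> x \<le> G x (D x)" using elim(1)[rule_format, of "D x"] by linarith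
    moreover have "G x (D x) \<le> G x 0 + grad (G x) (D x) \<bullet> D x"
      using elim(2)[rule_format, of "D x" 0] by (simp add: inner_diff_right)
    ultimately show ?case by simp
  qed
qed

text \<open>Lower growth bounds \<open>G x (D x)\<close> from below and the tangent at
  \<open>D x\<close>, evaluated at 0, bounds it from above. For a weak solution the last integral is
  the functional applied to the solution itself.\<close>

lemma gradient_energy_bound:
  assumes D: "in_Lp M p D"
  shows "A * (LINT x|M. norm (D x) powr p)
    \<le> (LINT x|M. \<bar>G x 0\<bar> + \<bar>\<psi> x\<bar>) + (LINT x|M. grad (G x) (D x) \<bullet> D x)"
proof -
  have "(LINT x|M. A * norm (D x) powr p) \<le> (LINT x|M. (\<bar>G x 0\<bar> + \<bar>\<psi> x\<bar>) + grad (G x) (D x) \<bullet> D x)"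
  proof (rule integral_mono_AE)
    show "AE x in M. A * norm (D x) powr p \<le> \<bar>G x 0\<bar> + \<bar>\<psi> x\<bar> + grad (G x) (D x) \<bullet> D x"
      using lower above_tangent
    proof eventually_elim
      case (elim x)
      show ?case using elim(1)[rule_format, of "D x"] elim(2)[rule_format, of "D x" 0]
        by (simp add: inner_diff_right)
    qed
  qed (use in_LpD(2)[OF D] \<psi> G0 grad_inner_integrable[OF D D] in auto)
  then show ?thesis using \<psi> G0 grad_inner_integrable[OF D D] by simp
qed

text \<open>For a weak solution the two gradient integrals become values of the functional, and the
  inequality says that the solution minimizes the energy.\<close>

lemma integral_above_tangent:
  assumes D: "in_Lp M p D" and E: "in_Lp M p E"
  shows "(LINT x|M. G x (D x)) + (LINT x|M. grad (G x) (D x) \<bullet> E x) - (LINT x|M. grad (G x) (D x) \<bullet> D x)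
    \<le> (LINT x|M. G x (E x))"
proof -
  note i = G_comp_integrable[OF D] G_comp_integrable[OF E] grad_inner_integrable[OF D E] grad_inner_integrable[OF D D]
  have "(LINT x|M. G x (D x) + (grad (G x) (D x) \<bullet> E x - grad (G x) (D x) \<bullet> D x)) \<le> (LINT x|M. G x (E x))"
    using above_tangent i by (intro integral_mono_AE) (auto simp: inner_diff_right elim!: eventually_mono)
  then show ?thesis using i by simp
qed

text \<open>The integrated pointwise bound is not homogeneous in \<open>E\<close>; applying it to
  \<open>E\<close> divided by its norm and using linearity makes it so.\<close>

lemma grad_functional_bounded:
  assumes D: "in_Lp M p D"
  shows "\<exists>C>0. \<forall>E. in_Lp M p E \<longrightarrow> \<bar>LINT x|M. grad (G x) (D x) \<bullet> E x\<bar> \<le> C * Lp_norm M p E"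
proof -
  define T0 where "T0 E = (LINT x|M. grad (G x) (D x) \<bullet> E x)" for E
  \<comment> \<open>The value of the inhomogeneous bound \<open>bd\<close> at fields whose p-th
    power has integral 1.\<close>
  define C where "C = 1 + (LINT x|M. norm (\<psi>' x) powr conj_exp p) + B * (LINT x|M. norm (D x) powr p) + B"
  have C: "0 < C" unfolding C_def using B by (intro add_pos_pos add_pos_nonneg) auto
  have bd: "\<bar>T0 E\<bar> \<le> (LINT x|M. norm (\<psi>' x) powr conj_exp p) + B * (LINT x|M. norm (D x) powr p)
      + (1 + B) * (LINT x|M. norm (E x) powr p)" if E: "in_Lp M p E" for E
  proof -
    have "\<bar>T0 E\<bar> \<le> (LINT x|M. norm (grad (G x) (D x) \<bullet> E x))" unfolding T0_def
      by (metis integral_norm_bound real_norm_def)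
    also have "\<dots> \<le> (LINT x|M. norm (\<psi>' x) powr conj_exp p + norm (E x) powr p + B * (norm (D x) powr p + norm (E x) powr p))"
      using grad_inner_bound grad_inner_integrable[OF D E] in_LpD(2)[OF \<psi>'] in_LpD(2)[OF D] in_LpD(2)[OF E]
      by (intro integral_mono_AE) (auto elim!: eventually_mono)
    also have "\<dots> = (LINT x|M. norm (\<psi>' x) powr conj_exp p) + B * (LINT x|M. norm (D x) powr p)
      + (1 + B) * (LINT x|M. norm (E x) powr p)"
      using in_LpD(2)[OF \<psi>'] in_LpD(2)[OF D] in_LpD(2)[OF E] by (simp add: algebra_simps)
    finally show ?thesis .
  qed
  have "\<bar>T0 E\<bar> \<le> C * Lp_norm M p E" if E: "in_Lp M p E" for E
  proof (cases "(LINT x|M. norm (E x) powr p) = 0")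
    case True
    then have "AE x in M. norm (E x) powr p = 0"
      using in_LpD(2)[OF E] by (subst (asm) integral_nonneg_eq_0_iff_AE) auto
    then have "AE x in M. grad (G x) (D x) \<bullet> E x = 0" by eventually_elim auto
    then have "T0 E = 0" unfolding T0_def by (simp add: integral_eq_zero_AE)
    then show ?thesis using C by (simp add: Lp_norm_def)
  next
    case False
    then have pos: "0 < (LINT x|M. norm (E x) powr p)"
      by (metis Bochner_Integration.integral_nonneg order_le_less powr_ge_zero)
    define s where "s = Lp_norm M p E"
    have s: "0 < s" "s powr p = (LINT x|M. norm (E x) powr p)"
      using pos p by (auto simp: s_def Lp_norm_def powr_powr)
    have E': "in_Lp M p (\<lambda>x. (1/s) *\<^sub>R E x)"
      using in_Lp_add_scaleR[OF _ E E, of "1/s" 0] p by simp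
    have "(LINT x|M. norm ((1/s) *\<^sub>R E x) powr p) = (LINT x|M. (1/s) powr p * norm (E x) powr p)"
      using s by (simp add: powr_divide)
    also have "\<dots> = 1"
      using s pos by (simp add: powr_divide)
    finally have "\<bar>T0 (\<lambda>x. (1/s) *\<^sub>R E x)\<bar> \<le> C"
      using bd[OF E'] by (simp add: C_def)
    moreover have "T0 (\<lambda>x. (1/s) *\<^sub>R E x) = T0 E / s" by (simp add: T0_def)
    ultimately show ?thesis using s by (simp add: s_def[symmetric] field_simps)
  qed
  then show ?thesis using C unfolding T0_def by blast
qed

end

lemma Lp_norm_powr:
  assumes "0 < p"
  shows "Lp_norm M p f powr p = (LINT x|M. norm (f x) powr p)"
  using assms by (simp add: Lp_norm_def powr_powr)

section \<open>The direct method on a closed subspace of \<open>L^p\<close>\<close>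

text \<open>\<open>V\<close> will be the set of p-integrable fields that are gradients, and
  \<open>T\<close> the given functional carried over to gradients. Closedness is phrased by
  integrals of p-th powers, so no normed space of classes has to be formed.\<close>

locale Lagrangian_on_subspace = Lagrangian M p G A B \<psi> \<psi>'
  for M :: "'x measure" and p and G :: "'x \<Rightarrow> 'a::euclidean_space \<Rightarrow> real" and A B \<psi> \<psi>' +
  fixes V :: "('x \<Rightarrow> 'a) set" and T :: "('x \<Rightarrow> 'a) \<Rightarrow> real" and C :: real
  assumes V_Lp: "\<And>D. D \<in> V \<Longrightarrow> in_Lp M p D"
    and V_ne: "V \<noteq> {}"
    and V_lin: "\<And>D E s t. D \<in> V \<Longrightarrow> E \<in> V \<Longrightarrow> (\<lambda>x. s *\<^sub>R D x + t *\<^sub>R E x) \<in> V"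
    and V_closed: "\<And>D E. (\<And>n::nat. D n \<in> V) \<Longrightarrow> in_Lp M p E \<Longrightarrow>
        (\<lambda>n. \<integral>\<^sup>+x. ennreal (norm (D n x - E x) powr p) \<partial>M) \<longlonglongrightarrow> 0 \<Longrightarrow> E \<in> V"
    and T_lin: "\<And>D E s t. D \<in> V \<Longrightarrow> E \<in> V \<Longrightarrow> T (\<lambda>x. s *\<^sub>R D x + t *\<^sub>R E x) = s * T D + t * T E"
    and T_bound: "\<And>D. D \<in> V \<Longrightarrow> \<bar>T D\<bar> \<le> C * Lp_norm M p D"
begin

definition \<Phi> :: "('x \<Rightarrow> 'a) \<Rightarrow> real" where
  "\<Phi> D = (LINT x|M. norm (D x) powr p)"

definition J :: "('x \<Rightarrow> 'a) \<Rightarrow> real" where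
  "J D = (LINT x|M. G x (D x)) - T D"

lemma \<Phi>_nonneg: "0 \<le> \<Phi> D"
  by (simp add: \<Phi>_def)

text \<open>Young's inequality absorbs the linear term into half of the growth term, hence the
  factor \<open>A / 2\<close>.\<close>

lemma J_coercive: "\<exists>c. \<forall>D\<in>V. A / 2 * \<Phi> D \<le> J D + c"
proof -
  define c where "c = (LINT x|M. \<psi> x) + (1/(A/2)) powr (1/(p-1)) * \<bar>C\<bar> powr conj_exp p"
  have "A / 2 * \<Phi> D \<le> J D + c" if D: "D \<in> V" for D
  proof -
    have "(LINT x|M. A * norm (D x) powr p - \<psi> x) \<le> (LINT x|M. G x (D x))"
      using lower \<psi> in_LpD(2)[OF V_Lp[OF D]] G_comp_integrable[OF V_Lp[OF D]]
      by (intro integral_mono_AE) (auto elim!: eventually_mono)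
    then have 1: "A * \<Phi> D - (LINT x|M. \<psi> x) \<le> (LINT x|M. G x (D x))"
      using \<psi> in_LpD(2)[OF V_Lp[OF D]] by (simp add: \<Phi>_def)
    have "T D \<le> \<bar>C\<bar> * Lp_norm M p D"
    proof -
      have "T D \<le> C * Lp_norm M p D" using T_bound[OF D] by simp
      also have "\<dots> \<le> \<bar>C\<bar> * Lp_norm M p D"
        by (intro mult_right_mono) (auto simp: Lp_norm_def)
      finally show ?thesis .
    qed
    also have "\<dots> \<le> A / 2 * Lp_norm M p D powr p + (1/(A/2)) powr (1/(p-1)) * \<bar>C\<bar> powr conj_exp p"
      using A p by (intro Young_absorb) (auto simp: Lp_norm_def)
    also have "Lp_norm M p D powr p = \<Phi> D"
      using p by (simp add: Lp_norm_powr \<Phi>_def)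
    finally show ?thesis using 1 by (simp add: J_def c_def)
  qed
  then show ?thesis by blast
qed

text \<open>Midpoints are all that uniform convexity compares, and this keeps them inside the
  sublevel sets of \<open>J\<close>.\<close>

lemma J_midpoint:
  assumes D: "D \<in> V" and E: "E \<in> V"
  shows "J (\<lambda>x. (1/2) *\<^sub>R D x + (1/2) *\<^sub>R E x) \<le> (J D + J E) / 2"
proof -
  have "(LINT x|M. G x ((1/2) *\<^sub>R D x + (1/2) *\<^sub>R E x)) \<le> (LINT x|M. (G x (D x) + G x (E x)) / 2)"
  proof (rule integral_mono_AE)
    show "AE x in M. G x ((1/2) *\<^sub>R D x + (1/2) *\<^sub>R E x) \<le> (G x (D x) + G x (E x)) / 2"
      using conv
    proof eventually_elim
      case (elim x)
      show ?case using convex_onD[OF elim, of "1/2" "D x" "E x"] by (simp add: field_simps)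
    qed
  qed (use G_comp_integrable[OF V_Lp] D E V_lin in auto)
  then show ?thesis
    using G_comp_integrable[OF V_Lp] D E T_lin[OF D E, of "1/2" "1/2"] by (simp add: J_def field_simps)
qed

text \<open>Elements of almost minimal norm in the nested convex sublevel sets of \<open>J\<close> form a Cauchy
  sequence by uniform convexity; this replaces weak compactness.\<close>

lemma minimizing_Cauchy_sequence:
  "\<exists>y \<mu>. (\<forall>n. y n \<in> V) \<and> (\<forall>n. J (y n) \<le> \<mu> + 1 / real (Suc n)) \<and> (\<forall>D\<in>V. \<mu> \<le> J D) \<and>
     (\<forall>\<delta>>0. \<exists>N. \<forall>i\<ge>N. \<forall>j\<ge>N. (LINT x|M. norm (y i x - y j x) powr p) \<le> \<delta>)"
proof -
  obtain c where c: "\<And>D. D \<in> V \<Longrightarrow> A / 2 * \<Phi> D \<le> J D + c" using J_coercive by blast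
  define \<mu> where "\<mu> = (INF D\<in>V. J D)"
  have bdd: "bdd_below (J ` V)"
  proof (rule bdd_belowI2)
    fix D assume "D \<in> V"
    moreover have "0 \<le> A / 2 * \<Phi> D" using A \<Phi>_nonneg by simp
    ultimately show "- c \<le> J D" using c[of D] by linarith
  qed
  have \<mu>: "\<mu> \<le> J D" if "D \<in> V" for D unfolding \<mu>_def using bdd that by (rule cINF_lower)
  define S where "S n = {D \<in> V. J D \<le> \<mu> + 1 / real (Suc n)}" for n
  have S_ne: "S n \<noteq> {}" for n
  proof -
    have "\<mu> < \<mu> + 1 / real (Suc n)" by simp
    then obtain D where "D \<in> V" "J D < \<mu> + 1 / real (Suc n)"
      using bdd V_ne unfolding \<mu>_def by (subst (asm) cINF_less_iff) auto
    then show ?thesis by (auto simp: S_def intro: less_imp_le)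
  qed
  have S_anti: "S j \<subseteq> S i" if "i \<le> j" for i j
  proof -
    have "1 / real (Suc j) \<le> 1 / real (Suc i)" using that by (intro divide_left_mono) auto
    then show ?thesis unfolding S_def by auto
  qed
  \<comment> \<open>Coercivity bounds \<open>\<Phi>\<close> on the largest sublevel set
    \<open>S 0\<close>, hence on all of them.\<close>
  define R where "R = (\<mu> + 1 + c) / (A / 2)"
  have R: "\<Phi> D \<le> R" if "D \<in> S n" for D n
  proof -
    have "D \<in> S 0" using S_anti[of 0 n] that by auto
    then have "A / 2 * \<Phi> D \<le> \<mu> + 1 + c" using c[of D] by (simp add: S_def)
    then show ?thesis using A unfolding R_def by (simp add: field_simps)
  qed
  have R0: "0 \<le> R" using R S_ne[of 0] \<Phi>_nonneg order_trans by blast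
  \<comment> \<open>The infimal size on the nested sets increases as the sets shrink and stays below
    \<open>R\<close>, so it converges. This squeezes together the sizes of two late elements and of
    their midpoint.\<close>
  define d where "d n = (INF D\<in>S n. \<Phi> D)" for n
  have bddS: "bdd_below (\<Phi> ` S n)" for n by (rule bdd_belowI2[of _ 0]) (rule \<Phi>_nonneg)
  have d_le: "d n \<le> \<Phi> D" if "D \<in> S n" for n D unfolding d_def using bddS that by (rule cINF_lower)
  have d_mono: "d i \<le> d j" if "i \<le> j" for i j
    unfolding d_def using S_ne bddS S_anti[OF that] by (intro cINF_superset_mono) auto
  have d_bd: "d n \<le> R" for n using d_le R S_ne[of n] order_trans by blast
  have "incseq d" using d_mono by (simp add: incseq_def)
  then obtain L where "d \<longlonglongrightarrow> L" and dL: "\<And>n. d n \<le> L"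
    using incseq_convergent[of d R] d_bd by blast
  have "\<exists>D\<in>S n. \<Phi> D < d n + 1 / real (Suc n)" for n
  proof -
    have "d n < d n + 1 / real (Suc n)" by simp
    then show ?thesis using S_ne bddS unfolding d_def by (subst (asm) cINF_less_iff) auto
  qed
  then obtain y where y: "\<And>n. y n \<in> S n" "\<And>n. \<Phi> (y n) < d n + 1 / real (Suc n)" by metis
  have yV: "y n \<in> V" for n using y(1)[of n] by (simp add: S_def)
  have "\<exists>N. \<forall>i\<ge>N. \<forall>j\<ge>N. (LINT x|M. norm (y i x - y j x) powr p) \<le> \<delta>" if \<delta>: "0 < \<delta>" for \<delta>
  proof -
    \<comment> \<open>Chosen, like \<open>\<eta>\<close> below, so that each of the two error terms
      \<open>\<epsilon> * (R + R)\<close> and \<open>K * (2 * \<eta>)\<close> is at most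
      \<open>\<delta> / 2\<close>; the added 1 keeps the denominators positive.\<close>
    define \<epsilon> where "\<epsilon> = \<delta> / (4 * (R + 1))"
    have \<epsilon>: "0 < \<epsilon>" using \<delta> R0 by (simp add: \<epsilon>_def)
    obtain K where K: "0 \<le> K" "\<And>a b::'a. norm (a - b) powr p \<le> \<epsilon> * (norm a powr p + norm b powr p)
       + K * ((norm a powr p + norm b powr p) / 2 - norm ((1/2) *\<^sub>R (a + b)) powr p)"
      using powr_norm_uniform_convexity[OF p \<epsilon>] by blast
    define \<eta> where "\<eta> = \<delta> / (4 * (K + 1))"
    have \<eta>: "0 < \<eta>" using \<delta> K by (simp add: \<eta>_def)
    have "\<forall>\<^sub>F n in sequentially. L - \<eta> < d n \<and> 1 / real (Suc n) < \<eta>"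
      using \<open>d \<longlonglongrightarrow> L\<close> \<eta> LIMSEQ_inverse_real_of_nat
      by (intro eventually_conj) (auto simp: inverse_eq_divide intro: order_tendstoD)
    then obtain N where N: "L - \<eta> < d N" "1 / real (Suc N) < \<eta>"
      unfolding eventually_sequentially by blast
    have "(LINT x|M. norm (y i x - y j x) powr p) \<le> \<delta>" if ij: "N \<le> i" "N \<le> j" for i j
    proof -
      define m where "m x = (1/2) *\<^sub>R y i x + (1/2) *\<^sub>R y j x" for x
      have in_N: "y i \<in> S N" "y j \<in> S N" using y(1) S_anti ij by blast+
      have "J m \<le> (J (y i) + J (y j)) / 2"
        unfolding m_def by (rule J_midpoint) (rule yV)+
      moreover have mV: "m \<in> V" unfolding m_def by (rule V_lin) (rule yV)+
      \<comment> \<open>The midpoint lies in \<open>S N\<close>, so its size is at least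
        \<open>d N\<close>, which exceeds \<open>L - \<eta>\<close>, whereas both endpoints have
        size at most \<open>L + \<eta>\<close>.\<close>
      ultimately have "m \<in> S N" using in_N by (auto simp: S_def)
      then have dm: "d N \<le> \<Phi> m" by (rule d_le)
      have small: "\<Phi> (y k) \<le> L + \<eta>" if "N \<le> k" for k
      proof -
        have "1 / real (Suc k) \<le> 1 / real (Suc N)" using that by (intro divide_left_mono) auto
        then show ?thesis using y(2)[of k] dL[of k] N by linarith
      qed
      note int = in_LpD(2)[OF V_Lp[OF yV]] in_LpD(2)[OF V_Lp[OF mV]]
      have diff: "in_Lp M p (\<lambda>x. y i x - y j x)"
        using in_Lp_add_scaleR[OF _ V_Lp[OF yV[of i]] V_Lp[OF yV[of j]], of 1 "-1"] p by simp
      have "(LINT x|M. norm (y i x - y j x) powr p) \<le>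
        (LINT x|M. \<epsilon> * (norm (y i x) powr p + norm (y j x) powr p)
          + K * ((norm (y i x) powr p + norm (y j x) powr p) / 2 - norm (m x) powr p))"
        using K(2) int in_LpD(2)[OF diff] by (intro integral_mono) (auto simp: m_def scaleR_add_right)
      also have "\<dots> = \<epsilon> * (\<Phi> (y i) + \<Phi> (y j)) + K * ((\<Phi> (y i) + \<Phi> (y j)) / 2 - \<Phi> m)"
        using int by (simp add: \<Phi>_def)
      also have "\<dots> \<le> \<epsilon> * (R + R) + K * (2 * \<eta>)"
      proof (intro add_mono mult_left_mono)
        show "\<Phi> (y i) \<le> R" "\<Phi> (y j) \<le> R" using R y(1) by blast+
        show "(\<Phi> (y i) + \<Phi> (y j)) / 2 - \<Phi> m \<le> 2 * \<eta>"
          using small[OF ij(1)] small[OF ij(2)] dm N(1) by (simp add: field_simps)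
      qed (use K \<epsilon> in auto)
      also have "\<dots> \<le> \<delta> / 2 + \<delta> / 2"
      proof (rule add_mono)
        have "\<epsilon> * (R + R) = \<delta> / 2 * (R / (R + 1))" using R0 by (simp add: \<epsilon>_def field_simps)
        also have "\<dots> \<le> \<delta> / 2 * 1" using \<delta> R0 by (intro mult_left_mono) auto
        finally show "\<epsilon> * (R + R) \<le> \<delta> / 2" by simp
        have "K * (2 * \<eta>) = \<delta> / 2 * (K / (K + 1))" using K by (simp add: \<eta>_def field_simps)
        also have "\<dots> \<le> \<delta> / 2 * 1" using \<delta> K by (intro mult_left_mono) auto
        finally show "K * (2 * \<eta>) \<le> \<delta> / 2" by simp
      qed
      finally show ?thesis by simp
    qed
    then show ?thesis by blast
  qed
  moreover have "J (y n) \<le> \<mu> + 1 / real (Suc n)" for n using y(1)[of n] by (simp add: S_def)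
  ultimately show ?thesis using yV \<mu> by blast
qed

text \<open>Fatou's lemma needs nonnegative integrands, so it is applied to \<open>G\<close> plus
  \<open>\<psi>\<close>; the linear part converges because \<open>T\<close> is bounded by the
  \<open>L^p\<close> norm.\<close>

lemma minimizer_exists: "\<exists>D\<in>V. \<forall>E\<in>V. J D \<le> J E"
proof -
  obtain y \<mu> where H: "\<forall>n. y n \<in> V" "\<forall>n. J (y n) \<le> \<mu> + 1 / real (Suc n)" "\<forall>D\<in>V. \<mu> \<le> J D"
    "\<forall>\<delta>>0. \<exists>N. \<forall>i\<ge>N. \<forall>j\<ge>N. (LINT x|M. norm (y i x - y j x) powr p) \<le> \<delta>"
    using minimizing_Cauchy_sequence by (elim exE conjE) (rule that)
  note yV = H(1)[rule_format] and Jy = H(2)[rule_format] and \<mu> = H(3)[rule_format] and cau = H(4)[rule_format]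
  have yL: "in_Lp M p (y n)" for n using V_Lp yV by blast
  note [measurable] = in_LpD(1)[OF yL]
  have diff: "in_Lp M p (\<lambda>x. D x - E x)" if "in_Lp M p D" "in_Lp M p E" for D E :: "'x \<Rightarrow> 'a"
    using in_Lp_add_scaleR[OF _ that, of 1 "-1"] p by simp
  have "\<exists>g\<in>borel_measurable M. (\<exists>r::nat \<Rightarrow> nat. strict_mono r \<and> (AE x in M. (\<lambda>k. y (r k) x) \<longlonglongrightarrow> g x)) \<and>
     (\<forall>n::nat. (\<lambda>i. \<integral>\<^sup>+x\<in>space M. ennreal (norm (y i x - g x) powr p) \<partial>M) \<longlonglongrightarrow> 0)"
  proof (rule Lp_complete_local)
    fix \<delta> :: real and n :: nat assume "0 < \<delta>"
    from cau[OF this] obtain N where N: "\<forall>i\<ge>N. \<forall>j\<ge>N. (LINT x|M. norm (y i x - y j x) powr p) \<le> \<delta>" ..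
    have "(\<integral>\<^sup>+x\<in>space M. ennreal (norm (y i x - y j x) powr p) \<partial>M) = ennreal (LINT x|M. norm (y i x - y j x) powr p)" for i j
    proof -
      have "(\<integral>\<^sup>+x\<in>space M. ennreal (norm (y i x - y j x) powr p) \<partial>M) = (\<integral>\<^sup>+x. ennreal (norm (y i x - y j x) powr p) \<partial>M)"
        by (intro nn_integral_cong) (auto simp: indicator_def)
      also have "\<dots> = ennreal (LINT x|M. norm (y i x - y j x) powr p)"
        using in_LpD(2)[OF diff[OF yL yL]] by (intro nn_integral_eq_integral) auto
      finally show ?thesis .
    qed
    then show "\<exists>N. \<forall>i\<ge>N. \<forall>j\<ge>N. (\<integral>\<^sup>+x\<in>space M. ennreal (norm (y i x - y j x) powr p) \<partial>M) \<le> ennreal \<delta>"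
      using N by (auto intro!: exI[of _ N] ennreal_leI)
  qed (use p in \<open>auto simp: incseq_def\<close>)
  then obtain g r where g[measurable]: "g \<in> borel_measurable M" and r: "strict_mono r"
    and lim: "AE x in M. (\<lambda>k. y (r k) x) \<longlonglongrightarrow> g x"
    and Lp': "(\<lambda>i. \<integral>\<^sup>+x\<in>space M. ennreal (norm (y i x - g x) powr p) \<partial>M) \<longlonglongrightarrow> 0" by blast
  have Lp: "(\<lambda>i. \<integral>\<^sup>+x. ennreal (norm (y i x - g x) powr p) \<partial>M) \<longlonglongrightarrow> 0"
  proof (rule Lim_transform_eventually[OF Lp' always_eventually], intro allI)
    show "(\<integral>\<^sup>+x\<in>space M. ennreal (norm (y i x - g x) powr p) \<partial>M) = (\<integral>\<^sup>+x. ennreal (norm (y i x - g x) powr p) \<partial>M)" for i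
      by (intro nn_integral_cong) (auto simp: indicator_def)
  qed
  have gL: "in_Lp M p g"
  proof -
    have "\<forall>\<^sub>F i in sequentially. (\<integral>\<^sup>+x. ennreal (norm (y i x - g x) powr p) \<partial>M) < 1"
      using Lp by (rule order_tendstoD) simp
    then obtain i where "(\<integral>\<^sup>+x. ennreal (norm (y i x - g x) powr p) \<partial>M) < 1"
      unfolding eventually_sequentially by blast
    then have "in_Lp M p (\<lambda>x. y i x - g x)"
      unfolding in_Lp_iff_nn_integral by (auto intro: less_trans)
    from diff[OF yL[of i] this] show ?thesis by simp
  qed
  have gV: "g \<in> V" using V_closed[OF yV gL Lp] .
  have Ty: "(\<lambda>i. T (y i)) \<longlonglongrightarrow> T g"
  proof -
    have bd: "\<bar>T (y i) - T g\<bar> \<le> C * Lp_norm M p (\<lambda>x. y i x - g x)" for i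
    proof -
      have "(\<lambda>x. y i x - g x) \<in> V" "T (\<lambda>x. y i x - g x) = T (y i) - T g"
        using T_lin[OF yV[of i] gV, of 1 "-1"] V_lin[OF yV[of i] gV, of 1 "-1"] by simp_all
      then show ?thesis using T_bound by metis
    qed
    have "(\<lambda>i. LINT x|M. norm (y i x - g x) powr p) \<longlonglongrightarrow> 0"
    proof -
      have "(\<lambda>i. ennreal (LINT x|M. norm (y i x - g x) powr p)) \<longlonglongrightarrow> ennreal 0"
      proof -
        have "(\<integral>\<^sup>+x. ennreal (norm (y i x - g x) powr p) \<partial>M) = ennreal (LINT x|M. norm (y i x - g x) powr p)" for i
          using in_LpD(2)[OF diff[OF yL gL]] by (intro nn_integral_eq_integral) auto
        then show ?thesis using Lp by simp
      qed
      then show ?thesis by (subst (asm) tendsto_ennreal_iff) auto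
    qed
    then have "(\<lambda>i. Lp_norm M p (\<lambda>x. y i x - g x)) \<longlonglongrightarrow> 0"
      unfolding Lp_norm_def using tendsto_powr'[OF _ tendsto_const, of _ 0 sequentially "1/p"] p
      by force
    then have "(\<lambda>i. C * Lp_norm M p (\<lambda>x. y i x - g x)) \<longlonglongrightarrow> 0"
      by (rule tendsto_mult_right_zero)
    then have "(\<lambda>i. T (y i) - T g) \<longlonglongrightarrow> 0"
      by (rule Lim_null_comparison[rotated]) (use bd in auto)
    then show ?thesis by (simp add: LIM_zero_iff)
  qed
  have nonneg: "AE x in M. \<forall>\<xi>. 0 \<le> G x \<xi> + \<psi> x"
    using lower
  proof eventually_elim
    case (elim x)
    have "0 \<le> G x \<xi> + \<psi> x" for \<xi>
    proof -
      have "0 \<le> A * norm \<xi> powr p" using A by simp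
      then show ?thesis using elim[rule_format, of \<xi>] by linarith
    qed
    then show ?case by blast
  qed
  have nn: "(\<integral>\<^sup>+x. ennreal (G x (D x) + \<psi> x) \<partial>M) = ennreal ((LINT x|M. G x (D x)) + (LINT x|M. \<psi> x))"
    if "in_Lp M p D" for D
  proof -
    have "(\<integral>\<^sup>+x. ennreal (G x (D x) + \<psi> x) \<partial>M) = ennreal (LINT x|M. G x (D x) + \<psi> x)"
      using nonneg \<psi> G_comp_integrable[OF that] by (intro nn_integral_eq_integral) (auto elim!: eventually_mono)
    then show ?thesis using \<psi> G_comp_integrable[OF that] by simp
  qed
  have nn0: "0 \<le> (LINT x|M. G x (D x)) + (LINT x|M. \<psi> x)" if "in_Lp M p D" for D
  proof -
    have "0 \<le> (LINT x|M. G x (D x) + \<psi> x)" using nonneg by (intro integral_nonneg_AE) (auto elim!: eventually_mono)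
    then show ?thesis using \<psi> G_comp_integrable[OF that] by simp
  qed
  have meas[measurable]: "(\<lambda>x. G x (y i x) + \<psi> x) \<in> borel_measurable M" for i
    using G_comp_measurable[of "y i"] \<psi> by auto
  have "J g \<le> \<mu>"
  proof (rule field_le_epsilon)
    fix \<delta> :: real assume \<delta>: "0 < \<delta>"
    \<comment> \<open>Half of \<open>\<delta>\<close> pays for the error in \<open>T\<close>, the
      other half for the distance of \<open>J\<close> from its infimum.\<close>
    have ev: "\<forall>\<^sub>F k in sequentially. T (y (r k)) < T g + \<delta> / 2 \<and> 1 / real (Suc (r k)) < \<delta> / 2"
    proof (intro eventually_conj)
      show "\<forall>\<^sub>F k in sequentially. T (y (r k)) < T g + \<delta> / 2"
        using LIMSEQ_subseq_LIMSEQ[OF Ty r] \<delta> by (intro order_tendstoD(2)) (auto simp: comp_def)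
      have "(\<lambda>k. 1 / real (Suc (r k))) \<longlonglongrightarrow> 0"
        using LIMSEQ_subseq_LIMSEQ[OF LIMSEQ_inverse_real_of_nat r] by (simp add: comp_def inverse_eq_divide)
      then show "\<forall>\<^sub>F k in sequentially. 1 / real (Suc (r k)) < \<delta> / 2"
        using \<delta> by (intro order_tendstoD(2)) auto
    qed
    have "ennreal ((LINT x|M. G x (g x)) + (LINT x|M. \<psi> x)) = (\<integral>\<^sup>+x. ennreal (G x (g x) + \<psi> x) \<partial>M)"
      using nn[OF gL] by simp
    also have "\<dots> = (\<integral>\<^sup>+x. liminf (\<lambda>k. ennreal (G x (y (r k) x) + \<psi> x)) \<partial>M)"
    proof (rule nn_integral_cong_AE)
      show "AE x in M. ennreal (G x (g x) + \<psi> x) = liminf (\<lambda>k. ennreal (G x (y (r k) x) + \<psi> x))"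
        using lim C1
      proof eventually_elim
        case (elim x)
        have "isCont (G x) (g x)"
          using Ck_1_continuous[OF elim(2), of UNIV] by (simp add: continuous_on_eq_continuous_at)
        then have "(\<lambda>k. G x (y (r k) x)) \<longlonglongrightarrow> G x (g x)" using elim(1) by (rule isCont_tendsto_compose)
        then have "(\<lambda>k. ennreal (G x (y (r k) x) + \<psi> x)) \<longlonglongrightarrow> ennreal (G x (g x) + \<psi> x)"
          by (intro tendsto_ennrealI tendsto_intros)
        then show ?case by (simp add: lim_imp_Liminf)
      qed
    qed
    also have "\<dots> \<le> liminf (\<lambda>k. \<integral>\<^sup>+x. ennreal (G x (y (r k) x) + \<psi> x) \<partial>M)"
      by (intro nn_integral_liminf) measurable
    also have "\<dots> \<le> ennreal (\<mu> + T g + \<delta> + (LINT x|M. \<psi> x))"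
    proof (rule order_trans[OF Liminf_le_Limsup Limsup_bounded])
      show "\<forall>\<^sub>F k in sequentially. (\<integral>\<^sup>+x. ennreal (G x (y (r k) x) + \<psi> x) \<partial>M) \<le> ennreal (\<mu> + T g + \<delta> + (LINT x|M. \<psi> x))"
        using ev
      proof eventually_elim
        case (elim k)
        have "(LINT x|M. G x (y (r k) x)) \<le> \<mu> + T g + \<delta>"
          using Jy[of "r k"] elim unfolding J_def by linarith
        then show ?case unfolding nn[OF yL] by (intro ennreal_leI) simp
      qed
    qed simp
    finally have le: "ennreal ((LINT x|M. G x (g x)) + (LINT x|M. \<psi> x)) \<le> ennreal (\<mu> + T g + \<delta> + (LINT x|M. \<psi> x))" .
    \<comment> \<open>\<open>ennreal\<close> sends negative numbers to 0, so the inequality can be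
      read back in the reals only once the right side is known to be nonnegative.\<close>
    obtain k where k: "T (y (r k)) < T g + \<delta> / 2" "1 / real (Suc (r k)) < \<delta> / 2"
      using ev unfolding eventually_sequentially by blast
    then have "(LINT x|M. G x (y (r k) x)) \<le> \<mu> + T g + \<delta>"
      using Jy[of "r k"] unfolding J_def by linarith
    then have "0 \<le> \<mu> + T g + \<delta> + (LINT x|M. \<psi> x)"
      using nn0[OF yL[of "r k"]] by linarith
    from le[unfolded ennreal_le_iff[OF this]]
    show "J g \<le> \<mu> + \<delta>" by (simp add: J_def)
  qed
  then show ?thesis using gV \<mu> by (intro bexI[of _ g]) (auto intro: order_trans)
qed

text \<open>Only forward difference quotients of \<open>J\<close> are used. Minimality makes them
  nonnegative, which gives one inequality for every direction; the direction \<open>- E\<close>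
  supplies the reverse one.\<close>

lemma Euler_Lagrange:
  assumes D: "D \<in> V" and min: "\<And>E. E \<in> V \<Longrightarrow> J D \<le> J E" and E: "E \<in> V"
  shows "(LINT x|M. grad (G x) (D x) \<bullet> E x) = T E"
proof -
  have ge: "T E \<le> (LINT x|M. grad (G x) (D x) \<bullet> E x)" if E: "E \<in> V" for E
  proof -
    note DL = V_Lp[OF D] and EL = V_Lp[OF E]
    define h where "h n = 1 / real (Suc n)" for n
    have h: "h \<longlonglongrightarrow> 0" "\<And>n. 0 < h n" "\<And>n. h n \<le> 1"
      unfolding h_def using LIMSEQ_inverse_real_of_nat by (auto simp: inverse_eq_divide)
    have mem: "(\<lambda>x. D x + t *\<^sub>R E x) \<in> V" for t using V_lin[OF D E, of 1 t] by simp
    define q where "q n x = (G x (D x + h n *\<^sub>R E x) - G x (D x)) / h n" for n x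
    have intG: "integrable M (\<lambda>x. G x (D x + t *\<^sub>R E x))" for t using G_comp_integrable[OF V_Lp[OF mem]] .
    have intG0: "integrable M (\<lambda>x. G x (D x))" using G_comp_integrable[OF DL] .
    have lim: "(\<lambda>n. LINT x|M. q n x) \<longlonglongrightarrow> (LINT x|M. grad (G x) (D x) \<bullet> E x)"
    proof (rule integral_dominated_convergence)
      show "integrable M (\<lambda>x. \<bar>grad (G x) (D x) \<bullet> E x\<bar> + \<bar>G x (D x + E x)\<bar> + \<bar>G x (D x)\<bar>)"
        using grad_inner_integrable[OF DL EL] intG[of 1] intG0 by auto
      show "q n \<in> borel_measurable M" for n
        using intG[of "h n"] intG0 unfolding q_def by measurable
      show "(\<lambda>x. grad (G x) (D x) \<bullet> E x) \<in> borel_measurable M" using grad_inner_integrable[OF DL EL] by auto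
      show "AE x in M. (\<lambda>n. q n x) \<longlonglongrightarrow> grad (G x) (D x) \<bullet> E x"
        using C1
      proof eventually_elim
        case (elim x)
        have "((\<lambda>t. G x (D x + t *\<^sub>R E x)) has_real_derivative E x \<bullet> grad (G x) (D x)) (at 0)"
          using Ck_1_GDERIV[OF elim, of "D x"] by (intro GDERIV_line) simp
        then have "((\<lambda>t. (G x (D x + t *\<^sub>R E x) - G x (D x)) / t) \<longlongrightarrow> E x \<bullet> grad (G x) (D x)) (at 0)"
          by (simp add: DERIV_def)
        then have "(\<lambda>n. q n x) \<longlonglongrightarrow> E x \<bullet> grad (G x) (D x)"
          unfolding q_def using h by (auto simp: tendsto_at_iff_sequentially comp_def less_imp_neq[symmetric])
        then show ?case by (simp add: inner_commute)
      qed
      \<comment> \<open>Convexity traps the quotient with step at most 1 between the derivative at 0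
        and the quotient with step 1; this bound does not depend on \<open>n\<close>.\<close>
      show "AE x in M. norm (q n x) \<le> \<bar>grad (G x) (D x) \<bullet> E x\<bar> + \<bar>G x (D x + E x)\<bar> + \<bar>G x (D x)\<bar>" for n
        using above_tangent conv
      proof eventually_elim
        case (elim x)
        have "grad (G x) (D x) \<bullet> (h n *\<^sub>R E x) \<le> G x (D x + h n *\<^sub>R E x) - G x (D x)"
          using elim(1)[rule_format, of "D x" "D x + h n *\<^sub>R E x"] by simp
        then have 1: "grad (G x) (D x) \<bullet> E x \<le> q n x"
          using h(2)[of n] by (simp add: q_def field_simps)
        have "D x + h n *\<^sub>R E x = (1 - h n) *\<^sub>R D x + h n *\<^sub>R (D x + E x)" by (simp add: algebra_simps)
        then have "G x (D x + h n *\<^sub>R E x) \<le> (1 - h n) * G x (D x) + h n * G x (D x + E x)"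
          using convex_onD[OF elim(2), of "h n" "D x" "D x + E x"] h(2)[of n] h(3)[of n] by simp
        then have "q n x \<le> G x (D x + E x) - G x (D x)"
          using h(2)[of n] by (simp add: q_def field_simps)
        with 1 show ?case by simp
      qed
    qed
    have qT: "T E \<le> (LINT x|M. q n x)" for n
    proof -
      have "J D \<le> J (\<lambda>x. D x + h n *\<^sub>R E x)" using min mem by blast
      moreover have "T (\<lambda>x. D x + h n *\<^sub>R E x) = T D + h n * T E" using T_lin[OF D E, of 1 "h n"] by simp
      ultimately have "h n * T E \<le> (LINT x|M. G x (D x + h n *\<^sub>R E x)) - (LINT x|M. G x (D x))"
        by (simp add: J_def)
      also have "\<dots> = h n * (LINT x|M. q n x)"
        using intG[of "h n"] intG0 h(2)[of n] by (simp add: q_def)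
      finally show ?thesis using h(2)[of n] by simp
    qed
    show ?thesis using tendsto_lowerbound[OF lim] qT by simp
  qed
  have nE: "(\<lambda>x. - E x) \<in> V" "T (\<lambda>x. - E x) = - T E"
    using V_lin[OF E E, of "-1" 0] T_lin[OF E E, of "-1" 0] by auto
  show ?thesis using ge[OF E] ge[OF nE(1)] nE(2) by simp
qed

theorem Euler_Lagrange_solution_exists:
  "\<exists>D\<in>V. \<forall>E\<in>V. (LINT x|M. grad (G x) (D x) \<bullet> E x) = T E"
  using minimizer_exists Euler_Lagrange by metis

end

section \<open>Smooth bump functions and mollification\<close>

text \<open>With \<open>s = 1 / t\<close>, the derivative of \<open>P(s) exp(- s)\<close> with
  respect to \<open>t\<close> is \<open>s^2 (P(s) - P'(s)) exp(- s)\<close>; the coefficient list is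
  the polynomial \<open>s^2\<close>.\<close>

primrec bump_poly :: "nat \<Rightarrow> real poly" where
  "bump_poly 0 = 1"
| "bump_poly (Suc k) = [:0, 0, 1:] * (bump_poly k - pderiv (bump_poly k))"

text \<open>\<open>bump_fun k\<close> is the \<open>k\<close>-th derivative of \<open>exp (- 1 / t)\<close>, extended by zero to \<open>t \<le> 0\<close>.\<close>

definition bump_fun :: "nat \<Rightarrow> real \<Rightarrow> real" where
  "bump_fun k t = (if 0 < t then poly (bump_poly k) (1 / t) * exp (- 1 / t) else 0)"

lemma poly_times_exp_minus_tendsto_0:
  fixes P :: "real poly"
  shows "((\<lambda>s. poly P s * exp (- s)) \<longlongrightarrow> 0) at_top"
proof -
  have "((\<lambda>s. \<Sum>i\<le>degree P. coeff P i * (s ^ i / exp s)) \<longlongrightarrow> (\<Sum>i\<le>degree P. coeff P i * 0)) at_top"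
    by (intro tendsto_sum tendsto_mult tendsto_const tendsto_power_div_exp_0)
  then show ?thesis
    by (simp add: poly_altdef exp_minus field_simps sum_distrib_right sum_divide_distrib[symmetric])
qed

text \<open>The only critical point is 0. There the right difference quotient is a polynomial in
  \<open>1 / h\<close> times \<open>exp (- 1 / h)\<close>, and the exponential wins.\<close>

lemma bump_fun_deriv: "(bump_fun k has_real_derivative bump_fun (Suc k) t) (at t)"
proof (cases t "0::real" rule: linorder_cases)
  case less
  have "((\<lambda>_. 0) has_real_derivative 0) (at t)" by simp
  then have "(bump_fun k has_real_derivative 0) (at t)"
    by (rule has_field_derivative_transform_within_open[where S = "{..<0}"])
      (use less in \<open>auto simp: bump_fun_def\<close>)
  then show ?thesis using less by (simp add: bump_fun_def)
next
  case greater
  have "((\<lambda>t. poly (bump_poly k) (1 / t) * exp (- 1 / t)) has_real_derivative bump_fun (Suc k) t) (at t)"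
    using greater
    by (auto intro!: derivative_eq_intros DERIV_chain2[OF poly_DERIV]
        simp: bump_fun_def field_simps power2_eq_square)
  then show ?thesis
    by (rule has_field_derivative_transform_within_open[where S = "{0<..}"])
      (use greater in \<open>auto simp: bump_fun_def\<close>)
next
  case equal
  have "((\<lambda>h. bump_fun k h / h) \<longlongrightarrow> 0) (at 0)"
  proof (rule filterlim_split_at)
    show "((\<lambda>h. bump_fun k h / h) \<longlongrightarrow> 0) (at_left 0)"
      by (rule tendsto_eventually) (auto simp: bump_fun_def eventually_at_filter)
    have "((\<lambda>h. poly (pCons 0 (bump_poly k)) (inverse h) * exp (- inverse h)) \<longlongrightarrow> 0) (at_right (0::real))"
      by (rule filterlim_compose[OF poly_times_exp_minus_tendsto_0 filterlim_inverse_at_top_right])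
    moreover have "\<forall>\<^sub>F h in at_right 0. poly (pCons 0 (bump_poly k)) (inverse h) * exp (- inverse h) = bump_fun k h / h"
      by (auto simp: bump_fun_def eventually_at_filter field_simps)
    ultimately show "((\<lambda>h. bump_fun k h / h) \<longlongrightarrow> 0) (at_right 0)"
      by (rule Lim_transform_eventually)
  qed
  then show ?thesis using equal by (simp add: DERIV_def bump_fun_def)
qed

section \<open>Closure properties of the classes \<open>Ck\<close>\<close>

lemma Ck_SucI:
  assumes "\<And>x. GDERIV f x :> F x" "\<And>i. i \<in> Basis \<Longrightarrow> Ck n (\<lambda>x. F x \<bullet> i)"
  shows "Ck (Suc n) f"
proof -
  have "grad f x = F x" for x using assms(1) by (rule grad_eqI)
  moreover have "f differentiable (at x)" for x
    using assms(1)[of x] by (auto simp: gderiv_def differentiable_def)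
  ultimately show ?thesis using assms(2) by simp
qed

lemma Ck_Suc_GDERIV: "Ck (Suc n) f \<Longrightarrow> GDERIV f x :> grad f x"
  by (simp add: GDERIV_grad)

lemma Ck_Suc_grad: "Ck (Suc n) f \<Longrightarrow> i \<in> Basis \<Longrightarrow> Ck n (\<lambda>x. grad f x \<bullet> i)"
  by simp

lemma Ck_SucD: "Ck (Suc n) f \<Longrightarrow> Ck n f"
proof (induction n arbitrary: f)
  case 0
  then show ?case by (auto intro!: continuous_at_imp_continuous_on differentiable_imp_continuous_within)
next
  case (Suc n)
  then show ?case by auto
qed

lemma Ck_const: "Ck n (\<lambda>x::'a::euclidean_space. c)"
proof (induction n arbitrary: c)
  case (Suc n)
  show ?case by (rule Ck_SucI[where F = "\<lambda>_. 0"]) (auto simp: GDERIV_const Suc)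
qed auto

lemma Ck_add: "Ck n f \<Longrightarrow> Ck n g \<Longrightarrow> Ck n (\<lambda>x. f x + g x)"
proof (induction n arbitrary: f g)
  case (Suc n)
  show ?case
  proof (rule Ck_SucI)
    show "GDERIV (\<lambda>x. f x + g x) x :> grad f x + grad g x" for x
      using Suc.prems by (intro GDERIV_add Ck_Suc_GDERIV)
    show "Ck n (\<lambda>x. (grad f x + grad g x) \<bullet> i)" if "i \<in> Basis" for i
      using Suc.IH[OF Ck_Suc_grad[OF Suc.prems(1) that] Ck_Suc_grad[OF Suc.prems(2) that]]
      by (simp add: inner_add_left)
  qed
qed (auto intro: continuous_intros)

lemma Ck_mult: "Ck n f \<Longrightarrow> Ck n g \<Longrightarrow> Ck n (\<lambda>x. f x * g x)"
proof (induction n arbitrary: f g)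
  case (Suc n)
  show ?case
  proof (rule Ck_SucI)
    show "GDERIV (\<lambda>x. f x * g x) x :> f x *\<^sub>R grad g x + g x *\<^sub>R grad f x" for x
      using Suc.prems by (intro GDERIV_mult Ck_Suc_GDERIV)
    show "Ck n (\<lambda>x. (f x *\<^sub>R grad g x + g x *\<^sub>R grad f x) \<bullet> i)" if "i \<in> Basis" for i
      using Ck_add[OF Suc.IH[OF Ck_SucD[OF Suc.prems(1)] Ck_Suc_grad[OF Suc.prems(2) that]]
          Suc.IH[OF Ck_SucD[OF Suc.prems(2)] Ck_Suc_grad[OF Suc.prems(1) that]]]
      by (simp add: inner_add_left)
  qed
qed (auto intro: continuous_intros)

lemma Ck_inner: "Ck n (\<lambda>x. x \<bullet> a)"
proof (cases n)
  case (Suc m)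
  show ?thesis unfolding Suc
  proof (rule Ck_SucI)
    show "GDERIV (\<lambda>x. x \<bullet> a) x :> a" for x
      unfolding gderiv_def by (auto intro!: derivative_eq_intros)
  qed (rule Ck_const)
qed (auto intro: continuous_intros)

lemma Ck_sum: "finite I \<Longrightarrow> (\<And>i. i \<in> I \<Longrightarrow> Ck n (f i)) \<Longrightarrow> Ck n (\<lambda>x. \<Sum>i\<in>I. f i x)"
  by (induction I rule: finite_induct) (auto intro: Ck_const Ck_add)

text \<open>The index \<open>k\<close> varies in the induction because differentiation raises it by
  one; \<open>P\<close> is assumed smooth of every order so that its gradient can be differentiated
  equally often.\<close>

lemma Ck_bump_compose: "\<forall>m. Ck m P \<Longrightarrow> Ck n (\<lambda>x. bump_fun k (P x))"
proof (induction n arbitrary: k)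
  case 0
  have "isCont (bump_fun k) t" for t using bump_fun_deriv by (rule DERIV_isCont)
  then have "continuous_on UNIV (bump_fun k)" by (simp add: continuous_on_eq_continuous_at)
  moreover have "continuous_on UNIV P" using 0[rule_format, of 0] by simp
  ultimately show ?case by (auto intro: continuous_on_compose2)
next
  case (Suc n)
  show ?case
  proof (rule Ck_SucI)
    show "GDERIV (\<lambda>x. bump_fun k (P x)) x :> bump_fun (Suc k) (P x) *\<^sub>R grad P x" for x
      using Suc.prems[rule_format, of 1] by (intro GDERIV_DERIV_compose bump_fun_deriv Ck_1_GDERIV)
    show "Ck n (\<lambda>x. (bump_fun (Suc k) (P x) *\<^sub>R grad P x) \<bullet> i)" if "i \<in> Basis" for i
      using Ck_mult[OF Suc.IH[OF Suc.prems] Ck_Suc_grad[OF Suc.prems[rule_format, of "Suc n"] that]] by simp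
  qed
qed

lemma GDERIV_affine:
  fixes f :: "'a::euclidean_space \<Rightarrow> real"
  assumes "GDERIV f (a + c *\<^sub>R x) :> D"
  shows "GDERIV (\<lambda>x. f (a + c *\<^sub>R x)) x :> c *\<^sub>R D"
proof -
  have "((\<lambda>x. f (a + c *\<^sub>R x)) has_derivative (\<lambda>h. (c *\<^sub>R h) \<bullet> D)) (at x)"
    by (rule has_derivative_compose[where g = f and f = "\<lambda>x. a + c *\<^sub>R x"])
      (use assms in \<open>auto simp: gderiv_def intro!: derivative_eq_intros\<close>)
  then show ?thesis unfolding gderiv_def by simp
qed

lemma Ck_affine: "Ck n f \<Longrightarrow> Ck n (\<lambda>x. f (a + c *\<^sub>R x))"
proof (induction n arbitrary: f)
  case (Suc n)
  show ?case
  proof (rule Ck_SucI)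
    show "GDERIV (\<lambda>x. f (a + c *\<^sub>R x)) x :> c *\<^sub>R grad f (a + c *\<^sub>R x)" for x
      using Suc.prems by (intro GDERIV_affine Ck_Suc_GDERIV)
    show "Ck n (\<lambda>x. (c *\<^sub>R grad f (a + c *\<^sub>R x)) \<bullet> i)" if "i \<in> Basis" for i
      using Ck_mult[OF Ck_const[of n c] Suc.IH[OF Ck_Suc_grad[OF Suc.prems that]]] by simp
  qed
qed (auto intro!: continuous_intros intro: continuous_on_compose2)

lemma Ck_1_continuous_grad:
  assumes "Ck 1 f"
  shows "continuous_on S (grad f)"
proof -
  have "continuous_on S (\<lambda>x. grad f x \<bullet> i)" if "i \<in> Basis" for i
    using assms that by (auto intro: continuous_on_subset)
  then show ?thesis by (subst continuous_on_componentwise) blast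
qed

lemma Ck_1I:
  fixes f :: "'a::euclidean_space \<Rightarrow> real"
  assumes "\<And>x. GDERIV f x :> F x" "continuous_on UNIV F"
  shows "Ck 1 f"
proof -
  have "Ck (Suc 0) f"
    by (rule Ck_SucI[OF assms(1)]) (use assms(2) in \<open>auto intro: continuous_intros\<close>)
  then show ?thesis by (simp only: One_nat_def)
qed

text \<open>The standard kernel: \<open>exp (- 1 / (1 - |y|^2))\<close> inside the unit ball and 0
  outside, divided by its integral. The squared norm is a polynomial in the coordinates, so
  smoothness reduces to that of \<open>bump_fun\<close>.\<close>

definition mollifier :: "'a::euclidean_space \<Rightarrow> real" where
  "mollifier y = bump_fun 0 (1 - y \<bullet> y) / (LINT z|lborel. bump_fun 0 (1 - (z::'a) \<bullet> z))"

text \<open>Positivity of the integral: a nonnegative function with integral 0 vanishes almost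
  everywhere, but the bump is positive on the open unit ball, which is not negligible.\<close>

lemma
  shows bump_ball_integrable: "integrable lborel (\<lambda>z::'a::euclidean_space. bump_fun 0 (1 - z \<bullet> z))"
    and bump_ball_integral_pos: "0 < (LINT z|lborel. bump_fun 0 (1 - (z::'a) \<bullet> z))"
    and bump_ball_Ck: "Ck n (\<lambda>z::'a. bump_fun 0 (1 - z \<bullet> z))"
proof -
  let ?b = "\<lambda>z::'a. bump_fun 0 (1 - z \<bullet> z)"
  have *: "1 - z \<bullet> z = 1 + (-1) * (\<Sum>i\<in>Basis. (z \<bullet> i) * (z \<bullet> i))" for z :: 'a
    by (simp add: euclidean_inner[of z z])
  show Ck: "Ck n ?b" for n
    unfolding * by (intro Ck_bump_compose allI Ck_add Ck_mult Ck_const Ck_sum Ck_inner) auto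
  have nonneg: "0 \<le> ?b z" for z by (simp add: bump_fun_def)
  have cont: "continuous_on UNIV ?b" using Ck[of 0] by simp
  have supp: "?b z = 0 \<longleftrightarrow> 1 \<le> norm z" for z
    by (simp add: bump_fun_def norm_eq_sqrt_inner not_less)
  have "integrable lborel (\<lambda>x. indicator (cball 0 1) x *\<^sub>R ?b x)"
    by (rule borel_integrable_compact) (use cont in \<open>auto intro: continuous_on_subset\<close>)
  moreover have "(\<lambda>x. indicator (cball 0 1) x *\<^sub>R ?b x) = ?b"
  proof
    fix x show "indicator (cball 0 1) x *\<^sub>R ?b x = ?b x"
      using supp[of x] by (auto simp: indicator_def)
  qed
  ultimately show int: "integrable lborel ?b" by simp
  have "(LINT z|lborel. ?b z) \<noteq> 0"
  proof
    assume "(LINT z|lborel. ?b z) = 0"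
    then have "AE z in lborel. ?b z = 0"
      using int nonneg by (subst (asm) integral_nonneg_eq_0_iff_AE) auto
    then have "AE z::'a in lborel. z \<notin> ball 0 1" by eventually_elim (simp add: supp)
    then have "ball (0::'a) 1 \<in> null_sets lborel" by (simp add: AE_iff_null_sets)
    then have "negligible (ball (0::'a) 1)"
      by (simp add: negligible_iff_null_sets null_sets_completionI)
    then show False using open_not_negligible[of "ball (0::'a) 1"] by simp
  qed
  moreover have "0 \<le> (LINT z|lborel. ?b z)" using nonneg by simp
  ultimately show "0 < (LINT z|lborel. ?b z)" by simp
qed

lemma mollifier_nonneg: "0 \<le> mollifier y"
  unfolding mollifier_def using bump_ball_integral_pos[where ?'a = 'a]
  by (intro divide_nonneg_pos) (auto simp: bump_fun_def)

lemma mollifier_eq_0_iff: "mollifier y = 0 \<longleftrightarrow> 1 \<le> norm y"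
  using bump_ball_integral_pos[where ?'a = 'a]
  by (auto simp: mollifier_def bump_fun_def norm_eq_sqrt_inner not_less)

lemma mollifier_integrable: "integrable lborel mollifier"
  unfolding mollifier_def using bump_ball_integrable by auto

lemma mollifier_integral: "(LINT y|lborel. mollifier (y::'a::euclidean_space)) = 1"
  unfolding mollifier_def using bump_ball_integral_pos[where ?'a = 'a] by simp

lemma mollifier_Ck: "Ck n (mollifier :: 'a::euclidean_space \<Rightarrow> real)"
  unfolding mollifier_def[abs_def] divide_inverse by (intro Ck_mult bump_ball_Ck Ck_const)

lemma mollifier_measurable[measurable]: "mollifier \<in> borel_measurable borel"
  using mollifier_Ck[of 0] by (auto intro: borel_measurable_continuous_onI)

text \<open>A probability measure, so that mollification is an average to which Jensen's inequality
  applies.\<close>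

definition mollifier_measure :: "'a::euclidean_space measure" where
  "mollifier_measure = density lborel mollifier"

lemma sets_mollifier_measure[measurable_cong, simp]: "sets mollifier_measure = sets borel"
  and space_mollifier_measure[simp]: "space mollifier_measure = UNIV"
  by (simp_all add: mollifier_measure_def)

lemma emeasure_mollifier_measure_UNIV: "emeasure (mollifier_measure :: 'a::euclidean_space measure) UNIV = 1"
proof -
  have "emeasure (mollifier_measure :: 'a measure) UNIV = (\<integral>\<^sup>+y. ennreal (mollifier (y::'a)) \<partial>lborel)"
    by (simp add: mollifier_measure_def emeasure_density)
  also have "\<dots> = ennreal (LINT y|lborel. mollifier (y::'a))"
    using mollifier_integrable mollifier_nonneg by (intro nn_integral_eq_integral) auto
  finally show ?thesis by (simp add: mollifier_integral)
qed

lemma finite_measure_mollifier_measure: "finite_measure mollifier_measure"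
  by (intro finite_measureI) (simp add: emeasure_mollifier_measure_UNIV)

lemma AE_mollifier_measure: "AE z::'a::euclidean_space in mollifier_measure. norm z < 1"
proof -
  have "norm z < 1" if "0 < ennreal (mollifier z)" for z :: 'a
    using that mollifier_eq_0_iff[of z] by (cases "norm z < 1") auto
  then show ?thesis
    unfolding mollifier_measure_def by (subst AE_density) auto
qed

text \<open>Lets the convolution kernel itself be used as a test function in the definition of the
  weak gradient.\<close>

lemma mollifier_translate_test_function:
  fixes q :: "'a::euclidean_space"
  assumes "0 < \<epsilon>" "cball q \<epsilon> \<subseteq> S"
  shows "(\<lambda>y. mollifier ((1/\<epsilon>) *\<^sub>R (q - y))) \<in> test_functions S"
proof -
  have eq: "(\<lambda>y. mollifier ((1/\<epsilon>) *\<^sub>R (q - y))) = (\<lambda>y. mollifier ((1/\<epsilon>) *\<^sub>R q + (- 1/\<epsilon>) *\<^sub>R y))"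
    by (simp add: algebra_simps)
  have "{y. mollifier ((1/\<epsilon>) *\<^sub>R (q - y)) \<noteq> 0} = ball q \<epsilon>"
  proof -
    have "norm ((1/\<epsilon>) *\<^sub>R (q - y)) = norm (q - y) / \<epsilon>" for y
      using assms by (subst norm_scaleR) simp
    then show ?thesis
      using assms by (auto simp: mollifier_eq_0_iff dist_norm simp del: scaleR_diff_right norm_scaleR)
  qed
  then have cl: "closure {y. mollifier ((1/\<epsilon>) *\<^sub>R (q - y)) \<noteq> 0} = cball q \<epsilon>"
    using assms by simp
  have "\<forall>n. Ck n (\<lambda>y. mollifier ((1/\<epsilon>) *\<^sub>R (q - y)))"
    unfolding eq by (intro allI Ck_affine mollifier_Ck)
  then show ?thesis
    unfolding test_functions_def mem_Collect_eq cl using assms(2) compact_cball by blast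
qed

section \<open>Density of continuous functions and continuity of affine changes of variable in
  \<open>L^q\<close>\<close>

lemma nn_integral_lborel_affine:
  fixes f :: "'a::euclidean_space \<Rightarrow> ennreal"
  assumes [measurable]: "f \<in> borel_measurable borel" and c: "c \<noteq> 0"
  shows "(\<integral>\<^sup>+x. f (t + c *\<^sub>R x) \<partial>lborel) = ennreal (1 / \<bar>c\<bar> ^ DIM('a)) * (\<integral>\<^sup>+x. f x \<partial>lborel)"
proof -
  have "(\<integral>\<^sup>+x. f x \<partial>lborel) = (\<integral>\<^sup>+x. f x \<partial>density (distr lborel borel (\<lambda>x. t + c *\<^sub>R x)) (\<lambda>_. \<bar>c\<bar> ^ DIM('a)))"
    using lborel_affine[OF c, of t] by simp
  also have "\<dots> = ennreal (\<bar>c\<bar> ^ DIM('a)) * (\<integral>\<^sup>+x. f (t + c *\<^sub>R x) \<partial>lborel)"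
    by (simp add: nn_integral_density nn_integral_distr nn_integral_cmult)
  finally have "ennreal (1 / \<bar>c\<bar> ^ DIM('a)) * (\<integral>\<^sup>+x. f x \<partial>lborel)
    = (ennreal (1 / \<bar>c\<bar> ^ DIM('a)) * ennreal (\<bar>c\<bar> ^ DIM('a))) * (\<integral>\<^sup>+x. f (t + c *\<^sub>R x) \<partial>lborel)"
    by (simp add: mult.assoc)
  also have "ennreal (1 / \<bar>c\<bar> ^ DIM('a)) * ennreal (\<bar>c\<bar> ^ DIM('a)) = 1"
    using c by (simp add: ennreal_mult[symmetric])
  finally show ?thesis by simp
qed

text \<open>A dilation factor of at least 1/2 has Jacobian at least \<open>(1/2) ^ DIM('a)\<close>.
  The bound is uniform in the factor.\<close>

lemma nn_integral_lborel_affine_le: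
  fixes h :: "'a::euclidean_space \<Rightarrow> ennreal"
  assumes [measurable]: "h \<in> borel_measurable borel" and c: "1/2 \<le> c"
  shows "(\<integral>\<^sup>+x. h (v + c *\<^sub>R x) \<partial>lborel) \<le> ennreal (2 ^ DIM('a)) * (\<integral>\<^sup>+x. h x \<partial>lborel)"
proof -
  have "(1/2) ^ DIM('a) \<le> c ^ DIM('a)" using c by (intro power_mono) auto
  then have "1 / \<bar>c\<bar> ^ DIM('a) \<le> 2 ^ DIM('a)" using c by (simp add: field_simps power_one_over)
  then show ?thesis
    using c by (subst nn_integral_lborel_affine) (auto intro!: mult_right_mono ennreal_leI)
qed

lemma nn_integral_powr_norm_diff_triangle:
  fixes f g h :: "'x \<Rightarrow> 'b::euclidean_space"
  assumes [measurable]: "f \<in> borel_measurable M" "g \<in> borel_measurable M" "h \<in> borel_measurable M" and q: "0 \<le> q"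
  shows "(\<integral>\<^sup>+x. ennreal (norm (f x - h x) powr q) \<partial>M)
    \<le> ennreal (2 powr q) * ((\<integral>\<^sup>+x. ennreal (norm (f x - g x) powr q) \<partial>M) + (\<integral>\<^sup>+x. ennreal (norm (g x - h x) powr q) \<partial>M))"
proof -
  have "(\<integral>\<^sup>+x. ennreal (norm (f x - h x) powr q) \<partial>M)
    \<le> (\<integral>\<^sup>+x. ennreal (2 powr q) * (ennreal (norm (f x - g x) powr q) + ennreal (norm (g x - h x) powr q)) \<partial>M)"
  proof (rule nn_integral_mono)
    fix x
    have "norm (f x - h x) powr q \<le> 2 powr q * (norm (f x - g x) powr q + norm (g x - h x) powr q)"
      using powr_norm_add_le[OF q, of "f x - g x" "g x - h x"] by simp
    then show "ennreal (norm (f x - h x) powr q)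
      \<le> ennreal (2 powr q) * (ennreal (norm (f x - g x) powr q) + ennreal (norm (g x - h x) powr q))"
      by (simp add: ennreal_mult[symmetric] ennreal_plus[symmetric] del: ennreal_plus)
  qed
  also have "\<dots> = ennreal (2 powr q) * ((\<integral>\<^sup>+x. ennreal (norm (f x - g x) powr q) \<partial>M) + (\<integral>\<^sup>+x. ennreal (norm (g x - h x) powr q) \<partial>M))"
    by (subst nn_integral_cmult; simp add: nn_integral_add)
  finally show ?thesis .
qed

text \<open>Bookkeeping for the triangle inequality of q-th powers: it states how small two terms
  have to be for the bound with factor \<open>c\<close> to fall below
  \<open>\<delta>\<close>.\<close>

lemma ennreal_small_factor:
  fixes c \<delta> :: real
  assumes "0 \<le> c" "0 < \<delta>"
  obtains d where "0 < d" "\<And>u v::ennreal. u < ennreal d \<Longrightarrow> v < ennreal d \<Longrightarrow> ennreal c * (u + v) < ennreal \<delta>"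
proof
  define d where "d = \<delta> / (2 * c + 2)"
  show d: "0 < d" using assms by (simp add: d_def)
  fix u v :: ennreal assume "u < ennreal d" "v < ennreal d"
  then have "u + v \<le> ennreal (2 * d)"
    using d add_mono[of u "ennreal d" v "ennreal d"] by (simp add: ennreal_plus[symmetric] del: ennreal_plus)
  then have "ennreal c * (u + v) \<le> ennreal c * ennreal (2 * d)" by (rule mult_left_mono) simp
  also have "\<dots> = ennreal (c * (2 * d))" using assms d by (simp add: ennreal_mult)
  also have "\<dots> < ennreal \<delta>"
    using assms by (intro ennreal_lessI) (auto simp: d_def field_simps)
  finally show "ennreal c * (u + v) < ennreal \<delta>" .
qed

text \<open>Truncation in both domain and range; the error is dominated by the q-th power of
  \<open>f\<close> itself.\<close>

lemma Lq_bounded_support_approx: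
  fixes f :: "'a::euclidean_space \<Rightarrow> 'b::euclidean_space"
  assumes [measurable]: "f \<in> borel_measurable borel" and q: "0 < q"
    and fin: "(\<integral>\<^sup>+x. ennreal (norm (f x) powr q) \<partial>lborel) < \<infinity>" and \<delta>: "0 < (\<delta>::real)"
  obtains n :: nat where "0 < n" "(\<integral>\<^sup>+x. ennreal (norm (f x - (if norm x \<le> real n \<and> norm (f x) \<le> real n then f x else 0)) powr q) \<partial>lborel) < ennreal \<delta>"
proof -
  define F where "F n x = (if norm x \<le> real n \<and> norm (f x) \<le> real n then f x else 0)" for n x
  have [measurable]: "F n \<in> borel_measurable borel" for n unfolding F_def by measurable
  have "(\<lambda>n. \<integral>\<^sup>+x. ennreal (norm (f x - F n x) powr q) \<partial>lborel) \<longlonglongrightarrow> (\<integral>\<^sup>+(x::'a). 0 \<partial>lborel)"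
  proof (rule nn_integral_dominated_convergence[where w = "\<lambda>x. ennreal (norm (f x) powr q)"])
    show "AE x in lborel. (\<lambda>n. ennreal (norm (f x - F n x) powr q)) \<longlonglongrightarrow> 0"
    proof (rule AE_I2)
      fix x
      obtain m :: nat where m: "max (norm x) (norm (f x)) \<le> real m" using real_arch_simple by blast
      show "(\<lambda>n. ennreal (norm (f x - F n x) powr q)) \<longlonglongrightarrow> 0"
        by (rule tendsto_eventually) (use m in \<open>auto simp: F_def eventually_sequentially intro!: exI[of _ m]\<close>)
    qed
  qed (use fin q in \<open>auto simp: F_def\<close>)
  then have "\<forall>\<^sub>F n in sequentially. (\<integral>\<^sup>+x. ennreal (norm (f x - F n x) powr q) \<partial>lborel) < ennreal \<delta> \<and> 0 < n"
    using \<delta> by (intro eventually_conj eventually_gt_at_top order_tendstoD) auto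
  then show ?thesis using that unfolding F_def eventually_sequentially by blast
qed

text \<open>A measurable function is an almost everywhere limit of continuous ones. After truncating
  the function and cutting off the approximants, dominated convergence makes this limit one in
  \<open>L^q\<close>.\<close>

lemma Lq_continuous_approx:
  fixes f :: "'a::euclidean_space \<Rightarrow> 'b::euclidean_space"
  assumes f[measurable]: "f \<in> borel_measurable borel" and q: "0 < q"
    and fin: "(\<integral>\<^sup>+x. ennreal (norm (f x) powr q) \<partial>lborel) < \<infinity>" and \<delta>: "0 < (\<delta>::real)"
  obtains g R where "continuous_on UNIV g" "0 < R" "\<And>x. R \<le> norm x \<Longrightarrow> g x = 0" "\<And>x. norm (g x) \<le> R"
    "(\<integral>\<^sup>+x. ennreal (norm (f x - g x) powr q) \<partial>lborel) < ennreal \<delta>"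
proof -
  obtain d where d: "0 < d" "\<And>u v::ennreal. u < ennreal d \<Longrightarrow> v < ennreal d \<Longrightarrow> ennreal (2 powr q) * (u + v) < ennreal \<delta>"
    using ennreal_small_factor[of "2 powr q" \<delta>] \<delta> by auto
  obtain n :: nat where n: "0 < n" and nd: "(\<integral>\<^sup>+x. ennreal (norm (f x - (if norm x \<le> real n \<and> norm (f x) \<le> real n then f x else 0)) powr q) \<partial>lborel) < ennreal d"
    using Lq_bounded_support_approx[OF f q fin d(1)] .
  define F where "F x = (if norm x \<le> real n \<and> norm (f x) \<le> real n then f x else 0)" for x
  have F[measurable]: "F \<in> borel_measurable borel" unfolding F_def by measurable
  have Fn: "norm (F x) \<le> n" "norm x > n \<Longrightarrow> F x = 0" for x by (auto simp: F_def)
  have "F \<in> borel_measurable lebesgue" by (auto intro: measurable_completion)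
  from lebesgue_measurable_imp_measurable_on[OF this sets.top] obtain N h where N: "negligible N" and h: "\<And>k. continuous_on UNIV (h k)"
    and hF: "\<And>x. x \<notin> N \<Longrightarrow> (\<lambda>k. h k x) \<longlonglongrightarrow> F x"
    unfolding measurable_on_def by auto
  \<comment> \<open>\<open>\<kappa>\<close> is 1 on the ball of radius \<open>n\<close> and 0
    outside radius \<open>n + 1\<close>; \<open>c\<close> is the radial retraction onto the ball of
    radius \<open>n\<close>. Both leave \<open>F\<close> unchanged and give the approximants a
    common bound and support.\<close>
  define \<kappa> where "\<kappa> x = max 0 (min 1 (real n + 1 - norm x))" for x :: 'a
  define c where "c y = (n / max n (norm y)) *\<^sub>R y" for y :: 'b
  define g where "g k x = \<kappa> x *\<^sub>R c (h k x)" for k x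
  have "continuous_on UNIV c" unfolding c_def using n by (intro continuous_intros) auto
  then have contg: "continuous_on UNIV (g k)" for k
    unfolding g_def \<kappa>_def using h by (intro continuous_intros) (auto intro: continuous_on_compose2)
  then have [measurable]: "g k \<in> borel_measurable borel" for k by (rule borel_measurable_continuous_onI)
  have cn: "norm (c y) \<le> n" for y
  proof -
    have "norm (c y) = n * (norm y / max n (norm y))" by (simp add: c_def)
    also have "\<dots> \<le> real n * 1" using n by (intro mult_left_mono) (auto simp: divide_le_eq)
    finally show ?thesis by simp
  qed
  have gn: "norm (g k x) \<le> n" for k x
  proof -
    have "norm (g k x) \<le> 1 * real n" unfolding g_def norm_scaleR by (intro mult_mono cn) (auto simp: \<kappa>_def)
    then show ?thesis by simp
  qed
  have g0: "g k x = 0" if "real n + 1 \<le> norm x" for k x using that by (simp add: g_def \<kappa>_def)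
  have lim: "(\<lambda>k. g k x) \<longlonglongrightarrow> F x" if "x \<notin> N" for x
  proof -
    have "isCont c (F x)" using \<open>continuous_on UNIV c\<close> by (simp add: continuous_on_eq_continuous_at)
    then have "(\<lambda>k. c (h k x)) \<longlonglongrightarrow> c (F x)" using hF[OF that] by (rule isCont_tendsto_compose)
    then have "(\<lambda>k. g k x) \<longlonglongrightarrow> \<kappa> x *\<^sub>R c (F x)" unfolding g_def by (intro tendsto_intros)
    moreover have "c (F x) = F x" using Fn(1)[of x] n by (simp add: c_def max_def)
    moreover have "\<kappa> x *\<^sub>R F x = F x" using Fn(2)[of x] by (cases "norm x \<le> n") (auto simp: \<kappa>_def)
    ultimately show ?thesis by simp
  qed
  have "(\<lambda>k. \<integral>\<^sup>+x. ennreal (norm (F x - g k x) powr q) \<partial>lborel) \<longlonglongrightarrow> (\<integral>\<^sup>+(x::'a). 0 \<partial>lborel)"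
  proof (rule nn_integral_dominated_convergence[where w = "\<lambda>x. ennreal ((2 * n) powr q) * indicator (cball 0 (n + 1)) x"])
    have "AE x in lborel. x \<notin> N"
      using N by (auto simp: negligible_iff_null_sets intro: AE_completion_iff[THEN iffD1] AE_not_in)
    then show "AE x in lborel. (\<lambda>k. ennreal (norm (F x - g k x) powr q)) \<longlonglongrightarrow> 0"
    proof eventually_elim
      case (elim x)
      have "(\<lambda>k. ennreal (norm (F x - g k x) powr q)) \<longlonglongrightarrow> ennreal (norm (F x - F x) powr q)"
        using q by (intro tendsto_ennrealI tendsto_powr' tendsto_intros lim elim) auto
      then show ?case using q by simp
    qed
    show "AE x in lborel. ennreal (norm (F x - g k x) powr q) \<le> ennreal ((2 * n) powr q) * indicator (cball 0 (n + 1)) x" for k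
    proof (rule AE_I2)
      fix x :: 'a
      show "ennreal (norm (F x - g k x) powr q) \<le> ennreal ((2 * n) powr q) * indicator (cball 0 (n + 1)) x"
      proof (cases "norm x \<le> n + 1")
        case True
        have "norm (F x - g k x) \<le> 2 * n"
          using norm_triangle_ineq4[of "F x" "g k x"] Fn(1)[of x] gn[of k x] by simp
        then show ?thesis using True q by (auto intro!: ennreal_leI powr_mono2)
      next
        case False
        then show ?thesis using Fn(2)[of x] g0[of x k] by simp
      qed
    qed
    show "(\<integral>\<^sup>+x. ennreal ((2 * n) powr q) * indicator (cball (0::'a) (n + 1)) x \<partial>lborel) < \<infinity>"
      using emeasure_lborel_cball_finite[of "0::'a" "n + 1"]
      by (subst nn_integral_cmult_indicator) (auto simp: ennreal_mult_less_top)
    show "(\<lambda>x. ennreal ((2 * n) powr q) * indicator (cball (0::'a) (n + 1)) x) \<in> borel_measurable lborel"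
      by (intro borel_measurable_times_ennreal borel_measurable_const borel_measurable_indicator) simp
    show "(\<lambda>x. ennreal (norm (F x - g k x) powr q)) \<in> borel_measurable lborel" for k
      by measurable
  qed simp
  then have "\<forall>\<^sub>F k in sequentially. (\<integral>\<^sup>+x. ennreal (norm (F x - g k x) powr q) \<partial>lborel) < ennreal d"
    using d(1) by (intro order_tendstoD(2)) auto
  then obtain k where k: "(\<integral>\<^sup>+x. ennreal (norm (F x - g k x) powr q) \<partial>lborel) < ennreal d"
    unfolding eventually_sequentially by blast
  have "(\<integral>\<^sup>+x. ennreal (norm (f x - g k x) powr q) \<partial>lborel) < ennreal \<delta>"
  proof (rule le_less_trans)
    show "(\<integral>\<^sup>+x. ennreal (norm (f x - g k x) powr q) \<partial>lborel) \<le> ennreal (2 powr q) *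
      ((\<integral>\<^sup>+x. ennreal (norm (f x - F x) powr q) \<partial>lborel) + (\<integral>\<^sup>+x. ennreal (norm (F x - g k x) powr q) \<partial>lborel))"
      by (rule nn_integral_powr_norm_diff_triangle) (use q in auto)
    show "ennreal (2 powr q) * ((\<integral>\<^sup>+x. ennreal (norm (f x - F x) powr q) \<partial>lborel) + (\<integral>\<^sup>+x. ennreal (norm (F x - g k x) powr q) \<partial>lborel)) < ennreal \<delta>"
      using d(2) nd[folded F_def] k by blast
  qed
  moreover have "norm (g k x) \<le> real n + 1" for x using gn[of k x] by simp
  ultimately show ?thesis using that[OF contg[of k], of "real n + 1"] g0 by auto
qed

text \<open>For a continuous function of bounded support the claim is dominated convergence. A
  general \<open>f\<close> is compared with such a \<open>g\<close> before and after the change of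
  variable; the latter costs the factor \<open>2 ^ DIM('a)\<close>.\<close>

lemma Lq_affine_continuity:
  fixes f :: "'a::euclidean_space \<Rightarrow> 'b::euclidean_space" and l :: "nat \<Rightarrow> real"
  assumes f[measurable]: "f \<in> borel_measurable borel" and q: "0 < q"
    and fin: "(\<integral>\<^sup>+x. ennreal (norm (f x) powr q) \<partial>lborel) < \<infinity>"
    and a: "a \<longlonglongrightarrow> 0" and l: "l \<longlonglongrightarrow> 1" "\<And>j. 1/2 \<le> l j"
  shows "(\<lambda>j. \<integral>\<^sup>+x. ennreal (norm (f (a j + l j *\<^sub>R x) - f x) powr q) \<partial>lborel) \<longlonglongrightarrow> 0"
proof (rule order_tendstoI)
  fix \<delta>' :: ennreal assume "0 < \<delta>'"
  then obtain \<delta> :: real where \<delta>: "0 < \<delta>" "ennreal \<delta> \<le> \<delta>'"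
  proof (cases \<delta>')
    case (real r)
    then show ?thesis using that[of r] \<open>0 < \<delta>'\<close> by (simp add: ennreal_less_zero_iff)
  next
    case top
    then show ?thesis using that[of 1] by simp
  qed
  obtain d where d: "0 < d" "\<And>u v::ennreal. u < ennreal d \<Longrightarrow> v < ennreal d \<Longrightarrow> ennreal (2 powr q) * (u + v) < ennreal \<delta>"
    using ennreal_small_factor[of "2 powr q" \<delta>] \<delta> by auto
  obtain d2 where d2: "0 < d2" "\<And>u v::ennreal. u < ennreal d2 \<Longrightarrow> v < ennreal d2 \<Longrightarrow> ennreal (2 powr q) * (u + v) < ennreal d"
    using ennreal_small_factor[of "2 powr q" d] d by auto
  \<comment> \<open>The division by \<open>2 ^ DIM('a)\<close> pays for the change of variable in
    the distance between \<open>f\<close> and \<open>g\<close>.\<close>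
  define e where "e = min d2 (d2 / 2 ^ DIM('a))"
  have e: "0 < e" "e \<le> d2" "e \<le> d2 / 2 ^ DIM('a)" using d2 by (auto simp: e_def)
  have ed: "e \<le> d2" using e by simp
  obtain g R where g: "continuous_on UNIV g" "0 < R" "\<And>x. R \<le> norm x \<Longrightarrow> g x = 0" "\<And>x. norm (g x) \<le> R"
    and fg: "(\<integral>\<^sup>+x. ennreal (norm (f x - g x) powr q) \<partial>lborel) < ennreal e"
    by (rule Lq_continuous_approx[OF f q fin e(1)]) (rule that)
  have [measurable]: "g \<in> borel_measurable borel" using g(1) by (rule borel_measurable_continuous_onI)
  have "(\<lambda>j. \<integral>\<^sup>+x. ennreal (norm (g (a j + l j *\<^sub>R x) - g x) powr q) \<partial>lborel) \<longlonglongrightarrow> (\<integral>\<^sup>+(x::'a). 0 \<partial>lborel)"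
  proof -
    have "Bseq a" by (rule convergent_imp_Bseq[OF convergentI[OF a]])
    then obtain c where c: "0 < c" "\<And>j. norm (a j) \<le> c" unfolding Bseq_def by blast
    show ?thesis
    proof (rule nn_integral_dominated_convergence[where w = "\<lambda>x. ennreal ((2 * R) powr q) * indicator (cball 0 (2 * (R + c))) x"])
      show "AE x in lborel. (\<lambda>j. ennreal (norm (g (a j + l j *\<^sub>R x) - g x) powr q)) \<longlonglongrightarrow> 0"
      proof (rule AE_I2)
        fix x
        have "(\<lambda>j. a j + l j *\<^sub>R x) \<longlonglongrightarrow> 0 + 1 *\<^sub>R x" by (intro tendsto_intros a l)
        then have "(\<lambda>j. g (a j + l j *\<^sub>R x)) \<longlonglongrightarrow> g x"
          using g(1) by (intro isCont_tendsto_compose[of x g]) (auto simp: continuous_on_eq_continuous_at)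
        then have "(\<lambda>j. ennreal (norm (g (a j + l j *\<^sub>R x) - g x) powr q)) \<longlonglongrightarrow> ennreal (norm (g x - g x) powr q)"
          using q by (intro tendsto_ennrealI tendsto_powr' tendsto_intros) auto
        then show "(\<lambda>j. ennreal (norm (g (a j + l j *\<^sub>R x) - g x) powr q)) \<longlonglongrightarrow> 0" using q by simp
      qed
      show "AE x in lborel. ennreal (norm (g (a j + l j *\<^sub>R x) - g x) powr q) \<le> ennreal ((2 * R) powr q) * indicator (cball 0 (2 * (R + c))) x" for j
      proof (rule AE_I2)
        fix x :: 'a
        show "ennreal (norm (g (a j + l j *\<^sub>R x) - g x) powr q) \<le> ennreal ((2 * R) powr q) * indicator (cball 0 (2 * (R + c))) x"
        proof (cases "norm x \<le> 2 * (R + c)")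
          case True
          have "norm (g (a j + l j *\<^sub>R x) - g x) \<le> 2 * R"
            using norm_triangle_ineq4[of "g (a j + l j *\<^sub>R x)" "g x"] g(4)[of x] g(4)[of "a j + l j *\<^sub>R x"] by simp
          then show ?thesis using True q by (auto intro!: ennreal_leI powr_mono2)
        next
          case False
          \<comment> \<open>Far from the origin the moved point has norm at least half of
            \<open>norm x\<close> minus \<open>c\<close>, hence at least \<open>R\<close>, so both
            values of \<open>g\<close> vanish. This gives a common support for all
            \<open>j\<close>.\<close>
          have "1/2 * norm x \<le> l j * norm x" by (rule mult_right_mono[OF l(2)]) simp
          then have "1/2 * norm x \<le> norm (l j *\<^sub>R x)" using l(2)[of j] by simp
          moreover have "norm (l j *\<^sub>R x) \<le> norm (a j + l j *\<^sub>R x) + norm (a j)"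
            using norm_triangle_ineq4[of "a j + l j *\<^sub>R x" "a j"] by simp
          ultimately have "R \<le> norm (a j + l j *\<^sub>R x)" using False c(2)[of j] by simp
          then have "g (a j + l j *\<^sub>R x) = 0" "g x = 0" using g(2) g(3) False c(1) by auto
          then show ?thesis by simp
        qed
      qed
      show "(\<integral>\<^sup>+x. ennreal ((2 * R) powr q) * indicator (cball (0::'a) (2 * (R + c))) x \<partial>lborel) < \<infinity>"
        using emeasure_lborel_cball_finite[of "0::'a" "2 * (R + c)"]
        by (subst nn_integral_cmult_indicator) (auto simp: ennreal_mult_less_top)
    show "(\<lambda>x. ennreal ((2 * R) powr q) * indicator (cball (0::'a) (2 * (R + c))) x) \<in> borel_measurable lborel"
      by (intro borel_measurable_times_ennreal borel_measurable_const borel_measurable_indicator) simp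
    show "(\<lambda>x. ennreal (norm (g (a k + l k *\<^sub>R x) - g x) powr q)) \<in> borel_measurable lborel" for k
      by measurable
  qed simp
  qed
  then have "\<forall>\<^sub>F j in sequentially. (\<integral>\<^sup>+x. ennreal (norm (g (a j + l j *\<^sub>R x) - g x) powr q) \<partial>lborel) < ennreal d2"
    using d2(1) by (intro order_tendstoD(2)) auto
  then show "\<forall>\<^sub>F j in sequentially. (\<integral>\<^sup>+x. ennreal (norm (f (a j + l j *\<^sub>R x) - f x) powr q) \<partial>lborel) < \<delta>'"
  proof eventually_elim
    case (elim j)
    have "(\<integral>\<^sup>+x. ennreal (norm (f (a j + l j *\<^sub>R x) - g (a j + l j *\<^sub>R x)) powr q) \<partial>lborel)
      \<le> ennreal (2 ^ DIM('a)) * (\<integral>\<^sup>+x. ennreal (norm (f x - g x) powr q) \<partial>lborel)"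
      by (rule nn_integral_lborel_affine_le[of "\<lambda>x. ennreal (norm (f x - g x) powr q)", OF _ l(2)]) measurable
    also have "\<dots> < ennreal d2"
    proof -
      have "ennreal (2 ^ DIM('a)) * (\<integral>\<^sup>+x. ennreal (norm (f x - g x) powr q) \<partial>lborel) < ennreal (2 ^ DIM('a)) * ennreal e"
        using fg by (intro ennreal_mult_strict_left_mono) auto
      also have "\<dots> \<le> ennreal d2" using e by (simp add: ennreal_mult[symmetric] field_simps ennreal_leI)
      finally show ?thesis .
    qed
    finally have 1: "(\<integral>\<^sup>+x. ennreal (norm (f (a j + l j *\<^sub>R x) - g (a j + l j *\<^sub>R x)) powr q) \<partial>lborel) < ennreal d2" .
    have fg': "(\<integral>\<^sup>+x. ennreal (norm (g x - f x) powr q) \<partial>lborel) < ennreal d"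
    proof -
      have "(\<integral>\<^sup>+x. ennreal (norm (g x - f x) powr q) \<partial>lborel) < ennreal d2"
        using less_le_trans[OF fg ennreal_leI[OF ed]] by (simp add: norm_minus_commute)
      \<comment> \<open>Otherwise the property of \<open>d2\<close>, with the summands
        \<open>d\<close> and 0, would yield \<open>2 powr q * d < d\<close>.\<close>
      moreover have "ennreal d2 \<le> ennreal d"
      proof (rule ccontr)
        assume "\<not> ennreal d2 \<le> ennreal d"
        then have "ennreal d < ennreal d2" by simp
        from d2(2)[OF this, of 0] have "ennreal (2 powr q * d) < ennreal d"
          using d2(1) d(1) by (simp add: ennreal_mult)
        moreover have "1 * d \<le> 2 powr q * d" using d(1) q by (intro mult_right_mono ge_one_powr_ge_zero) auto
        ultimately show False using d(1) by (simp add: ennreal_less_iff)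
      qed
      ultimately show ?thesis by (rule less_le_trans)
    qed
    have "(\<integral>\<^sup>+x. ennreal (norm (f (a j + l j *\<^sub>R x) - g x) powr q) \<partial>lborel) \<le> ennreal (2 powr q) *
      ((\<integral>\<^sup>+x. ennreal (norm (f (a j + l j *\<^sub>R x) - g (a j + l j *\<^sub>R x)) powr q) \<partial>lborel)
       + (\<integral>\<^sup>+x. ennreal (norm (g (a j + l j *\<^sub>R x) - g x) powr q) \<partial>lborel))"
      by (rule nn_integral_powr_norm_diff_triangle) (use q in auto)
    also have "\<dots> < ennreal d" using d2(2)[OF 1 elim] .
    finally have 2: "(\<integral>\<^sup>+x. ennreal (norm (f (a j + l j *\<^sub>R x) - g x) powr q) \<partial>lborel) < ennreal d" .
    have "(\<integral>\<^sup>+x. ennreal (norm (f (a j + l j *\<^sub>R x) - f x) powr q) \<partial>lborel) \<le> ennreal (2 powr q) *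
      ((\<integral>\<^sup>+x. ennreal (norm (f (a j + l j *\<^sub>R x) - g x) powr q) \<partial>lborel)
       + (\<integral>\<^sup>+x. ennreal (norm (g x - f x) powr q) \<partial>lborel))"
      by (rule nn_integral_powr_norm_diff_triangle) (use q in auto)
    also have "\<dots> < ennreal \<delta>" using d(2)[OF 2 fg'] .
    finally show ?case using \<delta>(2) by simp
  qed
qed simp

section \<open>Mollification as an average, and its convergence\<close>

text \<open>Jensen's inequality on a probability space: the tangent to the power at the mean
  \<open>m\<close> of the norm is integrated, and its linear term integrates to 0.\<close>

lemma powr_norm_integral_le:
  fixes g :: "'x \<Rightarrow> 'b::euclidean_space"
  assumes [measurable]: "g \<in> borel_measurable M" and one: "emeasure M (space M) = 1" and q: "1 \<le> q"
    and fin: "(\<integral>\<^sup>+z. ennreal (norm (g z) powr q) \<partial>M) < \<infinity>"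
  shows "integrable M g" "ennreal (norm (LINT z|M. g z) powr q) \<le> (\<integral>\<^sup>+z. ennreal (norm (g z) powr q) \<partial>M)"
proof -
  interpret finite_measure M using one by (intro finite_measureI) simp
  have m1: "measure M (space M) = 1" using one by (simp add: measure_def)
  have gq: "integrable M (\<lambda>z. norm (g z) powr q)" using fin by (simp add: integrable_iff_bounded)
  have "t \<le> 1 + t powr q" if "0 \<le> t" for t :: real
  proof (cases "t \<le> 1")
    case True
    then show ?thesis using powr_ge_zero[of t q] by linarith
  next
    case False
    then show ?thesis using powr_mono[of 1 q t] q by simp
  qed
  then show g: "integrable M g"
    using gq by (intro Bochner_Integration.integrable_bound[of M "\<lambda>z. 1 + norm (g z) powr q" g]) auto
  define m where "m = (LINT z|M. norm (g z))"
  have "norm (LINT z|M. g z) \<le> m" unfolding m_def by (rule integral_norm_bound)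
  then have "norm (LINT z|M. g z) powr q \<le> m powr q" using q by (intro powr_mono2) auto
  also have "m powr q \<le> (LINT z|M. norm (g z) powr q)"
  proof (cases "m = 0")
    case True
    then show ?thesis by simp
  next
    case False
    then have "0 < m" unfolding m_def by (metis Bochner_Integration.integral_nonneg norm_ge_zero order_le_less)
    then have "(LINT z|M. m powr q + q * m powr (q - 1) * (norm (g z) - m)) \<le> (LINT z|M. norm (g z) powr q)"
      using g gq q by (intro integral_mono powr_tangent) auto
    moreover have "(LINT z|M. m powr q + q * m powr (q - 1) * (norm (g z) - m)) = m powr q"
      using g m1 by (simp add: m_def)
    ultimately show ?thesis by simp
  qed
  finally show "ennreal (norm (LINT z|M. g z) powr q) \<le> (\<integral>\<^sup>+z. ennreal (norm (g z) powr q) \<partial>M)"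
    using gq by (subst nn_integral_eq_integral) (auto intro: ennreal_leI)
qed

text \<open>Averaging at scale \<open>\<epsilon>\<close> around the dilated point
  \<open>a + l *\<^sub>R x\<close>. With a suitable dilation even boundary points see only values
  from inside the domain.\<close>

definition mollify :: "'a::euclidean_space \<Rightarrow> real \<Rightarrow> real \<Rightarrow> ('a \<Rightarrow> 'b::euclidean_space) \<Rightarrow> 'a \<Rightarrow> 'b" where
  "mollify a l \<epsilon> f x = (LINT z|mollifier_measure. f (a + l *\<^sub>R x - \<epsilon> *\<^sub>R z))"

lemma mollify_measurable[measurable]:
  assumes [measurable]: "f \<in> borel_measurable borel"
  shows "mollify a l \<epsilon> f \<in> borel_measurable borel"
proof -
  interpret finite_measure "mollifier_measure :: 'a measure" by (rule finite_measure_mollifier_measure)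
  show ?thesis unfolding mollify_def by measurable
qed

text \<open>Jensen's inequality for the mollifier measure. When the right side is infinite there is
  nothing to prove, so integrability of the translate need not be assumed.\<close>

lemma mollify_diff_powr_le:
  fixes f :: "'a::euclidean_space \<Rightarrow> 'b::euclidean_space"
  assumes [measurable]: "f \<in> borel_measurable borel" and q: "1 \<le> q"
  shows "ennreal (norm (mollify a l \<epsilon> f x - f x) powr q)
    \<le> (\<integral>\<^sup>+z. ennreal (norm (f (a + l *\<^sub>R x - \<epsilon> *\<^sub>R z) - f x) powr q) \<partial>mollifier_measure)"
proof (cases "(\<integral>\<^sup>+z. ennreal (norm (f (a + l *\<^sub>R x - \<epsilon> *\<^sub>R z) - f x) powr q) \<partial>mollifier_measure) < \<infinity>")
  case True
  interpret finite_measure "mollifier_measure :: 'a measure" by (rule finite_measure_mollifier_measure)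
  have m1: "measure (mollifier_measure :: 'a measure) UNIV = 1"
    by (simp add: measure_def emeasure_mollifier_measure_UNIV)
  have int: "integrable mollifier_measure (\<lambda>z. f (a + l *\<^sub>R x - \<epsilon> *\<^sub>R z) - f x)"
    and le: "ennreal (norm (LINT z|mollifier_measure. f (a + l *\<^sub>R x - \<epsilon> *\<^sub>R z) - f x) powr q)
    \<le> (\<integral>\<^sup>+z. ennreal (norm (f (a + l *\<^sub>R x - \<epsilon> *\<^sub>R z) - f x) powr q) \<partial>mollifier_measure)"
    using powr_norm_integral_le[of "\<lambda>z. f (a + l *\<^sub>R x - \<epsilon> *\<^sub>R z) - f x" mollifier_measure q] q True
    by (auto simp: emeasure_mollifier_measure_UNIV)
  have "integrable mollifier_measure (\<lambda>z. f (a + l *\<^sub>R x - \<epsilon> *\<^sub>R z))"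
    using Bochner_Integration.integrable_add[OF int integrable_const[of "f x"]] by simp
  then have "(LINT z|mollifier_measure. f (a + l *\<^sub>R x - \<epsilon> *\<^sub>R z) - f x) = mollify a l \<epsilon> f x - f x"
    unfolding mollify_def using m1 by simp
  with le show ?thesis by simp
qed (simp add: not_less top_unique)

text \<open>By Jensen and Fubini the error is at most the average over \<open>z\<close> of the
  errors \<open>I j z\<close> of single affine maps. Each of these tends to 0, and all are bounded
  by the constant \<open>w\<close>.\<close>

lemma mollify_tendsto_Lq:
  fixes f :: "'a::euclidean_space \<Rightarrow> 'b::euclidean_space" and l \<epsilon> :: "nat \<Rightarrow> real"
  assumes f[measurable]: "f \<in> borel_measurable borel" and q: "1 \<le> q"
    and fin: "(\<integral>\<^sup>+x. ennreal (norm (f x) powr q) \<partial>lborel) < \<infinity>"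
    and a: "a \<longlonglongrightarrow> 0" and l: "l \<longlonglongrightarrow> 1" "\<And>j. 1/2 \<le> l j" and \<epsilon>: "\<epsilon> \<longlonglongrightarrow> 0"
  shows "(\<lambda>j. \<integral>\<^sup>+x. ennreal (norm (mollify (a j) (l j) (\<epsilon> j) f x - f x) powr q) \<partial>lborel) \<longlonglongrightarrow> 0"
proof -
  let ?\<mu> = "mollifier_measure :: 'a measure"
  interpret finite_measure ?\<mu> by (rule finite_measure_mollifier_measure)
  interpret P: pair_sigma_finite lborel ?\<mu> ..
  have [measurable]: "(\<lambda>p. ennreal (norm (f (a j + l j *\<^sub>R fst p - \<epsilon> j *\<^sub>R snd p) - f (fst p)) powr q)) \<in> borel_measurable (lborel \<Otimes>\<^sub>M ?\<mu>)" for j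
    by measurable
  define I where "I j z = (\<integral>\<^sup>+x. ennreal (norm (f (a j + l j *\<^sub>R x - \<epsilon> j *\<^sub>R z) - f x) powr q) \<partial>lborel)" for j z
  have I_meas: "I j \<in> borel_measurable ?\<mu>" for j unfolding I_def by measurable
  define w where "w = ennreal (2 powr q) * (ennreal (2 ^ DIM('a)) * (\<integral>\<^sup>+x. ennreal (norm (f x) powr q) \<partial>lborel) + (\<integral>\<^sup>+x. ennreal (norm (f x) powr q) \<partial>lborel))"
  have Iw: "I j z \<le> w" for j z
  proof -
    have "I j z \<le> ennreal (2 powr q) * ((\<integral>\<^sup>+x. ennreal (norm (f (a j + l j *\<^sub>R x - \<epsilon> j *\<^sub>R z) - 0) powr q) \<partial>lborel) + (\<integral>\<^sup>+x. ennreal (norm (0 - f x) powr q) \<partial>lborel))"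
      unfolding I_def by (rule nn_integral_powr_norm_diff_triangle[where g = "\<lambda>_. 0"]) (use q in auto)
    also have "(\<integral>\<^sup>+x. ennreal (norm (f (a j + l j *\<^sub>R x - \<epsilon> j *\<^sub>R z) - 0) powr q) \<partial>lborel)
      \<le> ennreal (2 ^ DIM('a)) * (\<integral>\<^sup>+x. ennreal (norm (f x) powr q) \<partial>lborel)"
      using nn_integral_lborel_affine_le[of "\<lambda>x. ennreal (norm (f x) powr q)" "l j" "a j - \<epsilon> j *\<^sub>R z"] l(2)[of j]
      by (simp add: algebra_simps)
    finally show ?thesis unfolding w_def by (simp add: add_right_mono mult_left_mono)
  qed
  have lim: "(\<lambda>j. \<integral>\<^sup>+z. I j z \<partial>?\<mu>) \<longlonglongrightarrow> (\<integral>\<^sup>+z. 0 \<partial>?\<mu>)"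
  proof (rule nn_integral_dominated_convergence[where w = "\<lambda>_. w"])
    show "(\<integral>\<^sup>+z. w \<partial>?\<mu>) < \<infinity>"
      using fin by (simp add: emeasure_mollifier_measure_UNIV w_def ennreal_mult_less_top)
    show "AE z in ?\<mu>. (\<lambda>j. I j z) \<longlonglongrightarrow> 0"
    proof (rule AE_I2)
      fix z
      have "(\<lambda>j. a j - \<epsilon> j *\<^sub>R z) \<longlonglongrightarrow> 0 - 0 *\<^sub>R z" by (intro tendsto_intros a \<epsilon>)
      then have "(\<lambda>j. \<integral>\<^sup>+x. ennreal (norm (f ((a j - \<epsilon> j *\<^sub>R z) + l j *\<^sub>R x) - f x) powr q) \<partial>lborel) \<longlonglongrightarrow> 0"
        using q fin l by (intro Lq_affine_continuity) auto
      then show "(\<lambda>j. I j z) \<longlonglongrightarrow> 0" unfolding I_def by (simp add: algebra_simps)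
    qed
  qed (use I_meas Iw in auto)
  have le: "(\<integral>\<^sup>+x. ennreal (norm (mollify (a j) (l j) (\<epsilon> j) f x - f x) powr q) \<partial>lborel) \<le> (\<integral>\<^sup>+z. I j z \<partial>?\<mu>)" for j
  proof -
    have "(\<integral>\<^sup>+x. ennreal (norm (mollify (a j) (l j) (\<epsilon> j) f x - f x) powr q) \<partial>lborel)
      \<le> (\<integral>\<^sup>+x. \<integral>\<^sup>+z. ennreal (norm (f (a j + l j *\<^sub>R x - \<epsilon> j *\<^sub>R z) - f x) powr q) \<partial>?\<mu> \<partial>lborel)"
      using q by (intro nn_integral_mono mollify_diff_powr_le) auto
    also have "\<dots> = (\<integral>\<^sup>+z. I j z \<partial>?\<mu>)"
      unfolding I_def
      by (rule P.Fubini'[where f = "\<lambda>x z. ennreal (norm (f (a j + l j *\<^sub>R x - \<epsilon> j *\<^sub>R z) - f x) powr q)", symmetric]) (simp add: split_def)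
    finally show ?thesis .
  qed
  show ?thesis
    by (rule tendsto_sandwich[OF _ _ tendsto_const lim[unfolded nn_integral_const mult_zero_left]]) (simp_all add: le)
qed

text \<open>Cutting \<open>f\<close> off outside \<open>S'\<close> does not change the averages at
  points of \<open>S\<close>, since these eventually see only \<open>S'\<close>.\<close>

lemma mollify_tendsto_Lq_local:
  fixes f :: "'a::euclidean_space \<Rightarrow> 'b::euclidean_space" and l \<epsilon> :: "nat \<Rightarrow> real"
  assumes f[measurable]: "f \<in> borel_measurable borel" and q: "1 \<le> q"
    and [measurable]: "S \<in> sets borel" "S' \<in> sets borel" and sub: "S \<subseteq> S'"
    and fin: "(\<integral>\<^sup>+x\<in>S'. ennreal (norm (f x) powr q) \<partial>lborel) < \<infinity>"
    and a: "a \<longlonglongrightarrow> 0" and l: "l \<longlonglongrightarrow> 1" "\<And>j. 1/2 \<le> l j" and \<epsilon>: "\<epsilon> \<longlonglongrightarrow> 0"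
    and near: "\<forall>\<^sub>F j in sequentially. \<forall>x\<in>S. \<forall>z. norm z < 1 \<longrightarrow> a j + l j *\<^sub>R x - \<epsilon> j *\<^sub>R z \<in> S'"
  shows "(\<lambda>j. \<integral>\<^sup>+x\<in>S. ennreal (norm (mollify (a j) (l j) (\<epsilon> j) f x - f x) powr q) \<partial>lborel) \<longlonglongrightarrow> 0"
proof -
  define g where "g x = (if x \<in> S' then f x else 0)" for x
  have [measurable]: "g \<in> borel_measurable borel" unfolding g_def by measurable
  have "(\<integral>\<^sup>+x. ennreal (norm (g x) powr q) \<partial>lborel) = (\<integral>\<^sup>+x\<in>S'. ennreal (norm (f x) powr q) \<partial>lborel)"
    by (intro nn_integral_cong) (auto simp: g_def)
  then have "(\<lambda>j. \<integral>\<^sup>+x. ennreal (norm (mollify (a j) (l j) (\<epsilon> j) g x - g x) powr q) \<partial>lborel) \<longlonglongrightarrow> 0"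
    using fin q a l \<epsilon> by (intro mollify_tendsto_Lq) auto
  then show ?thesis
  proof (rule tendsto_sandwich[OF _ _ tendsto_const, rotated 2])
    show "\<forall>\<^sub>F j in sequentially. (\<integral>\<^sup>+x\<in>S. ennreal (norm (mollify (a j) (l j) (\<epsilon> j) f x - f x) powr q) \<partial>lborel)
      \<le> (\<integral>\<^sup>+x. ennreal (norm (mollify (a j) (l j) (\<epsilon> j) g x - g x) powr q) \<partial>lborel)"
      using near
    proof eventually_elim
      case (elim j)
      show ?case
      proof (rule nn_integral_mono)
        fix x
        show "ennreal (norm (mollify (a j) (l j) (\<epsilon> j) f x - f x) powr q) * indicator S x
          \<le> ennreal (norm (mollify (a j) (l j) (\<epsilon> j) g x - g x) powr q)"
        proof (cases "x \<in> S")
          case True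
          have "mollify (a j) (l j) (\<epsilon> j) f x = mollify (a j) (l j) (\<epsilon> j) g x"
            unfolding mollify_def
          proof (rule integral_cong_AE)
            show "AE z in mollifier_measure. f (a j + l j *\<^sub>R x - \<epsilon> j *\<^sub>R z) = g (a j + l j *\<^sub>R x - \<epsilon> j *\<^sub>R z)"
              using AE_mollifier_measure by eventually_elim (use elim True in \<open>auto simp: g_def\<close>)
          qed measurable
          moreover have "f x = g x" using True sub by (auto simp: g_def)
          ultimately show ?thesis using True by simp
        qed simp
      qed
    qed
  qed auto
qed

lemma lborel_integral_affine:
  fixes h :: "'a::euclidean_space \<Rightarrow> 'b::euclidean_space"
  assumes [measurable]: "h \<in> borel_measurable borel" and c: "c \<noteq> 0"
  shows "(LINT y|lborel. h y) = (\<bar>c\<bar> ^ DIM('a)) *\<^sub>R (LINT z|lborel. h (t + c *\<^sub>R z))"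
proof -
  have "(LINT y|lborel. h y) = (LINT y|density (distr lborel borel (\<lambda>x. t + c *\<^sub>R x)) (\<lambda>_. \<bar>c\<bar> ^ DIM('a)). h y)"
    using lborel_affine[OF c, of t] by simp
  also have "\<dots> = (LINT y|distr lborel borel (\<lambda>x. t + c *\<^sub>R x). (\<bar>c\<bar> ^ DIM('a)) *\<^sub>R h y)"
    by (subst integral_density) auto
  also have "\<dots> = (LINT z|lborel. (\<bar>c\<bar> ^ DIM('a)) *\<^sub>R h (t + c *\<^sub>R z))"
    by (subst integral_distr) auto
  finally show ?thesis by simp
qed

text \<open>Links the averaging form, suited to \<open>L^q\<close> bounds, to the kernel form, in
  which derivatives fall on the smooth kernel.\<close>

lemma mollify_eq_convolution:
  fixes f :: "'a::euclidean_space \<Rightarrow> 'b::euclidean_space"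
  assumes [measurable]: "f \<in> borel_measurable borel" and \<epsilon>: "0 < \<epsilon>"
  shows "(LINT y|lborel. mollifier ((1/\<epsilon>) *\<^sub>R (a + l *\<^sub>R x - y)) *\<^sub>R f y) = (\<epsilon> ^ DIM('a)) *\<^sub>R mollify a l \<epsilon> f x"
proof -
  let ?q = "a + l *\<^sub>R x"
  have "(LINT y|lborel. mollifier ((1/\<epsilon>) *\<^sub>R (?q - y)) *\<^sub>R f y)
    = (\<bar>- \<epsilon>\<bar> ^ DIM('a)) *\<^sub>R (LINT z|lborel. mollifier ((1/\<epsilon>) *\<^sub>R (?q - (?q + (- \<epsilon>) *\<^sub>R z))) *\<^sub>R f (?q + (- \<epsilon>) *\<^sub>R z))"
    using \<epsilon> by (intro lborel_integral_affine) auto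
  also have "(LINT z|lborel. mollifier ((1/\<epsilon>) *\<^sub>R (?q - (?q + (- \<epsilon>) *\<^sub>R z))) *\<^sub>R f (?q + (- \<epsilon>) *\<^sub>R z))
    = (LINT z|lborel. mollifier z *\<^sub>R f (?q - \<epsilon> *\<^sub>R z))"
    using \<epsilon> by (intro Bochner_Integration.integral_cong refl) simp
  also have "\<dots> = mollify a l \<epsilon> f x"
    unfolding mollify_def mollifier_measure_def
    by (subst integral_density) (auto simp: mollifier_nonneg)
  finally show ?thesis using \<epsilon> by simp
qed

section \<open>Convolution with smooth kernels and weak gradients\<close>

definition loc_integrable :: "('a::euclidean_space \<Rightarrow> 'b::euclidean_space) \<Rightarrow> bool" where
  "loc_integrable u \<longleftrightarrow> u \<in> borel_measurable borel \<and> (\<forall>R. set_integrable lborel (cball 0 R) u)"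

lemma loc_integrable_abs:
  fixes u :: "'a::euclidean_space \<Rightarrow> real"
  assumes "loc_integrable u"
  shows "integrable lborel (\<lambda>y. B * (indicator (cball 0 R) y *\<^sub>R \<bar>u y\<bar>))"
proof -
  have "integrable lborel (\<lambda>y. indicator (cball 0 R) y *\<^sub>R u y)"
    using assms by (simp add: loc_integrable_def set_integrable_def)
  then have "integrable lborel (\<lambda>y. norm (indicator (cball 0 R) y *\<^sub>R u y))" by (rule integrable_norm)
  also have "(\<lambda>y. norm (indicator (cball 0 R) y *\<^sub>R u y)) = (\<lambda>y. indicator (cball 0 R) y *\<^sub>R \<bar>u y\<bar>)"
    by (auto simp: indicator_def)
  finally show ?thesis by (rule integrable_mult_right)
qed

lemma kernel_bounded:
  fixes k :: "'a::euclidean_space \<Rightarrow> 'b::euclidean_space"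
  assumes k: "continuous_on UNIV k" and supp: "\<And>z. r < norm z \<Longrightarrow> k z = 0"
  obtains B where "0 \<le> B" "\<And>z. norm (k z) \<le> B"
proof -
  have "bounded (k ` cball 0 r)"
    by (intro compact_imp_bounded compact_continuous_image continuous_on_subset[OF k]) auto
  then obtain B where "\<forall>y\<in>k ` cball 0 r. norm y \<le> B" unfolding bounded_iff by blast
  then have B: "\<And>z. z \<in> cball 0 r \<Longrightarrow> norm (k z) \<le> B" by blast
  have "norm (k z) \<le> max 0 B" for z
    using B[of z] supp[of z] by (cases "norm z \<le> r") (auto simp: not_le)
  then show ?thesis using that[of "max 0 B"] by auto
qed

text \<open>While \<open>w\<close> stays bounded, the support of the kernel confines the integrand
  to a fixed ball, where a multiple of the absolute value of \<open>u\<close> dominates it.\<close>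

lemma
  fixes k :: "'a::euclidean_space \<Rightarrow> 'b::euclidean_space" and u :: "'a \<Rightarrow> real"
  assumes u: "loc_integrable u" and k: "continuous_on UNIV k" and supp: "\<And>z. r < norm z \<Longrightarrow> k z = 0"
  shows convolution_integrable: "integrable lborel (\<lambda>y. u y *\<^sub>R k (w - y))"
    and convolution_continuous: "continuous_on UNIV (\<lambda>w. LINT y|lborel. u y *\<^sub>R k (w - y))"
proof -
  have [measurable]: "u \<in> borel_measurable borel" using u by (simp add: loc_integrable_def)
  note uint = loc_integrable_abs[OF u]
  have [measurable]: "k \<in> borel_measurable borel" using k by (rule borel_measurable_continuous_onI)
  obtain B where B: "0 \<le> B" "\<And>z. norm (k z) \<le> B" using kernel_bounded[OF k supp] by metis
  have bound: "norm (u y *\<^sub>R k (w - y)) \<le> B * (indicator (cball 0 (c + r)) y *\<^sub>R \<bar>u y\<bar>)" if "norm w \<le> c" for w y c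
  proof (cases "r < norm (w - y)")
    case True
    then show ?thesis using supp B by simp
  next
    case False
    then have "norm y \<le> c + r" using that norm_triangle_ineq4[of w "w - y"] by simp
    then show ?thesis using mult_right_mono[OF B(2)[of "w - y"], of "\<bar>u y\<bar>"] by (simp add: mult.commute)
  qed
  show "integrable lborel (\<lambda>y. u y *\<^sub>R k (w - y))"
    by (rule Bochner_Integration.integrable_bound[OF uint[of B "norm w + r"]])
      (use bound[OF order_refl] B in \<open>auto intro: order_trans[OF _ abs_ge_self]\<close>)
  show "continuous_on UNIV (\<lambda>w. LINT y|lborel. u y *\<^sub>R k (w - y))"
  proof (rule continuous_at_imp_continuous_on, intro ballI, unfold continuous_at_sequentially comp_def, intro allI impI)
    fix w and X :: "nat \<Rightarrow> 'a" assume X: "X \<longlonglongrightarrow> w"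
    obtain c where c: "\<And>n. norm (X n) \<le> c"
      using convergent_imp_Bseq[OF convergentI[OF X]] by (auto simp: Bseq_def)
    show "(\<lambda>n. LINT y|lborel. u y *\<^sub>R k (X n - y)) \<longlonglongrightarrow> (LINT y|lborel. u y *\<^sub>R k (w - y))"
    proof (rule integral_dominated_convergence[OF _ _ uint[of B "c + r"]])
      show "AE y in lborel. (\<lambda>n. u y *\<^sub>R k (X n - y)) \<longlonglongrightarrow> u y *\<^sub>R k (w - y)"
      proof (rule AE_I2)
        fix y
        have "isCont k (w - y)" using k by (simp add: continuous_on_eq_continuous_at)
        then have "(\<lambda>n. k (X n - y)) \<longlonglongrightarrow> k (w - y)" by (rule isCont_tendsto_compose) (intro tendsto_intros X)
        then show "(\<lambda>n. u y *\<^sub>R k (X n - y)) \<longlonglongrightarrow> u y *\<^sub>R k (w - y)" by (intro tendsto_intros)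
      qed
    qed (use bound c in auto)
  qed
qed

lemma grad_eq_0_outside:
  fixes \<rho> :: "'a::euclidean_space \<Rightarrow> real"
  assumes "\<And>z. r < norm z \<Longrightarrow> \<rho> z = 0" "r < norm z"
  shows "grad \<rho> z = 0"
proof (rule grad_eqI)
  have "((\<lambda>_. 0) has_derivative (\<lambda>h. h \<bullet> 0)) (at z)" by simp
  then show "GDERIV \<rho> z :> 0"
    unfolding gderiv_def
    by (rule has_derivative_transform_within_open[where s = "- cball 0 r"]) (use assms in auto)
qed

lemma Ck_1_Lipschitz:
  fixes \<rho> :: "'a::euclidean_space \<Rightarrow> real"
  assumes "Ck 1 \<rho>" "\<And>z. norm (grad \<rho> z) \<le> B"
  shows "\<bar>\<rho> x - \<rho> y\<bar> \<le> B * norm (x - y)"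
proof -
  have "norm (\<rho> x - \<rho> y) \<le> B * norm (x - y)"
  proof (rule differentiable_bound[where S = UNIV])
    show "(\<rho> has_derivative (\<lambda>h. h \<bullet> grad \<rho> x)) (at x within UNIV)" for x
      using Ck_1_GDERIV[OF assms(1), of x] by (simp add: gderiv_def)
    show "onorm (\<lambda>h. h \<bullet> grad \<rho> x) \<le> B" for x
      by (rule order_trans[OF onorm_le[where b = "norm (grad \<rho> x)"] assms(2)])
        (metis Cauchy_Schwarz_ineq2 mult.commute real_norm_def)
  qed auto
  then show ?thesis by simp
qed

text \<open>Differentiation under the integral sign: the normalised remainders of the kernel are at
  most \<open>2 * B\<close> by its Lipschitz bound, and they vanish outside a fixed ball, so
  dominated convergence applies.\<close>

lemma convolution_GDERIV:
  fixes \<rho> :: "'a::euclidean_space \<Rightarrow> real" and u :: "'a \<Rightarrow> real"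
  assumes u: "loc_integrable u" and \<rho>: "Ck 1 \<rho>" and supp: "\<And>z. r < norm z \<Longrightarrow> \<rho> z = 0"
  shows "GDERIV (\<lambda>w. LINT y|lborel. u y * \<rho> (w - y)) w :> (LINT y|lborel. u y *\<^sub>R grad \<rho> (w - y))"
proof -
  have supp': "r < norm z \<Longrightarrow> grad \<rho> z = 0" for z using grad_eq_0_outside[of r \<rho>] supp by blast
  have c\<rho>: "continuous_on UNIV \<rho>" and cg: "continuous_on UNIV (grad \<rho>)"
    using \<rho> by (auto intro: Ck_1_continuous Ck_1_continuous_grad)
  have [measurable]: "u \<in> borel_measurable borel" using u by (simp add: loc_integrable_def)
  have [measurable]: "\<rho> \<in> borel_measurable borel" "grad \<rho> \<in> borel_measurable borel"
    using c\<rho> cg by (auto intro: borel_measurable_continuous_onI)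
  obtain B where B: "0 \<le> B" "\<And>z. norm (grad \<rho> z) \<le> B" using kernel_bounded[OF cg supp'] by metis
  have int: "integrable lborel (\<lambda>y. u y * \<rho> (x - y))" for x
    using convolution_integrable[OF u c\<rho>, of r x] supp by simp
  have intg: "integrable lborel (\<lambda>y. u y *\<^sub>R grad \<rho> (x - y))" for x
    using convolution_integrable[OF u cg, of r x] supp' by simp
  define V where "V w = (LINT y|lborel. u y * \<rho> (w - y))" for w
  define V' where "V' = (LINT y|lborel. u y *\<^sub>R grad \<rho> (w - y))"
  have "((\<lambda>h. (V (w + h) - V w - h \<bullet> V') /\<^sub>R norm h) \<longlongrightarrow> 0) (at 0)"
    unfolding tendsto_at_iff_sequentially comp_def
  proof (intro allI impI)
    fix X :: "nat \<Rightarrow> 'a" assume X: "\<forall>n. X n \<in> UNIV - {0}" "X \<longlonglongrightarrow> 0"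
    define s where "s n y = u y * ((\<rho> (w + X n - y) - \<rho> (w - y) - X n \<bullet> grad \<rho> (w - y)) / norm (X n))" for n y
    obtain c where c: "\<And>n. norm (X n) \<le> c"
      using convergent_imp_Bseq[OF convergentI[OF X(2)]] by (auto simp: Bseq_def)
    have "(\<lambda>n. LINT y|lborel. s n y) \<longlonglongrightarrow> (LINT (y::'a)|lborel. 0)"
    proof (rule integral_dominated_convergence)
      show "integrable lborel (\<lambda>y. (2 * B) * (indicator (cball 0 (norm w + c + r)) y *\<^sub>R \<bar>u y\<bar>))"
        by (rule loc_integrable_abs[OF u])
      show "AE y in lborel. (\<lambda>n. s n y) \<longlonglongrightarrow> 0"
      proof (rule AE_I2)
        fix y
        have "((\<lambda>h. (\<rho> ((w - y) + h) - \<rho> (w - y) - h \<bullet> grad \<rho> (w - y)) /\<^sub>R norm h) \<longlongrightarrow> 0) (at 0)"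
          by (rule tendsto_norm_zero_cancel)
            (use Ck_1_GDERIV[OF \<rho>, of "w - y"] in \<open>simp add: gderiv_def has_derivative_at divide_inverse mult.commute abs_mult\<close>)
        then have "(\<lambda>n. (\<rho> ((w - y) + X n) - \<rho> (w - y) - X n \<bullet> grad \<rho> (w - y)) /\<^sub>R norm (X n)) \<longlonglongrightarrow> 0"
          using X unfolding tendsto_at_iff_sequentially comp_def by blast
        then have "(\<lambda>n. u y * ((\<rho> ((w - y) + X n) - \<rho> (w - y) - X n \<bullet> grad \<rho> (w - y)) /\<^sub>R norm (X n))) \<longlonglongrightarrow> u y * 0"
          by (intro tendsto_intros)
        then show "(\<lambda>n. s n y) \<longlonglongrightarrow> 0" by (simp add: s_def algebra_simps divide_inverse)
      qed
      show "AE y in lborel. norm (s n y) \<le> (2 * B) * (indicator (cball 0 (norm w + c + r)) y *\<^sub>R \<bar>u y\<bar>)" for n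
      proof (rule AE_I2)
        fix y
        show "norm (s n y) \<le> (2 * B) * (indicator (cball 0 (norm w + c + r)) y *\<^sub>R \<bar>u y\<bar>)"
        proof (cases "norm y \<le> norm w + c + r")
          case False
          have "norm y \<le> norm w + norm (w - y)" using norm_triangle_ineq4[of w "w - y"] by simp
          then have 1: "r < norm (w - y)" using False c[of n] norm_ge_zero[of "X n"] by linarith
          have "norm y \<le> norm (w + X n - y) + norm w + norm (X n)"
            using norm_triangle_ineq4[of "w + X n" "w + X n - y"] norm_triangle_ineq[of w "X n"] by simp
          then have 2: "r < norm (w + X n - y)" using False c[of n] by linarith
          show ?thesis using supp[OF 1] supp[OF 2] supp'[OF 1] B by (simp add: s_def)
        next
          case True
          have X0: "0 < norm (X n)" using X(1) by simp
          have "\<bar>\<rho> (w + X n - y) - \<rho> (w - y)\<bar> \<le> B * norm (X n)"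
            using Ck_1_Lipschitz[OF \<rho> B(2), of "w + X n - y" "w - y"] by simp
          moreover have "\<bar>X n \<bullet> grad \<rho> (w - y)\<bar> \<le> B * norm (X n)"
            using Cauchy_Schwarz_ineq2[of "X n" "grad \<rho> (w - y)"] mult_left_mono[OF B(2)[of "w - y"], of "norm (X n)"]
            by (simp add: mult.commute)
          ultimately have "\<bar>\<rho> (w + X n - y) - \<rho> (w - y) - X n \<bullet> grad \<rho> (w - y)\<bar> / norm (X n) \<le> 2 * B"
            using X0 by (simp add: divide_le_eq)
          then have "\<bar>u y\<bar> * (\<bar>\<rho> (w + X n - y) - \<rho> (w - y) - X n \<bullet> grad \<rho> (w - y)\<bar> / norm (X n)) \<le> \<bar>u y\<bar> * (2 * B)"
            by (rule mult_left_mono) simp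
          then show ?thesis using True by (simp add: s_def abs_mult mult.commute)
        qed
      qed
    qed (auto simp: s_def)
    moreover have "(LINT y|lborel. s n y) = (V (w + X n) - V w - X n \<bullet> V') /\<^sub>R norm (X n)" for n
    proof -
      have i3: "integrable lborel (\<lambda>y. u y * (X n \<bullet> grad \<rho> (w - y)))"
        and e3: "(LINT y|lborel. u y * (X n \<bullet> grad \<rho> (w - y))) = X n \<bullet> V'"
        using integrable_inner_right[OF intg[of w], of "X n"] integral_inner_right[of "X n" lborel "\<lambda>y. u y *\<^sub>R grad \<rho> (w - y)"] intg[of w]
        by (auto simp: V'_def)
      have "(LINT y|lborel. s n y) = (LINT y|lborel. (u y * \<rho> (w + X n - y) - u y * \<rho> (w - y) - u y * (X n \<bullet> grad \<rho> (w - y))) / norm (X n))"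
        by (simp add: s_def algebra_simps diff_divide_distrib)
      also have "\<dots> = (V (w + X n) - V w - X n \<bullet> V') / norm (X n)"
        using int[of "w + X n"] int[of w] i3 e3 by (simp add: V_def)
      finally show ?thesis by (simp add: divide_inverse mult.commute)
    qed
    ultimately show "(\<lambda>n. (V (w + X n) - V w - X n \<bullet> V') /\<^sub>R norm (X n)) \<longlonglongrightarrow> 0" by simp
  qed
  from tendsto_norm_zero[OF this]
  have "((\<lambda>h. norm (V (w + h) - V w - h \<bullet> V') / norm h) \<longlongrightarrow> 0) (at 0)"
    by (simp add: divide_inverse mult.commute abs_mult)
  then have "(V has_derivative (\<lambda>h. h \<bullet> V')) (at w)"
    unfolding has_derivative_at using bounded_linear_inner_left[of V'] by blast
  then show ?thesis unfolding V_def V'_def gderiv_def .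
qed

text \<open>A function and its weak gradient, represented by Borel functions on the whole space that vanish
  outside \<open>\<Omega>\<close>, so that Fubini's theorem for \<^term>\<open>lborel\<close> applies to translates and dilates.\<close>

definition weak_pair :: "'a::euclidean_space set \<Rightarrow> ('a \<Rightarrow> real) \<Rightarrow> ('a \<Rightarrow> 'a) \<Rightarrow> bool" where
  "weak_pair \<Omega> u D \<longleftrightarrow> u \<in> borel_measurable borel \<and> D \<in> borel_measurable borel \<and>
     (\<forall>x. x \<notin> \<Omega> \<longrightarrow> u x = 0 \<and> D x = 0) \<and>
     (\<forall>K. compact K \<longrightarrow> K \<subseteq> \<Omega> \<longrightarrow> set_integrable lborel K u \<and> set_integrable lborel K D) \<and>
     (\<forall>\<phi>\<in>test_functions \<Omega>. \<forall>i\<in>Basis.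
        (LINT x|lborel. u x * (grad \<phi> x \<bullet> i)) = - (LINT x|lborel. (D x \<bullet> i) * \<phi> x))"

text \<open>Restricting \<open>u\<close> to the closed set \<open>F\<close> makes it locally
  integrable on the whole space, so the convolution is globally of class \<open>Ck 1\<close>. Where
  the averaging ball lies in \<open>F\<close> the restriction is invisible, and testing the weak
  gradient with the kernel moves the derivative onto \<open>D\<close>; the factor \<open>l\<close>
  comes from the chain rule.\<close>

lemma weak_pair_mollify:
  fixes u :: "'a::euclidean_space \<Rightarrow> real"
  assumes wp: "weak_pair \<Omega> u D" and \<epsilon>: "0 < \<epsilon>" and F: "closed F" "F \<subseteq> \<Omega>"
  obtains U where "Ck 1 U"
    "\<And>x. cball (a + l *\<^sub>R x) \<epsilon> \<subseteq> F \<Longrightarrow> U x = mollify a l \<epsilon> u x \<and> grad U x = l *\<^sub>R mollify a l \<epsilon> D x"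
proof -
  have [measurable]: "u \<in> borel_measurable borel" "D \<in> borel_measurable borel" "F \<in> sets borel"
    using wp F by (auto simp: weak_pair_def)
  define u' where "u' y = indicator F y * u y" for y
  define \<rho> where "\<rho> w = mollifier ((1/\<epsilon>) *\<^sub>R w)" for w :: 'a
  have u': "loc_integrable u'"
    unfolding loc_integrable_def
  proof (intro conjI allI)
    show "u' \<in> borel_measurable borel" unfolding u'_def by measurable
    fix R
    have "compact (cball 0 R \<inter> F)" using F by (intro compact_Int_closed) auto
    then have "set_integrable lborel (cball 0 R \<inter> F) u"
      using wp F by (auto simp: weak_pair_def)
    then show "set_integrable lborel (cball 0 R) u'"
      unfolding set_integrable_def u'_def by (simp add: indicator_inter_arith mult.assoc)
  qed
  have \<rho>: "Ck n \<rho>" for n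
    unfolding \<rho>_def using Ck_affine[where a = 0 and c = "1/\<epsilon>", OF mollifier_Ck] by simp
  have supp: "\<rho> z = 0" if "\<epsilon> < norm z" for z
    using that \<epsilon> by (auto simp: \<rho>_def mollifier_eq_0_iff)
  have cg: "continuous_on UNIV (grad \<rho>)" using \<rho> by (rule Ck_1_continuous_grad)
  have supp': "\<epsilon> < norm z \<Longrightarrow> grad \<rho> z = 0" for z using grad_eq_0_outside[of \<epsilon> \<rho>] supp by blast
  define V where "V w = (LINT y|lborel. u' y * \<rho> (w - y))" for w
  define V' where "V' w = (LINT y|lborel. u' y *\<^sub>R grad \<rho> (w - y))" for w
  have V: "GDERIV V w :> V' w" for w
    unfolding V_def V'_def by (rule convolution_GDERIV[OF u' \<rho> supp])
  have V'c: "continuous_on UNIV V'" unfolding V'_def by (rule convolution_continuous[OF u' cg supp'])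
  \<comment> \<open>Undoes the factor \<open>\<epsilon> ^ DIM('a)\<close> between kernel form and
    average.\<close>
  define b where "b = (1 / \<epsilon> ^ DIM('a))"
  have b: "b * \<epsilon> ^ DIM('a) = 1" using \<epsilon> by (simp add: b_def)
  define U where "U x = b * V (a + l *\<^sub>R x)" for x
  have U: "GDERIV U x :> (b * l) *\<^sub>R V' (a + l *\<^sub>R x)" for x
  proof -
    have "GDERIV (\<lambda>x. V (a + l *\<^sub>R x)) x :> l *\<^sub>R V' (a + l *\<^sub>R x)" by (rule GDERIV_affine[OF V])
    from GDERIV_mult[OF GDERIV_const[of b] this] show ?thesis by (simp add: U_def[abs_def])
  qed
  show ?thesis
  proof
    show "Ck 1 U"
      by (rule Ck_1I[OF U]) (auto intro!: continuous_intros continuous_on_compose2[OF V'c])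
    fix x assume sub: "cball (a + l *\<^sub>R x) \<epsilon> \<subseteq> F"
    let ?w = "a + l *\<^sub>R x"
    have in_F: "y \<in> F" if "norm (?w - y) \<le> \<epsilon>" for y using that sub by (auto simp: dist_norm subset_iff)
    have "V ?w = (LINT y|lborel. mollifier ((1/\<epsilon>) *\<^sub>R (?w - y)) *\<^sub>R u y)"
      unfolding V_def
    proof (intro Bochner_Integration.integral_cong refl)
      fix y show "u' y * \<rho> (?w - y) = mollifier ((1/\<epsilon>) *\<^sub>R (?w - y)) *\<^sub>R u y"
        using in_F[of y] supp[of "?w - y"] by (cases "norm (?w - y) \<le> \<epsilon>") (auto simp: u'_def \<rho>_def not_le)
    qed
    also have "\<dots> = \<epsilon> ^ DIM('a) * mollify a l \<epsilon> u x"
      using \<epsilon> by (subst mollify_eq_convolution) auto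
    finally have Ux: "U x = mollify a l \<epsilon> u x" using b unfolding U_def by (simp add: mult.assoc[symmetric])
    have "V' ?w = (\<epsilon> ^ DIM('a)) *\<^sub>R mollify a l \<epsilon> D x"
    proof (rule euclidean_eqI)
      fix i :: 'a assume i: "i \<in> Basis"
      define \<phi> where "\<phi> y = mollifier ((1/\<epsilon>) *\<^sub>R (?w - y))" for y
      have \<phi>: "\<phi> \<in> test_functions \<Omega>"
        unfolding \<phi>_def using sub F \<epsilon> by (intro mollifier_translate_test_function) auto
      \<comment> \<open>The kernel is reflected in its argument; this sign cancels the minus sign in
        the definition of the weak gradient.\<close>
      have g\<phi>: "grad \<phi> y = - grad \<rho> (?w - y)" for y
      proof (rule grad_eqI)
        have "GDERIV (\<lambda>y. \<rho> (?w + (-1) *\<^sub>R y)) y :> (-1) *\<^sub>R grad \<rho> (?w - y)"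
          using Ck_1_GDERIV[OF \<rho>, of "?w - y"] by (intro GDERIV_affine) simp
        then show "GDERIV \<phi> y :> - grad \<rho> (?w - y)" by (simp add: \<phi>_def[abs_def] \<rho>_def)
      qed
      have "V' ?w \<bullet> i = (LINT y|lborel. (u' y *\<^sub>R grad \<rho> (?w - y)) \<bullet> i)"
        unfolding V'_def using convolution_integrable[OF u' cg supp'] by (subst integral_inner_left) auto
      also have "\<dots> = (LINT y|lborel. - (u y * (grad \<phi> y \<bullet> i)))"
      proof (intro Bochner_Integration.integral_cong refl)
        fix y show "(u' y *\<^sub>R grad \<rho> (?w - y)) \<bullet> i = - (u y * (grad \<phi> y \<bullet> i))"
          using in_F[of y] supp'[of "?w - y"] by (cases "norm (?w - y) \<le> \<epsilon>") (auto simp: u'_def g\<phi> not_le)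
      qed
      also have "\<dots> = (LINT y|lborel. (D y \<bullet> i) * \<phi> y)"
        using wp \<phi> i unfolding weak_pair_def by simp
      also have "\<dots> = (LINT y|lborel. mollifier ((1/\<epsilon>) *\<^sub>R (?w - y)) *\<^sub>R D y) \<bullet> i"
      proof -
        have "integrable lborel (\<lambda>y. mollifier ((1/\<epsilon>) *\<^sub>R (?w - y)) *\<^sub>R D y)"
        proof -
          have "set_integrable lborel (cball ?w \<epsilon>) D" using wp sub F by (auto simp: weak_pair_def)
          then have i1: "integrable lborel (\<lambda>y. indicator (cball ?w \<epsilon>) y *\<^sub>R D y)" by (simp add: set_integrable_def)
          have "continuous_on UNIV \<rho>" using \<rho>[of 0] by simp
          then obtain B where B: "0 \<le> B" "\<And>z. norm (\<rho> z) \<le> B"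
            by (rule kernel_bounded[of \<rho> \<epsilon>]) (auto intro: supp that)
          show ?thesis
          proof (rule Bochner_Integration.integrable_bound[OF integrable_mult_right[OF integrable_norm[OF i1], of B]])
            show "AE y in lborel. norm (mollifier ((1/\<epsilon>) *\<^sub>R (?w - y)) *\<^sub>R D y) \<le> norm (B * norm (indicator (cball ?w \<epsilon>) y *\<^sub>R D y))"
            proof (rule AE_I2)
              fix y
              show "norm (mollifier ((1/\<epsilon>) *\<^sub>R (?w - y)) *\<^sub>R D y) \<le> norm (B * norm (indicator (cball ?w \<epsilon>) y *\<^sub>R D y))"
              proof (cases "norm (?w - y) \<le> \<epsilon>")
                case True
                then show ?thesis using B(1) mult_right_mono[OF B(2)[of "?w - y"], of "norm (D y)"]
                  by (simp add: \<rho>_def dist_norm)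
              next
                case False
                then show ?thesis using supp[of "?w - y"] by (simp add: \<rho>_def)
              qed
            qed
          qed measurable
        qed
        then show ?thesis by (subst integral_inner_left[symmetric]) (auto simp: \<phi>_def mult.commute)
      qed
      also have "\<dots> = ((\<epsilon> ^ DIM('a)) *\<^sub>R mollify a l \<epsilon> D x) \<bullet> i"
        using \<epsilon> by (subst mollify_eq_convolution) auto
      finally show "V' ?w \<bullet> i = ((\<epsilon> ^ DIM('a)) *\<^sub>R mollify a l \<epsilon> D x) \<bullet> i" .
    qed
    then have "(b * l) *\<^sub>R V' ?w = ((b * \<epsilon> ^ DIM('a)) * l) *\<^sub>R mollify a l \<epsilon> D x"
      by (simp add: mult.commute mult.left_commute)
    then have "grad U x = l *\<^sub>R mollify a l \<epsilon> D x" using grad_eqI[OF U[of x]] b by simp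
    with Ux show "U x = mollify a l \<epsilon> u x \<and> grad U x = l *\<^sub>R mollify a l \<epsilon> D x" by blast
  qed
qed

lemma AE_eq_0_on_open:
  fixes f :: "'a::euclidean_space \<Rightarrow> real"
  assumes [measurable]: "f \<in> borel_measurable borel" and "open \<Omega>"
    and 0: "\<And>K. compact K \<Longrightarrow> K \<subseteq> \<Omega> \<Longrightarrow> (\<integral>\<^sup>+x\<in>K. ennreal \<bar>f x\<bar> \<partial>lborel) = 0"
  shows "AE x in lborel. x \<in> \<Omega> \<longrightarrow> f x = 0"
proof -
  obtain K where K: "\<And>n::nat. compact (K n)" "\<And>n. K n \<subseteq> \<Omega>" "(\<Union>n. K n) = \<Omega>"
    using open_Union_compact_subsets[OF \<open>open \<Omega>\<close>] by metis
  have [measurable]: "K n \<in> sets borel" for n using K(1) by (auto intro!: borel_closed compact_imp_closed)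
  have "AE x in lborel. \<forall>n. ennreal \<bar>f x\<bar> * indicator (K n) x = 0"
  proof (subst AE_all_countable, intro allI)
    fix n show "AE x in lborel. ennreal \<bar>f x\<bar> * indicator (K n) x = 0"
      using 0[OF K(1)[of n] K(2)[of n]] by (subst (asm) nn_integral_0_iff_AE) auto
  qed
  then show ?thesis
  proof eventually_elim
    case (elim x)
    show ?case
    proof
      assume "x \<in> \<Omega>"
      then obtain n where "x \<in> K n" using K(3) by auto
      then show "f x = 0" using elim[rule_format, of n] by simp
    qed
  qed
qed

text \<open>The local convergence theorem with exponent 1, applied to \<open>K\<close> inside its
  closed \<open>d\<close>-neighbourhood, which still lies in the open set.\<close>

lemma mollify_tendsto_L1_compact:
  fixes f :: "'a::euclidean_space \<Rightarrow> 'b::euclidean_space" and l \<epsilon> :: "nat \<Rightarrow> real"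
  assumes [measurable]: "f \<in> borel_measurable borel" and \<Omega>: "open \<Omega>"
    and int: "\<And>K. compact K \<Longrightarrow> K \<subseteq> \<Omega> \<Longrightarrow> set_integrable lborel K f"
    and K: "compact K" "K \<subseteq> \<Omega>"
    and a: "a \<longlonglongrightarrow> 0" and l: "l \<longlonglongrightarrow> 1" "\<And>j. 1/2 \<le> l j" and \<epsilon>: "\<epsilon> \<longlonglongrightarrow> 0"
  shows "(\<lambda>j. \<integral>\<^sup>+x\<in>K. ennreal (norm (mollify (a j) (l j) (\<epsilon> j) f x - f x)) \<partial>lborel) \<longlonglongrightarrow> 0"
proof -
  obtain d where d: "0 < d" "(\<Union>x\<in>K. cball x d) \<subseteq> \<Omega>"
    using compact_subset_open_imp_cball_epsilon_subset[OF K(1) \<Omega> K(2)] by blast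
  define K' where "K' = {x + y | x y. x \<in> K \<and> y \<in> cball 0 d}"
  have K': "compact K'" "K \<subseteq> K'" "K' \<subseteq> \<Omega>"
  proof -
    show "compact K'" unfolding K'_def by (rule compact_sums[OF K(1) compact_cball])
    show "K \<subseteq> K'" unfolding K'_def using d by force
    show "K' \<subseteq> \<Omega>" unfolding K'_def using d(2) by (force simp: dist_norm)
  qed
  obtain B where B: "0 < B" "\<And>x. x \<in> K \<Longrightarrow> norm x \<le> B"
    using compact_imp_bounded[OF K(1)] by (auto simp: bounded_pos)
  have "(\<lambda>j. \<integral>\<^sup>+x\<in>K. ennreal (norm (mollify (a j) (l j) (\<epsilon> j) f x - f x) powr 1) \<partial>lborel) \<longlonglongrightarrow> 0"
  proof (rule mollify_tendsto_Lq_local[where S' = K'])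
    show "K \<in> sets borel" "K' \<in> sets borel" using K(1) K'(1) by (auto intro!: borel_closed compact_imp_closed)
    have "integrable lborel (\<lambda>x. indicator K' x *\<^sub>R f x)" using int[OF K'(1,3)] by (simp add: set_integrable_def)
    then have "(\<integral>\<^sup>+x. ennreal (norm (indicator K' x *\<^sub>R f x)) \<partial>lborel) < \<infinity>" by (simp add: integrable_iff_bounded)
    also have "(\<integral>\<^sup>+x. ennreal (norm (indicator K' x *\<^sub>R f x)) \<partial>lborel) = (\<integral>\<^sup>+x\<in>K'. ennreal (norm (f x) powr 1) \<partial>lborel)"
      by (intro nn_integral_cong) (auto simp: indicator_def)
    finally show "(\<integral>\<^sup>+x\<in>K'. ennreal (norm (f x) powr 1) \<partial>lborel) < \<infinity>" .
    have "(\<lambda>j. norm (a j) + \<bar>l j - 1\<bar> * B + \<bar>\<epsilon> j\<bar>) \<longlonglongrightarrow> norm (0::'a) + \<bar>1 - 1\<bar> * B + \<bar>0\<bar>"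
      by (intro tendsto_intros a l \<epsilon>)
    then have "\<forall>\<^sub>F j in sequentially. norm (a j) + \<bar>l j - 1\<bar> * B + \<bar>\<epsilon> j\<bar> < d"
      using d(1) by (intro order_tendstoD(2)) auto
    then show "\<forall>\<^sub>F j in sequentially. \<forall>x\<in>K. \<forall>z. norm z < 1 \<longrightarrow> a j + l j *\<^sub>R x - \<epsilon> j *\<^sub>R z \<in> K'"
    proof eventually_elim
      case (elim j)
      show ?case
      proof (intro ballI allI impI)
        fix x z :: 'a assume xz: "x \<in> K" "norm z < 1"
        define y where "y = a j + (l j - 1) *\<^sub>R x - \<epsilon> j *\<^sub>R z"
        have "norm y \<le> norm (a j) + norm ((l j - 1) *\<^sub>R x) + norm (\<epsilon> j *\<^sub>R z)"
          unfolding y_def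
          using norm_triangle_ineq4[of "a j + (l j - 1) *\<^sub>R x" "\<epsilon> j *\<^sub>R z"] norm_triangle_ineq[of "a j" "(l j - 1) *\<^sub>R x"]
          by linarith
        also have "\<dots> \<le> norm (a j) + \<bar>l j - 1\<bar> * B + \<bar>\<epsilon> j\<bar> * 1"
          unfolding norm_scaleR using B xz by (intro add_mono mult_left_mono) auto
        finally have "y \<in> cball 0 d" using elim by simp
        moreover have "a j + l j *\<^sub>R x - \<epsilon> j *\<^sub>R z = x + y" by (simp add: y_def algebra_simps)
        ultimately show "a j + l j *\<^sub>R x - \<epsilon> j *\<^sub>R z \<in> K'" unfolding K'_def using xz(1) by blast
      qed
    qed
  qed (use K' a l \<epsilon> in auto)
  then show ?thesis by simp
qed

text \<open>On a compact set the mollifications of \<open>f\<close> at small scales are integrals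
  against test functions, hence 0, while they converge to \<open>f\<close> in
  \<open>L^1\<close>.\<close>

lemma fundamental_lemma_calculus_of_variations:
  fixes f :: "'a::euclidean_space \<Rightarrow> real"
  assumes [measurable]: "f \<in> borel_measurable borel" and \<Omega>: "open \<Omega>"
    and int: "\<And>K. compact K \<Longrightarrow> K \<subseteq> \<Omega> \<Longrightarrow> set_integrable lborel K f"
    and 0: "\<And>\<phi>. \<phi> \<in> test_functions \<Omega> \<Longrightarrow> (LINT x|lborel. f x * \<phi> x) = 0"
  shows "AE x in lborel. x \<in> \<Omega> \<longrightarrow> f x = 0"
proof (rule AE_eq_0_on_open[OF _ \<Omega>])
  fix K assume K: "compact K" "K \<subseteq> \<Omega>"
  obtain d where d: "0 < d" "(\<Union>x\<in>K. cball x d) \<subseteq> \<Omega>"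
    using compact_subset_open_imp_cball_epsilon_subset[OF K(1) \<Omega> K(2)] by blast
  define \<epsilon> where "\<epsilon> j = d / real (Suc j)" for j
  have \<epsilon>: "\<epsilon> \<longlonglongrightarrow> 0" "\<And>j. 0 < \<epsilon> j" "\<And>j. \<epsilon> j \<le> d"
  proof -
    show "\<epsilon> \<longlonglongrightarrow> 0" unfolding \<epsilon>_def
      using tendsto_mult_right_zero[OF LIMSEQ_inverse_real_of_nat, of d] by (simp add: divide_inverse)
    show "0 < \<epsilon> j" "\<epsilon> j \<le> d" for j using d by (auto simp: \<epsilon>_def divide_le_eq)
  qed
  have "(\<lambda>j. \<integral>\<^sup>+x\<in>K. ennreal (norm (mollify 0 1 (\<epsilon> j) f x - f x)) \<partial>lborel) \<longlonglongrightarrow> 0"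
    by (rule mollify_tendsto_L1_compact[OF _ \<Omega> int K]) (use \<epsilon> in auto)
  moreover have "(\<integral>\<^sup>+x\<in>K. ennreal (norm (mollify 0 1 (\<epsilon> j) f x - f x)) \<partial>lborel) = (\<integral>\<^sup>+x\<in>K. ennreal \<bar>f x\<bar> \<partial>lborel)" for j
  proof (rule nn_integral_cong)
    fix x
    show "ennreal (norm (mollify 0 1 (\<epsilon> j) f x - f x)) * indicator K x = ennreal \<bar>f x\<bar> * indicator K x"
    proof (cases "x \<in> K")
      case True
      have "cball x (\<epsilon> j) \<subseteq> \<Omega>" using True d(2) \<epsilon>(3)[of j] by (force simp: subset_iff)
      then have "(LINT y|lborel. f y * mollifier ((1/\<epsilon> j) *\<^sub>R (x - y))) = 0"
        using \<epsilon>(2) by (intro 0 mollifier_translate_test_function) auto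
      then have "mollify 0 1 (\<epsilon> j) f x = 0"
        using mollify_eq_convolution[of f "\<epsilon> j" 0 1 x] \<epsilon>(2)[of j] by (simp add: mult.commute)
      then show ?thesis by simp
    qed simp
  qed
  ultimately show "(\<integral>\<^sup>+x\<in>K. ennreal \<bar>f x\<bar> \<partial>lborel) = 0" by (simp add: LIMSEQ_const_iff)
qed simp

section \<open>The Poincare inequality on the slab\<close>

text \<open>The fundamental theorem of calculus along the segment, followed by Jensen's inequality
  on the unit interval.\<close>

lemma segment_powr_bound:
  fixes U :: "'a::euclidean_space \<Rightarrow> real"
  assumes U: "Ck 1 U" and p: "1 \<le> p"
  shows "ennreal (\<bar>U y - U x\<bar> powr p)
    \<le> ennreal (norm (y - x) powr p) * (\<integral>\<^sup>+t. ennreal (norm (grad U (x + t *\<^sub>R (y - x))) powr p) * indicator {0..1} t \<partial>lborel)"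
proof -
  have cg: "continuous_on UNIV (grad U)" using U by (rule Ck_1_continuous_grad)
  define g where "g t = (y - x) \<bullet> grad U (x + t *\<^sub>R (y - x))" for t
  have contg: "continuous_on UNIV (\<lambda>t. grad U (x + t *\<^sub>R (y - x)))"
    by (rule continuous_on_compose2[OF cg]) (auto intro!: continuous_intros)
  have [measurable]: "(\<lambda>t. grad U (x + t *\<^sub>R (y - x))) \<in> borel_measurable borel"
    using contg by (rule borel_measurable_continuous_onI)
  have [measurable]: "g \<in> borel_measurable borel" unfolding g_def by measurable
  have "(LINT t|lborel. indicator {0..1} t *\<^sub>R g t) = U (x + 1 *\<^sub>R (y - x)) - U (x + 0 *\<^sub>R (y - x))"
  proof (rule integral_FTC_atLeastAtMost[where F = "\<lambda>t. U (x + t *\<^sub>R (y - x))"])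
    show "((\<lambda>t. U (x + t *\<^sub>R (y - x))) has_vector_derivative g t) (at t within {0..1})" for t
      unfolding g_def using GDERIV_line[OF Ck_1_GDERIV[OF U]]
      by (auto intro: has_field_derivative_at_within simp: has_real_derivative_iff_has_vector_derivative[symmetric])
    show "continuous_on {0..1} g"
      unfolding g_def by (intro continuous_intros continuous_on_subset[OF contg]) auto
  qed simp
  then have Ueq: "U y - U x = (LINT t|restrict_space lborel {0..1}. g t)"
    by (simp add: integral_restrict_space)
  have gm: "g \<in> borel_measurable (restrict_space lborel {0..1})"
    by (rule measurable_restrict_space1) measurable
  have eq: "(\<integral>\<^sup>+t. h t \<partial>restrict_space lborel {0..1}) = (\<integral>\<^sup>+t. h t * indicator {0..1} t \<partial>lborel)" for h :: "real \<Rightarrow> ennreal"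
    by (rule nn_integral_restrict_space) simp
  have fin: "(\<integral>\<^sup>+t. ennreal (norm (g t) powr p) \<partial>restrict_space lborel {0..1}) < \<infinity>"
  proof -
    have "bounded (g ` {0..1})"
      unfolding g_def
      by (intro compact_imp_bounded compact_continuous_image continuous_intros continuous_on_subset[OF contg]) auto
    then obtain B where B: "\<forall>y\<in>g ` {0..1}. norm y \<le> B" unfolding bounded_iff by blast
    have "(\<integral>\<^sup>+t. ennreal (norm (g t) powr p) * indicator {0..1} t \<partial>lborel) \<le> (\<integral>\<^sup>+t. ennreal (B powr p) * indicator {0..1::real} t \<partial>lborel)"
      using B p by (intro nn_integral_mono) (auto simp: indicator_def intro!: ennreal_leI powr_mono2)
    also have "\<dots> < \<infinity>" by (subst nn_integral_cmult_indicator) auto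
    finally show ?thesis unfolding eq .
  qed
  have "ennreal (\<bar>U y - U x\<bar> powr p) \<le> (\<integral>\<^sup>+t. ennreal (norm (g t) powr p) \<partial>restrict_space lborel {0..1})"
    unfolding Ueq using powr_norm_integral_le(2)[OF gm _ p fin]
    by (simp add: emeasure_restrict_space)
  also have "\<dots> \<le> (\<integral>\<^sup>+t. ennreal (norm (y - x) powr p) * (ennreal (norm (grad U (x + t *\<^sub>R (y - x))) powr p) * indicator {0..1} t) \<partial>lborel)"
    unfolding eq
  proof (rule nn_integral_mono)
    fix t
    have "norm (g t) powr p \<le> (norm (y - x) * norm (grad U (x + t *\<^sub>R (y - x)))) powr p"
      unfolding g_def using p Cauchy_Schwarz_ineq2 by (intro powr_mono2) auto
    then have "ennreal (norm (g t) powr p) \<le> ennreal (norm (y - x) powr p) * ennreal (norm (grad U (x + t *\<^sub>R (y - x))) powr p)"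
      by (simp add: powr_mult ennreal_mult[symmetric] ennreal_leI)
    then show "ennreal (norm (g t) powr p) * indicator {0..1} t
      \<le> ennreal (norm (y - x) powr p) * (ennreal (norm (grad U (x + t *\<^sub>R (y - x))) powr p) * indicator {0..1} t)"
      by (simp add: mult.assoc[symmetric] mult_right_mono)
  qed
  also have "\<dots> = ennreal (norm (y - x) powr p) * (\<integral>\<^sup>+t. ennreal (norm (grad U (x + t *\<^sub>R (y - x))) powr p) * indicator {0..1} t \<partial>lborel)"
    by (rule nn_integral_cmult) measurable
  finally show ?thesis .
qed

text \<open>The segment bound is integrated over all pairs of points. For each position
  \<open>t\<close> on the segment one endpoint is traded for the intermediate point, which stays in
  \<open>S\<close> by convexity: \<open>x\<close> if \<open>t \<le> 1/2\<close>, otherwise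
  \<open>y\<close>. The coefficient is then at least 1/2 and the Jacobian costs at most
  \<open>2 ^ DIM('a)\<close>.\<close>

lemma Poincare_C1:
  fixes U :: "'a::euclidean_space \<Rightarrow> real"
  assumes U: "Ck 1 U" and p: "1 \<le> p" and S[measurable]: "S \<in> sets borel" and conv: "convex S"
    and diam: "\<And>x y. x \<in> S \<Longrightarrow> y \<in> S \<Longrightarrow> norm (y - x) \<le> d"
  shows "(\<integral>\<^sup>+x\<in>S. (\<integral>\<^sup>+y\<in>S. ennreal (\<bar>U y - U x\<bar> powr p) \<partial>lborel) \<partial>lborel)
    \<le> ennreal (d powr p * 2 ^ DIM('a)) * emeasure lborel S * (\<integral>\<^sup>+z\<in>S. ennreal (norm (grad U z) powr p) \<partial>lborel)"
proof -
  have [measurable]: "grad U \<in> borel_measurable borel"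
    using Ck_1_continuous_grad[OF U] by (rule borel_measurable_continuous_onI)
  have [measurable]: "U \<in> borel_measurable borel"
    using Ck_1_continuous[OF U] by (rule borel_measurable_continuous_onI)
  define h where "h z = ennreal (norm (grad U z) powr p) * indicator S z" for z
  have [measurable]: "h \<in> borel_measurable borel" unfolding h_def by measurable
  define I where "I = (\<integral>\<^sup>+z. h z \<partial>lborel)"
  define F where "F x y t = indicator S x * (indicator S y * (h (x + t *\<^sub>R (y - x)) * indicator {0..1} t))" for x y and t :: real
  define C where "C = ennreal (d powr p)"
  have Fle: "(\<integral>\<^sup>+x. \<integral>\<^sup>+y. F x y t \<partial>lborel \<partial>lborel) \<le> ennreal (2 ^ DIM('a)) * emeasure lborel S * I * indicator {0..1} t" for t
  proof (cases "t \<in> {0..1}")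
    case False
    then show ?thesis by (simp add: F_def)
  next
    case t: True
    have x: "x + t *\<^sub>R (y - x) = t *\<^sub>R y + (1 - t) *\<^sub>R x" for x y :: 'a by (simp add: algebra_simps)
    show ?thesis
    proof (cases "t \<le> 1/2")
      case True
      have "(\<integral>\<^sup>+x. \<integral>\<^sup>+y. F x y t \<partial>lborel \<partial>lborel) = (\<integral>\<^sup>+y. \<integral>\<^sup>+x. F x y t \<partial>lborel \<partial>lborel)"
        by (rule lborel_pair.Fubini'[where f = "\<lambda>x y. F x y t", symmetric]) (simp add: F_def split_def)
      also have "\<dots> \<le> (\<integral>\<^sup>+y. (ennreal (2 ^ DIM('a)) * I) * indicator S y \<partial>lborel)"
      proof (rule nn_integral_mono)
        fix y
        have "(\<integral>\<^sup>+x. F x y t \<partial>lborel) \<le> (\<integral>\<^sup>+x. h (t *\<^sub>R y + (1 - t) *\<^sub>R x) * indicator S y \<partial>lborel)"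
          unfolding F_def x by (intro nn_integral_mono) (auto simp: indicator_def)
        also have "\<dots> = (\<integral>\<^sup>+x. h (t *\<^sub>R y + (1 - t) *\<^sub>R x) \<partial>lborel) * indicator S y"
          by (rule nn_integral_multc) measurable
        also have "\<dots> \<le> (ennreal (2 ^ DIM('a)) * I) * indicator S y"
          unfolding I_def using True by (intro mult_right_mono nn_integral_lborel_affine_le) auto
        finally show "(\<integral>\<^sup>+x. F x y t \<partial>lborel) \<le> (ennreal (2 ^ DIM('a)) * I) * indicator S y" .
      qed
      also have "\<dots> = (ennreal (2 ^ DIM('a)) * I) * emeasure lborel S" by (rule nn_integral_cmult_indicator) simp
      finally show ?thesis using t by (simp add: mult.assoc mult.commute[of I])
    next
      case False
      have "(\<integral>\<^sup>+x. \<integral>\<^sup>+y. F x y t \<partial>lborel \<partial>lborel) \<le> (\<integral>\<^sup>+x. (ennreal (2 ^ DIM('a)) * I) * indicator S x \<partial>lborel)"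
      proof (rule nn_integral_mono)
        fix x'
        have "(\<integral>\<^sup>+y. F x' y t \<partial>lborel) \<le> (\<integral>\<^sup>+y. h ((1 - t) *\<^sub>R x' + t *\<^sub>R y) * indicator S x' \<partial>lborel)"
          unfolding F_def x by (intro nn_integral_mono) (auto simp: indicator_def add.commute)
        also have "\<dots> = (\<integral>\<^sup>+y. h ((1 - t) *\<^sub>R x' + t *\<^sub>R y) \<partial>lborel) * indicator S x'"
          by (rule nn_integral_multc) measurable
        also have "\<dots> \<le> (ennreal (2 ^ DIM('a)) * I) * indicator S x'"
          unfolding I_def using False by (intro mult_right_mono nn_integral_lborel_affine_le) auto
        finally show "(\<integral>\<^sup>+y. F x' y t \<partial>lborel) \<le> (ennreal (2 ^ DIM('a)) * I) * indicator S x'" .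
      qed
      also have "\<dots> = (ennreal (2 ^ DIM('a)) * I) * emeasure lborel S" by (rule nn_integral_cmult_indicator) simp
      finally show ?thesis using t by (simp add: mult.assoc mult.commute[of I])
    qed
  qed
  have "(\<integral>\<^sup>+x\<in>S. (\<integral>\<^sup>+y\<in>S. ennreal (\<bar>U y - U x\<bar> powr p) \<partial>lborel) \<partial>lborel)
    \<le> (\<integral>\<^sup>+x. \<integral>\<^sup>+y. C * (\<integral>\<^sup>+t. F x y t \<partial>lborel) \<partial>lborel \<partial>lborel)"
  proof (rule nn_integral_mono)
    fix x
    have "(\<integral>\<^sup>+y\<in>S. ennreal (\<bar>U y - U x\<bar> powr p) \<partial>lborel) * indicator S x
      = (\<integral>\<^sup>+y. ennreal (\<bar>U y - U x\<bar> powr p) * indicator S y * indicator S x \<partial>lborel)"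
      by (rule nn_integral_multc[symmetric]) measurable
    also have "\<dots> \<le> (\<integral>\<^sup>+y. C * (\<integral>\<^sup>+t. F x y t \<partial>lborel) \<partial>lborel)"
    proof (rule nn_integral_mono)
      fix y
      show "ennreal (\<bar>U y - U x\<bar> powr p) * indicator S y * indicator S x \<le> C * (\<integral>\<^sup>+t. F x y t \<partial>lborel)"
      proof (cases "x \<in> S \<and> y \<in> S")
        case True
        have "ennreal (\<bar>U y - U x\<bar> powr p) \<le> ennreal (norm (y - x) powr p) *
          (\<integral>\<^sup>+t. ennreal (norm (grad U (x + t *\<^sub>R (y - x))) powr p) * indicator {0..1} t \<partial>lborel)"
          by (rule segment_powr_bound[OF U p])
        also have "(\<integral>\<^sup>+t. ennreal (norm (grad U (x + t *\<^sub>R (y - x))) powr p) * indicator {0..1} t \<partial>lborel) = (\<integral>\<^sup>+t. F x y t \<partial>lborel)"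
        proof (rule nn_integral_cong)
          fix t :: real
          have "x + t *\<^sub>R (y - x) \<in> S" if "t \<in> {0..1}"
          proof -
            have "(1 - t) *\<^sub>R x + t *\<^sub>R y \<in> S" using convexD_alt[OF conv, of x y t] True that by auto
            then show ?thesis by (simp add: algebra_simps)
          qed
          then show "ennreal (norm (grad U (x + t *\<^sub>R (y - x))) powr p) * indicator {0..1} t = F x y t"
            using True by (cases "t \<in> {0..1}") (auto simp: F_def h_def)
        qed
        also have "ennreal (norm (y - x) powr p) * (\<integral>\<^sup>+t. F x y t \<partial>lborel) \<le> C * (\<integral>\<^sup>+t. F x y t \<partial>lborel)"
          unfolding C_def using diam[of x y] True p by (intro mult_right_mono ennreal_leI powr_mono2) auto
        finally show ?thesis using True by simp
      qed auto
    qed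
    finally show "(\<integral>\<^sup>+y\<in>S. ennreal (\<bar>U y - U x\<bar> powr p) \<partial>lborel) * indicator S x
      \<le> (\<integral>\<^sup>+y. C * (\<integral>\<^sup>+t. F x y t \<partial>lborel) \<partial>lborel)" .
  qed
  also have "\<dots> = C * (\<integral>\<^sup>+x. \<integral>\<^sup>+y. \<integral>\<^sup>+t. F x y t \<partial>lborel \<partial>lborel \<partial>lborel)"
    unfolding F_def by (subst nn_integral_cmult, measurable)+ 
  also have "(\<integral>\<^sup>+x. \<integral>\<^sup>+y. \<integral>\<^sup>+t. F x y t \<partial>lborel \<partial>lborel \<partial>lborel) = (\<integral>\<^sup>+x. \<integral>\<^sup>+t. \<integral>\<^sup>+y. F x y t \<partial>lborel \<partial>lborel \<partial>lborel)"
    by (intro nn_integral_cong lborel_pair.Fubini'[symmetric]) (simp add: F_def split_def)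
  also have "\<dots> = (\<integral>\<^sup>+t. \<integral>\<^sup>+x. \<integral>\<^sup>+y. F x y t \<partial>lborel \<partial>lborel \<partial>lborel)"
    by (intro lborel_pair.Fubini'[symmetric]) (simp add: F_def split_def)
  also have "C * (\<integral>\<^sup>+t. \<integral>\<^sup>+x. \<integral>\<^sup>+y. F x y t \<partial>lborel \<partial>lborel \<partial>lborel)
    \<le> C * (\<integral>\<^sup>+t. ennreal (2 ^ DIM('a)) * emeasure lborel S * I * indicator {0..1::real} t \<partial>lborel)"
    by (intro mult_left_mono nn_integral_mono Fle) simp
  also have "\<dots> = C * (ennreal (2 ^ DIM('a)) * emeasure lborel S * I)"
    by (subst nn_integral_cmult_indicator) auto
  finally show ?thesis by (simp add: C_def I_def h_def ennreal_mult mult.assoc)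
qed

text \<open>Along a subsequence with geometrically small errors the sum of all errors is integrable,
  so almost everywhere the errors form a convergent series.\<close>

lemma AE_convergent_subseq:
  fixes f :: "nat \<Rightarrow> 'x \<Rightarrow> 'b::euclidean_space"
  assumes [measurable]: "\<And>j. f j \<in> borel_measurable M" "g \<in> borel_measurable M" "\<And>n. B n \<in> sets M"
    and inc: "incseq B"
    and lim: "\<And>n. (\<lambda>j. \<integral>\<^sup>+x\<in>B n. ennreal (norm (f j x - g x)) \<partial>M) \<longlonglongrightarrow> 0"
  obtains r :: "nat \<Rightarrow> nat" where "strict_mono r" "AE x in M. x \<in> (\<Union>n. B n) \<longrightarrow> (\<lambda>k. f (r k) x) \<longlonglongrightarrow> g x"
proof -
  have "\<exists>N. \<forall>j\<ge>N. (\<integral>\<^sup>+x\<in>B n. ennreal (norm (f j x - g x)) \<partial>M) < ennreal ((1/2) ^ n)" for n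
    using order_tendstoD(2)[OF lim, of "ennreal ((1/2) ^ n)" n] by (simp add: eventually_sequentially)
  then obtain N where N: "\<And>n j. N n \<le> j \<Longrightarrow> (\<integral>\<^sup>+x\<in>B n. ennreal (norm (f j x - g x)) \<partial>M) < ennreal ((1/2) ^ n)"
    by metis
  define r where "r = rec_nat (N 0) (\<lambda>n s. max (Suc s) (N (Suc n)))"
  have r_Suc: "r (Suc n) = max (Suc (r n)) (N (Suc n))" and r_0: "r 0 = N 0" for n
    by (auto simp: r_def)
  have r: "strict_mono r" by (auto simp: strict_mono_Suc_iff r_Suc)
  have rN: "N n \<le> r n" for n by (cases n) (auto simp: r_0 r_Suc)
  have "(\<integral>\<^sup>+x. (\<Sum>k. ennreal (norm (f (r k) x - g x)) * indicator (B k) x) \<partial>M)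
    = (\<Sum>k. (\<integral>\<^sup>+x. ennreal (norm (f (r k) x - g x)) * indicator (B k) x \<partial>M))"
    by (intro nn_integral_suminf) measurable
  also have "\<dots> \<le> (\<Sum>k. ennreal ((1/2) ^ k))"
    using N rN by (intro suminf_le) (auto intro: less_imp_le)
  also have "\<dots> < \<infinity>"
  proof -
    have "(\<lambda>k. (1/2::real) ^ k) sums (1 / (1 - 1/2))" by (intro geometric_sums) simp
    then have "(\<Sum>k. ennreal ((1/2) ^ k)) = ennreal (1 / (1 - 1/2))"
      by (subst suminf_ennreal2) (auto simp: sums_iff)
    then show ?thesis by simp
  qed
  finally have "AE x in M. (\<Sum>k. ennreal (norm (f (r k) x - g x)) * indicator (B k) x) \<noteq> \<infinity>"
    by (intro nn_integral_PInf_AE) auto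
  then have "AE x in M. x \<in> (\<Union>n. B n) \<longrightarrow> (\<lambda>k. f (r k) x) \<longlonglongrightarrow> g x"
  proof eventually_elim
    case (elim x)
    show ?case
    proof
      assume "x \<in> (\<Union>n. B n)"
      then obtain n0 where "x \<in> B n0" by auto
      then have xB: "x \<in> B k" if "n0 \<le> k" for k using inc that by (auto simp: incseq_def)
      define s where "s k = norm (f (r k) x - g x) * indicator (B k) x" for k
      have "(\<Sum>k. ennreal (s k)) \<noteq> top"
        using elim by (simp add: s_def ennreal_mult ennreal_indicator)
      then have "summable s" by (intro summable_suminf_not_top) (auto simp: s_def)
      then have "s \<longlonglongrightarrow> 0" by (rule summable_LIMSEQ_zero)
      then have "(\<lambda>k. norm (f (r k) x - g x)) \<longlonglongrightarrow> 0"
        by (rule Lim_transform_eventually) (use xB in \<open>auto simp: s_def eventually_sequentially intro!: exI[of _ n0]\<close>)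
      then show "(\<lambda>k. f (r k) x) \<longlonglongrightarrow> g x"
        by (simp add: tendsto_norm_zero_iff LIM_zero_iff)
    qed
  qed
  with r show ?thesis using that by blast
qed

text \<open>Values up to \<open>\<eta>\<close> are paid for by \<open>\<eta>\<close>, larger ones by
  their p-th power. Integrated over a set of finite measure this replaces Hoelder's
  inequality.\<close>

lemma le_add_powr:
  fixes t \<eta> p :: real
  assumes "0 \<le> t" "0 < \<eta>" "1 \<le> p"
  shows "t \<le> \<eta> + \<eta> powr (1 - p) * t powr p"
proof (cases "t \<le> \<eta>")
  case True
  then show ?thesis by (simp add: add_increasing2)
next
  case False
  have "t = t powr (1 - p) * t powr p" using False assms by (simp add: powr_add[symmetric])
  also have "\<dots> \<le> \<eta> powr (1 - p) * t powr p"
    using False assms by (intro mult_right_mono powr_mono2') auto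
  finally show ?thesis using assms by simp
qed

section \<open>Approximation up to the boundary of the slab, and the weak Poincare
  inequality\<close>

locale slab_data =
  fixes e :: "'a::euclidean_space" and b1 b2 p :: real
  assumes e: "e \<in> Basis" and b: "b1 < b2" and p: "1 < p"
begin

abbreviation \<Omega> :: "'a set" where "\<Omega> \<equiv> slab e b1 b2"

text \<open>Convex sets of finite measure and bounded diameter exhausting the slab: this is what
  \<open>Poincare_C1\<close> asks for.\<close>

definition piece :: "real \<Rightarrow> 'a set" where "piece R = \<Omega> \<inter> ball 0 R"

text \<open>The dilation \<open>x \<mapsto> shift j + (1 - \<delta> j) x\<close> about the point \<open>(b1 + b2) / 2 e\<close> maps the closed slab
  into the open one, at distance more than \<open>eps j\<close> from the boundary.\<close>

definition \<delta> :: "nat \<Rightarrow> real" where "\<delta> j = 1 / real (j + 2)"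
definition shift :: "nat \<Rightarrow> 'a" where "shift j = (\<delta> j * ((b1 + b2) / 2)) *\<^sub>R e"
definition eps :: "nat \<Rightarrow> real" where "eps j = \<delta> j * ((b2 - b1) / 4)"

abbreviation mol :: "nat \<Rightarrow> ('a \<Rightarrow> 'b::euclidean_space) \<Rightarrow> 'a \<Rightarrow> 'b" where
  "mol j \<equiv> mollify (shift j) (1 - \<delta> j) (eps j)"

lemma e_simps [simp]: "e \<bullet> e = 1" "norm e = 1"
  using e by (simp_all add: inner_Basis)

lemma \<delta>: "0 < \<delta> j" "\<delta> j \<le> 1/2" "\<delta> \<longlonglongrightarrow> 0"
proof -
  show "0 < \<delta> j" "\<delta> j \<le> 1/2" by (simp_all add: \<delta>_def field_simps)
  have "(\<lambda>j. inverse (real (Suc (j + 1)))) \<longlonglongrightarrow> 0" by (rule LIMSEQ_ignore_initial_segment[OF LIMSEQ_inverse_real_of_nat])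
  then show "\<delta> \<longlonglongrightarrow> 0" by (simp add: \<delta>_def[abs_def] inverse_eq_divide)
qed

lemma eps_pos: "0 < eps j"
  using \<delta>(1) b by (simp add: eps_def)

lemma shift_lim: "shift \<longlonglongrightarrow> 0" and lam_lim: "(\<lambda>j. 1 - \<delta> j) \<longlonglongrightarrow> 1" and eps_lim: "eps \<longlonglongrightarrow> 0"
proof -
  have "(\<lambda>j. (\<delta> j * ((b1 + b2) / 2)) *\<^sub>R e) \<longlonglongrightarrow> (0 * ((b1 + b2) / 2)) *\<^sub>R e" by (intro tendsto_intros \<delta>)
  then show "shift \<longlonglongrightarrow> 0" by (simp add: shift_def[abs_def])
  have "(\<lambda>j. 1 - \<delta> j) \<longlonglongrightarrow> 1 - 0" by (intro tendsto_intros \<delta>)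
  then show "(\<lambda>j. 1 - \<delta> j) \<longlonglongrightarrow> 1" by simp
  have "(\<lambda>j. \<delta> j * ((b2 - b1) / 4)) \<longlonglongrightarrow> 0 * ((b2 - b1) / 4)" by (intro tendsto_intros \<delta>)
  then show "eps \<longlonglongrightarrow> 0" by (simp add: eps_def[abs_def])
qed

lemma open_slab: "open \<Omega>"
proof -
  have "\<Omega> = {x. b1 < x \<bullet> e} \<inter> {x. x \<bullet> e < b2}" by (auto simp: slab_def)
  then show ?thesis by (simp add: open_Int open_Collect_less continuous_on_inner)
qed

lemma convex_slab: "convex \<Omega>"
proof -
  have "\<Omega> = {x. e \<bullet> x > b1} \<inter> {x. e \<bullet> x < b2}" by (auto simp: slab_def inner_commute)
  then show ?thesis by (simp add: convex_Int convex_halfspace_gt convex_halfspace_lt)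
qed

lemma slab_borel[measurable]: "\<Omega> \<in> sets borel"
  using open_slab by simp

lemma piece_borel[measurable]: "piece R \<in> sets borel"
  unfolding piece_def by (intro sets.Int slab_borel) simp

lemma convex_piece: "convex (piece R)"
  unfolding piece_def by (intro convex_Int convex_slab convex_ball)

lemma piece_diam: "x \<in> piece R \<Longrightarrow> y \<in> piece R \<Longrightarrow> norm (y - x) \<le> 2 * R"
  using norm_triangle_ineq4[of y x] by (simp add: piece_def)

lemma emeasure_piece: "emeasure lborel (piece R) < \<infinity>"
proof -
  have "emeasure lborel (piece R) \<le> emeasure lborel (ball (0::'a) R)"
    using emeasure_mono[of "piece R" "ball 0 R" lborel] by (auto simp: piece_def)
  also have "\<dots> < \<infinity>" using emeasure_lborel_ball_finite by (simp add: top.not_eq_extremum)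
  finally show ?thesis .
qed

text \<open>The dilation moves each boundary plane inwards by
  \<open>\<delta> j * ((b2 - b1) / 2)\<close>, which is twice \<open>eps j\<close>. One half is used
  up by the radius of the ball, the other half remains as distance from the boundary.\<close>

lemma cball_in_slab:
  assumes "b1 \<le> x \<bullet> e" "x \<bullet> e \<le> b2"
  shows "cball (shift j + (1 - \<delta> j) *\<^sub>R x) (eps j) \<subseteq> {y. b1 + eps j \<le> y \<bullet> e \<and> y \<bullet> e \<le> b2 - eps j}"
proof
  fix y assume "y \<in> cball (shift j + (1 - \<delta> j) *\<^sub>R x) (eps j)"
  then have "norm (shift j + (1 - \<delta> j) *\<^sub>R x - y) \<le> eps j" by (simp add: dist_norm)
  moreover have "\<bar>(shift j + (1 - \<delta> j) *\<^sub>R x - y) \<bullet> e\<bar> \<le> norm (shift j + (1 - \<delta> j) *\<^sub>R x - y)"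
    using Basis_le_norm[OF e] by blast
  ultimately have 1: "\<bar>(shift j + (1 - \<delta> j) *\<^sub>R x) \<bullet> e - y \<bullet> e\<bar> \<le> eps j" by (simp add: inner_diff_left)
  have 2: "(shift j + (1 - \<delta> j) *\<^sub>R x) \<bullet> e = \<delta> j * ((b1 + b2) / 2) + (1 - \<delta> j) * (x \<bullet> e)"
    by (simp add: shift_def inner_add_left)
  have "(1 - \<delta> j) * b1 \<le> (1 - \<delta> j) * (x \<bullet> e)" "(1 - \<delta> j) * (x \<bullet> e) \<le> (1 - \<delta> j) * b2"
    using assms \<delta>(2)[of j] by (intro mult_left_mono; simp)+
  moreover have "b1 + d * ((b2 - b1) / 4) \<le> Y \<and> Y \<le> b2 - d * ((b2 - b1) / 4)"
    if "\<bar>d * ((b1 + b2) / 2) + P - Y\<bar> \<le> d * ((b2 - b1) / 4)" "(1 - d) * b1 \<le> P" "P \<le> (1 - d) * b2" for d P Y :: real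
    using that unfolding abs_le_iff by (simp add: field_simps)
  ultimately show "y \<in> {y. b1 + eps j \<le> y \<bullet> e \<and> y \<bullet> e \<le> b2 - eps j}"
    using 1 unfolding 2 eps_def by blast
qed

lemma inner_slab_subset: "0 < c \<Longrightarrow> {y. b1 + c \<le> y \<bullet> e \<and> y \<bullet> e \<le> b2 - c} \<subseteq> \<Omega>"
  by (auto simp: slab_def)

lemma near_in_slab:
  assumes "b1 \<le> x \<bullet> e" "x \<bullet> e \<le> b2" "norm z < 1"
  shows "shift j + (1 - \<delta> j) *\<^sub>R x - eps j *\<^sub>R z \<in> \<Omega>"
proof -
  have "shift j + (1 - \<delta> j) *\<^sub>R x - eps j *\<^sub>R z \<in> cball (shift j + (1 - \<delta> j) *\<^sub>R x) (eps j)"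
    using assms(3) eps_pos[of j] by (simp add: dist_norm mult_left_le)
  then show ?thesis using cball_in_slab[OF assms(1,2), of j] inner_slab_subset[OF eps_pos[of j]] by blast
qed

text \<open>The formulas hold on the closed slab because the balls seen from there lie in a closed
  subset of the open slab.\<close>

lemma smooth_approximants:
  assumes wp: "weak_pair \<Omega> u D"
  obtains U where "\<And>j. Ck 1 (U j)"
    "\<And>j x. b1 \<le> x \<bullet> e \<Longrightarrow> x \<bullet> e \<le> b2 \<Longrightarrow> U j x = mol j u x \<and> grad (U j) x = (1 - \<delta> j) *\<^sub>R mol j D x"
proof -
  have "\<exists>U. Ck 1 U \<and> (\<forall>x. b1 \<le> x \<bullet> e \<longrightarrow> x \<bullet> e \<le> b2 \<longrightarrow> U x = mol j u x \<and> grad U x = (1 - \<delta> j) *\<^sub>R mol j D x)" for j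
  proof -
    let ?F = "{y. b1 + eps j \<le> y \<bullet> e \<and> y \<bullet> e \<le> b2 - eps j}"
    have cl: "closed ?F" by (intro closed_Collect_conj closed_Collect_le continuous_intros)
    obtain U where U: "Ck 1 U" "\<And>x. cball (shift j + (1 - \<delta> j) *\<^sub>R x) (eps j) \<subseteq> ?F \<Longrightarrow>
       U x = mol j u x \<and> grad U x = (1 - \<delta> j) *\<^sub>R mol j D x"
      by (rule weak_pair_mollify[OF wp eps_pos[of j] cl inner_slab_subset[OF eps_pos[of j]], where a = "shift j" and l = "1 - \<delta> j"])
        (rule that)
    then show ?thesis using cball_in_slab by blast
  qed
  then show ?thesis using that by metis
qed

lemma weak_pairD:
  assumes "weak_pair \<Omega> u D"
  shows "u \<in> borel_measurable borel" "D \<in> borel_measurable borel" "x \<notin> \<Omega> \<Longrightarrow> u x = 0" "x \<notin> \<Omega> \<Longrightarrow> D x = 0"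
    "compact K \<Longrightarrow> K \<subseteq> \<Omega> \<Longrightarrow> set_integrable lborel K u" "compact K \<Longrightarrow> K \<subseteq> \<Omega> \<Longrightarrow> set_integrable lborel K D"
    "\<phi> \<in> test_functions \<Omega> \<Longrightarrow> i \<in> Basis \<Longrightarrow> (LINT x|lborel. u x * (grad \<phi> x \<bullet> i)) = - (LINT x|lborel. (D x \<bullet> i) * \<phi> x)"
  using assms by (auto simp: weak_pair_def)

text \<open>The error splits into \<open>1 - \<delta> j\<close> times the mollification error and
  \<open>\<delta> j\<close> times \<open>D\<close>.\<close>

lemma approximants_gradient_lim:
  assumes [measurable]: "D \<in> borel_measurable borel" and fin: "(\<integral>\<^sup>+x. ennreal (norm (D x) powr p) \<partial>lborel) < \<infinity>"
    and U: "\<And>j x. x \<in> \<Omega> \<Longrightarrow> grad (U j) x = (1 - \<delta> j) *\<^sub>R mol j D x"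
  shows "(\<lambda>j. \<integral>\<^sup>+x\<in>\<Omega>. ennreal (norm (grad (U j) x - D x) powr p) \<partial>lborel) \<longlonglongrightarrow> 0"
proof -
  define I where "I = (\<integral>\<^sup>+x. ennreal (norm (D x) powr p) \<partial>lborel)"
  have 1: "(\<lambda>j. \<integral>\<^sup>+x. ennreal (norm (mol j D x - D x) powr p) \<partial>lborel) \<longlonglongrightarrow> 0"
    using p fin \<delta>(2) by (intro mollify_tendsto_Lq shift_lim lam_lim eps_lim) (auto simp: field_simps)
  have "(\<lambda>j. ennreal (2 powr p) * ((\<integral>\<^sup>+x. ennreal (norm (mol j D x - D x) powr p) \<partial>lborel) + I * ennreal (\<delta> j powr p)))
     \<longlonglongrightarrow> ennreal (2 powr p) * (0 + I * ennreal (0 powr p))"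
    using fin p unfolding I_def by (intro tendsto_intros ennreal_tendsto_cmult 1 tendsto_ennrealI tendsto_powr' \<delta>(3)) (auto simp: less_imp_le \<delta>)
  then have lim: "(\<lambda>j. ennreal (2 powr p) * ((\<integral>\<^sup>+x. ennreal (norm (mol j D x - D x) powr p) \<partial>lborel) + I * ennreal (\<delta> j powr p))) \<longlonglongrightarrow> 0"
    using p by simp
  have le: "(\<integral>\<^sup>+x\<in>\<Omega>. ennreal (norm (grad (U j) x - D x) powr p) \<partial>lborel)
    \<le> ennreal (2 powr p) * ((\<integral>\<^sup>+x. ennreal (norm (mol j D x - D x) powr p) \<partial>lborel) + I * ennreal (\<delta> j powr p))" for j
  proof -
    have "(\<integral>\<^sup>+x\<in>\<Omega>. ennreal (norm (grad (U j) x - D x) powr p) \<partial>lborel)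
      \<le> (\<integral>\<^sup>+x. ennreal (2 powr p) * (ennreal (norm (mol j D x - D x) powr p) + ennreal (norm (D x) powr p) * ennreal (\<delta> j powr p)) \<partial>lborel)"
    proof (rule nn_integral_mono)
      fix x
      show "ennreal (norm (grad (U j) x - D x) powr p) * indicator \<Omega> x
        \<le> ennreal (2 powr p) * (ennreal (norm (mol j D x - D x) powr p) + ennreal (norm (D x) powr p) * ennreal (\<delta> j powr p))"
      proof (cases "x \<in> \<Omega>")
        case True
        have eq: "grad (U j) x - D x = (1 - \<delta> j) *\<^sub>R (mol j D x - D x) + (- \<delta> j) *\<^sub>R D x"
          unfolding U[OF True] by (simp add: algebra_simps)
        have "norm (grad (U j) x - D x) powr p
          \<le> 2 powr p * (norm ((1 - \<delta> j) *\<^sub>R (mol j D x - D x)) powr p + norm ((- \<delta> j) *\<^sub>R D x) powr p)"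
          unfolding eq using p by (intro powr_norm_add_le) auto
        also have "\<dots> \<le> 2 powr p * (norm (mol j D x - D x) powr p + norm (D x) powr p * \<delta> j powr p)"
        proof (intro mult_left_mono add_mono)
          show "norm ((1 - \<delta> j) *\<^sub>R (mol j D x - D x)) powr p \<le> norm (mol j D x - D x) powr p"
            using p \<delta>(1,2)[of j] by (intro powr_mono2) (auto simp: mult_left_le_one_le)
          show "norm ((- \<delta> j) *\<^sub>R D x) powr p \<le> norm (D x) powr p * \<delta> j powr p"
            using \<delta>(1)[of j] by (simp add: powr_mult)
        qed simp
        finally show ?thesis using True
          by (simp add: ennreal_mult[symmetric] ennreal_plus[symmetric] ennreal_leI del: ennreal_plus)
      qed simp
    qed
    also have "\<dots> = ennreal (2 powr p) * ((\<integral>\<^sup>+x. ennreal (norm (mol j D x - D x) powr p) \<partial>lborel) + I * ennreal (\<delta> j powr p))"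
      unfolding I_def by (subst nn_integral_cmult; simp add: nn_integral_add nn_integral_multc)
    finally show ?thesis .
  qed
  show ?thesis by (rule tendsto_sandwich[OF _ _ tendsto_const lim]) (simp_all add: le)
qed

text \<open>Only local convergence is available, since \<open>u\<close> need not be p-integrable on
  the whole slab.\<close>

lemma approximants_function_lim:
  assumes [measurable]: "u \<in> borel_measurable borel" and fin: "\<And>R. (\<integral>\<^sup>+x\<in>piece R. ennreal (\<bar>u x\<bar> powr p) \<partial>lborel) < \<infinity>"
    and U: "\<And>j x. x \<in> \<Omega> \<Longrightarrow> U j x = mol j u x" and R: "0 < R"
  shows "(\<lambda>j. \<integral>\<^sup>+x\<in>piece R. ennreal (\<bar>U j x - u x\<bar> powr p) \<partial>lborel) \<longlonglongrightarrow> 0"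
proof -
  \<comment> \<open>Large enough for every point entering the averages over \<open>piece R\<close>:
    the dilation moves towards its centre on the axis, and the averaging radius is below the width
    of the slab.\<close>
  define R' where "R' = R + norm (((b1 + b2) / 2) *\<^sub>R e) + (b2 - b1)"
  have "(\<lambda>j. \<integral>\<^sup>+x\<in>piece R. ennreal (norm (mol j u x - u x) powr p) \<partial>lborel) \<longlonglongrightarrow> 0"
  proof (rule mollify_tendsto_Lq_local[where S' = "piece R'"])
    show "piece R \<subseteq> piece R'" using b norm_ge_zero[of "((b1 + b2) / 2) *\<^sub>R e"]
      by (auto simp: piece_def R'_def simp del: norm_scaleR norm_ge_zero)
    show "(\<integral>\<^sup>+x\<in>piece R'. ennreal (norm (u x) powr p) \<partial>lborel) < \<infinity>" using fin by simp
    have "shift j + (1 - \<delta> j) *\<^sub>R x - eps j *\<^sub>R z \<in> piece R'" if "x \<in> piece R" "norm z < 1" for j x z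
    proof -
      have "norm (shift j + (1 - \<delta> j) *\<^sub>R x - eps j *\<^sub>R z) \<le> norm (shift j) + norm ((1 - \<delta> j) *\<^sub>R x) + norm (eps j *\<^sub>R z)"
        using norm_triangle_ineq4[of "shift j + (1 - \<delta> j) *\<^sub>R x" "eps j *\<^sub>R z"] norm_triangle_ineq[of "shift j" "(1 - \<delta> j) *\<^sub>R x"] by linarith
      also have "\<dots> < norm (((b1 + b2) / 2) *\<^sub>R e) + R + (b2 - b1)"
      proof (intro add_le_less_mono add_mono)
        show "norm (shift j) \<le> norm (((b1 + b2) / 2) *\<^sub>R e)"
          using \<delta>(1,2)[of j] by (auto simp: shift_def abs_mult intro!: mult_left_le_one_le)
        have "norm ((1 - \<delta> j) *\<^sub>R x) \<le> norm x" using \<delta>(1,2)[of j] by (simp add: mult_left_le_one_le)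
        then show "norm ((1 - \<delta> j) *\<^sub>R x) \<le> R" using that by (simp add: piece_def)
        have "norm (eps j *\<^sub>R z) \<le> eps j * 1" unfolding norm_scaleR using that eps_pos[of j] by (intro mult_mono) auto
        also have "eps j \<le> 1 * ((b2 - b1) / 4)" unfolding eps_def using \<delta>(2)[of j] b by (intro mult_right_mono) auto
        finally show "norm (eps j *\<^sub>R z) < b2 - b1" using b by simp
      qed
      finally show ?thesis using near_in_slab[of x z j] that by (simp add: piece_def slab_def R'_def)
    qed
    then show "\<forall>\<^sub>F j in sequentially. \<forall>x\<in>piece R. \<forall>z. norm z < 1 \<longrightarrow> shift j + (1 - \<delta> j) *\<^sub>R x - eps j *\<^sub>R z \<in> piece R'"
      by (intro always_eventually allI ballI impI)
    show "1/2 \<le> 1 - \<delta> j" for j using \<delta>(2)[of j] by simp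
  qed (use p shift_lim lam_lim eps_lim in auto)
  moreover have "(\<integral>\<^sup>+x\<in>piece R. ennreal (norm (mol j u x - u x) powr p) \<partial>lborel) = (\<integral>\<^sup>+x\<in>piece R. ennreal (\<bar>U j x - u x\<bar> powr p) \<partial>lborel)" for j
    by (intro nn_integral_cong) (auto simp: indicator_def piece_def U)
  ultimately show ?thesis by simp
qed

text \<open>The constant of \<open>Poincare_C1\<close> for diameter \<open>2 * R\<close>, times the
  factor \<open>2 powr p\<close> lost when the gradient of an approximant is split into the limit
  and an error.\<close>

definition Poincare_const :: "real \<Rightarrow> ennreal" where
  "Poincare_const R = ennreal ((2 * R) powr p * 2 ^ DIM('a)) * emeasure lborel (piece R) * ennreal (2 powr p)"

lemma Poincare_const_finite: "Poincare_const R < \<infinity>"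
  using emeasure_piece[of R] by (simp add: Poincare_const_def ennreal_mult_less_top)

text \<open>That \<open>u\<close> is p-integrable on pieces is not known yet, so only
  \<open>L^1\<close> convergence of the approximants on compact subsets is available. It yields an
  almost everywhere convergent subsequence, and Fatou's lemma, used in both the inner and the outer
  integral, transfers the inequality.\<close>

lemma weak_Poincare:
  assumes wp: "weak_pair \<Omega> u D" and fin: "(\<integral>\<^sup>+x. ennreal (norm (D x) powr p) \<partial>lborel) < \<infinity>"
  shows "(\<integral>\<^sup>+x\<in>piece R. (\<integral>\<^sup>+y\<in>piece R. ennreal (\<bar>u y - u x\<bar> powr p) \<partial>lborel) \<partial>lborel)
    \<le> Poincare_const R * (\<integral>\<^sup>+x. ennreal (norm (D x) powr p) \<partial>lborel)"
proof -
  note [measurable] = weak_pairD(1,2)[OF wp]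
  obtain U where U: "\<And>j. Ck 1 (U j)"
    and UD: "\<And>j x. b1 \<le> x \<bullet> e \<Longrightarrow> x \<bullet> e \<le> b2 \<Longrightarrow> U j x = mol j u x \<and> grad (U j) x = (1 - \<delta> j) *\<^sub>R mol j D x"
    by (rule smooth_approximants[OF wp]) (rule that)
  have Uu: "U j x = mol j u x" and UgD: "grad (U j) x = (1 - \<delta> j) *\<^sub>R mol j D x" if "x \<in> \<Omega>" for j x
    using UD[of x j] that by (auto simp: slab_def)
  have [measurable]: "U j \<in> borel_measurable borel" for j
    using Ck_1_continuous[OF U] by (rule borel_measurable_continuous_onI)
  have [measurable]: "grad (U j) \<in> borel_measurable borel" for j
    using Ck_1_continuous_grad[OF U] by (rule borel_measurable_continuous_onI)
  obtain C :: "nat \<Rightarrow> 'a set" where C: "\<And>n. compact (C n)" "\<And>n. C n \<subseteq> \<Omega>" "\<And>n. C n \<subseteq> interior (C (Suc n))" "(\<Union>n. C n) = \<Omega>"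
    by (rule open_Union_compact_subsets[OF open_slab]) (rule that)
  have [measurable]: "C n \<in> sets borel" for n using C(1) by (auto intro!: borel_closed compact_imp_closed)
  obtain r where r: "strict_mono r" and ae: "AE x in lborel. x \<in> (\<Union>n. C n) \<longrightarrow> (\<lambda>k. U (r k) x) \<longlonglongrightarrow> u x"
  proof (rule AE_convergent_subseq[of U lborel u C])
    show "incseq C" using C(3) interior_subset by (intro incseq_SucI) blast
    fix n
    have "(\<lambda>j. \<integral>\<^sup>+x\<in>C n. ennreal (norm (mol j u x - u x)) \<partial>lborel) \<longlonglongrightarrow> 0"
      by (rule mollify_tendsto_L1_compact[OF _ open_slab weak_pairD(5)[OF wp] C(1,2)])
        (use shift_lim lam_lim eps_lim \<delta>(2) in \<open>auto simp: field_simps\<close>)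
    moreover have "(\<integral>\<^sup>+x\<in>C n. ennreal (norm (mol j u x - u x)) \<partial>lborel) = (\<integral>\<^sup>+x\<in>C n. ennreal (norm (U j x - u x)) \<partial>lborel)" for j
      using C(2)[of n] Uu by (intro nn_integral_cong) (auto simp: indicator_def subset_iff)
    ultimately show "(\<lambda>j. \<integral>\<^sup>+x\<in>C n. ennreal (norm (U j x - u x)) \<partial>lborel) \<longlonglongrightarrow> 0" by simp
  qed auto
  define I where "I = (\<integral>\<^sup>+x. ennreal (norm (D x) powr p) \<partial>lborel)"
  define E where "E j = (\<integral>\<^sup>+x\<in>\<Omega>. ennreal (norm (grad (U j) x - D x) powr p) \<partial>lborel)" for j
  define A where "A = ennreal ((2 * R) powr p * 2 ^ DIM('a)) * emeasure lborel (piece R)"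
  have A: "A < \<infinity>" using emeasure_piece[of R] by (simp add: A_def ennreal_mult_less_top)
  have E: "E \<longlonglongrightarrow> 0" unfolding E_def by (rule approximants_gradient_lim) (use fin UgD in auto)
  define H where "H j x y = ennreal (\<bar>U j y - U j x\<bar> powr p) * indicator (piece R) y" for j x y
  have [measurable]: "(\<lambda>y. H j x y) \<in> borel_measurable borel" for j x unfolding H_def by measurable
  have [measurable]: "(\<lambda>x. \<integral>\<^sup>+y. H j x y \<partial>lborel) \<in> borel_measurable borel" for j unfolding H_def by measurable
  have Hb: "(\<integral>\<^sup>+x. (\<integral>\<^sup>+y. H j x y \<partial>lborel) * indicator (piece R) x \<partial>lborel) \<le> A * (ennreal (2 powr p) * (E j + I))" for j
  proof -
    have "(\<integral>\<^sup>+x. (\<integral>\<^sup>+y. H j x y \<partial>lborel) * indicator (piece R) x \<partial>lborel)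
      \<le> A * (\<integral>\<^sup>+z\<in>piece R. ennreal (norm (grad (U j) z) powr p) \<partial>lborel)"
      unfolding H_def A_def using p by (intro Poincare_C1[OF U _ _ convex_piece piece_diam]) auto
    also have "\<dots> \<le> A * (ennreal (2 powr p) * (E j + I))"
    proof (rule mult_left_mono)
      have "(\<integral>\<^sup>+z\<in>piece R. ennreal (norm (grad (U j) z) powr p) \<partial>lborel)
        \<le> (\<integral>\<^sup>+z. ennreal (2 powr p) * (ennreal (norm (grad (U j) z - D z) powr p) * indicator \<Omega> z + ennreal (norm (D z) powr p)) \<partial>lborel)"
      proof (rule nn_integral_mono)
        fix z
        have "norm (grad (U j) z) powr p \<le> 2 powr p * (norm (grad (U j) z - D z) powr p + norm (D z) powr p)"
          using powr_norm_add_le[of p "grad (U j) z - D z" "D z"] p by simp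
        then show "ennreal (norm (grad (U j) z) powr p) * indicator (piece R) z
          \<le> ennreal (2 powr p) * (ennreal (norm (grad (U j) z - D z) powr p) * indicator \<Omega> z + ennreal (norm (D z) powr p))"
          by (cases "z \<in> piece R") (auto simp: piece_def ennreal_mult[symmetric] ennreal_plus[symmetric] ennreal_leI simp del: ennreal_plus)
      qed
      also have "\<dots> = ennreal (2 powr p) * (E j + I)"
        unfolding E_def I_def by (subst nn_integral_cmult; simp add: nn_integral_add)
      finally show "(\<integral>\<^sup>+z\<in>piece R. ennreal (norm (grad (U j) z) powr p) \<partial>lborel) \<le> ennreal (2 powr p) * (E j + I)" .
    qed simp
    finally show ?thesis .
  qed
  have "(\<integral>\<^sup>+x\<in>piece R. (\<integral>\<^sup>+y\<in>piece R. ennreal (\<bar>u y - u x\<bar> powr p) \<partial>lborel) \<partial>lborel)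
    \<le> (\<integral>\<^sup>+x. liminf (\<lambda>k. (\<integral>\<^sup>+y. H (r k) x y \<partial>lborel) * indicator (piece R) x) \<partial>lborel)"
  proof (rule nn_integral_mono_AE)
    show "AE x in lborel. (\<integral>\<^sup>+y\<in>piece R. ennreal (\<bar>u y - u x\<bar> powr p) \<partial>lborel) * indicator (piece R) x
      \<le> liminf (\<lambda>k. (\<integral>\<^sup>+y. H (r k) x y \<partial>lborel) * indicator (piece R) x)"
      using ae
    proof eventually_elim
      case (elim x)
      show ?case
      proof (cases "x \<in> piece R")
        case True
        then have limx: "(\<lambda>k. U (r k) x) \<longlonglongrightarrow> u x" using elim C(4) by (simp add: piece_def)
        have "(\<integral>\<^sup>+y\<in>piece R. ennreal (\<bar>u y - u x\<bar> powr p) \<partial>lborel) = (\<integral>\<^sup>+y. liminf (\<lambda>k. H (r k) x y) \<partial>lborel)"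
        proof (rule nn_integral_cong_AE)
          show "AE y in lborel. ennreal (\<bar>u y - u x\<bar> powr p) * indicator (piece R) y = liminf (\<lambda>k. H (r k) x y)"
            using ae
          proof eventually_elim
            case (elim y)
            show ?case
            proof (cases "y \<in> piece R")
              case y: True
              then have "(\<lambda>k. U (r k) y) \<longlonglongrightarrow> u y" using elim C(4) by (simp add: piece_def)
              then have "(\<lambda>k. ennreal (\<bar>U (r k) y - U (r k) x\<bar> powr p)) \<longlonglongrightarrow> ennreal (\<bar>u y - u x\<bar> powr p)"
                using limx p by (intro tendsto_ennrealI tendsto_powr' tendsto_intros) auto
              from lim_imp_Liminf[OF trivial_limit_sequentially this] show ?thesis using y by (simp add: H_def)
            qed (simp add: H_def Liminf_const)
          qed
        qed
        also have "\<dots> \<le> liminf (\<lambda>k. \<integral>\<^sup>+y. H (r k) x y \<partial>lborel)"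
          by (rule nn_integral_liminf) measurable
        finally show ?thesis using True by simp
      qed (simp add: Liminf_const)
    qed
  qed
  also have "\<dots> \<le> liminf (\<lambda>k. \<integral>\<^sup>+x. (\<integral>\<^sup>+y. H (r k) x y \<partial>lborel) * indicator (piece R) x \<partial>lborel)"
    by (rule nn_integral_liminf) measurable
  also have "\<dots> \<le> liminf (\<lambda>k. A * (ennreal (2 powr p) * (E (r k) + I)))"
    by (intro Liminf_mono always_eventually allI Hb)
  also have "\<dots> = A * (ennreal (2 powr p) * (0 + I))"
  proof (rule lim_imp_Liminf)
    have "(\<lambda>k. E (r k)) \<longlonglongrightarrow> 0" using LIMSEQ_subseq_LIMSEQ[OF E r] by (simp add: comp_def)
    then show "(\<lambda>k. A * (ennreal (2 powr p) * (E (r k) + I))) \<longlonglongrightarrow> A * (ennreal (2 powr p) * (0 + I))"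
      using A by (intro ennreal_tendsto_cmult tendsto_intros) auto
  qed simp
  finally show ?thesis unfolding Poincare_const_def A_def I_def by (simp add: mult.assoc)
qed

text \<open>Finiteness of the double integral gives a point \<open>x\<close> of the piece whose
  inner integral is finite; \<open>u\<close> then differs from the constant \<open>u x\<close> by a
  p-integrable function. A null piece is treated apart, as it offers no such point.\<close>

lemma weak_pair_Lp_piece:
  assumes wp: "weak_pair \<Omega> u D" and fin: "(\<integral>\<^sup>+x. ennreal (norm (D x) powr p) \<partial>lborel) < \<infinity>"
  shows "(\<integral>\<^sup>+x\<in>piece R. ennreal (\<bar>u x\<bar> powr p) \<partial>lborel) < \<infinity>"
proof (cases "emeasure lborel (piece R) = 0")
  case True
  then have "AE x in lborel. x \<notin> piece R" by (intro AE_not_in) auto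
  then have "(\<integral>\<^sup>+x\<in>piece R. ennreal (\<bar>u x\<bar> powr p) \<partial>lborel) = (\<integral>\<^sup>+(x::'a). 0 \<partial>lborel)"
    by (intro nn_integral_cong_AE) (auto elim!: eventually_mono)
  then show ?thesis by simp
next
  case False
  note [measurable] = weak_pairD(1,2)[OF wp]
  have "(\<integral>\<^sup>+x\<in>piece R. (\<integral>\<^sup>+y\<in>piece R. ennreal (\<bar>u y - u x\<bar> powr p) \<partial>lborel) \<partial>lborel) < \<infinity>"
    using weak_Poincare[OF wp fin, of R] fin Poincare_const_finite[of R]
    by (auto intro!: le_less_trans[OF weak_Poincare[OF wp fin]] simp: ennreal_mult_less_top)
  then have "AE x in lborel. (\<integral>\<^sup>+y\<in>piece R. ennreal (\<bar>u y - u x\<bar> powr p) \<partial>lborel) * indicator (piece R) x \<noteq> \<infinity>"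
    by (intro nn_integral_PInf_AE) auto
  then have "AE x in lborel. x \<notin> piece R" if "\<not> (\<exists>x\<in>piece R. (\<integral>\<^sup>+y\<in>piece R. ennreal (\<bar>u y - u x\<bar> powr p) \<partial>lborel) \<noteq> \<infinity>)"
    by (rule eventually_mono) (use that in auto)
  moreover have "\<not> (AE x in lborel. x \<notin> piece R)"
    using False by (subst AE_iff_null_sets[symmetric]) (auto simp: null_sets_def)
  ultimately have "\<exists>x\<in>piece R. (\<integral>\<^sup>+y\<in>piece R. ennreal (\<bar>u y - u x\<bar> powr p) \<partial>lborel) \<noteq> \<infinity>"
    by blast
  then obtain x where x: "x \<in> piece R" "(\<integral>\<^sup>+y\<in>piece R. ennreal (\<bar>u y - u x\<bar> powr p) \<partial>lborel) < \<infinity>"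
    by (auto simp: top.not_eq_extremum)
  have "(\<integral>\<^sup>+y\<in>piece R. ennreal (\<bar>u y\<bar> powr p) \<partial>lborel)
    \<le> (\<integral>\<^sup>+y. ennreal (2 powr p) * (ennreal (\<bar>u y - u x\<bar> powr p) * indicator (piece R) y + ennreal (\<bar>u x\<bar> powr p) * indicator (piece R) y) \<partial>lborel)"
  proof (rule nn_integral_mono)
    fix y
    have "\<bar>u y\<bar> powr p \<le> 2 powr p * (\<bar>u y - u x\<bar> powr p + \<bar>u x\<bar> powr p)"
      using powr_norm_add_le[of p "u y - u x" "u x"] p by simp
    then show "ennreal (\<bar>u y\<bar> powr p) * indicator (piece R) y
      \<le> ennreal (2 powr p) * (ennreal (\<bar>u y - u x\<bar> powr p) * indicator (piece R) y + ennreal (\<bar>u x\<bar> powr p) * indicator (piece R) y)"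
      by (cases "y \<in> piece R") (auto simp: ennreal_mult[symmetric] ennreal_plus[symmetric] ennreal_leI simp del: ennreal_plus)
  qed
  also have "\<dots> = ennreal (2 powr p) * ((\<integral>\<^sup>+y\<in>piece R. ennreal (\<bar>u y - u x\<bar> powr p) \<partial>lborel) + ennreal (\<bar>u x\<bar> powr p) * emeasure lborel (piece R))"
    by (subst nn_integral_cmult; simp add: nn_integral_add nn_integral_cmult_indicator)
  also have "\<dots> < \<infinity>" using x(2) emeasure_piece[of R] by (simp add: ennreal_mult_less_top)
  finally show ?thesis .
qed

end

section \<open>Linear structure and limits of weak pairs\<close>

lemma test_functionE:
  fixes \<phi> :: "'a::euclidean_space \<Rightarrow> real"
  assumes "\<phi> \<in> test_functions \<Omega>"
  obtains K B where "compact K" "K \<subseteq> \<Omega>" "0 \<le> B" "Ck 1 \<phi>" "\<And>x. x \<notin> K \<Longrightarrow> \<phi> x = 0 \<and> grad \<phi> x = 0"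
    "\<And>x. \<bar>\<phi> x\<bar> \<le> B" "\<And>x. norm (grad \<phi> x) \<le> B"
proof -
  define K where "K = closure {x. \<phi> x \<noteq> 0}"
  have K: "compact K" "K \<subseteq> \<Omega>" and Ck: "Ck 1 \<phi>"
    using assms by (auto simp: test_functions_def K_def)
  have 0: "\<phi> x = 0 \<and> grad \<phi> x = 0" if "x \<notin> K" for x
  proof
    have z: "\<phi> y = 0" if "y \<notin> K" for y using that closure_subset[of "{x. \<phi> x \<noteq> 0}"] by (auto simp: K_def)
    then show "\<phi> x = 0" using that by blast
    have "((\<lambda>_. 0) has_derivative (\<lambda>h. h \<bullet> 0)) (at x)" by simp
    then have "GDERIV \<phi> x :> 0"
      unfolding gderiv_def
      by (rule has_derivative_transform_within_open[where s = "- K"]) (use that z compact_imp_closed[OF K(1)] in auto)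
    then show "grad \<phi> x = 0" by (rule grad_eqI)
  qed
  have "bounded (\<phi> ` K)" "bounded (grad \<phi> ` K)"
    using K Ck by (auto intro!: compact_imp_bounded compact_continuous_image Ck_1_continuous Ck_1_continuous_grad)
  then obtain B1 B2 where B: "\<forall>y\<in>\<phi> ` K. norm y \<le> B1" "\<forall>y\<in>grad \<phi> ` K. norm y \<le> B2"
    unfolding bounded_iff by blast
  define B where "B = max 0 (max B1 B2)"
  have B0: "0 \<le> B" by (simp add: B_def)
  have BB: "\<bar>\<phi> x\<bar> \<le> B" "norm (grad \<phi> x) \<le> B" for x
    using B 0[of x] by (cases "x \<in> K"; force simp: B_def)+
  show ?thesis by (rule that[OF K B0 Ck 0 BB])
qed

lemma integrable_bounded_scaleR:
  fixes f :: "'a::euclidean_space \<Rightarrow> 'b::euclidean_space" and k :: "'a \<Rightarrow> real"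
  assumes K: "set_integrable lborel K f" and [measurable]: "f \<in> borel_measurable borel" "k \<in> borel_measurable borel"
    and B: "\<And>x. \<bar>k x\<bar> \<le> B" and 0: "\<And>x. x \<notin> K \<Longrightarrow> k x = 0"
  shows "integrable lborel (\<lambda>x. k x *\<^sub>R f x)"
proof (rule Bochner_Integration.integrable_bound)
  show "integrable lborel (\<lambda>x. B * norm (indicator K x *\<^sub>R f x))"
    using K by (intro integrable_mult_right integrable_norm) (simp add: set_integrable_def)
  show "AE x in lborel. norm (k x *\<^sub>R f x) \<le> norm (B * norm (indicator K x *\<^sub>R f x))"
  proof (rule AE_I2)
    fix x
    have "0 \<le> B" using B[of x] by linarith
    then show "norm (k x *\<^sub>R f x) \<le> norm (B * norm (indicator K x *\<^sub>R f x))"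
      using B[of x] 0[of x] by (cases "x \<in> K") (auto simp: mult_right_mono)
  qed
qed measurable

lemma grad_borel_measurable[measurable_dest]: "Ck 1 \<phi> \<Longrightarrow> grad \<phi> \<in> borel_measurable borel"
  by (rule borel_measurable_continuous_onI[OF Ck_1_continuous_grad])

lemma Ck_1_borel_measurable[measurable_dest]: "Ck 1 \<phi> \<Longrightarrow> \<phi> \<in> borel_measurable borel"
  by (rule borel_measurable_continuous_onI[OF Ck_1_continuous])

lemma weak_pair_integrable:
  assumes wp: "weak_pair \<Omega> u D" and \<phi>: "\<phi> \<in> test_functions \<Omega>" and i: "i \<in> Basis"
  shows "integrable lborel (\<lambda>x. u x * (grad \<phi> x \<bullet> i))" "integrable lborel (\<lambda>x. (D x \<bullet> i) * \<phi> x)"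
proof -
  obtain K B where K: "compact K" "K \<subseteq> \<Omega>" "0 \<le> B" "Ck 1 \<phi>" "\<And>x. x \<notin> K \<Longrightarrow> \<phi> x = 0 \<and> grad \<phi> x = 0"
    "\<And>x. \<bar>\<phi> x\<bar> \<le> B" "\<And>x. norm (grad \<phi> x) \<le> B"
    by (rule test_functionE[OF \<phi>]) (rule that)
  have [measurable]: "u \<in> borel_measurable borel" "D \<in> borel_measurable borel"
    and int: "set_integrable lborel K u" "set_integrable lborel K D"
    using wp K(1,2) by (auto simp: weak_pair_def)
  note [measurable] = grad_borel_measurable[OF K(4)] Ck_1_borel_measurable[OF K(4)]
  have "integrable lborel (\<lambda>x. (grad \<phi> x \<bullet> i) *\<^sub>R u x)"
    using K(5,7) i by (intro integrable_bounded_scaleR[OF int(1), where B = B])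
      (auto intro: order_trans[OF Basis_le_norm])
  then show "integrable lborel (\<lambda>x. u x * (grad \<phi> x \<bullet> i))" by (simp add: mult.commute)
  have "integrable lborel (\<lambda>x. \<phi> x *\<^sub>R D x)"
    using K(5,6) by (intro integrable_bounded_scaleR[OF int(2), where B = B]) auto
  then have "integrable lborel (\<lambda>x. (\<phi> x *\<^sub>R D x) \<bullet> i)" by (rule integrable_inner_left) 
  then show "integrable lborel (\<lambda>x. (D x \<bullet> i) * \<phi> x)" by (simp add: mult.commute)
qed

lemma weak_pair_linear:
  assumes u: "weak_pair \<Omega> u D" and v: "weak_pair \<Omega> v E"
  shows "weak_pair \<Omega> (\<lambda>x. s * u x + t * v x) (\<lambda>x. s *\<^sub>R D x + t *\<^sub>R E x)"
proof -
  have [measurable]: "u \<in> borel_measurable borel" "D \<in> borel_measurable borel" "v \<in> borel_measurable borel" "E \<in> borel_measurable borel"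
    using u v by (auto simp: weak_pair_def)
  show ?thesis
    unfolding weak_pair_def
  proof (intro conjI allI impI ballI)
    fix K :: "'a set" assume K: "compact K" "K \<subseteq> \<Omega>"
    have "set_integrable lborel K u" "set_integrable lborel K D" "set_integrable lborel K v" "set_integrable lborel K E"
      using u v K by (auto simp: weak_pair_def)
    note i = this[unfolded set_integrable_def]
    have "integrable lborel (\<lambda>x. s *\<^sub>R (indicator K x *\<^sub>R u x) + t *\<^sub>R (indicator K x *\<^sub>R v x))" using i by auto
    then show "set_integrable lborel K (\<lambda>x. s * u x + t * v x)" by (simp add: set_integrable_def algebra_simps)
    have "integrable lborel (\<lambda>x. s *\<^sub>R (indicator K x *\<^sub>R D x) + t *\<^sub>R (indicator K x *\<^sub>R E x))"
      by (intro Bochner_Integration.integrable_add integrable_scaleR_right i)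
    then show "set_integrable lborel K (\<lambda>x. s *\<^sub>R D x + t *\<^sub>R E x)"
      by (simp add: set_integrable_def scaleR_add_right mult.commute)
  next
    fix \<phi> and i :: 'a assume \<phi>: "\<phi> \<in> test_functions \<Omega>" and i: "i \<in> Basis"
    note int = weak_pair_integrable[OF u \<phi> i] weak_pair_integrable[OF v \<phi> i]
    have "(LINT x|lborel. (s * u x + t * v x) * (grad \<phi> x \<bullet> i)) = (LINT x|lborel. s * (u x * (grad \<phi> x \<bullet> i)) + t * (v x * (grad \<phi> x \<bullet> i)))"
      by (simp add: algebra_simps)
    also have "\<dots> = s * (LINT x|lborel. u x * (grad \<phi> x \<bullet> i)) + t * (LINT x|lborel. v x * (grad \<phi> x \<bullet> i))"
      using int by simp
    also have "\<dots> = - (s * (LINT x|lborel. (D x \<bullet> i) * \<phi> x) + t * (LINT x|lborel. (E x \<bullet> i) * \<phi> x))"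
      using u v \<phi> i by (simp add: weak_pair_def)
    also have "s * (LINT x|lborel. (D x \<bullet> i) * \<phi> x) + t * (LINT x|lborel. (E x \<bullet> i) * \<phi> x)
      = (LINT x|lborel. s * ((D x \<bullet> i) * \<phi> x) + t * ((E x \<bullet> i) * \<phi> x))" using int by simp
    also have "\<dots> = (LINT x|lborel. ((s *\<^sub>R D x + t *\<^sub>R E x) \<bullet> i) * \<phi> x)"
      by (simp add: inner_add_left algebra_simps)
    finally show "(LINT x|lborel. (s * u x + t * v x) * (grad \<phi> x \<bullet> i)) = - (LINT x|lborel. ((s *\<^sub>R D x + t *\<^sub>R E x) \<bullet> i) * \<phi> x)" .
  qed (use u v in \<open>auto simp: weak_pair_def\<close>)
qed

text \<open>Convolving the constant 1 with \<open>\<phi>\<close> gives a constant, whose gradient is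
  both 0 and the integral of the gradient of \<open>\<phi>\<close>.\<close>

lemma integral_grad_test_function:
  assumes \<phi>: "\<phi> \<in> test_functions \<Omega>" and i: "i \<in> Basis"
  shows "(LINT x|lborel. grad \<phi> x \<bullet> i) = 0"
proof -
  obtain K B where K: "compact K" "K \<subseteq> \<Omega>" "0 \<le> B" "Ck 1 \<phi>" "\<And>x. x \<notin> K \<Longrightarrow> \<phi> x = 0 \<and> grad \<phi> x = 0"
    "\<And>x. \<bar>\<phi> x\<bar> \<le> B" "\<And>x. norm (grad \<phi> x) \<le> B"
    by (rule test_functionE[OF \<phi>]) (rule that)
  note [measurable] = grad_borel_measurable[OF K(4)] Ck_1_borel_measurable[OF K(4)]
  obtain r where r: "\<And>x. x \<in> K \<Longrightarrow> norm x \<le> r"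
    using compact_imp_bounded[OF K(1)] by (auto simp: bounded_iff)
  have supp: "\<phi> z = 0" "grad \<phi> z = 0" if "r < norm z" for z using r[of z] K(5)[of z] that by auto
  have one: "loc_integrable (\<lambda>_::'a. 1::real)"
    unfolding loc_integrable_def set_integrable_def
    using emeasure_lborel_cball_finite[of "0::'a"] by (auto simp: top.not_eq_extremum)
  have refl: "(LINT y|lborel. h (w - y)) = (LINT y|lborel. h y)"
    if [measurable]: "h \<in> borel_measurable borel" for h :: "'a \<Rightarrow> 'b::euclidean_space" and w
    using lborel_integral_affine[of h "-1" w] by simp
  have "GDERIV (\<lambda>w. LINT y|lborel. 1 * \<phi> (w - y)) 0 :> (LINT y|lborel. 1 *\<^sub>R grad \<phi> (0 - y))"
    by (rule convolution_GDERIV[OF one K(4), where r = r]) (rule supp)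
  then have "GDERIV (\<lambda>w. LINT y|lborel. \<phi> y) (0::'a) :> (LINT y|lborel. grad \<phi> y)"
    using refl[of \<phi>] refl[of "grad \<phi>" 0] by simp
  then have "(LINT y|lborel. grad \<phi> y) = 0"
    using grad_eqI GDERIV_const by metis
  moreover have "integrable lborel (grad \<phi>)"
  proof -
    have "integrable lborel (\<lambda>x. indicator K x *\<^sub>R grad \<phi> x)"
      by (rule borel_integrable_compact[OF K(1) Ck_1_continuous_grad[OF K(4)]])
    moreover have "(\<lambda>x. indicator K x *\<^sub>R grad \<phi> x) = grad \<phi>"
      using K(5) by (auto simp: indicator_def fun_eq_iff)
    ultimately show ?thesis by simp
  qed
  ultimately show ?thesis by (subst integral_inner_left) auto
qed

text \<open>Constants on the slab have weak gradient 0; this is what permits the subtraction of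
  means.\<close>

lemma weak_pair_const:
  fixes \<Omega> :: "'a::euclidean_space set"
  assumes "open \<Omega>"
  shows "weak_pair \<Omega> (\<lambda>x. indicator \<Omega> x) (\<lambda>_. 0)"
  unfolding weak_pair_def
proof (intro conjI allI impI ballI)
  show "indicator \<Omega> \<in> borel_measurable borel" using assms by simp
  fix K :: "'a set" assume K: "compact K" "K \<subseteq> \<Omega>"
  have "integrable lborel (indicator K :: 'a \<Rightarrow> real)"
    using emeasure_compact_finite[OF K(1)] borel_compact[OF K(1)] by (simp add: top.not_eq_extremum)
  moreover have "(\<lambda>x. indicator K x *\<^sub>R indicator \<Omega> x) = (indicator K :: 'a \<Rightarrow> real)"
    using K(2) by (auto simp: indicator_def fun_eq_iff)
  ultimately show "set_integrable lborel K (indicator \<Omega> :: 'a \<Rightarrow> real)" by (simp add: set_integrable_def)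
  show "set_integrable lborel K (\<lambda>_. 0 :: 'a)" by (simp add: set_integrable_def)
next
  fix \<phi> and i :: 'a assume \<phi>: "\<phi> \<in> test_functions \<Omega>" and i: "i \<in> Basis"
  obtain K B where K: "compact K" "K \<subseteq> \<Omega>" "0 \<le> B" "Ck 1 \<phi>" "\<And>x. x \<notin> K \<Longrightarrow> \<phi> x = 0 \<and> grad \<phi> x = 0"
    "\<And>x. \<bar>\<phi> x\<bar> \<le> B" "\<And>x. norm (grad \<phi> x) \<le> B"
    by (rule test_functionE[OF \<phi>]) (rule that)
  have "(LINT x|lborel. indicator \<Omega> x * (grad \<phi> x \<bullet> i)) = (LINT x|lborel. grad \<phi> x \<bullet> i)"
  proof (intro Bochner_Integration.integral_cong refl)
    fix x
    have "grad \<phi> x = 0" if "x \<notin> \<Omega>" using K(2,5) that by blast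
    then show "indicator \<Omega> x * (grad \<phi> x \<bullet> i) = grad \<phi> x \<bullet> i" by (auto simp: indicator_def)
  qed
  then show "(LINT x|lborel. indicator \<Omega> x * (grad \<phi> x \<bullet> i)) = - (LINT x|lborel. (0 \<bullet> i) * \<phi> x)"
    using integral_grad_test_function[OF \<phi> i] by simp
qed auto

lemma integral_tendsto_of_L1_compact:
  fixes f :: "nat \<Rightarrow> 'a::euclidean_space \<Rightarrow> 'b::euclidean_space" and k :: "'a \<Rightarrow> real"
  assumes [measurable]: "\<And>n. f n \<in> borel_measurable borel" "g \<in> borel_measurable borel" "k \<in> borel_measurable borel" "K \<in> sets borel"
    and f: "\<And>n. set_integrable lborel K (f n)"
    and lim: "(\<lambda>n. \<integral>\<^sup>+x\<in>K. ennreal (norm (f n x - g x)) \<partial>lborel) \<longlonglongrightarrow> 0"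
    and B: "\<And>x. \<bar>k x\<bar> \<le> B" and 0: "\<And>x. x \<notin> K \<Longrightarrow> k x = 0"
  shows "set_integrable lborel K g" "(\<lambda>n. LINT x|lborel. k x *\<^sub>R f n x) \<longlonglongrightarrow> (LINT x|lborel. k x *\<^sub>R g x)"
proof -
  have nn: "(\<integral>\<^sup>+x. ennreal (norm (indicator K x *\<^sub>R f n x - indicator K x *\<^sub>R g x)) \<partial>lborel)
    = (\<integral>\<^sup>+x\<in>K. ennreal (norm (f n x - g x)) \<partial>lborel)" for n
    by (intro nn_integral_cong) (auto simp: indicator_def)
  show g: "set_integrable lborel K g"
  proof -
    have "\<forall>\<^sub>F n in sequentially. (\<integral>\<^sup>+x\<in>K. ennreal (norm (f n x - g x)) \<partial>lborel) < 1"
      using lim by (rule order_tendstoD) simp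
    then obtain n where n: "(\<integral>\<^sup>+x\<in>K. ennreal (norm (f n x - g x)) \<partial>lborel) < 1"
      unfolding eventually_sequentially by blast
    have "integrable lborel (\<lambda>x. indicator K x *\<^sub>R f n x - indicator K x *\<^sub>R g x)"
      unfolding integrable_iff_bounded nn using n by (auto intro: less_trans)
    from Bochner_Integration.integrable_diff[OF f[of n, unfolded set_integrable_def] this]
    show ?thesis by (simp add: set_integrable_def)
  qed
  have B0: "0 \<le> B" using B[of 0] by linarith
  have if': "integrable lborel (\<lambda>x. k x *\<^sub>R f n x)" for n using B 0 by (intro integrable_bounded_scaleR[OF f, where B = B]) auto
  have ig: "integrable lborel (\<lambda>x. k x *\<^sub>R g x)" using B 0 by (intro integrable_bounded_scaleR[OF g, where B = B]) auto
  show "(\<lambda>n. LINT x|lborel. k x *\<^sub>R f n x) \<longlonglongrightarrow> (LINT x|lborel. k x *\<^sub>R g x)"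
  proof (rule tendsto_L1_int[OF if' ig])
    have "(\<lambda>n. ennreal B * (\<integral>\<^sup>+x\<in>K. ennreal (norm (f n x - g x)) \<partial>lborel)) \<longlonglongrightarrow> ennreal B * 0"
      by (intro ennreal_tendsto_cmult lim) simp
    then have lim': "(\<lambda>n. ennreal B * (\<integral>\<^sup>+x\<in>K. ennreal (norm (f n x - g x)) \<partial>lborel)) \<longlonglongrightarrow> 0" by simp
    have "(\<integral>\<^sup>+x. ennreal (norm (k x *\<^sub>R f n x - k x *\<^sub>R g x)) \<partial>lborel) \<le> ennreal B * (\<integral>\<^sup>+x\<in>K. ennreal (norm (f n x - g x)) \<partial>lborel)" for n
    proof -
      have "(\<integral>\<^sup>+x. ennreal (norm (k x *\<^sub>R f n x - k x *\<^sub>R g x)) \<partial>lborel) \<le> (\<integral>\<^sup>+x. ennreal B * (ennreal (norm (f n x - g x)) * indicator K x) \<partial>lborel)"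
      proof (rule nn_integral_mono)
        fix x
        have "norm (k x *\<^sub>R f n x - k x *\<^sub>R g x) \<le> B * norm (f n x - g x)"
          using B[of x] by (simp add: scaleR_diff_right[symmetric] mult_right_mono del: scaleR_diff_right)
        then show "ennreal (norm (k x *\<^sub>R f n x - k x *\<^sub>R g x)) \<le> ennreal B * (ennreal (norm (f n x - g x)) * indicator K x)"
          using 0[of x] B0 by (cases "x \<in> K") (auto simp: ennreal_mult[symmetric] intro!: ennreal_leI)
      qed
      also have "\<dots> = ennreal B * (\<integral>\<^sup>+x\<in>K. ennreal (norm (f n x - g x)) \<partial>lborel)"
        by (rule nn_integral_cmult) measurable
      finally show ?thesis .
    qed
    then show "(\<lambda>n. \<integral>\<^sup>+x. ennreal (norm (k x *\<^sub>R f n x - k x *\<^sub>R g x)) \<partial>lborel) \<longlonglongrightarrow> 0"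
      by (intro tendsto_sandwich[OF _ _ tendsto_const lim']) simp_all
  qed
qed

text \<open>Test functions and their gradients are bounded with compact support, so
  \<open>L^1\<close> convergence on compact subsets suffices to pass to the limit in the defining
  identity.\<close>

lemma weak_pair_limit:
  fixes u :: "'a::euclidean_space \<Rightarrow> real"
  assumes wp: "\<And>n. weak_pair \<Omega> (f n) (D n)"
    and [measurable]: "u \<in> borel_measurable borel" "E \<in> borel_measurable borel" and 0: "\<And>x. x \<notin> \<Omega> \<Longrightarrow> u x = 0 \<and> E x = 0"
    and limu: "\<And>K. compact K \<Longrightarrow> K \<subseteq> \<Omega> \<Longrightarrow> (\<lambda>n. \<integral>\<^sup>+x\<in>K. ennreal (norm (f n x - u x)) \<partial>lborel) \<longlonglongrightarrow> 0"
    and limE: "\<And>K. compact K \<Longrightarrow> K \<subseteq> \<Omega> \<Longrightarrow> (\<lambda>n. \<integral>\<^sup>+x\<in>K. ennreal (norm (D n x - E x)) \<partial>lborel) \<longlonglongrightarrow> 0"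
  shows "weak_pair \<Omega> u E"
proof -
  have [measurable]: "f n \<in> borel_measurable borel" "D n \<in> borel_measurable borel" for n
    using wp by (auto simp: weak_pair_def)
  have iK: "set_integrable lborel K (f n)" "set_integrable lborel K (D n)" if "compact K" "K \<subseteq> \<Omega>" for K n
    using wp[of n] that by (auto simp: weak_pair_def)
  show ?thesis
    unfolding weak_pair_def
  proof (intro conjI allI impI ballI)
    fix K :: "'a set" assume K: "compact K" "K \<subseteq> \<Omega>"
    have [measurable]: "K \<in> sets borel" by (rule borel_compact[OF K(1)])
    show "set_integrable lborel K u"
      by (rule integral_tendsto_of_L1_compact(1)[where f = f and k = "\<lambda>_. 0" and B = 0]) (use iK[OF K] limu[OF K] in auto)
    show "set_integrable lborel K E"
      by (rule integral_tendsto_of_L1_compact(1)[where f = D and k = "\<lambda>_. 0" and B = 0]) (use iK[OF K] limE[OF K] in auto)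
  next
    fix \<phi> and i :: 'a assume \<phi>: "\<phi> \<in> test_functions \<Omega>" and i: "i \<in> Basis"
    obtain K B where K: "compact K" "K \<subseteq> \<Omega>" "0 \<le> B" "Ck 1 \<phi>" "\<And>x. x \<notin> K \<Longrightarrow> \<phi> x = 0 \<and> grad \<phi> x = 0"
      "\<And>x. \<bar>\<phi> x\<bar> \<le> B" "\<And>x. norm (grad \<phi> x) \<le> B"
      by (rule test_functionE[OF \<phi>]) (rule that)
    have [measurable]: "K \<in> sets borel" by (rule borel_compact[OF K(1)])
    note [measurable] = grad_borel_measurable[OF K(4)] Ck_1_borel_measurable[OF K(4)]
    have 1: "(\<lambda>n. LINT x|lborel. (grad \<phi> x \<bullet> i) *\<^sub>R f n x) \<longlonglongrightarrow> (LINT x|lborel. (grad \<phi> x \<bullet> i) *\<^sub>R u x)"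
      by (rule integral_tendsto_of_L1_compact(2)[OF _ _ _ _ iK(1)[OF K(1,2)] limu[OF K(1,2)], where B = B])
        (use K(5,7) i in \<open>auto intro: order_trans[OF Basis_le_norm]\<close>)
    have 2: "(\<lambda>n. LINT x|lborel. \<phi> x *\<^sub>R D n x) \<longlonglongrightarrow> (LINT x|lborel. \<phi> x *\<^sub>R E x)"
      by (rule integral_tendsto_of_L1_compact(2)[OF _ _ _ _ iK(2)[OF K(1,2)] limE[OF K(1,2)], where B = B])
        (use K(5,6) in auto)
    have iE: "set_integrable lborel K E"
      by (rule integral_tendsto_of_L1_compact(1)[where f = D and k = "\<lambda>_. 0" and B = 0]) (use iK[OF K(1,2)] limE[OF K(1,2)] in auto)
    have i\<phi>: "integrable lborel (\<lambda>x. \<phi> x *\<^sub>R D n x)" "integrable lborel (\<lambda>x. \<phi> x *\<^sub>R E x)" for n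
      using K(5,6) iK(2)[OF K(1,2)] iE by (auto intro!: integrable_bounded_scaleR[where B = B and K = K])
    have "(LINT x|lborel. (grad \<phi> x \<bullet> i) *\<^sub>R f n x) = - ((LINT x|lborel. \<phi> x *\<^sub>R D n x) \<bullet> i)" for n
    proof -
      have "(LINT x|lborel. (grad \<phi> x \<bullet> i) *\<^sub>R f n x) = - (LINT x|lborel. (D n x \<bullet> i) * \<phi> x)"
        using wp[of n] \<phi> i by (simp add: weak_pair_def mult.commute)
      also have "(LINT x|lborel. (D n x \<bullet> i) * \<phi> x) = (LINT x|lborel. \<phi> x *\<^sub>R D n x) \<bullet> i"
        using i\<phi>(1)[of n] by (subst integral_inner_left[symmetric]) (auto simp: mult.commute)
      finally show ?thesis .
    qed
    then have "(\<lambda>n. LINT x|lborel. (grad \<phi> x \<bullet> i) *\<^sub>R f n x) \<longlonglongrightarrow> - ((LINT x|lborel. \<phi> x *\<^sub>R E x) \<bullet> i)"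
      using tendsto_minus[OF tendsto_inner[OF 2 tendsto_const[of i]]] by simp
    from LIMSEQ_unique[OF 1 this]
    have "(LINT x|lborel. (grad \<phi> x \<bullet> i) *\<^sub>R u x) = - (LINT x|lborel. (\<phi> x *\<^sub>R E x) \<bullet> i)"
      using i\<phi>(2) by (subst integral_inner_left) auto
    then show "(LINT x|lborel. u x * (grad \<phi> x \<bullet> i)) = - (LINT x|lborel. (E x \<bullet> i) * \<phi> x)"
      by (simp add: mult.commute)
  qed (use 0 in auto)
qed

text \<open>The integrated form of \<open>le_add_powr\<close>; \<open>\<eta>\<close> stays free so
  that it can be chosen before the p-th powers are made small.\<close>

lemma L1_le_Lp:
  fixes f :: "'x \<Rightarrow> 'b::euclidean_space"
  assumes [measurable]: "f \<in> borel_measurable M" "S \<in> sets M" and \<eta>: "0 < \<eta>" and p: "1 \<le> p"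
  shows "(\<integral>\<^sup>+x\<in>S. ennreal (norm (f x)) \<partial>M) \<le> ennreal \<eta> * emeasure M S + ennreal (\<eta> powr (1 - p)) * (\<integral>\<^sup>+x\<in>S. ennreal (norm (f x) powr p) \<partial>M)"
proof -
  have "(\<integral>\<^sup>+x\<in>S. ennreal (norm (f x)) \<partial>M) \<le> (\<integral>\<^sup>+x. ennreal \<eta> * indicator S x + ennreal (\<eta> powr (1 - p)) * (ennreal (norm (f x) powr p) * indicator S x) \<partial>M)"
  proof (rule nn_integral_mono)
    fix x
    show "ennreal (norm (f x)) * indicator S x \<le> ennreal \<eta> * indicator S x + ennreal (\<eta> powr (1 - p)) * (ennreal (norm (f x) powr p) * indicator S x)"
      using le_add_powr[of "norm (f x)" \<eta> p] \<eta> p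
      by (cases "x \<in> S") (auto simp: ennreal_mult[symmetric] ennreal_plus[symmetric] ennreal_leI simp del: ennreal_plus)
  qed
  also have "\<dots> = ennreal \<eta> * emeasure M S + ennreal (\<eta> powr (1 - p)) * (\<integral>\<^sup>+x\<in>S. ennreal (norm (f x) powr p) \<partial>M)"
    by (subst nn_integral_add; simp add: nn_integral_cmult)
  finally show ?thesis .
qed

section \<open>Closedness of the space of gradients\<close>

context slab_data
begin

lemma piece_mono: "R \<le> R' \<Longrightarrow> piece R \<subseteq> piece R'"
  by (auto simp: piece_def)

lemma compact_subset_piece:
  assumes "compact K" "K \<subseteq> \<Omega>"
  obtains R where "K \<subseteq> piece R" "R0 \<le> R"
proof -
  obtain r where r: "\<And>x. x \<in> K \<Longrightarrow> norm x \<le> r"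
    using compact_imp_bounded[OF assms(1)] by (auto simp: bounded_iff)
  show ?thesis
    by (rule that[of "max R0 (r + 1)"]) (use assms(2) r in \<open>fastforce simp: piece_def\<close>)+
qed

text \<open>With p-integrability on pieces established, the approximants converge in
  \<open>L^p\<close> on each piece, and their gradients on the whole slab.\<close>

lemma smooth_approximation:
  assumes wp: "weak_pair \<Omega> u D" and fin: "(\<integral>\<^sup>+x. ennreal (norm (D x) powr p) \<partial>lborel) < \<infinity>"
  obtains U where "\<And>j::nat. Ck 1 (U j)"
    "\<And>R. 0 < R \<Longrightarrow> (\<lambda>j. \<integral>\<^sup>+x\<in>piece R. ennreal (\<bar>U j x - u x\<bar> powr p) \<partial>lborel) \<longlonglongrightarrow> 0"
    "(\<lambda>j. \<integral>\<^sup>+x\<in>\<Omega>. ennreal (norm (grad (U j) x - D x) powr p) \<partial>lborel) \<longlonglongrightarrow> 0"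
proof -
  note [measurable] = weak_pairD(1,2)[OF wp]
  obtain U where U: "\<And>j. Ck 1 (U j)"
    and UD: "\<And>j x. b1 \<le> x \<bullet> e \<Longrightarrow> x \<bullet> e \<le> b2 \<Longrightarrow> U j x = mol j u x \<and> grad (U j) x = (1 - \<delta> j) *\<^sub>R mol j D x"
    by (rule smooth_approximants[OF wp]) (rule that)
  have U1: "U j x = mol j u x" and U2: "grad (U j) x = (1 - \<delta> j) *\<^sub>R mol j D x" if "x \<in> \<Omega>" for j x
    using UD[of x j] that by (auto simp: slab_def)
  have "(\<lambda>j. \<integral>\<^sup>+x\<in>\<Omega>. ennreal (norm (grad (U j) x - D x) powr p) \<partial>lborel) \<longlonglongrightarrow> 0"
    by (rule approximants_gradient_lim[OF _ fin U2]) auto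
  moreover have "(\<lambda>j. \<integral>\<^sup>+x\<in>piece R. ennreal (\<bar>U j x - u x\<bar> powr p) \<partial>lborel) \<longlonglongrightarrow> 0" if "0 < R" for R
    by (rule approximants_function_lim[OF _ weak_pair_Lp_piece[OF wp fin] U1 that]) auto
  ultimately show ?thesis using that[of U] U by blast
qed

text \<open>The ball of this radius contains the point \<open>((b1 + b2) / 2) *\<^sub>R e\<close> of
  the slab, so the piece is a nonempty open set and has positive measure.\<close>

definition base_radius :: real where "base_radius = \<bar>(b1 + b2) / 2\<bar> + 1"

lemma base_piece: "0 < emeasure lborel (piece base_radius)" "0 < measure lborel (piece base_radius)"
  "emeasure lborel (piece base_radius) = ennreal (measure lborel (piece base_radius))"
proof -
  have "open (piece base_radius)" unfolding piece_def using open_slab by auto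
  moreover have "((b1 + b2) / 2) *\<^sub>R e \<in> piece base_radius"
    using b by (auto simp: piece_def slab_def base_radius_def)
  ultimately have "\<not> negligible (piece base_radius)" using open_not_negligible by blast
  then have "piece base_radius \<notin> null_sets lborel" by (auto simp: negligible_iff_null_sets null_sets_completionI)
  then show pos: "0 < emeasure lborel (piece base_radius)" by (auto simp: null_sets_def zero_less_iff_neq_zero)
  show eq: "emeasure lborel (piece base_radius) = ennreal (measure lborel (piece base_radius))"
    using emeasure_piece by (intro emeasure_eq_ennreal_measure) (auto simp: less_top)
  show "0 < measure lborel (piece base_radius)" using pos unfolding eq by simp
qed

lemma weak_pair_piece_integrable:
  assumes wp: "weak_pair \<Omega> u D" and fin: "(\<integral>\<^sup>+x. ennreal (norm (D x) powr p) \<partial>lborel) < \<infinity>"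
  shows "integrable lborel (\<lambda>x. indicator (piece R) x *\<^sub>R u x)"
proof -
  note [measurable] = weak_pairD(1,2)[OF wp]
  have "(\<integral>\<^sup>+x\<in>piece R. ennreal (norm (u x)) \<partial>lborel)
    \<le> ennreal 1 * emeasure lborel (piece R) + ennreal (1 powr (1 - p)) * (\<integral>\<^sup>+x\<in>piece R. ennreal (norm (u x) powr p) \<partial>lborel)"
    by (rule L1_le_Lp) (use p in auto)
  also have "\<dots> < \<infinity>" using emeasure_piece[of R] weak_pair_Lp_piece[OF wp fin, of R] by simp
  also have "(\<integral>\<^sup>+x\<in>piece R. ennreal (norm (u x)) \<partial>lborel) = (\<integral>\<^sup>+x. ennreal (norm (indicator (piece R) x *\<^sub>R u x)) \<partial>lborel)"
    by (intro nn_integral_cong) (auto simp: indicator_def)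
  finally show ?thesis by (simp add: integrable_iff_bounded)
qed

definition mean :: "('a \<Rightarrow> real) \<Rightarrow> real" where
  "mean u = (LINT x|lborel. indicator (piece base_radius) x *\<^sub>R u x) / measure lborel (piece base_radius)"

text \<open>The distance of \<open>u x\<close> from the mean, times the measure of the base piece,
  is at most the integral of the distances \<open>\<bar>u y - u x\<bar>\<close> over
  \<open>y\<close> in that piece. The double integral is then handled by \<open>L1_le_Lp\<close> and
  \<open>weak_Poincare\<close>.\<close>

lemma Poincare_mean:
  assumes wp: "weak_pair \<Omega> u D" and fin: "(\<integral>\<^sup>+x. ennreal (norm (D x) powr p) \<partial>lborel) < \<infinity>"
    and R: "base_radius \<le> R" and \<eta>: "0 < \<eta>"
  shows "ennreal (measure lborel (piece base_radius)) * (\<integral>\<^sup>+x\<in>piece R. ennreal \<bar>u x - mean u\<bar> \<partial>lborel)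
    \<le> ennreal \<eta> * (emeasure lborel (piece R) * emeasure lborel (piece R))
      + ennreal (\<eta> powr (1 - p)) * (Poincare_const R * (\<integral>\<^sup>+x. ennreal (norm (D x) powr p) \<partial>lborel))"
proof -
  note [measurable] = weak_pairD(1,2)[OF wp]
  let ?P = "piece base_radius" and ?\<mu> = "measure lborel (piece base_radius)"
  have int: "integrable lborel (\<lambda>x. indicator ?P x *\<^sub>R u x)" by (rule weak_pair_piece_integrable[OF wp fin])
  have int1: "integrable lborel (indicator ?P :: 'a \<Rightarrow> real)" using emeasure_piece by simp
  have pt: "ennreal ?\<mu> * ennreal \<bar>u x - mean u\<bar> \<le> (\<integral>\<^sup>+y\<in>?P. ennreal \<bar>u y - u x\<bar> \<partial>lborel)" for x
  proof -
    have i: "integrable lborel (\<lambda>y. indicator ?P y *\<^sub>R u y - u x * indicator ?P y)"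
      using int int1 by auto
    have "?\<mu> * (mean u - u x) = (LINT y|lborel. indicator ?P y *\<^sub>R u y) - u x * ?\<mu>"
      using base_piece(2) by (simp add: mean_def field_simps)
    also have "\<dots> = (LINT y|lborel. indicator ?P y *\<^sub>R u y - u x * indicator ?P y)"
      using int int1 by simp
    finally have "?\<mu> * \<bar>u x - mean u\<bar> = norm (LINT y|lborel. indicator ?P y *\<^sub>R u y - u x * indicator ?P y)"
      using base_piece(2) by (metis abs_minus_commute abs_mult abs_of_pos real_norm_def)
    then have "ennreal (?\<mu> * \<bar>u x - mean u\<bar>) \<le> (\<integral>\<^sup>+y. ennreal (norm (indicator ?P y *\<^sub>R u y - u x * indicator ?P y)) \<partial>lborel)"
      using integral_norm_bound_ennreal[OF i] by simp
    also have "\<dots> = (\<integral>\<^sup>+y\<in>?P. ennreal \<bar>u y - u x\<bar> \<partial>lborel)"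
      by (intro nn_integral_cong) (auto simp: indicator_def)
    finally show ?thesis using base_piece(2) by (simp add: ennreal_mult)
  qed
  have "ennreal ?\<mu> * (\<integral>\<^sup>+x\<in>piece R. ennreal \<bar>u x - mean u\<bar> \<partial>lborel) = (\<integral>\<^sup>+x. ennreal ?\<mu> * (ennreal \<bar>u x - mean u\<bar> * indicator (piece R) x) \<partial>lborel)"
    by (rule nn_integral_cmult[symmetric]) measurable
  also have "\<dots> \<le> (\<integral>\<^sup>+x. ((\<integral>\<^sup>+y\<in>piece R. ennreal (norm (u y - u x)) \<partial>lborel)) * indicator (piece R) x \<partial>lborel)"
  proof (rule nn_integral_mono)
    fix x
    have "(\<integral>\<^sup>+y\<in>?P. ennreal \<bar>u y - u x\<bar> \<partial>lborel) \<le> (\<integral>\<^sup>+y\<in>piece R. ennreal (norm (u y - u x)) \<partial>lborel)"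
      using piece_mono[OF R] by (intro nn_integral_mono) (auto simp: indicator_def)
    then show "ennreal ?\<mu> * (ennreal \<bar>u x - mean u\<bar> * indicator (piece R) x) \<le> (\<integral>\<^sup>+y\<in>piece R. ennreal (norm (u y - u x)) \<partial>lborel) * indicator (piece R) x"
      using order_trans[OF pt[of x]] by (simp add: indicator_def)
  qed
  also have "\<dots> \<le> (\<integral>\<^sup>+x. (ennreal \<eta> * emeasure lborel (piece R)) * indicator (piece R) x
      + ennreal (\<eta> powr (1 - p)) * ((\<integral>\<^sup>+y\<in>piece R. ennreal (\<bar>u y - u x\<bar> powr p) \<partial>lborel) * indicator (piece R) x) \<partial>lborel)"
  proof (rule nn_integral_mono)
    fix x
    show "(\<integral>\<^sup>+y\<in>piece R. ennreal (norm (u y - u x)) \<partial>lborel) * indicator (piece R) x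
      \<le> (ennreal \<eta> * emeasure lborel (piece R)) * indicator (piece R) x
      + ennreal (\<eta> powr (1 - p)) * ((\<integral>\<^sup>+y\<in>piece R. ennreal (\<bar>u y - u x\<bar> powr p) \<partial>lborel) * indicator (piece R) x)"
      using L1_le_Lp[of "\<lambda>y. u y - u x" lborel "piece R" \<eta> p] \<eta> p by (cases "x \<in> piece R") auto
  qed
  also have "\<dots> = (ennreal \<eta> * emeasure lborel (piece R)) * emeasure lborel (piece R)
      + ennreal (\<eta> powr (1 - p)) * (\<integral>\<^sup>+x\<in>piece R. (\<integral>\<^sup>+y\<in>piece R. ennreal (\<bar>u y - u x\<bar> powr p) \<partial>lborel) \<partial>lborel)"
    by (subst nn_integral_add; (subst nn_integral_cmult)?; simp add: nn_integral_cmult_indicator)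
  also have "\<dots> \<le> ennreal \<eta> * (emeasure lborel (piece R) * emeasure lborel (piece R))
      + ennreal (\<eta> powr (1 - p)) * (Poincare_const R * (\<integral>\<^sup>+x. ennreal (norm (D x) powr p) \<partial>lborel))"
    by (intro add_mono mult_left_mono weak_Poincare[OF wp fin]) (simp_all add: mult.assoc)
  finally show ?thesis .
qed

text \<open>The quantifier order needed for Cauchy sequences: \<open>\<kappa>\<close> depends on
  \<open>R\<close> and \<open>\<epsilon>\<close> but not on the function.\<close>

lemma Poincare_mean_small:
  assumes R: "base_radius \<le> R" and \<epsilon>: "0 < \<epsilon>"
  obtains \<kappa> :: real where "0 < \<kappa>" "\<And>u D. weak_pair \<Omega> u D \<Longrightarrow> (\<integral>\<^sup>+x. ennreal (norm (D x) powr p) \<partial>lborel) < ennreal \<kappa> \<Longrightarrow>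
    (\<integral>\<^sup>+x\<in>piece R. ennreal \<bar>u x - mean u\<bar> \<partial>lborel) \<le> ennreal \<epsilon>"
proof -
  define \<mu> where "\<mu> = measure lborel (piece base_radius)"
  have \<mu>: "0 < \<mu>" using base_piece(2) by (simp add: \<mu>_def)
  obtain s where s: "emeasure lborel (piece R) * emeasure lborel (piece R) = ennreal s" "0 \<le> s"
    using emeasure_piece[of R] by (cases "emeasure lborel (piece R) * emeasure lborel (piece R)") (auto simp: ennreal_mult_eq_top_iff)
  obtain c where c: "Poincare_const R = ennreal c" "0 \<le> c"
    using Poincare_const_finite[of R] by (cases "Poincare_const R") auto
  \<comment> \<open>\<open>\<eta>\<close> makes the measure term at most half of the target
    \<open>\<mu> * \<epsilon>\<close>; this fixes the factor \<open>k\<close> of the gradient term,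
    and \<open>\<kappa>\<close> then makes that term at most the other half.\<close>
  define \<eta> where "\<eta> = \<mu> * \<epsilon> / (2 * (s + 1))"
  have \<eta>: "0 < \<eta>" using \<mu> \<epsilon> s by (simp add: \<eta>_def)
  have \<eta>s: "\<eta> * s \<le> \<mu> * \<epsilon> / 2"
  proof -
    have "\<eta> * s = \<mu> * \<epsilon> / 2 * (s / (s + 1))" using s by (simp add: \<eta>_def)
    also have "\<dots> \<le> \<mu> * \<epsilon> / 2 * 1" using \<mu> \<epsilon> s by (intro mult_left_mono) auto
    finally show ?thesis by simp
  qed
  define k where "k = \<eta> powr (1 - p) * c"
  have k: "0 \<le> k" using c by (simp add: k_def)
  define \<kappa> where "\<kappa> = \<mu> * \<epsilon> / (2 * (k + 1))"
  have \<kappa>: "0 < \<kappa>" using \<mu> \<epsilon> k by (simp add: \<kappa>_def)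
  have k\<kappa>: "k * \<kappa> \<le> \<mu> * \<epsilon> / 2"
  proof -
    have "k * \<kappa> = \<mu> * \<epsilon> / 2 * (k / (k + 1))" using k by (simp add: \<kappa>_def)
    also have "\<dots> \<le> \<mu> * \<epsilon> / 2 * 1" using \<mu> \<epsilon> k by (intro mult_left_mono) auto
    finally show ?thesis by simp
  qed
  show ?thesis
  proof (rule that[OF \<kappa>])
    fix u D assume wp: "weak_pair \<Omega> u D" and fin: "(\<integral>\<^sup>+x. ennreal (norm (D x) powr p) \<partial>lborel) < ennreal \<kappa>"
    have fin': "(\<integral>\<^sup>+x. ennreal (norm (D x) powr p) \<partial>lborel) < \<infinity>" using fin by (rule less_trans) simp
    have "ennreal \<mu> * (\<integral>\<^sup>+x\<in>piece R. ennreal \<bar>u x - mean u\<bar> \<partial>lborel)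
      \<le> ennreal \<eta> * ennreal s + ennreal (\<eta> powr (1 - p)) * (ennreal c * (\<integral>\<^sup>+x. ennreal (norm (D x) powr p) \<partial>lborel))"
      using Poincare_mean[OF wp fin' R \<eta>] by (simp add: s c \<mu>_def)
    also have "\<dots> \<le> ennreal \<eta> * ennreal s + ennreal (\<eta> powr (1 - p)) * (ennreal c * ennreal \<kappa>)"
      using fin by (intro add_mono mult_left_mono) (auto intro: less_imp_le)
    also have "\<dots> = ennreal (\<eta> * s + k * \<kappa>)"
      using \<eta> s c \<kappa> k by (simp add: k_def ennreal_mult[symmetric] ennreal_plus[symmetric] mult.assoc del: ennreal_plus)
    also have "\<dots> \<le> ennreal (\<mu> * \<epsilon>)" using \<eta>s k\<kappa> by (intro ennreal_leI) simp
    also have "\<dots> = ennreal \<mu> * ennreal \<epsilon>" using \<mu> \<epsilon> by (simp add: ennreal_mult)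
    finally have "ennreal \<mu> * (\<integral>\<^sup>+x\<in>piece R. ennreal \<bar>u x - mean u\<bar> \<partial>lborel) \<le> ennreal \<mu> * ennreal \<epsilon>" .
    then show "(\<integral>\<^sup>+x\<in>piece R. ennreal \<bar>u x - mean u\<bar> \<partial>lborel) \<le> ennreal \<epsilon>"
      using \<mu> by (subst (asm) ennreal_mult_le_mult_iff) auto
  qed
qed

text \<open>After subtraction of their means the functions form a Cauchy sequence in
  \<open>L^1\<close> on each piece, because their gradients do so in \<open>L^p\<close>. The limit
  function has the limit gradient by \<open>weak_pair_limit\<close>.\<close>

lemma weak_gradient_complete:
  assumes wp: "\<And>n::nat. weak_pair \<Omega> (v n) (D n)" and fin: "\<And>n. (\<integral>\<^sup>+x. ennreal (norm (D n x) powr p) \<partial>lborel) < \<infinity>"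
    and E[measurable]: "E \<in> borel_measurable borel" and E0: "\<And>x. x \<notin> \<Omega> \<Longrightarrow> E x = 0"
    and lim: "(\<lambda>n. \<integral>\<^sup>+x. ennreal (norm (D n x - E x) powr p) \<partial>lborel) \<longlonglongrightarrow> 0"
  shows "\<exists>u. weak_pair \<Omega> u E"
proof -
  note [measurable] = weak_pairD(1,2)[OF wp]
  define f where "f n x = 1 * v n x + (- mean (v n)) * indicator \<Omega> x" for n x
  have f: "weak_pair \<Omega> (f n) (D n)" for n
    using weak_pair_linear[OF wp[of n] weak_pair_const[OF open_slab], of 1 "- mean (v n)"] by (simp add: f_def[abs_def])
  note [measurable] = weak_pairD(1)[OF f]
  have diff: "weak_pair \<Omega> (\<lambda>x. 1 * v i x + (-1) * v j x) (\<lambda>x. 1 *\<^sub>R D i x + (-1) *\<^sub>R D j x)" for i j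
    by (rule weak_pair_linear[OF wp wp])
  have mdiff: "mean (\<lambda>x. 1 * v i x + (-1) * v j x) = mean (v i) - mean (v j)" for i j
    using weak_pair_piece_integrable[OF wp fin, of base_radius i] weak_pair_piece_integrable[OF wp fin, of base_radius j]
    by (simp add: mean_def right_diff_distrib diff_divide_distrib)
  \<comment> \<open>The complement of the slab is added so that the sets exhaust the whole space, as
    \<open>Lp_complete_local\<close> demands; all \<open>f n\<close> vanish there.\<close>
  define B where "B n = piece (base_radius + real n) \<union> - \<Omega>" for n
  have Bb[measurable]: "B n \<in> sets borel" for n unfolding B_def by measurable
  have "\<exists>g\<in>borel_measurable lborel. (\<exists>r::nat \<Rightarrow> nat. strict_mono r \<and> (AE x in lborel. (\<lambda>k. f (r k) x) \<longlonglongrightarrow> g x)) \<and>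
     (\<forall>n. (\<lambda>i. \<integral>\<^sup>+x\<in>B n. ennreal (norm (f i x - g x) powr 1) \<partial>lborel) \<longlonglongrightarrow> 0)"
  proof (rule Lp_complete_local)
    show "incseq B"
    proof (rule incseq_SucI)
      fix n
      have "piece (base_radius + real n) \<subseteq> piece (base_radius + real (Suc n))" by (rule piece_mono) simp
      then show "B n \<subseteq> B (Suc n)" unfolding B_def by blast
    qed
    show "(\<Union>n. B n) = space lborel"
    proof -
      have "\<exists>n. x \<in> B n" for x
      proof -
        obtain n :: nat where "norm x < real n" using reals_Archimedean2 by blast
        moreover have "0 \<le> base_radius" by (simp add: base_radius_def)
        ultimately show ?thesis by (intro exI[of _ n]) (auto simp: B_def piece_def)
      qed
      then show ?thesis by auto
    qed
    fix n and \<epsilon> :: real assume "0 < \<epsilon>"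
    obtain \<kappa> where \<kappa>: "0 < \<kappa>" and small: "\<And>u D. weak_pair \<Omega> u D \<Longrightarrow> (\<integral>\<^sup>+x. ennreal (norm (D x) powr p) \<partial>lborel) < ennreal \<kappa> \<Longrightarrow>
        (\<integral>\<^sup>+x\<in>piece (base_radius + real n). ennreal \<bar>u x - mean u\<bar> \<partial>lborel) \<le> ennreal \<epsilon>"
      by (rule Poincare_mean_small[OF _ \<open>0 < \<epsilon>\<close>, of "base_radius + real n"]) (simp, rule that)
    obtain d where d: "0 < d" "\<And>u v::ennreal. u < ennreal d \<Longrightarrow> v < ennreal d \<Longrightarrow> ennreal (2 powr p) * (u + v) < ennreal \<kappa>"
      using ennreal_small_factor[of "2 powr p" \<kappa>] \<kappa> by auto
    obtain N where N: "\<And>i. N \<le> i \<Longrightarrow> (\<integral>\<^sup>+x. ennreal (norm (D i x - E x) powr p) \<partial>lborel) < ennreal d"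
      using order_tendstoD(2)[OF lim, of "ennreal d"] d(1) by (auto simp: eventually_sequentially)
    have "(\<integral>\<^sup>+x\<in>B n. ennreal (norm (f i x - f j x) powr 1) \<partial>lborel) \<le> ennreal \<epsilon>" if ij: "N \<le> i" "N \<le> j" for i j
    proof -
      have "(\<integral>\<^sup>+x. ennreal (norm (D i x - D j x) powr p) \<partial>lborel)
        \<le> ennreal (2 powr p) * ((\<integral>\<^sup>+x. ennreal (norm (D i x - E x) powr p) \<partial>lborel) + (\<integral>\<^sup>+x. ennreal (norm (E x - D j x) powr p) \<partial>lborel))"
        by (rule nn_integral_powr_norm_diff_triangle) (use p in auto)
      also have "\<dots> < ennreal \<kappa>"
        using d(2) N[OF ij(1)] N[OF ij(2)] by (simp add: norm_minus_commute)
      finally have "(\<integral>\<^sup>+x. ennreal (norm (1 *\<^sub>R D i x + (-1) *\<^sub>R D j x) powr p) \<partial>lborel) < ennreal \<kappa>" by simp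
      from small[OF diff this]
      have "(\<integral>\<^sup>+x\<in>piece (base_radius + real n). ennreal \<bar>(1 * v i x + (-1) * v j x) - (mean (v i) - mean (v j))\<bar> \<partial>lborel) \<le> ennreal \<epsilon>"
        unfolding mdiff .
      also have "(\<integral>\<^sup>+x\<in>piece (base_radius + real n). ennreal \<bar>(1 * v i x + (-1) * v j x) - (mean (v i) - mean (v j))\<bar> \<partial>lborel)
        = (\<integral>\<^sup>+x\<in>B n. ennreal (norm (f i x - f j x) powr 1) \<partial>lborel)"
      proof (rule nn_integral_cong)
        fix x
        consider "x \<in> \<Omega>" "x \<in> piece (base_radius + real n)" | "x \<in> \<Omega>" "x \<notin> piece (base_radius + real n)" | "x \<notin> \<Omega>" by blast
        then show "ennreal \<bar>(1 * v i x + (-1) * v j x) - (mean (v i) - mean (v j))\<bar> * indicator (piece (base_radius + real n)) x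
          = ennreal (norm (f i x - f j x) powr 1) * indicator (B n) x"
        proof cases
          case 1
          then show ?thesis by (simp add: B_def f_def algebra_simps)
        next
          case 2
          then show ?thesis by (simp add: B_def)
        next
          case 3
          then show ?thesis using weak_pairD(3)[OF wp] by (simp add: B_def f_def piece_def)
        qed
      qed
      finally show ?thesis .
    qed
    then show "\<exists>N. \<forall>i\<ge>N. \<forall>j\<ge>N. (\<integral>\<^sup>+x\<in>B n. ennreal (norm (f i x - f j x) powr 1) \<partial>lborel) \<le> ennreal \<epsilon>" by blast
  qed auto
  then obtain g where g[measurable]: "g \<in> borel_measurable borel"
    and glim: "\<And>n. (\<lambda>i. \<integral>\<^sup>+x\<in>B n. ennreal (norm (f i x - g x) powr 1) \<partial>lborel) \<longlonglongrightarrow> 0" by auto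
  define u where "u x = indicator \<Omega> x * g x" for x
  have [measurable]: "u \<in> borel_measurable borel" unfolding u_def by measurable
  have "weak_pair \<Omega> u E"
  proof (rule weak_pair_limit[OF f])
    fix K :: "'a set" assume K: "compact K" "K \<subseteq> \<Omega>"
    have [measurable]: "K \<in> sets borel" by (rule borel_compact[OF K(1)])
    obtain R where R: "K \<subseteq> piece R" "base_radius \<le> R" by (rule compact_subset_piece[OF K]) (rule that)
    obtain n :: nat where n: "R \<le> base_radius + real n"
      using real_arch_simple[of "R - base_radius"] by (auto simp: algebra_simps)
    have KB: "K \<subseteq> B n" using R(1) piece_mono[OF n] by (auto simp: B_def)
    show "(\<lambda>n. \<integral>\<^sup>+x\<in>K. ennreal (norm (f n x - u x)) \<partial>lborel) \<longlonglongrightarrow> 0"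
    proof (rule tendsto_sandwich[OF _ _ tendsto_const glim[of n]])
      have "(\<integral>\<^sup>+x\<in>K. ennreal (norm (f i x - u x)) \<partial>lborel) \<le> (\<integral>\<^sup>+x\<in>B n. ennreal (norm (f i x - g x) powr 1) \<partial>lborel)" for i
      proof (rule nn_integral_mono)
        fix x
        show "ennreal (norm (f i x - u x)) * indicator K x \<le> ennreal (norm (f i x - g x) powr 1) * indicator (B n) x"
          using KB K(2) by (cases "x \<in> K") (auto simp: u_def indicator_def)
      qed
      then show "\<forall>\<^sub>F i in sequentially. (\<integral>\<^sup>+x\<in>K. ennreal (norm (f i x - u x)) \<partial>lborel) \<le> (\<integral>\<^sup>+x\<in>B n. ennreal (norm (f i x - g x) powr 1) \<partial>lborel)"
        by simp
    qed simp
    show "(\<lambda>n. \<integral>\<^sup>+x\<in>K. ennreal (norm (D n x - E x)) \<partial>lborel) \<longlonglongrightarrow> 0"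
    proof (rule tendsto_0_if_Limsup_eq_0_ennreal, rule antisym[OF ennreal_le_epsilon zero_le])
      fix \<epsilon> :: real assume \<epsilon>: "0 < \<epsilon>"
      have Kfin: "emeasure lborel K < \<infinity>" using emeasure_compact_finite[OF K(1)] by (simp add: less_top)
      have limK: "(\<lambda>i. \<integral>\<^sup>+x\<in>K. ennreal (norm (D i x - E x) powr p) \<partial>lborel) \<longlonglongrightarrow> 0"
        by (rule tendsto_sandwich[OF _ _ tendsto_const lim]) (auto intro!: always_eventually nn_integral_mono simp: indicator_def)
      obtain m where m: "emeasure lborel K = ennreal m" "0 \<le> m" using Kfin by (cases "emeasure lborel K") auto
      \<comment> \<open>Makes the measure term \<open>\<eta> * m\<close> at most
        \<open>\<epsilon> / 2\<close>, leaving the other half to the p-th powers, which tend to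
        0.\<close>
      define \<eta> where "\<eta> = \<epsilon> / (2 * (m + 1))"
      have \<eta>: "0 < \<eta>" using m \<epsilon> by (simp add: \<eta>_def)
      have \<eta>m: "\<eta> * m \<le> \<epsilon> / 2"
      proof -
        have "\<eta> * m = \<epsilon> / 2 * (m / (m + 1))" using m by (simp add: \<eta>_def)
        also have "\<dots> \<le> \<epsilon> / 2 * 1" using \<epsilon> m by (intro mult_left_mono) auto
        finally show ?thesis by simp
      qed
      have "(\<lambda>i. ennreal (\<eta> powr (1 - p)) * (\<integral>\<^sup>+x\<in>K. ennreal (norm (D i x - E x) powr p) \<partial>lborel)) \<longlonglongrightarrow> ennreal (\<eta> powr (1 - p)) * 0"
        by (intro ennreal_tendsto_cmult limK) simp
      then have "\<forall>\<^sub>F i in sequentially. ennreal (\<eta> powr (1 - p)) * (\<integral>\<^sup>+x\<in>K. ennreal (norm (D i x - E x) powr p) \<partial>lborel) < ennreal (\<epsilon> / 2)"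
        using \<epsilon> by (intro order_tendstoD(2)[where y = 0]) auto
      then show "limsup (\<lambda>n. \<integral>\<^sup>+x\<in>K. ennreal (norm (D n x - E x)) \<partial>lborel) \<le> 0 + ennreal \<epsilon>"
      proof (intro Limsup_bounded, eventually_elim)
        case (elim i)
        have "(\<integral>\<^sup>+x\<in>K. ennreal (norm (D i x - E x)) \<partial>lborel)
          \<le> ennreal \<eta> * emeasure lborel K + ennreal (\<eta> powr (1 - p)) * (\<integral>\<^sup>+x\<in>K. ennreal (norm (D i x - E x) powr p) \<partial>lborel)"
          by (rule L1_le_Lp) (use \<eta> p in auto)
        also have "\<dots> \<le> ennreal (\<epsilon> / 2) + ennreal (\<epsilon> / 2)"
        proof (rule add_mono)
          show "ennreal \<eta> * emeasure lborel K \<le> ennreal (\<epsilon> / 2)"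
            using \<eta>m m \<eta> by (simp add: ennreal_mult[symmetric] ennreal_leI)
        qed (rule less_imp_le[OF elim(2)])
        also have "\<dots> = 0 + ennreal \<epsilon>" using \<epsilon> by (simp add: ennreal_plus[symmetric] del: ennreal_plus)
        finally show ?case .
      qed
    qed
  qed (use E0 in \<open>auto simp: u_def\<close>)
  then show ?thesis by blast
qed

section \<open>Traces on the boundary of the slab\<close>

definition Q :: "('a \<Rightarrow> real) measure" where "Q = (\<Pi>\<^sub>M b\<in>Basis - {e}. lborel)"
definition vec :: "('a \<Rightarrow> real) \<Rightarrow> 'a" where "vec y = (\<Sum>b\<in>Basis - {e}. y b *\<^sub>R b)"
text \<open>The surface measure before completion. On Borel sets Fubini's theorem is available;
  traces are measurable for the completion only.\<close>

definition surface0 :: "'a measure" where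
  "surface0 = distr (count_space {b1, b2} \<Otimes>\<^sub>M Q) borel (\<lambda>(t, y). t *\<^sub>R e + vec y)"

lemma slab_surface_eq: "slab_surface e b1 b2 = completion surface0"
  by (simp add: slab_surface_def surface0_def Q_def vec_def)

lemma sets_surface0[measurable_cong, simp]: "sets surface0 = sets borel" and space_surface0[simp]: "space surface0 = UNIV"
  by (simp_all add: surface0_def)

lemma vec_measurable[measurable]: "vec \<in> borel_measurable Q"
  unfolding vec_def Q_def by measurable

lemma sigma_finite_Q: "sigma_finite_measure Q"
proof -
  interpret product_sigma_finite "\<lambda>_::'a. lborel :: real measure" ..
  show ?thesis unfolding Q_def by (rule sigma_finite) simp
qed

lemma nn_integral_surface0:
  assumes [measurable]: "h \<in> borel_measurable borel"
  shows "(\<integral>\<^sup>+x. h x \<partial>surface0) = (\<integral>\<^sup>+y. h (b1 *\<^sub>R e + vec y) + h (b2 *\<^sub>R e + vec y) \<partial>Q)"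
proof -
  interpret Q: sigma_finite_measure Q by (rule sigma_finite_Q)
  have [measurable]: "(\<lambda>t. t *\<^sub>R e) \<in> borel_measurable (count_space {b1, b2})" by simp
  have [measurable]: "(\<lambda>z. fst z *\<^sub>R e) \<in> borel_measurable (count_space {b1, b2} \<Otimes>\<^sub>M Q)"
    by (rule measurable_compose[OF measurable_fst]) measurable
  have m: "(\<lambda>(t, y). t *\<^sub>R e + vec y) \<in> borel_measurable (count_space {b1, b2} \<Otimes>\<^sub>M Q)"
    unfolding split_def by measurable
  have "(\<integral>\<^sup>+x. h x \<partial>surface0) = (\<integral>\<^sup>+z. h (case z of (t, y) \<Rightarrow> t *\<^sub>R e + vec y) \<partial>(count_space {b1, b2} \<Otimes>\<^sub>M Q))"
    unfolding surface0_def by (rule nn_integral_distr[OF m]) simp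
  also have "\<dots> = (\<integral>\<^sup>+t. \<integral>\<^sup>+y. h (t *\<^sub>R e + vec y) \<partial>Q \<partial>count_space {b1, b2})"
    by (subst Q.nn_integral_fst[symmetric]) (use m in \<open>auto intro: measurable_compose\<close>)
  also have "\<dots> = (\<integral>\<^sup>+y. h (b1 *\<^sub>R e + vec y) \<partial>Q) + (\<integral>\<^sup>+y. h (b2 *\<^sub>R e + vec y) \<partial>Q)"
    using b by (subst nn_integral_count_space_finite) auto
  also have "\<dots> = (\<integral>\<^sup>+y. h (b1 *\<^sub>R e + vec y) + h (b2 *\<^sub>R e + vec y) \<partial>Q)"
    by (rule nn_integral_add[symmetric]) measurable
  finally show ?thesis .
qed

text \<open>Slices the volume along lines parallel to \<open>e\<close> with the same measure
  \<open>Q\<close> that parametrises the two boundary planes.\<close>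

lemma nn_integral_lborel_slices:
  assumes [measurable]: "h \<in> borel_measurable borel"
  shows "(\<integral>\<^sup>+x. h x \<partial>lborel) = (\<integral>\<^sup>+y. \<integral>\<^sup>+t. h (t *\<^sub>R e + vec y) \<partial>lborel \<partial>Q)"
proof -
  interpret product_sigma_finite "\<lambda>_::'a. lborel :: real measure" ..
  have B: "insert e (Basis - {e}) = Basis" using e by blast
  have m: "(\<lambda>f. \<Sum>b\<in>Basis. f b *\<^sub>R b) \<in> borel_measurable (\<Pi>\<^sub>M b\<in>(Basis::'a set). lborel)" by measurable
  have "(\<integral>\<^sup>+x. h x \<partial>lborel) = (\<integral>\<^sup>+f. h (\<Sum>b\<in>Basis. f b *\<^sub>R b) \<partial>(\<Pi>\<^sub>M b\<in>(Basis::'a set). lborel))"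
    by (subst lborel_eq) (rule nn_integral_distr[OF m], simp)
  also have "\<dots> = (\<integral>\<^sup>+f. h (\<Sum>b\<in>Basis. f b *\<^sub>R b) \<partial>(\<Pi>\<^sub>M b\<in>insert e (Basis - {e}). lborel))" by (simp only: B)
  also have "\<dots> = (\<integral>\<^sup>+y. \<integral>\<^sup>+t. h (\<Sum>b\<in>Basis. (y(e := t)) b *\<^sub>R b) \<partial>lborel \<partial>(\<Pi>\<^sub>M b\<in>Basis - {e}. lborel))"
    by (rule product_nn_integral_insert) (auto simp: B intro: measurable_compose[OF m])
  also have "\<dots> = (\<integral>\<^sup>+y. \<integral>\<^sup>+t. h (t *\<^sub>R e + vec y) \<partial>lborel \<partial>Q)"
  proof -
    have "(\<Sum>b\<in>Basis. (y(e := t)) b *\<^sub>R b) = t *\<^sub>R e + vec y" for y t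
    proof -
      have "(\<Sum>b\<in>Basis. (y(e := t)) b *\<^sub>R b) = (y(e := t)) e *\<^sub>R e + (\<Sum>b\<in>Basis - {e}. (y(e := t)) b *\<^sub>R b)"
        using e by (intro sum.remove) auto
      also have "(\<Sum>b\<in>Basis - {e}. (y(e := t)) b *\<^sub>R b) = vec y" unfolding vec_def by (intro sum.cong) auto
      finally show ?thesis by simp
    qed
    then show ?thesis by (simp add: Q_def)
  qed
  finally show ?thesis .
qed

lemma vec_inner: "vec y \<bullet> e = 0"
  using e by (auto simp: vec_def inner_sum_left inner_Basis intro!: sum.neutral)

text \<open>The segment bound contributes the p-th power of the length, and the substitution to the
  coordinate \<open>\<tau>\<close> divides by the length once; hence the exponent
  \<open>p - 1\<close>.\<close>

lemma segment_e_bound: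
  fixes U :: "'a \<Rightarrow> real"
  assumes U: "Ck 1 U" and \<beta>: "\<beta> \<in> {b1..b2}" and t: "t \<in> {b1..b2}"
  shows "ennreal (\<bar>U (\<beta> *\<^sub>R e + v) - U (t *\<^sub>R e + v)\<bar> powr p)
    \<le> ennreal ((b2 - b1) powr (p - 1)) * (\<integral>\<^sup>+\<tau>\<in>{b1..b2}. ennreal (norm (grad U (\<tau> *\<^sub>R e + v)) powr p) \<partial>lborel)"
proof (cases "t = \<beta>")
  case True
  then show ?thesis by simp
next
  case False
  note [measurable] = grad_borel_measurable[OF U]
  define g where "g \<tau> = ennreal (norm (grad U (\<tau> *\<^sub>R e + v)) powr p) * indicator {b1..b2} \<tau>" for \<tau>
  have [measurable]: "g \<in> borel_measurable borel" unfolding g_def by measurable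
  define c where "c = \<beta> - t"
  have c: "c \<noteq> 0" "\<bar>c\<bar> \<le> b2 - b1" using False \<beta> t by (auto simp: c_def)
  have "ennreal (\<bar>U (\<beta> *\<^sub>R e + v) - U (t *\<^sub>R e + v)\<bar> powr p)
    \<le> ennreal (norm ((\<beta> *\<^sub>R e + v) - (t *\<^sub>R e + v)) powr p) *
      (\<integral>\<^sup>+s. ennreal (norm (grad U ((t *\<^sub>R e + v) + s *\<^sub>R ((\<beta> *\<^sub>R e + v) - (t *\<^sub>R e + v)))) powr p) * indicator {0..1} s \<partial>lborel)"
    using p by (intro segment_powr_bound U) auto
  also have "(\<beta> *\<^sub>R e + v) - (t *\<^sub>R e + v) = c *\<^sub>R e" by (simp add: c_def algebra_simps)
  also have "(\<integral>\<^sup>+s. ennreal (norm (grad U ((t *\<^sub>R e + v) + s *\<^sub>R (c *\<^sub>R e))) powr p) * indicator {0..1} s \<partial>lborel) \<le> (\<integral>\<^sup>+s. g (t + c * s) \<partial>lborel)"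
  proof (rule nn_integral_mono)
    fix s :: real
    have eq: "(t *\<^sub>R e + v) + s *\<^sub>R (c *\<^sub>R e) = (t + c * s) *\<^sub>R e + v" by (simp add: algebra_simps)
    have "t + c * s \<in> {b1..b2}" if "s \<in> {0..1}"
    proof -
      have "(1 - s) *\<^sub>R t + s *\<^sub>R \<beta> \<in> {b1..b2}" using that by (intro convexD_alt[OF convex_real_interval(5) t \<beta>]) auto
      then show ?thesis by (simp add: c_def algebra_simps)
    qed
    then show "ennreal (norm (grad U ((t *\<^sub>R e + v) + s *\<^sub>R (c *\<^sub>R e))) powr p) * indicator {0..1} s \<le> g (t + c * s)"
      unfolding eq by (cases "s \<in> {0..1}") (auto simp: g_def)
  qed
  also have "ennreal (norm (c *\<^sub>R e) powr p) * (\<integral>\<^sup>+s. g (t + c * s) \<partial>lborel) = ennreal (\<bar>c\<bar> powr (p - 1)) * (\<integral>\<^sup>+\<tau>. g \<tau> \<partial>lborel)"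
  proof -
    have "(\<integral>\<^sup>+\<tau>. g \<tau> \<partial>lborel) = ennreal \<bar>c\<bar> * (\<integral>\<^sup>+s. g (t + c * s) \<partial>lborel)"
      by (rule nn_integral_real_affine) (use c in auto)
    moreover have "\<bar>c\<bar> powr p = \<bar>c\<bar> powr (p - 1) * \<bar>c\<bar>"
      using c powr_mult_base[of "\<bar>c\<bar>" "p - 1"] by (simp add: mult.commute)
    ultimately show ?thesis by (simp add: ennreal_mult mult.assoc)
  qed
  also have "\<dots> \<le> ennreal ((b2 - b1) powr (p - 1)) * (\<integral>\<^sup>+\<tau>. g \<tau> \<partial>lborel)"
    using c p by (intro mult_right_mono ennreal_leI powr_mono2) auto
  finally show ?thesis by (simp add: g_def mult_left_mono)
qed

text \<open>The outer 2 counts the two boundary planes, \<open>2 powr p\<close> comes from splitting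
  the boundary value, the sum \<open>1 + (b2 - b1) powr p\<close> from the function and gradient
  parts, and the denominator from averaging over the thickness.\<close>

definition trace_const :: real where
  "trace_const = 2 * (2 powr p * (1 + (b2 - b1) powr p) / (b2 - b1))"

text \<open>A boundary value is compared with the value at each point of the same line parallel to
  \<open>e\<close>, averaged over the thickness of the slab, and integrated over all such lines.
  Moving along a line can leave the ball by at most the width, hence the larger radius on the
  right.\<close>

lemma trace_inequality:
  fixes U :: "'a \<Rightarrow> real"
  assumes U: "Ck 1 U"
  shows "(\<integral>\<^sup>+x\<in>ball 0 R. ennreal (\<bar>U x\<bar> powr p) \<partial>surface0)
    \<le> ennreal trace_const * ((\<integral>\<^sup>+x\<in>piece (R + (b2 - b1)). ennreal (\<bar>U x\<bar> powr p) \<partial>lborel)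
        + (\<integral>\<^sup>+x\<in>piece (R + (b2 - b1)). ennreal (norm (grad U x) powr p) \<partial>lborel))"
proof -
  note [measurable] = grad_borel_measurable[OF U] Ck_1_borel_measurable[OF U]
  have ballb[measurable]: "ball (0::'a) R \<in> sets borel" by simp
  define L where "L = b2 - b1"
  have L: "0 < L" using b by (simp add: L_def)
  define S where "S = piece (R + (b2 - b1))"
  have [measurable]: "S \<in> sets borel" by (simp add: S_def)
  define H where "H x = (ennreal (\<bar>U x\<bar> powr p) + ennreal (norm (grad U x) powr p)) * indicator S x" for x
  have [measurable]: "H \<in> borel_measurable borel" unfolding H_def by measurable
  define W where "W v = (\<integral>\<^sup>+t. H (t *\<^sub>R e + v) \<partial>lborel)" for v
  define c where "c = 2 powr p * (1 + L powr p)"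
  have c: "0 \<le> c" by (simp add: c_def)
  have pt: "ennreal (\<bar>U (\<beta> *\<^sub>R e + vec y)\<bar> powr p) * indicator (ball 0 R) (\<beta> *\<^sub>R e + vec y) \<le> ennreal (c / L) * W (vec y)"
    if \<beta>: "\<beta> \<in> {b1..b2}" for \<beta> y
  proof (cases "\<beta> *\<^sub>R e + vec y \<in> ball 0 R")
    case True
    define v where "v = vec y"
    have in_S: "t *\<^sub>R e + v \<in> S" if "t \<in> {b1<..<b2}" for t
    proof -
      have eq: "t *\<^sub>R e + v = (\<beta> *\<^sub>R e + v) + (t - \<beta>) *\<^sub>R e" by (simp add: algebra_simps)
      have "norm (t *\<^sub>R e + v) \<le> norm (\<beta> *\<^sub>R e + v) + \<bar>t - \<beta>\<bar>"
        unfolding eq using norm_triangle_ineq[of "\<beta> *\<^sub>R e + v" "(t - \<beta>) *\<^sub>R e"] by simp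
      also have "\<dots> < R + (b2 - b1)" using True \<beta> that by (auto simp: v_def)
      finally show ?thesis using that vec_inner[of y]
        by (simp add: S_def piece_def slab_def inner_add_left v_def)
    qed
    \<comment> \<open>The gradient integral runs over the closed interval while the slab is open;
      the two endpoints are null.\<close>
    have ae: "AE t in lborel. t \<noteq> b1 \<and> t \<noteq> b2"
      using AE_lborel_singleton[of b1] AE_lborel_singleton[of b2] by eventually_elim auto
    define Gr where "Gr = (\<integral>\<^sup>+\<tau>\<in>{b1..b2}. ennreal (norm (grad U (\<tau> *\<^sub>R e + v)) powr p) \<partial>lborel)"
    define I where "I = (\<integral>\<^sup>+t\<in>{b1<..<b2}. ennreal (\<bar>U (t *\<^sub>R e + v)\<bar> powr p) \<partial>lborel)"
    have "ennreal L * ennreal (\<bar>U (\<beta> *\<^sub>R e + v)\<bar> powr p) = (\<integral>\<^sup>+t. ennreal (\<bar>U (\<beta> *\<^sub>R e + v)\<bar> powr p) * indicator {b1<..<b2} t \<partial>lborel)"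
      using b by (subst nn_integral_cmult_indicator) (auto simp: L_def mult.commute)
    also have "\<dots> \<le> (\<integral>\<^sup>+t. ennreal (2 powr p) * (ennreal (\<bar>U (t *\<^sub>R e + v)\<bar> powr p) * indicator {b1<..<b2} t
        + (ennreal (L powr (p - 1)) * Gr) * indicator {b1<..<b2} t) \<partial>lborel)"
    proof (rule nn_integral_mono)
      fix t
      show "ennreal (\<bar>U (\<beta> *\<^sub>R e + v)\<bar> powr p) * indicator {b1<..<b2} t \<le> ennreal (2 powr p) * (ennreal (\<bar>U (t *\<^sub>R e + v)\<bar> powr p) * indicator {b1<..<b2} t
        + (ennreal (L powr (p - 1)) * Gr) * indicator {b1<..<b2} t)"
      proof (cases "t \<in> {b1<..<b2}")
        case True
        have "\<bar>U (\<beta> *\<^sub>R e + v)\<bar> powr p \<le> 2 powr p * (\<bar>U (t *\<^sub>R e + v)\<bar> powr p + \<bar>U (\<beta> *\<^sub>R e + v) - U (t *\<^sub>R e + v)\<bar> powr p)"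
          using powr_norm_add_le[of p "U (t *\<^sub>R e + v)" "U (\<beta> *\<^sub>R e + v) - U (t *\<^sub>R e + v)"] p by simp
        then have "ennreal (\<bar>U (\<beta> *\<^sub>R e + v)\<bar> powr p) \<le> ennreal (2 powr p) * (ennreal (\<bar>U (t *\<^sub>R e + v)\<bar> powr p) + ennreal (\<bar>U (\<beta> *\<^sub>R e + v) - U (t *\<^sub>R e + v)\<bar> powr p))"
          by (simp add: ennreal_mult[symmetric] ennreal_plus[symmetric] ennreal_leI del: ennreal_plus)
        also have "\<dots> \<le> ennreal (2 powr p) * (ennreal (\<bar>U (t *\<^sub>R e + v)\<bar> powr p) + ennreal (L powr (p - 1)) * Gr)"
          using segment_e_bound[OF U \<beta>, of t v] True by (intro mult_left_mono add_left_mono) (auto simp: Gr_def L_def)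
        finally show ?thesis using True by simp
      qed simp
    qed
    also have "\<dots> = ennreal (2 powr p) * (I + (ennreal (L powr (p - 1)) * Gr) * ennreal L)"
      unfolding I_def using b by (subst nn_integral_cmult; simp add: nn_integral_add nn_integral_cmult_indicator L_def)
    also have "\<dots> = ennreal (2 powr p) * (I + ennreal (L powr p) * Gr)"
    proof -
      have "L powr p = L powr (p - 1) * L" using L powr_mult_base[of L "p - 1"] by (simp add: mult.commute)
      then show ?thesis using L by (simp add: ennreal_mult mult.assoc mult.commute mult.left_commute)
    qed
    also have "\<dots> \<le> ennreal (2 powr p) * (W v + ennreal (L powr p) * W v)"
    proof (intro mult_left_mono add_mono)
      show "I \<le> W v" unfolding I_def W_def
      proof (rule nn_integral_mono)
        fix t show "ennreal (\<bar>U (t *\<^sub>R e + v)\<bar> powr p) * indicator {b1<..<b2} t \<le> H (t *\<^sub>R e + v)"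
          using in_S[of t] by (cases "t \<in> {b1<..<b2}") (auto simp: H_def)
      qed
      show "Gr \<le> W v" unfolding Gr_def W_def
      proof (rule nn_integral_mono_AE)
        show "AE t in lborel. ennreal (norm (grad U (t *\<^sub>R e + v)) powr p) * indicator {b1..b2} t \<le> H (t *\<^sub>R e + v)"
          using ae
        proof eventually_elim
          case (elim t)
          then show ?case using in_S[of t] by (cases "t \<in> {b1<..<b2}") (auto simp: H_def indicator_def)
        qed
      qed
    qed simp_all
    also have "\<dots> = ennreal c * W v"
    proof -
      have "ennreal c = ennreal (2 powr p) * (1 + ennreal (L powr p))" by (simp add: c_def ennreal_mult)
      then show ?thesis by (simp add: distrib_left distrib_right mult.assoc)
    qed
    finally have "ennreal (1 / L) * (ennreal L * ennreal (\<bar>U (\<beta> *\<^sub>R e + v)\<bar> powr p)) \<le> ennreal (1 / L) * (ennreal c * W v)"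
      by (rule mult_left_mono) simp
    then have "ennreal (\<bar>U (\<beta> *\<^sub>R e + v)\<bar> powr p) \<le> ennreal (c / L) * W v"
      using L c by (simp add: mult.assoc[symmetric] ennreal_mult[symmetric])
    then show ?thesis using True by (simp add: v_def)
  qed simp
  have "(\<integral>\<^sup>+x\<in>ball 0 R. ennreal (\<bar>U x\<bar> powr p) \<partial>surface0)
    = (\<integral>\<^sup>+y. ennreal (\<bar>U (b1 *\<^sub>R e + vec y)\<bar> powr p) * indicator (ball 0 R) (b1 *\<^sub>R e + vec y)
      + ennreal (\<bar>U (b2 *\<^sub>R e + vec y)\<bar> powr p) * indicator (ball 0 R) (b2 *\<^sub>R e + vec y) \<partial>Q)"
    by (rule nn_integral_surface0) (intro borel_measurable_times_ennreal borel_measurable_indicator ballb, measurable)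
  also have "\<dots> \<le> (\<integral>\<^sup>+y. ennreal (2 * (c / L)) * W (vec y) \<partial>Q)"
  proof (rule nn_integral_mono)
    fix y
    have "ennreal (2 * (c / L)) = ennreal (c / L) + ennreal (c / L)" using c L by (simp add: ennreal_plus[symmetric] del: ennreal_plus)
    then have "ennreal (2 * (c / L)) * W (vec y) = ennreal (c / L) * W (vec y) + ennreal (c / L) * W (vec y)"
      by (simp only: distrib_right)
    then show "ennreal (\<bar>U (b1 *\<^sub>R e + vec y)\<bar> powr p) * indicator (ball 0 R) (b1 *\<^sub>R e + vec y)
      + ennreal (\<bar>U (b2 *\<^sub>R e + vec y)\<bar> powr p) * indicator (ball 0 R) (b2 *\<^sub>R e + vec y) \<le> ennreal (2 * (c / L)) * W (vec y)"
      using pt[of b1 y] pt[of b2 y] b by (auto intro!: add_mono)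
  qed
  also have "\<dots> = ennreal (2 * (c / L)) * (\<integral>\<^sup>+y. W (vec y) \<partial>Q)"
    unfolding W_def by (rule nn_integral_cmult) measurable
  also have "(\<integral>\<^sup>+y. W (vec y) \<partial>Q) = (\<integral>\<^sup>+x. H x \<partial>lborel)"
    unfolding W_def by (rule nn_integral_lborel_slices[symmetric]) measurable
  also have "\<dots> = (\<integral>\<^sup>+x\<in>S. ennreal (\<bar>U x\<bar> powr p) \<partial>lborel) + (\<integral>\<^sup>+x\<in>S. ennreal (norm (grad U x) powr p) \<partial>lborel)"
    unfolding H_def distrib_right by (rule nn_integral_add) measurable
  finally show ?thesis by (simp add: S_def trace_const_def c_def L_def)
qed

lemma Ck_1_diff:
  assumes "Ck 1 U" "Ck 1 V"
  shows "Ck 1 (\<lambda>x. U x - V x)" "grad (\<lambda>x. U x - V x) x = grad U x - grad V x"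
proof -
  have "Ck 1 (\<lambda>x. U x + (-1) * V x)" by (intro Ck_add Ck_mult Ck_const assms)
  then show "Ck 1 (\<lambda>x. U x - V x)" by simp
  show "grad (\<lambda>x. U x - V x) x = grad U x - grad V x"
    by (intro grad_eqI GDERIV_diff Ck_1_GDERIV assms)
qed

end

section \<open>Existence and uniqueness of boundary values\<close>

lemma nn_set_integral_powr_norm_diff_triangle:
  fixes f g h :: "'x \<Rightarrow> 'b::euclidean_space"
  assumes [measurable]: "f \<in> borel_measurable M" "g \<in> borel_measurable M" "h \<in> borel_measurable M" "S \<in> sets M" and q: "0 \<le> q"
  shows "(\<integral>\<^sup>+x\<in>S. ennreal (norm (f x - h x) powr q) \<partial>M)
    \<le> ennreal (2 powr q) * ((\<integral>\<^sup>+x\<in>S. ennreal (norm (f x - g x) powr q) \<partial>M) + (\<integral>\<^sup>+x\<in>S. ennreal (norm (g x - h x) powr q) \<partial>M))"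
proof -
  have eq: "(\<integral>\<^sup>+x. F x \<partial>restrict_space M S) = (\<integral>\<^sup>+x\<in>S. F x \<partial>M)" for F
    by (rule nn_integral_restrict_space) simp
  show ?thesis
    using nn_integral_powr_norm_diff_triangle[of f "restrict_space M S" g h q] q
    unfolding eq by (simp add: measurable_restrict_space1)
qed

lemma Lp_tendsto_trans:
  fixes f g :: "nat \<Rightarrow> 'x \<Rightarrow> 'b::euclidean_space"
  assumes [measurable]: "\<And>j. f j \<in> borel_measurable M" "\<And>j. g j \<in> borel_measurable M" "\<And>j. h j \<in> borel_measurable M" "S \<in> sets M"
    and q: "0 \<le> q"
    and f: "(\<lambda>j. \<integral>\<^sup>+x\<in>S. ennreal (norm (f j x - g j x) powr q) \<partial>M) \<longlonglongrightarrow> 0"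
    and g: "(\<lambda>j. \<integral>\<^sup>+x\<in>S. ennreal (norm (g j x - h j x) powr q) \<partial>M) \<longlonglongrightarrow> 0"
  shows "(\<lambda>j. \<integral>\<^sup>+x\<in>S. ennreal (norm (f j x - h j x) powr q) \<partial>M) \<longlonglongrightarrow> 0"
proof -
  have "(\<lambda>j. ennreal (2 powr q) * ((\<integral>\<^sup>+x\<in>S. ennreal (norm (f j x - g j x) powr q) \<partial>M) + (\<integral>\<^sup>+x\<in>S. ennreal (norm (g j x - h j x) powr q) \<partial>M)))
    \<longlonglongrightarrow> ennreal (2 powr q) * (0 + 0)"
    by (intro ennreal_tendsto_cmult tendsto_add f g) simp
  then have lim: "(\<lambda>j. ennreal (2 powr q) * ((\<integral>\<^sup>+x\<in>S. ennreal (norm (f j x - g j x) powr q) \<partial>M) + (\<integral>\<^sup>+x\<in>S. ennreal (norm (g j x - h j x) powr q) \<partial>M))) \<longlonglongrightarrow> 0"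
    by simp
  show ?thesis
    by (rule tendsto_sandwich[OF _ _ tendsto_const lim])
      (auto intro!: always_eventually nn_set_integral_powr_norm_diff_triangle q)
qed

lemma Lp_tendsto_imp_Cauchy:
  fixes f :: "nat \<Rightarrow> 'x \<Rightarrow> 'b::euclidean_space"
  assumes [measurable]: "\<And>j. f j \<in> borel_measurable M" "g \<in> borel_measurable M" "S \<in> sets M" and q: "0 \<le> q"
    and f: "(\<lambda>j. \<integral>\<^sup>+x\<in>S. ennreal (norm (f j x - g x) powr q) \<partial>M) \<longlonglongrightarrow> 0" and \<delta>: "0 < (\<delta>::real)"
  obtains N where "\<And>i j. N \<le> i \<Longrightarrow> N \<le> j \<Longrightarrow> (\<integral>\<^sup>+x\<in>S. ennreal (norm (f i x - f j x) powr q) \<partial>M) < ennreal \<delta>"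
proof -
  obtain d where d: "0 < d" "\<And>u v::ennreal. u < ennreal d \<Longrightarrow> v < ennreal d \<Longrightarrow> ennreal (2 powr q) * (u + v) < ennreal \<delta>"
    using ennreal_small_factor[of "2 powr q" \<delta>] \<delta> by auto
  obtain N where N: "\<And>i. N \<le> i \<Longrightarrow> (\<integral>\<^sup>+x\<in>S. ennreal (norm (f i x - g x) powr q) \<partial>M) < ennreal d"
    using order_tendstoD(2)[OF f, of "ennreal d"] d(1) by (auto simp: eventually_sequentially)
  have "(\<integral>\<^sup>+x\<in>S. ennreal (norm (f i x - f j x) powr q) \<partial>M) < ennreal \<delta>" if "N \<le> i" "N \<le> j" for i j
  proof (rule le_less_trans)
    show "(\<integral>\<^sup>+x\<in>S. ennreal (norm (f i x - f j x) powr q) \<partial>M) \<le> ennreal (2 powr q) *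
      ((\<integral>\<^sup>+x\<in>S. ennreal (norm (f i x - g x) powr q) \<partial>M) + (\<integral>\<^sup>+x\<in>S. ennreal (norm (g x - f j x) powr q) \<partial>M))"
      by (rule nn_set_integral_powr_norm_diff_triangle) (use q in auto)
    show "ennreal (2 powr q) * ((\<integral>\<^sup>+x\<in>S. ennreal (norm (f i x - g x) powr q) \<partial>M) + (\<integral>\<^sup>+x\<in>S. ennreal (norm (g x - f j x) powr q) \<partial>M)) < ennreal \<delta>"
      using d(2)[OF N[OF that(1)] N[OF that(2)]] by (simp add: norm_minus_commute)
  qed
  then show ?thesis using that by blast
qed

lemma Lp_finite_of_close:
  fixes f g :: "'x \<Rightarrow> 'b::euclidean_space"
  assumes [measurable]: "f \<in> borel_measurable M" "g \<in> borel_measurable M" "S \<in> sets M" and q: "0 \<le> q"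
    and d: "(\<integral>\<^sup>+x\<in>S. ennreal (norm (f x - g x) powr q) \<partial>M) < \<infinity>" and g: "(\<integral>\<^sup>+x\<in>S. ennreal (norm (g x) powr q) \<partial>M) < \<infinity>"
  shows "(\<integral>\<^sup>+x\<in>S. ennreal (norm (f x) powr q) \<partial>M) < \<infinity>"
proof -
  have "(\<integral>\<^sup>+x\<in>S. ennreal (norm (f x - 0) powr q) \<partial>M) \<le> ennreal (2 powr q) *
      ((\<integral>\<^sup>+x\<in>S. ennreal (norm (f x - g x) powr q) \<partial>M) + (\<integral>\<^sup>+x\<in>S. ennreal (norm (g x - 0) powr q) \<partial>M))"
    by (rule nn_set_integral_powr_norm_diff_triangle) (use q in auto)
  also have "\<dots> < \<infinity>" using d g by (simp add: ennreal_mult_less_top)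
  finally show ?thesis by simp
qed

context slab_data
begin

lemma grad_lim_piece:
  assumes "(\<lambda>j. \<integral>\<^sup>+x\<in>\<Omega>. ennreal (norm (F j x) powr p) \<partial>lborel) \<longlonglongrightarrow> 0"
  shows "(\<lambda>j. \<integral>\<^sup>+x\<in>piece R. ennreal (norm (F j x) powr p) \<partial>lborel) \<longlonglongrightarrow> 0"
  by (rule tendsto_sandwich[OF _ _ tendsto_const assms])
    (auto intro!: always_eventually nn_integral_mono simp: indicator_def piece_def)

text \<open>The trace inequality for differences makes the boundary values of the approximants a
  Cauchy sequence on every ball. The limit is p-integrable there because it is close to the boundary
  values of a single approximant.\<close>

lemma surface_trace_exists:
  assumes U: "\<And>j::nat. Ck 1 (U j)" and [measurable]: "u \<in> borel_measurable borel" "D \<in> borel_measurable borel"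
    and fin: "\<And>R. (\<integral>\<^sup>+x\<in>piece R. ennreal (\<bar>u x\<bar> powr p) \<partial>lborel) < \<infinity>" "(\<integral>\<^sup>+x. ennreal (norm (D x) powr p) \<partial>lborel) < \<infinity>"
    and limu: "\<And>R. 0 < R \<Longrightarrow> (\<lambda>j. \<integral>\<^sup>+x\<in>piece R. ennreal (\<bar>U j x - u x\<bar> powr p) \<partial>lborel) \<longlonglongrightarrow> 0"
    and limD: "\<And>R. 0 < R \<Longrightarrow> (\<lambda>j. \<integral>\<^sup>+x\<in>piece R. ennreal (norm (grad (U j) x - D x) powr p) \<partial>lborel) \<longlonglongrightarrow> 0"
  obtains g where "g \<in> borel_measurable borel"
    "\<And>R. 0 < R \<Longrightarrow> (\<lambda>j. \<integral>\<^sup>+x\<in>ball 0 R. ennreal (\<bar>U j x - g x\<bar> powr p) \<partial>surface0) \<longlonglongrightarrow> 0"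
    "\<And>R. (\<integral>\<^sup>+x\<in>ball 0 R. ennreal (\<bar>g x\<bar> powr p) \<partial>surface0) < \<infinity>"
proof -
  note [measurable] = grad_borel_measurable[OF U] Ck_1_borel_measurable[OF U]
  have ballb: "ball (0::'a) R \<in> sets surface0" for R by simp
  have "\<exists>g\<in>borel_measurable surface0. (\<exists>r::nat \<Rightarrow> nat. strict_mono r \<and> (AE x in surface0. (\<lambda>k. U (r k) x) \<longlonglongrightarrow> g x)) \<and>
     (\<forall>n. (\<lambda>i. \<integral>\<^sup>+x\<in>ball 0 (real n). ennreal (norm (U i x - g x) powr p) \<partial>surface0) \<longlonglongrightarrow> 0)"
  proof (rule Lp_complete_local)
    show "incseq (\<lambda>n. ball (0::'a) (real n))" by (auto simp: incseq_def)
    show "(\<Union>n. ball (0::'a) (real n)) = space surface0" using reals_Archimedean2 by auto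
    fix n :: nat and \<delta> :: real assume \<delta>: "0 < \<delta>"
    define R where "R = real n + (b2 - b1)"
    have R: "0 < R" using b by (simp add: R_def)
    obtain d where d: "0 < d" "\<And>u v::ennreal. u < ennreal d \<Longrightarrow> v < ennreal d \<Longrightarrow> ennreal trace_const * (u + v) < ennreal \<delta>"
      using ennreal_small_factor[of trace_const \<delta>] \<delta> b by (auto simp: trace_const_def)
    obtain N1 where N1: "\<And>i j. N1 \<le> i \<Longrightarrow> N1 \<le> j \<Longrightarrow> (\<integral>\<^sup>+x\<in>piece R. ennreal (norm (U i x - U j x) powr p) \<partial>lborel) < ennreal d"
      by (rule Lp_tendsto_imp_Cauchy[of U lborel u "piece R" p d]) (use p d(1) limu[OF R] in auto)
    obtain N2 where N2: "\<And>i j. N2 \<le> i \<Longrightarrow> N2 \<le> j \<Longrightarrow> (\<integral>\<^sup>+x\<in>piece R. ennreal (norm (grad (U i) x - grad (U j) x) powr p) \<partial>lborel) < ennreal d"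
      by (rule Lp_tendsto_imp_Cauchy[of "\<lambda>j. grad (U j)" lborel D "piece R" p d]) (use p d(1) limD[OF R] in auto)
    have "(\<integral>\<^sup>+x\<in>ball 0 (real n). ennreal (norm (U i x - U j x) powr p) \<partial>surface0) \<le> ennreal \<delta>" if "max N1 N2 \<le> i" "max N1 N2 \<le> j" for i j
    proof -
      have "(\<integral>\<^sup>+x\<in>ball 0 (real n). ennreal (norm (U i x - U j x) powr p) \<partial>surface0) \<le> ennreal trace_const *
        ((\<integral>\<^sup>+x\<in>piece R. ennreal (norm (U i x - U j x) powr p) \<partial>lborel) + (\<integral>\<^sup>+x\<in>piece R. ennreal (norm (grad (U i) x - grad (U j) x) powr p) \<partial>lborel))"
        using trace_inequality[OF Ck_1_diff(1)[OF U[of i] U[of j]], of "real n"] by (simp add: Ck_1_diff(2)[OF U U] R_def)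
      also have "\<dots> < ennreal \<delta>" using that by (intro d(2) N1 N2) auto
      finally show ?thesis by simp
    qed
    then show "\<exists>N. \<forall>i\<ge>N. \<forall>j\<ge>N. (\<integral>\<^sup>+x\<in>ball 0 (real n). ennreal (norm (U i x - U j x) powr p) \<partial>surface0) \<le> ennreal \<delta>" by blast
  qed (use p ballb in auto)
  then obtain g where g[measurable]: "g \<in> borel_measurable borel"
    and lim: "\<And>n. (\<lambda>i. \<integral>\<^sup>+x\<in>ball 0 (real n). ennreal (norm (U i x - g x) powr p) \<partial>surface0) \<longlonglongrightarrow> 0"
    by (auto simp: measurable_cong_sets[OF sets_surface0 refl])
  have limR: "(\<lambda>j. \<integral>\<^sup>+x\<in>ball 0 R. ennreal (\<bar>U j x - g x\<bar> powr p) \<partial>surface0) \<longlonglongrightarrow> 0" for R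
  proof -
    obtain n :: nat where "R \<le> real n" using real_arch_simple by blast
    then show ?thesis
      by (intro tendsto_sandwich[OF _ _ tendsto_const lim[of n]])
        (auto intro!: always_eventually nn_integral_mono simp: indicator_def)
  qed
  have "(\<integral>\<^sup>+x\<in>ball 0 R. ennreal (\<bar>g x\<bar> powr p) \<partial>surface0) < \<infinity>" for R
  proof -
    \<comment> \<open>Finiteness is claimed for every real \<open>R\<close>, but the limits are
      assumed for positive radii only; the maximum with 1 guarantees positivity.\<close>
    define R' where "R' = max 1 (R + (b2 - b1))"
    have R': "0 < R'" by (simp add: R'_def)
    have "\<forall>\<^sub>F j in sequentially. (\<integral>\<^sup>+x\<in>ball 0 R. ennreal (\<bar>U j x - g x\<bar> powr p) \<partial>surface0) < 1
      \<and> (\<integral>\<^sup>+x\<in>piece R'. ennreal (\<bar>U j x - u x\<bar> powr p) \<partial>lborel) < 1 \<and> (\<integral>\<^sup>+x\<in>piece R'. ennreal (norm (grad (U j) x - D x) powr p) \<partial>lborel) < 1"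
      by (intro eventually_conj order_tendstoD(2)[OF limR] order_tendstoD(2)[OF limu[OF R']] order_tendstoD(2)[OF limD[OF R']]) auto
    then obtain j where j: "(\<integral>\<^sup>+x\<in>ball 0 R. ennreal (\<bar>U j x - g x\<bar> powr p) \<partial>surface0) < 1"
      "(\<integral>\<^sup>+x\<in>piece R'. ennreal (\<bar>U j x - u x\<bar> powr p) \<partial>lborel) < 1" "(\<integral>\<^sup>+x\<in>piece R'. ennreal (norm (grad (U j) x - D x) powr p) \<partial>lborel) < 1"
      unfolding eventually_sequentially by blast
    have one: "x < \<infinity>" if "x < 1" for x :: ennreal using that by (rule less_trans) simp
    have 1: "(\<integral>\<^sup>+x\<in>piece R'. ennreal (norm (U j x) powr p) \<partial>lborel) < \<infinity>"
      by (rule Lp_finite_of_close[of _ _ u]) (use p one[OF j(2)] fin(1)[of R'] in auto)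
    have "(\<integral>\<^sup>+x\<in>piece R'. ennreal (norm (D x) powr p) \<partial>lborel) \<le> (\<integral>\<^sup>+x. ennreal (norm (D x) powr p) \<partial>lborel)"
      by (intro nn_integral_mono) (auto simp: indicator_def)
    note Dp = le_less_trans[OF this fin(2)]
    have 2: "(\<integral>\<^sup>+x\<in>piece R'. ennreal (norm (grad (U j) x) powr p) \<partial>lborel) < \<infinity>"
      by (rule Lp_finite_of_close[OF _ _ _ _ one[OF j(3)] Dp]) (use p in auto)
    have sub: "piece (R + (b2 - b1)) \<subseteq> piece R'" by (rule piece_mono) (simp add: R'_def)
    have "(\<integral>\<^sup>+x\<in>ball 0 R. ennreal (\<bar>U j x\<bar> powr p) \<partial>surface0)
      \<le> ennreal trace_const * ((\<integral>\<^sup>+x\<in>piece (R + (b2 - b1)). ennreal (\<bar>U j x\<bar> powr p) \<partial>lborel)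
        + (\<integral>\<^sup>+x\<in>piece (R + (b2 - b1)). ennreal (norm (grad (U j) x) powr p) \<partial>lborel))" by (rule trace_inequality[OF U])
    also have "\<dots> \<le> ennreal trace_const * ((\<integral>\<^sup>+x\<in>piece R'. ennreal (norm (U j x) powr p) \<partial>lborel)
        + (\<integral>\<^sup>+x\<in>piece R'. ennreal (norm (grad (U j) x) powr p) \<partial>lborel))"
      using sub by (intro mult_left_mono add_mono nn_integral_mono) (auto simp: indicator_def)
    also have "\<dots> < \<infinity>" using 1 2 by (simp add: ennreal_mult_less_top)
    finally have 3: "(\<integral>\<^sup>+x\<in>ball 0 R. ennreal (norm (U j x) powr p) \<partial>surface0) < \<infinity>" by simp
    have "(\<integral>\<^sup>+x\<in>ball 0 R. ennreal (norm (g x) powr p) \<partial>surface0) < \<infinity>"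
      by (rule Lp_finite_of_close[of _ _ "U j"]) (use p one[OF j(1)] 3 ballb in \<open>auto simp: abs_minus_commute\<close>)
    then show ?thesis by simp
  qed
  then show ?thesis using that[OF g] limR by blast
qed

text \<open>The differences of two approximating sequences tend to 0 together with their gradients
  on every piece, so by the trace inequality their boundary values do as well.\<close>

lemma surface_trace_unique:
  assumes U: "\<And>j::nat. Ck 1 (U j)" and V: "\<And>j::nat. Ck 1 (V j)" and [measurable]: "u \<in> borel_measurable borel" "D \<in> borel_measurable borel"
    and g: "g \<in> borel_measurable (completion surface0)" and h: "h \<in> borel_measurable (completion surface0)"
    and U_u: "\<And>R. 0 < R \<Longrightarrow> (\<lambda>j. \<integral>\<^sup>+x\<in>piece R. ennreal (\<bar>U j x - u x\<bar> powr p) \<partial>lborel) \<longlonglongrightarrow> 0"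
    and U_D: "\<And>R. 0 < R \<Longrightarrow> (\<lambda>j. \<integral>\<^sup>+x\<in>piece R. ennreal (norm (grad (U j) x - D x) powr p) \<partial>lborel) \<longlonglongrightarrow> 0"
    and U_g: "\<And>R. 0 < R \<Longrightarrow> (\<lambda>j. \<integral>\<^sup>+x\<in>ball 0 R. ennreal (\<bar>U j x - g x\<bar> powr p) \<partial>completion surface0) \<longlonglongrightarrow> 0"
    and V_u: "\<And>R. 0 < R \<Longrightarrow> (\<lambda>j. \<integral>\<^sup>+x\<in>piece R. ennreal (\<bar>V j x - u x\<bar> powr p) \<partial>lborel) \<longlonglongrightarrow> 0"
    and V_D: "\<And>R. 0 < R \<Longrightarrow> (\<lambda>j. \<integral>\<^sup>+x\<in>piece R. ennreal (norm (grad (V j) x - D x) powr p) \<partial>lborel) \<longlonglongrightarrow> 0"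
    and V_h: "\<And>R. 0 < R \<Longrightarrow> (\<lambda>j. \<integral>\<^sup>+x\<in>ball 0 R. ennreal (\<bar>V j x - h x\<bar> powr p) \<partial>completion surface0) \<longlonglongrightarrow> 0"
  shows "AE x in completion surface0. g x = h x"
proof -
  note [measurable] = grad_borel_measurable[OF U] Ck_1_borel_measurable[OF U] grad_borel_measurable[OF V] Ck_1_borel_measurable[OF V]
  have mU: "U j \<in> borel_measurable (completion surface0)" "V j \<in> borel_measurable (completion surface0)" for j
    by (auto intro!: measurable_completion)
  have ballb: "ball (0::'a) R \<in> sets (completion surface0)" for R by (intro sets_completionI_sets) simp
  have 0: "(\<integral>\<^sup>+x\<in>ball 0 R. ennreal (norm (g x - h x) powr p) \<partial>completion surface0) = 0" if R: "0 < R" for R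
  proof -
    define R' where "R' = R + (b2 - b1)"
    have R': "0 < R'" using R b by (simp add: R'_def)
    have p0: "0 \<le> p" using p by simp
    have 1: "(\<lambda>j. \<integral>\<^sup>+x\<in>piece R'. ennreal (norm (U j x - V j x) powr p) \<partial>lborel) \<longlonglongrightarrow> 0"
      by (rule Lp_tendsto_trans[where g = "\<lambda>_. u"]) (use p0 U_u[OF R'] V_u[OF R'] in \<open>auto simp: abs_minus_commute\<close>)
    have 2: "(\<lambda>j. \<integral>\<^sup>+x\<in>piece R'. ennreal (norm (grad (U j) x - grad (V j) x) powr p) \<partial>lborel) \<longlonglongrightarrow> 0"
      by (rule Lp_tendsto_trans[where g = "\<lambda>_. D"]) (use p0 U_D[OF R'] V_D[OF R'] in \<open>auto simp: norm_minus_commute\<close>)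
    have "(\<lambda>j. ennreal trace_const * ((\<integral>\<^sup>+x\<in>piece R'. ennreal (norm (U j x - V j x) powr p) \<partial>lborel)
      + (\<integral>\<^sup>+x\<in>piece R'. ennreal (norm (grad (U j) x - grad (V j) x) powr p) \<partial>lborel))) \<longlonglongrightarrow> ennreal trace_const * (0 + 0)"
      by (intro ennreal_tendsto_cmult tendsto_add 1 2) simp
    then have lim: "(\<lambda>j. ennreal trace_const * ((\<integral>\<^sup>+x\<in>piece R'. ennreal (norm (U j x - V j x) powr p) \<partial>lborel)
      + (\<integral>\<^sup>+x\<in>piece R'. ennreal (norm (grad (U j) x - grad (V j) x) powr p) \<partial>lborel))) \<longlonglongrightarrow> 0" by simp
    have 3: "(\<lambda>j. \<integral>\<^sup>+x\<in>ball 0 R. ennreal (norm (U j x - V j x) powr p) \<partial>completion surface0) \<longlonglongrightarrow> 0"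
    proof (rule tendsto_sandwich[OF _ _ tendsto_const lim])
      have "(\<integral>\<^sup>+x\<in>ball 0 R. ennreal (norm (U j x - V j x) powr p) \<partial>completion surface0) \<le> ennreal trace_const * ((\<integral>\<^sup>+x\<in>piece R'. ennreal (norm (U j x - V j x) powr p) \<partial>lborel)
        + (\<integral>\<^sup>+x\<in>piece R'. ennreal (norm (grad (U j) x - grad (V j) x) powr p) \<partial>lborel))" for j
        using trace_inequality[OF Ck_1_diff(1)[OF U[of j] V[of j]], of R]
        by (simp add: nn_integral_completion Ck_1_diff(2)[OF U V] R'_def)
      then show "\<forall>\<^sub>F j in sequentially. (\<integral>\<^sup>+x\<in>ball 0 R. ennreal (norm (U j x - V j x) powr p) \<partial>completion surface0) \<le> ennreal trace_const * ((\<integral>\<^sup>+x\<in>piece R'. ennreal (norm (U j x - V j x) powr p) \<partial>lborel)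
        + (\<integral>\<^sup>+x\<in>piece R'. ennreal (norm (grad (U j) x - grad (V j) x) powr p) \<partial>lborel))" by simp
    qed simp
    have 4: "(\<lambda>j. \<integral>\<^sup>+x\<in>ball 0 R. ennreal (norm (g x - V j x) powr p) \<partial>completion surface0) \<longlonglongrightarrow> 0"
      by (rule Lp_tendsto_trans[where g = U, OF _ _ _ _ p0 _ 3]) (use mU g ballb U_g[OF R] in \<open>auto simp: abs_minus_commute\<close>)
    have "(\<lambda>j::nat. \<integral>\<^sup>+x\<in>ball 0 R. ennreal (norm (g x - h x) powr p) \<partial>completion surface0) \<longlonglongrightarrow> 0"
      by (rule Lp_tendsto_trans[where g = V and f = "\<lambda>_. g" and h = "\<lambda>_. h", OF _ _ _ _ p0 4]) (use mU g h ballb V_h[OF R] in auto)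
    then show ?thesis by (simp add: LIMSEQ_const_iff)
  qed
  have "AE x in completion surface0. \<forall>n. ennreal (norm (g x - h x) powr p) * indicator (ball 0 (real (Suc n))) x = 0"
  proof (subst AE_all_countable, intro allI)
    fix n
    have m: "(\<lambda>x. ennreal (norm (g x - h x) powr p) * indicator (ball 0 (real (Suc n))) x) \<in> borel_measurable (completion surface0)"
      using g h ballb by (intro borel_measurable_times_ennreal borel_measurable_indicator) auto
    show "AE x in completion surface0. ennreal (norm (g x - h x) powr p) * indicator (ball 0 (real (Suc n))) x = 0"
      using nn_integral_0_iff_AE[OF m] 0[of "real (Suc n)"] by simp
  qed
  then show ?thesis
  proof eventually_elim
    case (elim x)
    obtain n :: nat where "norm x < real n" using reals_Archimedean2 by blast
    then have "x \<in> ball 0 (real (Suc n))" by simp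
    then have "ennreal (norm (g x - h x) powr p) = 0" using elim[rule_format, of n] by simp
    then show ?case by simp
  qed
qed

end

section \<open>Sobolev functions on the slab\<close>

text \<open>The scalar result is applied to each coordinate, and the finitely many null sets are
  united.\<close>

lemma borel_representative:
  fixes f :: "'a::euclidean_space \<Rightarrow> 'b::euclidean_space"
  assumes f: "f \<in> borel_measurable lebesgue"
  shows "\<exists>g\<in>borel_measurable borel. AE x in lborel. f x = g x"
proof -
  have "\<forall>i\<in>Basis. \<exists>g\<in>borel_measurable lborel. AE x in lborel. f x \<bullet> i = g x"
  proof
    fix i :: 'b assume "i \<in> Basis"
    have "(\<lambda>x. f x \<bullet> i) \<in> borel_measurable lebesgue" using f by measurable
    then show "\<exists>g\<in>borel_measurable lborel. AE x in lborel. f x \<bullet> i = g x"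
      by (rule completion_ex_borel_measurable_real)
  qed
  then obtain g where g: "\<And>i. i \<in> Basis \<Longrightarrow> g i \<in> borel_measurable lborel" "\<And>i. i \<in> Basis \<Longrightarrow> AE x in lborel. f x \<bullet> i = g i x"
    by metis
  have "AE x in lborel. \<forall>i\<in>Basis. f x \<bullet> i = g i x"
    using g(2) by (intro AE_finite_allI) auto
  then have ae: "AE x in lborel. f x = (\<Sum>i\<in>Basis. g i x *\<^sub>R i)"
  proof eventually_elim
    case (elim x)
    have "f x = (\<Sum>i\<in>Basis. (f x \<bullet> i) *\<^sub>R i)" by (simp add: euclidean_representation)
    also have "\<dots> = (\<Sum>i\<in>Basis. g i x *\<^sub>R i)" using elim by (intro sum.cong) auto
    finally show ?case .
  qed
  have "(\<lambda>x. \<Sum>i\<in>Basis. g i x *\<^sub>R i) \<in> borel_measurable borel"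
    using g(1) by (intro borel_measurable_sum borel_measurable_scaleR) auto
  then show ?thesis by (intro bexI[where x = "\<lambda>x. \<Sum>i\<in>Basis. g i x *\<^sub>R i"] ae)
qed

lemma AE_lebesgue_on_iff:
  assumes "S \<in> sets borel"
  shows "(AE x in lebesgue_on S. P x) \<longleftrightarrow> (AE x in lborel. x \<in> S \<longrightarrow> P x)"
proof -
  have "S \<in> sets lebesgue" using assms by simp
  then show ?thesis by (simp add: AE_restrict_space_iff AE_completion_iff)
qed

lemma nn_integral_lebesgue_on:
  assumes "S \<in> sets borel"
  shows "(\<integral>\<^sup>+x. f x \<partial>lebesgue_on S) = (\<integral>\<^sup>+x\<in>S. f x \<partial>lborel)"
proof -
  have "S \<inter> space lebesgue \<in> sets lebesgue" using assms by simp
  then show ?thesis by (simp add: nn_integral_restrict_space nn_integral_completion)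
qed

lemma measurable_lebesgue_onI:
  fixes f g :: "'a::euclidean_space \<Rightarrow> 'b::euclidean_space"
  assumes "S \<in> sets borel" "g \<in> borel_measurable borel" "AE x in lborel. x \<in> S \<longrightarrow> f x = g x"
  shows "f \<in> borel_measurable (lebesgue_on S)"
proof -
  note [measurable] = assms(1,2)
  have "(\<lambda>x. if x \<in> S then g x else 0) \<in> borel_measurable borel" by measurable
  then have "(\<lambda>x. if x \<in> S then g x else 0) \<in> borel_measurable lebesgue"
    by (auto intro: measurable_completion)
  moreover have "AE x in lebesgue. (if x \<in> S then g x else 0) = (if x \<in> S then f x else 0)"
    unfolding AE_completion_iff using assms(3) by eventually_elim auto
  ultimately have "(\<lambda>x. if x \<in> S then f x else 0) \<in> borel_measurable lebesgue"
    by (rule completion.borel_measurable_cong_AE)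
  then show ?thesis using assms(1) by (subst (asm) borel_measurable_if) auto
qed

text \<open>Allows the locale \<open>Lagrangian\<close> to be instantiated on the slab.\<close>

lemma complete_measure_lebesgue_on:
  fixes S :: "'a::euclidean_space set"
  assumes "S \<in> sets borel"
  shows "complete_measure (lebesgue_on S)"
proof
  fix A B :: "'a set" assume AB: "A \<subseteq> B" "B \<in> null_sets (lebesgue_on S)"
  have S: "S \<in> sets lebesgue" using assms by simp
  have "B \<in> null_sets lebesgue" "B \<subseteq> S" using AB(2) S by (auto simp: null_sets_restrict_space)
  then have "A \<in> sets lebesgue" "A \<subseteq> S" using AB(1) by (auto intro: completion.complete)
  then show "A \<in> sets (lebesgue_on S)" using S by (simp add: sets_restrict_space_iff)
qed

lemma lebesgue_on_integral_cong:
  fixes F F' :: "'a::euclidean_space \<Rightarrow> 'b::euclidean_space"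
  assumes S: "S \<in> sets borel" and F': "F' \<in> borel_measurable borel" and 0: "\<And>x. x \<notin> S \<Longrightarrow> F' x = 0"
    and ae: "AE x in lborel. x \<in> S \<longrightarrow> F x = F' x"
  shows "(LINT x|lebesgue_on S. F x) = (LINT x|lborel. F' x)"
proof -
  have ae': "AE x in lebesgue. F' x = indicator S x *\<^sub>R F x"
    unfolding AE_completion_iff using ae by eventually_elim (use 0 in \<open>auto simp: indicator_def\<close>)
  have m: "F' \<in> borel_measurable lebesgue" using F' by (auto intro: measurable_completion)
  have "(LINT x|lebesgue_on S. F x) = (LINT x|lebesgue. indicator S x *\<^sub>R F x)"
    using S by (intro integral_restrict_space) auto
  also have "\<dots> = (LINT x|lebesgue. F' x)"
    using ae' m completion.borel_measurable_cong_AE[OF m ae'] by (intro integral_cong_AE) (auto elim: eventually_mono)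
  also have "\<dots> = (LINT x|lborel. F' x)" using F' by (intro integral_completion) auto
  finally show ?thesis .
qed

lemma absolutely_integrable_on_cong_borel:
  fixes u u' :: "'a::euclidean_space \<Rightarrow> 'b::euclidean_space"
  assumes K: "K \<in> sets borel" and u': "u' \<in> borel_measurable borel" and ae: "AE x in lborel. x \<in> K \<longrightarrow> u x = u' x"
  shows "u absolutely_integrable_on K \<longleftrightarrow> set_integrable lborel K u'"
proof -
  have m: "(\<lambda>x. indicator K x *\<^sub>R u' x) \<in> borel_measurable lborel" using K u' by measurable
  then have m': "(\<lambda>x. indicator K x *\<^sub>R u' x) \<in> borel_measurable lebesgue" by (rule measurable_completion)
  have ae': "AE x in lebesgue. indicator K x *\<^sub>R u' x = indicator K x *\<^sub>R u x"
    unfolding AE_completion_iff using ae by eventually_elim (auto simp: indicator_def)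
  have "u absolutely_integrable_on K \<longleftrightarrow> integrable lebesgue (\<lambda>x. indicator K x *\<^sub>R u' x)"
    unfolding set_integrable_def
    by (rule integrable_cong_AE[OF completion.borel_measurable_cong_AE[OF m' ae'] m'])
      (use ae' in \<open>auto elim: eventually_mono\<close>)
  also have "\<dots> \<longleftrightarrow> set_integrable lborel K u'"
    unfolding set_integrable_def using m by (rule integrable_completion)
  finally show ?thesis .
qed

lemma L1_loc_representative:
  fixes u :: "'a::euclidean_space \<Rightarrow> 'b::euclidean_space"
  assumes \<Omega>: "open \<Omega>" and u: "in_L1_loc \<Omega> u"
  obtains u' where "u' \<in> borel_measurable borel" "\<And>x. x \<notin> \<Omega> \<Longrightarrow> u' x = 0" "AE x in lborel. x \<in> \<Omega> \<longrightarrow> u x = u' x"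
    "\<And>K. compact K \<Longrightarrow> K \<subseteq> \<Omega> \<Longrightarrow> set_integrable lborel K u'"
proof -
  have [measurable]: "\<Omega> \<in> sets borel" using \<Omega> by simp
  have "(\<lambda>x. if x \<in> \<Omega> then u x else 0) \<in> borel_measurable lebesgue"
    using u by (subst borel_measurable_if) (auto simp: in_L1_loc_def)
  then obtain g where [measurable]: "g \<in> borel_measurable borel" and g: "AE x in lborel. (if x \<in> \<Omega> then u x else 0) = g x"
    using borel_representative by blast
  define u' where "u' x = (if x \<in> \<Omega> then g x else 0)" for x
  have [measurable]: "u' \<in> borel_measurable borel" unfolding u'_def by measurable
  have ae: "AE x in lborel. x \<in> \<Omega> \<longrightarrow> u x = u' x" using g by eventually_elim (auto simp: u'_def)
  have "set_integrable lborel K u'" if K: "compact K" "K \<subseteq> \<Omega>" for K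
  proof -
    have "AE x in lborel. x \<in> K \<longrightarrow> u x = u' x" using ae by eventually_elim (use K in auto)
    then show ?thesis
      using absolutely_integrable_on_cong_borel[OF borel_compact[OF K(1)], of u' u] u K by (auto simp: in_L1_loc_def)
  qed
  then show ?thesis using that[of u'] ae by (auto simp: u'_def)
qed

text \<open>The defining conditions of a weak gradient are integrals and do not notice changes on
  null sets, so Borel representatives extended by 0 inherit them.\<close>

lemma weak_pair_of_weak_grad:
  fixes u :: "'a::euclidean_space \<Rightarrow> real"
  assumes \<Omega>: "open \<Omega>" and u: "in_L1_loc \<Omega> u" and D: "is_weak_grad \<Omega> u D"
  obtains u' D' where "weak_pair \<Omega> u' D'" "AE x in lborel. x \<in> \<Omega> \<longrightarrow> u x = u' x" "AE x in lborel. x \<in> \<Omega> \<longrightarrow> D x = D' x"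
proof -
  have \<Omega>b: "\<Omega> \<in> sets borel" using \<Omega> by simp
  obtain u' where u': "u' \<in> borel_measurable borel" "\<And>x. x \<notin> \<Omega> \<Longrightarrow> u' x = 0" "AE x in lborel. x \<in> \<Omega> \<longrightarrow> u x = u' x"
    "\<And>K. compact K \<Longrightarrow> K \<subseteq> \<Omega> \<Longrightarrow> set_integrable lborel K u'"
    by (rule L1_loc_representative[OF \<Omega> u]) (rule that)
  have "in_L1_loc \<Omega> D" using D by (simp add: is_weak_grad_def)
  from L1_loc_representative[OF \<Omega> this]
  obtain D' where D': "D' \<in> borel_measurable borel" "\<And>x. x \<notin> \<Omega> \<Longrightarrow> D' x = 0" "AE x in lborel. x \<in> \<Omega> \<longrightarrow> D x = D' x"
    "\<And>K. compact K \<Longrightarrow> K \<subseteq> \<Omega> \<Longrightarrow> set_integrable lborel K D'" by metis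
  have "weak_pair \<Omega> u' D'"
    unfolding weak_pair_def
  proof (intro conjI allI impI ballI)
    fix \<phi> and i :: 'a assume \<phi>: "\<phi> \<in> test_functions \<Omega>" and i: "i \<in> Basis"
    have Ck: "Ck 1 \<phi>" using \<phi> by (auto simp: test_functions_def)
    note [measurable] = grad_borel_measurable[OF Ck] Ck_1_borel_measurable[OF Ck] u'(1) D'(1)
    have "(LINT x|lborel. u' x * (grad \<phi> x \<bullet> i)) = (LINT x|lebesgue_on \<Omega>. u x * (grad \<phi> x \<bullet> i))"
      by (rule lebesgue_on_integral_cong[OF \<Omega>b, symmetric]) (use u'(2,3) in \<open>auto elim: eventually_mono\<close>)
    also have "\<dots> = - (LINT x|lebesgue_on \<Omega>. (D x \<bullet> i) * \<phi> x)"
      using D \<phi> i by (simp add: is_weak_grad_def)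
    also have "(LINT x|lebesgue_on \<Omega>. (D x \<bullet> i) * \<phi> x) = (LINT x|lborel. (D' x \<bullet> i) * \<phi> x)"
      by (rule lebesgue_on_integral_cong[OF \<Omega>b]) (use D'(2,3) in \<open>auto elim: eventually_mono\<close>)
    finally show "(LINT x|lborel. u' x * (grad \<phi> x \<bullet> i)) = - (LINT x|lborel. (D' x \<bullet> i) * \<phi> x)" .
  qed (use u' D' in auto)
  then show ?thesis using that u'(3) D'(3) by blast
qed

lemma weak_grad_of_weak_pair:
  fixes u :: "'a::euclidean_space \<Rightarrow> real"
  assumes \<Omega>: "open \<Omega>" and wp: "weak_pair \<Omega> u' D'"
    and u: "AE x in lborel. x \<in> \<Omega> \<longrightarrow> u x = u' x" and D: "AE x in lborel. x \<in> \<Omega> \<longrightarrow> D x = D' x"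
  shows "in_L1_loc \<Omega> u" "is_weak_grad \<Omega> u D"
proof -
  have \<Omega>b: "\<Omega> \<in> sets borel" using \<Omega> by simp
  have m[measurable]: "u' \<in> borel_measurable borel" "D' \<in> borel_measurable borel" using wp by (auto simp: weak_pair_def)
  have aK: "AE x in lborel. x \<in> K \<longrightarrow> u x = u' x" "AE x in lborel. x \<in> K \<longrightarrow> D x = D' x" if "K \<subseteq> \<Omega>" for K
    by (rule eventually_mono[OF u], use that in blast) (rule eventually_mono[OF D], use that in blast)
  show u1: "in_L1_loc \<Omega> u"
    unfolding in_L1_loc_def
    using measurable_lebesgue_onI[OF \<Omega>b m(1) u] absolutely_integrable_on_cong_borel[OF borel_compact m(1) aK(1)] wp
    by (auto simp: weak_pair_def)
  have D1: "in_L1_loc \<Omega> D"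
    unfolding in_L1_loc_def
    using measurable_lebesgue_onI[OF \<Omega>b m(2) D] absolutely_integrable_on_cong_borel[OF borel_compact m(2) aK(2)] wp
    by (auto simp: weak_pair_def)
  show "is_weak_grad \<Omega> u D"
    unfolding is_weak_grad_def
  proof (intro conjI ballI D1)
    fix \<phi> and i :: 'a assume \<phi>: "\<phi> \<in> test_functions \<Omega>" and i: "i \<in> Basis"
    have Ck: "Ck 1 \<phi>" using \<phi> by (auto simp: test_functions_def)
    note [measurable] = grad_borel_measurable[OF Ck] Ck_1_borel_measurable[OF Ck]
    have 0: "u' x = 0" "D' x = 0" if "x \<notin> \<Omega>" for x using wp that by (auto simp: weak_pair_def)
    have "(LINT x|lebesgue_on \<Omega>. u x * (grad \<phi> x \<bullet> i)) = (LINT x|lborel. u' x * (grad \<phi> x \<bullet> i))"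
      by (rule lebesgue_on_integral_cong[OF \<Omega>b]) (use 0 u in \<open>auto elim: eventually_mono\<close>)
    also have "\<dots> = - (LINT x|lborel. (D' x \<bullet> i) * \<phi> x)" using wp \<phi> i by (simp add: weak_pair_def)
    also have "(LINT x|lborel. (D' x \<bullet> i) * \<phi> x) = (LINT x|lebesgue_on \<Omega>. (D x \<bullet> i) * \<phi> x)"
      by (rule lebesgue_on_integral_cong[OF \<Omega>b, symmetric]) (use 0 D in \<open>auto elim: eventually_mono\<close>)
    finally show "(LINT x|lebesgue_on \<Omega>. u x * (grad \<phi> x \<bullet> i)) = - (LINT x|lebesgue_on \<Omega>. (D x \<bullet> i) * \<phi> x)" .
  qed
qed

text \<open>Equal functions give the same integrals against gradients of test functions; the
  fundamental lemma is then applied to each coordinate of \<open>D - E\<close>.\<close>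

lemma weak_pair_gradient_unique:
  fixes u :: "'a::euclidean_space \<Rightarrow> real"
  assumes \<Omega>: "open \<Omega>" and D: "weak_pair \<Omega> u D" and E: "weak_pair \<Omega> v E"
    and uv: "AE x in lborel. x \<in> \<Omega> \<longrightarrow> u x = v x"
  shows "AE x in lborel. x \<in> \<Omega> \<longrightarrow> D x = E x"
proof -
  have [measurable]: "u \<in> borel_measurable borel" "v \<in> borel_measurable borel" "D \<in> borel_measurable borel" "E \<in> borel_measurable borel"
    using D E by (auto simp: weak_pair_def)
  have "AE x in lborel. x \<in> \<Omega> \<longrightarrow> (D x - E x) \<bullet> i = 0" if i: "i \<in> Basis" for i
  proof (rule fundamental_lemma_calculus_of_variations[OF _ \<Omega>])
    show "(\<lambda>x. (D x - E x) \<bullet> i) \<in> borel_measurable borel" by measurable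
    fix K :: "'a set" assume K: "compact K" "K \<subseteq> \<Omega>"
    have "integrable lborel (\<lambda>x. indicator K x *\<^sub>R D x)" "integrable lborel (\<lambda>x. indicator K x *\<^sub>R E x)"
      using D E K by (auto simp: weak_pair_def set_integrable_def)
    then have "integrable lborel (\<lambda>x. (indicator K x *\<^sub>R D x - indicator K x *\<^sub>R E x) \<bullet> i)"
      by (intro integrable_inner_left Bochner_Integration.integrable_diff)
    then show "set_integrable lborel K (\<lambda>x. (D x - E x) \<bullet> i)"
      by (simp add: set_integrable_def inner_diff_left algebra_simps)
  next
    fix \<phi> assume \<phi>: "\<phi> \<in> test_functions \<Omega>"
    have Ck: "Ck 1 \<phi>" using \<phi> by (auto simp: test_functions_def)
    note [measurable] = grad_borel_measurable[OF Ck] Ck_1_borel_measurable[OF Ck]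
    have "(LINT x|lborel. u x * (grad \<phi> x \<bullet> i)) = (LINT x|lborel. v x * (grad \<phi> x \<bullet> i))"
    proof (rule integral_cong_AE)
      show "AE x in lborel. u x * (grad \<phi> x \<bullet> i) = v x * (grad \<phi> x \<bullet> i)"
        using uv
      proof eventually_elim
        case (elim x)
        then show ?case using D E by (cases "x \<in> \<Omega>") (auto simp: weak_pair_def)
      qed
    qed measurable
    then have "(LINT x|lborel. (D x \<bullet> i) * \<phi> x) = (LINT x|lborel. (E x \<bullet> i) * \<phi> x)"
      using D E \<phi> i by (simp add: weak_pair_def)
    moreover have "(LINT x|lborel. ((D x - E x) \<bullet> i) * \<phi> x) = (LINT x|lborel. (D x \<bullet> i) * \<phi> x) - (LINT x|lborel. (E x \<bullet> i) * \<phi> x)"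
      using weak_pair_integrable(2)[OF D \<phi> i] weak_pair_integrable(2)[OF E \<phi> i]
      by (simp add: inner_diff_left left_diff_distrib)
    ultimately show "(LINT x|lborel. ((D x - E x) \<bullet> i) * \<phi> x) = 0" by simp
  qed
  then have "AE x in lborel. \<forall>i\<in>Basis. x \<in> \<Omega> \<longrightarrow> (D x - E x) \<bullet> i = 0" by (intro AE_finite_allI) auto
  then show ?thesis
  proof eventually_elim
    case (elim x)
    show ?case
    proof
      assume "x \<in> \<Omega>"
      then have "D x \<bullet> i = E x \<bullet> i" if "i \<in> Basis" for i using elim that by (simp add: inner_diff_left)
      then show "D x = E x" by (rule euclidean_eqI)
    qed
  qed
qed

section \<open>Transfer of the results to \<open>hom_sobolev\<close> and \<open>Tr\<close>\<close>

context slab_data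
begin

text \<open>Agreement is required for the function only. That \<open>D'\<close> equals the chosen
  \<open>weak_grad\<close> almost everywhere is a consequence of uniqueness.\<close>

definition represents :: "('a \<Rightarrow> real) \<Rightarrow> ('a \<Rightarrow> real) \<Rightarrow> ('a \<Rightarrow> 'a) \<Rightarrow> bool" where
  "represents u u' D' \<longleftrightarrow> weak_pair \<Omega> u' D' \<and> (\<integral>\<^sup>+x. ennreal (norm (D' x) powr p) \<partial>lborel) < \<infinity> \<and>
     (AE x in lborel. x \<in> \<Omega> \<longrightarrow> u x = u' x)"

lemma nn_integral_slab_eq:
  assumes "AE x in lborel. x \<in> \<Omega> \<longrightarrow> D x = D' x" "\<And>x. x \<notin> \<Omega> \<Longrightarrow> D' x = 0"
  shows "(\<integral>\<^sup>+x. ennreal (norm (D x) powr p) \<partial>lebesgue_on \<Omega>) = (\<integral>\<^sup>+x. ennreal (norm (D' x) powr p) \<partial>lborel)"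
  unfolding nn_integral_lebesgue_on[OF slab_borel]
proof (rule nn_integral_cong_AE)
  show "AE x in lborel. ennreal (norm (D x) powr p) * indicator \<Omega> x = ennreal (norm (D' x) powr p)"
    using assms(1) by eventually_elim (use assms(2) in \<open>auto simp: indicator_def\<close>)
qed

lemma hom_sobolev_represents:
  assumes "u \<in> hom_sobolev \<Omega> p"
  obtains u' D' where "represents u u' D'"
proof -
  obtain D where u: "in_L1_loc \<Omega> u" and D: "is_weak_grad \<Omega> u D" "in_Lp (lebesgue_on \<Omega>) p D"
    using assms by (auto simp: hom_sobolev_def)
  obtain u' D' where wp: "weak_pair \<Omega> u' D'" "AE x in lborel. x \<in> \<Omega> \<longrightarrow> u x = u' x" "AE x in lborel. x \<in> \<Omega> \<longrightarrow> D x = D' x"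
    by (rule weak_pair_of_weak_grad[OF open_slab u D(1)]) (rule that)
  have "(\<integral>\<^sup>+x. ennreal (norm (D' x) powr p) \<partial>lborel) < \<infinity>"
    using D(2) nn_integral_slab_eq[OF wp(3) weak_pairD(4)[OF wp(1)]] by (simp add: in_Lp_iff_nn_integral)
  then show ?thesis using that wp by (auto simp: represents_def)
qed

text \<open>\<open>weak_grad\<close> is a choice among weak gradients; any two of them agree almost
  everywhere, so it may be replaced by the Borel field \<open>D'\<close>.\<close>

lemma represents_hom_sobolev:
  assumes "represents u u' D'"
  shows "u \<in> hom_sobolev \<Omega> p" "AE x in lborel. x \<in> \<Omega> \<longrightarrow> weak_grad \<Omega> u x = D' x"
proof -
  have wp: "weak_pair \<Omega> u' D'" and fin: "(\<integral>\<^sup>+x. ennreal (norm (D' x) powr p) \<partial>lborel) < \<infinity>"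
    and ae: "AE x in lborel. x \<in> \<Omega> \<longrightarrow> u x = u' x"
    using assms by (auto simp: represents_def)
  have u: "in_L1_loc \<Omega> u" "is_weak_grad \<Omega> u D'"
    using weak_grad_of_weak_pair[OF open_slab wp ae, of D'] by auto
  have "in_Lp (lebesgue_on \<Omega>) p D'"
    using fin nn_integral_slab_eq[of D' D'] weak_pairD(4)[OF wp] u(2)
    by (auto simp: in_Lp_iff_nn_integral is_weak_grad_def in_L1_loc_def)
  then show "u \<in> hom_sobolev \<Omega> p" using u by (auto simp: hom_sobolev_def)
  have wg: "is_weak_grad \<Omega> u (weak_grad \<Omega> u)" unfolding weak_grad_def by (rule someI[of "is_weak_grad \<Omega> u", OF u(2)])
  obtain v E where v: "weak_pair \<Omega> v E" "AE x in lborel. x \<in> \<Omega> \<longrightarrow> u x = v x" "AE x in lborel. x \<in> \<Omega> \<longrightarrow> weak_grad \<Omega> u x = E x"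
    by (rule weak_pair_of_weak_grad[OF open_slab u(1) wg]) (rule that)
  have "AE x in lborel. x \<in> \<Omega> \<longrightarrow> v x = u' x" using v(2) ae by eventually_elim auto
  from weak_pair_gradient_unique[OF open_slab v(1) wp this] v(3)
  show "AE x in lborel. x \<in> \<Omega> \<longrightarrow> weak_grad \<Omega> u x = D' x" by eventually_elim auto
qed

lemma represents_linear:
  assumes u: "represents u u' D" and v: "represents v v' E"
  shows "represents (\<lambda>x. s * u x + t * v x) (\<lambda>x. s * u' x + t * v' x) (\<lambda>x. s *\<^sub>R D x + t *\<^sub>R E x)"
  unfolding represents_def
proof (intro conjI)
  have wp: "weak_pair \<Omega> u' D" "weak_pair \<Omega> v' E" using u v by (auto simp: represents_def)
  show "weak_pair \<Omega> (\<lambda>x. s * u' x + t * v' x) (\<lambda>x. s *\<^sub>R D x + t *\<^sub>R E x)"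
    by (rule weak_pair_linear[OF wp])
  have "in_Lp lborel p D" "in_Lp lborel p E"
    using u v weak_pairD(2)[OF wp(1)] weak_pairD(2)[OF wp(2)] by (auto simp: represents_def in_Lp_iff_nn_integral)
  then have "in_Lp lborel p (\<lambda>x. s *\<^sub>R D x + t *\<^sub>R E x)" using p by (intro in_Lp_add_scaleR) auto
  then show "(\<integral>\<^sup>+x. ennreal (norm (s *\<^sub>R D x + t *\<^sub>R E x) powr p) \<partial>lborel) < \<infinity>" by (simp add: in_Lp_iff_nn_integral)
  have "AE x in lborel. x \<in> \<Omega> \<longrightarrow> u x = u' x" "AE x in lborel. x \<in> \<Omega> \<longrightarrow> v x = v' x" using u v by (auto simp: represents_def)
  then show "AE x in lborel. x \<in> \<Omega> \<longrightarrow> s * u x + t * v x = s * u' x + t * v' x" by eventually_elim auto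
qed

lemma hom_sobolev_linear:
  assumes "u \<in> hom_sobolev \<Omega> p" "v \<in> hom_sobolev \<Omega> p"
  shows "(\<lambda>x. s * u x + t * v x) \<in> hom_sobolev \<Omega> p"
    "AE x in lebesgue_on \<Omega>. weak_grad \<Omega> (\<lambda>x. s * u x + t * v x) x = s *\<^sub>R weak_grad \<Omega> u x + t *\<^sub>R weak_grad \<Omega> v x"
proof -
  obtain u' D where u: "represents u u' D" by (rule hom_sobolev_represents[OF assms(1)]) (rule that)
  obtain v' E where v: "represents v v' E" by (rule hom_sobolev_represents[OF assms(2)]) (rule that)
  note r = represents_linear[OF u v, of s t]
  show "(\<lambda>x. s * u x + t * v x) \<in> hom_sobolev \<Omega> p" by (rule represents_hom_sobolev(1)[OF r])
  show "AE x in lebesgue_on \<Omega>. weak_grad \<Omega> (\<lambda>x. s * u x + t * v x) x = s *\<^sub>R weak_grad \<Omega> u x + t *\<^sub>R weak_grad \<Omega> v x"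
    unfolding AE_lebesgue_on_iff[OF slab_borel]
    using represents_hom_sobolev(2)[OF r] represents_hom_sobolev(2)[OF u] represents_hom_sobolev(2)[OF v]
    by eventually_elim auto
qed

lemma weak_grad_in_Lp:
  assumes "u \<in> hom_sobolev \<Omega> p"
  shows "in_Lp (lebesgue_on \<Omega>) p (weak_grad \<Omega> u)"
proof -
  obtain u' D where u: "represents u u' D" by (rule hom_sobolev_represents[OF assms]) (rule that)
  have wp: "weak_pair \<Omega> u' D" using u by (simp add: represents_def)
  note ae = represents_hom_sobolev(2)[OF u]
  show ?thesis
    using measurable_lebesgue_onI[OF slab_borel weak_pairD(2)[OF wp] ae] nn_integral_slab_eq[OF ae weak_pairD(4)[OF wp]] u
    by (simp add: in_Lp_iff_nn_integral represents_def)
qed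

text \<open>Supplies the closedness assumption of \<open>Lagrangian_on_subspace\<close>: an
  \<open>L^p\<close> limit of gradients is again a gradient.\<close>

lemma hom_sobolev_complete:
  assumes v: "\<And>n::nat. v n \<in> hom_sobolev \<Omega> p" and E: "in_Lp (lebesgue_on \<Omega>) p E"
    and lim: "(\<lambda>n. \<integral>\<^sup>+x. ennreal (norm (weak_grad \<Omega> (v n) x - E x) powr p) \<partial>lebesgue_on \<Omega>) \<longlonglongrightarrow> 0"
  shows "\<exists>u\<in>hom_sobolev \<Omega> p. AE x in lebesgue_on \<Omega>. E x = weak_grad \<Omega> u x"
proof -
  have "\<exists>v' D. represents (v n) v' D" for n by (rule hom_sobolev_represents[OF v[of n]]) blast
  then obtain v' D where r: "\<And>n. represents (v n) (v' n) (D n)" by metis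
  have wp: "weak_pair \<Omega> (v' n) (D n)" and fin: "(\<integral>\<^sup>+x. ennreal (norm (D n x) powr p) \<partial>lborel) < \<infinity>" for n
    using r[of n] by (auto simp: represents_def)
  have "(\<lambda>x. if x \<in> \<Omega> then E x else 0) \<in> borel_measurable lebesgue"
    using in_LpD(1)[OF E] by (subst borel_measurable_if) auto
  then obtain g where [measurable]: "g \<in> borel_measurable borel" and g: "AE x in lborel. (if x \<in> \<Omega> then E x else 0) = g x"
    using borel_representative by blast
  define E' where "E' x = (if x \<in> \<Omega> then g x else 0)" for x
  have E'm: "E' \<in> borel_measurable borel" unfolding E'_def by measurable
  have E': "AE x in lborel. x \<in> \<Omega> \<longrightarrow> E x = E' x" using g by eventually_elim (auto simp: E'_def)
  have E'0: "E' x = 0" if "x \<notin> \<Omega>" for x using that by (simp add: E'_def)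
  have "(\<integral>\<^sup>+x. ennreal (norm (weak_grad \<Omega> (v n) x - E x) powr p) \<partial>lebesgue_on \<Omega>) = (\<integral>\<^sup>+x. ennreal (norm (D n x - E' x) powr p) \<partial>lborel)" for n
  proof (rule nn_integral_slab_eq)
    show "AE x in lborel. x \<in> \<Omega> \<longrightarrow> weak_grad \<Omega> (v n) x - E x = D n x - E' x"
      using represents_hom_sobolev(2)[OF r] E' by eventually_elim auto
  qed (simp add: weak_pairD(4)[OF wp] E'0)
  with lim have lim': "(\<lambda>n. \<integral>\<^sup>+x. ennreal (norm (D n x - E' x) powr p) \<partial>lborel) \<longlonglongrightarrow> 0" by simp
  have "\<exists>u. weak_pair \<Omega> u E'"
    by (rule weak_gradient_complete[OF wp fin E'm E'0 lim'])
  then obtain u where u: "weak_pair \<Omega> u E'" by blast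
  have "(\<integral>\<^sup>+x. ennreal (norm (E' x) powr p) \<partial>lborel) < \<infinity>"
    using E nn_integral_slab_eq[OF E' E'0] by (simp add: in_Lp_iff_nn_integral)
  then have ru: "represents u u E'" using u by (auto simp: represents_def)
  have "AE x in lborel. x \<in> \<Omega> \<longrightarrow> E x = weak_grad \<Omega> u x"
    using represents_hom_sobolev(2)[OF ru] E' by eventually_elim auto
  then show ?thesis using represents_hom_sobolev(1)[OF ru] unfolding AE_lebesgue_on_iff[OF slab_borel, symmetric] by blast
qed

lemma nn_integral_ball_lebesgue_on:
  "(\<integral>\<^sup>+x\<in>ball 0 R. f x \<partial>lebesgue_on \<Omega>) = (\<integral>\<^sup>+x\<in>piece R. f x \<partial>lborel)"
  unfolding nn_integral_lebesgue_on[OF slab_borel]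
  by (intro nn_integral_cong) (auto simp: indicator_def piece_def)

lemma nn_integral_piece_cong:
  "AE x in lborel. x \<in> \<Omega> \<longrightarrow> f x = g x \<Longrightarrow> (\<integral>\<^sup>+x\<in>piece R. f x \<partial>lborel) = (\<integral>\<^sup>+x\<in>piece R. g x \<partial>lborel)"
  by (intro nn_integral_cong_AE) (auto elim!: eventually_mono simp: indicator_def piece_def)

lemma is_trace_iff:
  assumes r: "represents u u' D"
  shows "is_trace e b1 b2 p u g \<longleftrightarrow> in_Lp_loc_bdry e b1 b2 p g \<and> (\<exists>U::nat \<Rightarrow> 'a \<Rightarrow> real. (\<forall>j. Ck 1 (U j)) \<and>
    (\<forall>R>0. (\<lambda>j. \<integral>\<^sup>+x\<in>piece R. ennreal (\<bar>U j x - u' x\<bar> powr p) \<partial>lborel) \<longlonglongrightarrow> 0 \<and>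
       (\<lambda>j. \<integral>\<^sup>+x\<in>piece R. ennreal (norm (grad (U j) x - D x) powr p) \<partial>lborel) \<longlonglongrightarrow> 0 \<and>
       (\<lambda>j. \<integral>\<^sup>+x\<in>ball 0 R. ennreal (\<bar>U j x - g x\<bar> powr p) \<partial>slab_surface e b1 b2) \<longlonglongrightarrow> 0))"
proof -
  have "AE x in lborel. x \<in> \<Omega> \<longrightarrow> u x = u' x" using r by (simp add: represents_def)
  then have 1: "(\<integral>\<^sup>+x\<in>ball 0 R. ennreal (\<bar>U x - u x\<bar> powr p) \<partial>lebesgue_on \<Omega>) = (\<integral>\<^sup>+x\<in>piece R. ennreal (\<bar>U x - u' x\<bar> powr p) \<partial>lborel)" for U R
    unfolding nn_integral_ball_lebesgue_on by (intro nn_integral_piece_cong) (auto elim!: eventually_mono)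
  have 2: "(\<integral>\<^sup>+x\<in>ball 0 R. ennreal (norm (H x - weak_grad \<Omega> u x) powr p) \<partial>lebesgue_on \<Omega>) = (\<integral>\<^sup>+x\<in>piece R. ennreal (norm (H x - D x) powr p) \<partial>lborel)" for H R
    unfolding nn_integral_ball_lebesgue_on using represents_hom_sobolev(2)[OF r]
    by (intro nn_integral_piece_cong) (auto elim!: eventually_mono)
  show ?thesis unfolding is_trace_def 1 2 by blast
qed

lemma trace_exists:
  assumes "u \<in> hom_sobolev \<Omega> p"
  shows "\<exists>g. is_trace e b1 b2 p u g"
proof -
  obtain u' D where r: "represents u u' D" by (rule hom_sobolev_represents[OF assms]) (rule that)
  have wp: "weak_pair \<Omega> u' D" and fin: "(\<integral>\<^sup>+x. ennreal (norm (D x) powr p) \<partial>lborel) < \<infinity>" using r by (auto simp: represents_def)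
  obtain U where U: "\<And>j::nat. Ck 1 (U j)"
    and Uu: "\<And>R. 0 < R \<Longrightarrow> (\<lambda>j. \<integral>\<^sup>+x\<in>piece R. ennreal (\<bar>U j x - u' x\<bar> powr p) \<partial>lborel) \<longlonglongrightarrow> 0"
    and UD: "(\<lambda>j. \<integral>\<^sup>+x\<in>\<Omega>. ennreal (norm (grad (U j) x - D x) powr p) \<partial>lborel) \<longlonglongrightarrow> 0"
    by (rule smooth_approximation[OF wp fin]) (rule that)
  note UD' = grad_lim_piece[OF UD]
  obtain g where g: "g \<in> borel_measurable borel"
    "\<And>R. 0 < R \<Longrightarrow> (\<lambda>j. \<integral>\<^sup>+x\<in>ball 0 R. ennreal (\<bar>U j x - g x\<bar> powr p) \<partial>surface0) \<longlonglongrightarrow> 0"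
    "\<And>R. (\<integral>\<^sup>+x\<in>ball 0 R. ennreal (\<bar>g x\<bar> powr p) \<partial>surface0) < \<infinity>"
    by (rule surface_trace_exists[OF U weak_pairD(1,2)[OF wp] weak_pair_Lp_piece[OF wp fin] fin Uu UD']) (assumption, rule that)
  have "in_Lp_loc_bdry e b1 b2 p g"
    unfolding in_Lp_loc_bdry_def slab_surface_eq
  proof (intro conjI allI impI)
    have gm: "g \<in> borel_measurable surface0" using g(1) by simp
    then show "g \<in> borel_measurable (completion surface0)" by (rule measurable_completion)
    fix K :: "'a set" assume K: "compact K"
    have Kb: "K \<in> sets surface0" using borel_compact[OF K] by simp
    obtain R where R: "\<And>x. x \<in> K \<Longrightarrow> norm x < R"
      using compact_imp_bounded[OF K] by (auto simp: bounded_pos_less)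
    have m: "(\<lambda>x. indicator K x *\<^sub>R (\<bar>g x\<bar> powr p)) \<in> borel_measurable surface0"
      using gm Kb by (intro borel_measurable_scaleR borel_measurable_indicator) auto
    have "(\<integral>\<^sup>+x. ennreal (norm (indicator K x *\<^sub>R (\<bar>g x\<bar> powr p))) \<partial>surface0) \<le> (\<integral>\<^sup>+x\<in>ball 0 R. ennreal (\<bar>g x\<bar> powr p) \<partial>surface0)"
      using R by (intro nn_integral_mono) (auto simp: indicator_def)
    then have "integrable surface0 (\<lambda>x. indicator K x *\<^sub>R (\<bar>g x\<bar> powr p))"
      using g(3)[of R] m by (auto simp: integrable_iff_bounded intro: le_less_trans)
    then show "set_integrable (completion surface0) K (\<lambda>x. \<bar>g x\<bar> powr p)"
      unfolding set_integrable_def using m by (simp add: integrable_completion)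
  qed
  then have "is_trace e b1 b2 p u g"
    unfolding is_trace_iff[OF r] slab_surface_eq nn_integral_completion using U Uu UD' g(2) by blast
  then show ?thesis by blast
qed

text \<open>Stated for arbitrary traces, because \<open>Tr\<close> is only a choice. The same
  combination of the approximating sequences approximates the combined function, and uniqueness
  identifies its boundary values with those of any other sequence.\<close>

lemma trace_linear_unique:
  assumes u: "u \<in> hom_sobolev \<Omega> p" and v: "v \<in> hom_sobolev \<Omega> p"
    and g: "is_trace e b1 b2 p u g" and h: "is_trace e b1 b2 p v h" and k: "is_trace e b1 b2 p (\<lambda>x. s * u x + t * v x) k"
  shows "AE x in slab_surface e b1 b2. k x = s * g x + t * h x"
proof -
  obtain u' D where ru: "represents u u' D" by (rule hom_sobolev_represents[OF u]) (rule that)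
  obtain v' E where rv: "represents v v' E" by (rule hom_sobolev_represents[OF v]) (rule that)
  note r = represents_linear[OF ru rv, of s t]
  have wpu: "weak_pair \<Omega> u' D" and wpv: "weak_pair \<Omega> v' E" using ru rv by (auto simp: represents_def)
  note [measurable] = weak_pairD(1,2)[OF wpu] weak_pairD(1,2)[OF wpv]
  obtain U :: "nat \<Rightarrow> 'a \<Rightarrow> real" where U: "\<And>j. Ck 1 (U j)"
    and Uu: "\<And>R. 0 < R \<Longrightarrow> (\<lambda>j. \<integral>\<^sup>+x\<in>piece R. ennreal (\<bar>U j x - u' x\<bar> powr p) \<partial>lborel) \<longlonglongrightarrow> 0"
    and UD: "\<And>R. 0 < R \<Longrightarrow> (\<lambda>j. \<integral>\<^sup>+x\<in>piece R. ennreal (norm (grad (U j) x - D x) powr p) \<partial>lborel) \<longlonglongrightarrow> 0"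
    and Ug: "\<And>R. 0 < R \<Longrightarrow> (\<lambda>j. \<integral>\<^sup>+x\<in>ball 0 R. ennreal (\<bar>U j x - g x\<bar> powr p) \<partial>completion surface0) \<longlonglongrightarrow> 0"
    using g unfolding is_trace_iff[OF ru] slab_surface_eq by blast
  obtain V :: "nat \<Rightarrow> 'a \<Rightarrow> real" where V: "\<And>j. Ck 1 (V j)"
    and Vv: "\<And>R. 0 < R \<Longrightarrow> (\<lambda>j. \<integral>\<^sup>+x\<in>piece R. ennreal (\<bar>V j x - v' x\<bar> powr p) \<partial>lborel) \<longlonglongrightarrow> 0"
    and VE: "\<And>R. 0 < R \<Longrightarrow> (\<lambda>j. \<integral>\<^sup>+x\<in>piece R. ennreal (norm (grad (V j) x - E x) powr p) \<partial>lborel) \<longlonglongrightarrow> 0"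
    and Vh: "\<And>R. 0 < R \<Longrightarrow> (\<lambda>j. \<integral>\<^sup>+x\<in>ball 0 R. ennreal (\<bar>V j x - h x\<bar> powr p) \<partial>completion surface0) \<longlonglongrightarrow> 0"
    using h unfolding is_trace_iff[OF rv] slab_surface_eq by blast
  obtain W :: "nat \<Rightarrow> 'a \<Rightarrow> real" where W: "\<And>j. Ck 1 (W j)"
    and Wu: "\<And>R. 0 < R \<Longrightarrow> (\<lambda>j. \<integral>\<^sup>+x\<in>piece R. ennreal (\<bar>W j x - (s * u' x + t * v' x)\<bar> powr p) \<partial>lborel) \<longlonglongrightarrow> 0"
    and WD: "\<And>R. 0 < R \<Longrightarrow> (\<lambda>j. \<integral>\<^sup>+x\<in>piece R. ennreal (norm (grad (W j) x - (s *\<^sub>R D x + t *\<^sub>R E x)) powr p) \<partial>lborel) \<longlonglongrightarrow> 0"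
    and Wk: "\<And>R. 0 < R \<Longrightarrow> (\<lambda>j. \<integral>\<^sup>+x\<in>ball 0 R. ennreal (\<bar>W j x - k x\<bar> powr p) \<partial>completion surface0) \<longlonglongrightarrow> 0"
    using k unfolding is_trace_iff[OF r] slab_surface_eq by blast
  have gm: "g \<in> borel_measurable (completion surface0)" "h \<in> borel_measurable (completion surface0)" "k \<in> borel_measurable (completion surface0)"
    using g h k by (auto simp: is_trace_def in_Lp_loc_bdry_def slab_surface_eq)
  note [measurable] = grad_borel_measurable[OF U] Ck_1_borel_measurable[OF U] grad_borel_measurable[OF V] Ck_1_borel_measurable[OF V]
  have mU: "U j \<in> borel_measurable (completion surface0)" "V j \<in> borel_measurable (completion surface0)" for j
    by (auto intro!: measurable_completion)
  have ballb: "ball (0::'a) R \<in> sets (completion surface0)" for R by (intro sets_completionI_sets) simp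
  \<comment> \<open>Generic in measure and codomain, since it is used for the functions, for their
    gradients and for the boundary values.\<close>
  have lin: "(\<lambda>j. \<integral>\<^sup>+x\<in>S. ennreal (norm ((s *\<^sub>R f j x + t *\<^sub>R f' j x) - (s *\<^sub>R c x + t *\<^sub>R c' x)) powr p) \<partial>M) \<longlonglongrightarrow> 0"
    if m: "\<And>j. f j \<in> borel_measurable M" "\<And>j. f' j \<in> borel_measurable M" "c \<in> borel_measurable M" "c' \<in> borel_measurable M" "S \<in> sets M"
      and l: "(\<lambda>j. \<integral>\<^sup>+x\<in>S. ennreal (norm (f j x - c x) powr p) \<partial>M) \<longlonglongrightarrow> 0" "(\<lambda>j. \<integral>\<^sup>+x\<in>S. ennreal (norm (f' j x - c' x) powr p) \<partial>M) \<longlonglongrightarrow> 0"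
    for f f' :: "nat \<Rightarrow> 'a \<Rightarrow> 'b::euclidean_space" and c c' and M :: "'a measure" and S
  proof -
    have sc: "(\<lambda>j. \<integral>\<^sup>+x\<in>S. ennreal (norm (a *\<^sub>R F j x) powr p) \<partial>M) \<longlonglongrightarrow> 0"
      if Fm: "\<And>j. F j \<in> borel_measurable M" and F: "(\<lambda>j. \<integral>\<^sup>+x\<in>S. ennreal (norm (F j x) powr p) \<partial>M) \<longlonglongrightarrow> 0" for F :: "nat \<Rightarrow> 'a \<Rightarrow> 'b" and a :: real
    proof -
      note [measurable] = Fm m(5)
      have "(\<lambda>j. ennreal (\<bar>a\<bar> powr p) * (\<integral>\<^sup>+x\<in>S. ennreal (norm (F j x) powr p) \<partial>M)) \<longlonglongrightarrow> ennreal (\<bar>a\<bar> powr p) * 0"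
        by (intro ennreal_tendsto_cmult F) simp
      moreover have "ennreal (\<bar>a\<bar> powr p) * (\<integral>\<^sup>+x\<in>S. ennreal (norm (F j x) powr p) \<partial>M) = (\<integral>\<^sup>+x\<in>S. ennreal (norm (a *\<^sub>R F j x) powr p) \<partial>M)" for j
        by (subst nn_integral_cmult[symmetric]) (auto simp: powr_mult ennreal_mult mult.assoc)
      ultimately show ?thesis by simp
    qed
    note [measurable] = m
    \<comment> \<open>The sum is written as a difference through the intermediate function 0, so
      that \<open>Lp_tendsto_trans\<close> applies.\<close>
    have "(\<lambda>j. \<integral>\<^sup>+x\<in>S. ennreal (norm (s *\<^sub>R (f j x - c x) - (- t) *\<^sub>R (f' j x - c' x)) powr p) \<partial>M) \<longlonglongrightarrow> 0"
      by (rule Lp_tendsto_trans[where g = "\<lambda>j x. 0"])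
        (use p sc[of "\<lambda>j x. f j x - c x" s] sc[of "\<lambda>j x. f' j x - c' x" t] l in auto)
    then show ?thesis by (simp add: algebra_simps)
  qed
  define X where "X j x = s * U j x + t * V j x" for j x
  have gX: "GDERIV (X j) x :> s *\<^sub>R grad (U j) x + t *\<^sub>R grad (V j) x" for j x
    unfolding X_def using GDERIV_add[OF GDERIV_mult[OF GDERIV_const[of s] Ck_1_GDERIV[OF U]] GDERIV_mult[OF GDERIV_const[of t] Ck_1_GDERIV[OF V]]]
    by simp
  have X: "Ck 1 (X j)" for j unfolding X_def by (intro Ck_add Ck_mult Ck_const U V)
  have "AE x in completion surface0. k x = s * g x + t * h x"
  proof (rule surface_trace_unique[OF W X _ _ gm(3) _ Wu WD Wk])
    show "(\<lambda>x. s * g x + t * h x) \<in> borel_measurable (completion surface0)" using gm by auto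
    fix R :: real assume R: "0 < R"
    show "(\<lambda>j. \<integral>\<^sup>+x\<in>piece R. ennreal (\<bar>X j x - (s * u' x + t * v' x)\<bar> powr p) \<partial>lborel) \<longlonglongrightarrow> 0"
      using lin[of U lborel V u' v' "piece R"] Uu[OF R] Vv[OF R] by (simp add: X_def)
    show "(\<lambda>j. \<integral>\<^sup>+x\<in>piece R. ennreal (norm (grad (X j) x - (s *\<^sub>R D x + t *\<^sub>R E x)) powr p) \<partial>lborel) \<longlonglongrightarrow> 0"
      using lin[of "\<lambda>j. grad (U j)" lborel "\<lambda>j. grad (V j)" D E "piece R"] UD[OF R] VE[OF R] by (simp add: grad_eqI[OF gX])
    show "(\<lambda>j. \<integral>\<^sup>+x\<in>ball 0 R. ennreal (\<bar>X j x - (s * g x + t * h x)\<bar> powr p) \<partial>completion surface0) \<longlonglongrightarrow> 0"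
      using lin[of U "completion surface0" V g h "ball 0 R"] Ug[OF R] Vh[OF R] mU gm ballb by (simp add: X_def)
  qed auto
  then show ?thesis unfolding slab_surface_eq .
qed

end

section \<open>The Neumann problem\<close>

text \<open>Membership of the scaled functions is assumed because \<open>linear_functional\<close>
  does not require \<open>V\<close> to be a subspace.\<close>

lemma linear_functional_combination:
  assumes L: "linear_functional M V L" and u: "u \<in> V" "(\<lambda>x. s * u x) \<in> V" and v: "v \<in> V" "(\<lambda>x. t * v x) \<in> V"
  shows "L (\<lambda>x. s * u x + t * v x) = s * L u + t * L v"
proof -
  from L have add: "\<forall>u\<in>V. \<forall>v\<in>V. L (\<lambda>x. u x + v x) = L u + L v"
    unfolding linear_functional_def by (elim conjE)
  from L have sc: "\<forall>a. \<forall>u\<in>V. L (\<lambda>x. a * u x) = a * L u"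
    unfolding linear_functional_def by (elim conjE)
  have "L (\<lambda>x. s * u x + t * v x) = L (\<lambda>x. s * u x) + L (\<lambda>x. t * v x)"
    by (rule add[rule_format, OF u(2) v(2)])
  also have "L (\<lambda>x. s * u x) = s * L u" by (rule sc[rule_format, OF u(1)])
  also have "L (\<lambda>x. t * v x) = t * L v" by (rule sc[rule_format, OF v(1)])
  finally show ?thesis .
qed

lemma linear_functional_cong_AE:
  assumes L: "linear_functional M V L" and "g \<in> V" "h \<in> V" "AE x in M. g x = h x"
  shows "L g = L h"
proof -
  from L have "\<forall>u\<in>V. \<forall>v\<in>V. (AE x in M. u x = v x) \<longrightarrow> L u = L v"
    unfolding linear_functional_def by (elim conjE)
  then show ?thesis using assms by blast
qed

lemma Lp_norm_cong_AE:
  assumes "f \<in> borel_measurable M" "g \<in> borel_measurable M" "AE x in M. f x = g x"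
  shows "Lp_norm M p f = Lp_norm M p g"
proof -
  have "(LINT x|M. norm (f x) powr p) = (LINT x|M. norm (g x) powr p)"
    using assms by (intro integral_cong_AE) (auto elim: eventually_mono)
  then show ?thesis by (simp add: Lp_norm_def)
qed

lemma Lp_norm_scaleR:
  assumes "0 < p"
  shows "Lp_norm M p (\<lambda>x. a *\<^sub>R f x) = \<bar>a\<bar> * Lp_norm M p f"
proof -
  have "(LINT x|M. norm (a *\<^sub>R f x) powr p) = \<bar>a\<bar> powr p * (LINT x|M. norm (f x) powr p)"
    by (simp add: powr_mult)
  then show ?thesis using assms by (simp add: Lp_norm_def powr_mult powr_powr)
qed

context slab_data
begin

text \<open>\<open>\<Lambda>\<close> respects almost everywhere equality only between members of
  \<open>trace_space\<close>, so that set must be closed under changes on null sets.\<close>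

lemma is_trace_cong_AE:
  assumes k: "is_trace e b1 b2 p u k" and ae: "AE x in slab_surface e b1 b2. k x = g x"
  shows "is_trace e b1 b2 p u g"
proof -
  let ?S = "slab_surface e b1 b2"
  have km: "k \<in> borel_measurable ?S" using k by (simp add: is_trace_def in_Lp_loc_bdry_def)
  have gm: "g \<in> borel_measurable ?S"
    using km ae unfolding slab_surface_eq by (rule completion.borel_measurable_cong_AE)
  have nn: "(\<integral>\<^sup>+x\<in>ball 0 R. ennreal (\<bar>U x - g x\<bar> powr p) \<partial>?S) = (\<integral>\<^sup>+x\<in>ball 0 R. ennreal (\<bar>U x - k x\<bar> powr p) \<partial>?S)" for U R
    using ae by (intro nn_integral_cong_AE) (auto elim: eventually_mono)
  have "in_Lp_loc_bdry e b1 b2 p g"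
    unfolding in_Lp_loc_bdry_def
  proof (intro conjI allI impI gm)
    fix K :: "'a set" assume K: "compact K"
    have "K \<in> sets ?S" unfolding slab_surface_eq using borel_compact[OF K] by (intro sets_completionI_sets) simp
    note [measurable] = this km gm
    have "set_integrable ?S K (\<lambda>x. \<bar>k x\<bar> powr p)" using k K by (simp add: is_trace_def in_Lp_loc_bdry_def)
    then show "set_integrable ?S K (\<lambda>x. \<bar>g x\<bar> powr p)"
      unfolding set_integrable_def
      by (rule integrable_cong_AE_imp) (measurable, use ae in \<open>auto elim: eventually_mono\<close>)
  qed
  then show ?thesis using k unfolding is_trace_def nn by blast
qed

lemma is_trace_Tr: "u \<in> hom_sobolev \<Omega> p \<Longrightarrow> is_trace e b1 b2 p u (Tr e b1 b2 p u)"
  unfolding Tr_def by (rule someI_ex[OF trace_exists])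

lemma trace_linear:
  assumes u: "u \<in> hom_sobolev \<Omega> p" and v: "v \<in> hom_sobolev \<Omega> p"
  shows "AE x in slab_surface e b1 b2. Tr e b1 b2 p (\<lambda>x. s * u x + t * v x) x = s * Tr e b1 b2 p u x + t * Tr e b1 b2 p v x"
    "(\<lambda>x. s * Tr e b1 b2 p u x + t * Tr e b1 b2 p v x) \<in> trace_space e b1 b2 p"
proof -
  have w: "(\<lambda>x. s * u x + t * v x) \<in> hom_sobolev \<Omega> p" by (rule hom_sobolev_linear(1)[OF u v])
  show ae: "AE x in slab_surface e b1 b2. Tr e b1 b2 p (\<lambda>x. s * u x + t * v x) x = s * Tr e b1 b2 p u x + t * Tr e b1 b2 p v x"
    by (rule trace_linear_unique[OF u v is_trace_Tr[OF u] is_trace_Tr[OF v] is_trace_Tr[OF w]])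
  show "(\<lambda>x. s * Tr e b1 b2 p u x + t * Tr e b1 b2 p v x) \<in> trace_space e b1 b2 p"
    unfolding trace_space_def using w is_trace_cong_AE[OF is_trace_Tr[OF w] ae] by blast
qed

text \<open>\<open>Tr\<close> is linear only up to null sets of the surface measure. Since
  \<open>\<Lambda>\<close> does not see these, its composition with \<open>Tr\<close> is linear
  exactly.\<close>

lemma functional_linear:
  assumes \<Psi>: "linear_functional (lebesgue_on \<Omega>) (hom_sobolev \<Omega> p) \<Psi>"
    and \<Lambda>: "linear_functional (slab_surface e b1 b2) (trace_space e b1 b2 p) \<Lambda>"
    and u: "u \<in> hom_sobolev \<Omega> p" and v: "v \<in> hom_sobolev \<Omega> p"
  shows "\<Psi> (\<lambda>x. s * u x + t * v x) + \<Lambda> (Tr e b1 b2 p (\<lambda>x. s * u x + t * v x))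
    = s * (\<Psi> u + \<Lambda> (Tr e b1 b2 p u)) + t * (\<Psi> v + \<Lambda> (Tr e b1 b2 p v))"
proof -
  have su: "(\<lambda>x. s * u x) \<in> hom_sobolev \<Omega> p" and tv: "(\<lambda>x. t * v x) \<in> hom_sobolev \<Omega> p"
    using hom_sobolev_linear(1)[OF u u, of s 0] hom_sobolev_linear(1)[OF v v, of t 0] by simp_all
  have 1: "\<Psi> (\<lambda>x. s * u x + t * v x) = s * \<Psi> u + t * \<Psi> v"
    by (rule linear_functional_combination[OF \<Psi> u su v tv])
  let ?g = "Tr e b1 b2 p u" and ?h = "Tr e b1 b2 p v"
  have w: "(\<lambda>x. s * u x + t * v x) \<in> hom_sobolev \<Omega> p" by (rule hom_sobolev_linear(1)[OF u v])
  have tr: "Tr e b1 b2 p u \<in> trace_space e b1 b2 p" if "u \<in> hom_sobolev \<Omega> p" for u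
    unfolding trace_space_def using is_trace_Tr[OF that] that by blast
  note mem = tr[OF u] tr[OF v] tr[OF w]
  have sg: "(\<lambda>x. s * ?g x) \<in> trace_space e b1 b2 p" and th: "(\<lambda>x. t * ?h x) \<in> trace_space e b1 b2 p"
    using trace_linear(2)[OF u u, of s 0] trace_linear(2)[OF v v, of t 0] by simp_all
  have "\<Lambda> (Tr e b1 b2 p (\<lambda>x. s * u x + t * v x)) = \<Lambda> (\<lambda>x. s * ?g x + t * ?h x)"
    by (rule linear_functional_cong_AE[OF \<Lambda> mem(3) trace_linear(2,1)[OF u v]])
  also have "\<dots> = s * \<Lambda> ?g + t * \<Lambda> ?h"
    by (rule linear_functional_combination[OF \<Lambda> mem(1) sg mem(2) th])
  finally show ?thesis using 1 by (simp add: algebra_simps)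
qed

lemma zero_in_hom_sobolev: "(\<lambda>_. 0) \<in> hom_sobolev \<Omega> p"
proof -
  have "weak_pair \<Omega> (\<lambda>_. 0) (\<lambda>_. 0)"
    using weak_pair_linear[OF weak_pair_const[OF open_slab] weak_pair_const[OF open_slab], of 0 0] by simp
  then have "represents (\<lambda>_. 0) (\<lambda>_. 0) (\<lambda>_. 0)" using p by (simp add: represents_def)
  then show ?thesis by (rule represents_hom_sobolev(1))
qed

lemma admissible_Lagrangian_imp_Lagrangian:
  assumes "admissible_Lagrangian \<Omega> p G A \<psi>"
  obtains B \<psi>' where "Lagrangian (lebesgue_on \<Omega>) p G A B \<psi> \<psi>'"
proof -
  interpret complete_measure "lebesgue_on \<Omega>" by (rule complete_measure_lebesgue_on[OF slab_borel])
  have L1: "integrable (lebesgue_on \<Omega>) f" if "in_Lp (lebesgue_on \<Omega>) 1 f" for f :: "'a \<Rightarrow> real"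
    using that integrable_norm_cancel[of "lebesgue_on \<Omega>" f] by (simp add: in_Lp_def)
  obtain B \<psi>' where "0 < B" "in_Lp (lebesgue_on \<Omega>) (conj_exp p) \<psi>'"
    "AE x in lebesgue_on \<Omega>. \<forall>\<xi>. norm (grad (G x) \<xi>) \<le> \<psi>' x + B * norm \<xi> powr (p - 1)"
    using assms unfolding admissible_Lagrangian_def by blast
  then have "Lagrangian (lebesgue_on \<Omega>) p G A B \<psi> \<psi>'"
    using assms p L1 by unfold_locales (auto simp: admissible_Lagrangian_def)
  then show ?thesis by (rule that)
qed

text \<open>The weak formulation represents the functional by the field \<open>grad (G x)\<close> at
  the solution, to which \<open>grad_functional_bounded\<close> applies.\<close>

lemma weak_solution_bounded:
  assumes adm: "admissible_Lagrangian \<Omega> p G A \<psi>" and u: "neumann_weak_solution e b1 b2 p G \<Psi> \<Lambda> u"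
  shows "\<exists>C>0. \<forall>v\<in>hom_sobolev \<Omega> p. \<bar>\<Psi> v + \<Lambda> (Tr e b1 b2 p v)\<bar> \<le> C * hom_seminorm \<Omega> p v"
proof -
  obtain B \<psi>' where "Lagrangian (lebesgue_on \<Omega>) p G A B \<psi> \<psi>'"
    by (rule admissible_Lagrangian_imp_Lagrangian[OF adm]) (rule that)
  then interpret Lagrangian "lebesgue_on \<Omega>" p G A B \<psi> \<psi>' .
  have "u \<in> hom_sobolev \<Omega> p" using u by (simp add: neumann_weak_solution_def)
  from grad_functional_bounded[OF weak_grad_in_Lp[OF this]]
  obtain C where "0 < C" "\<And>E. in_Lp (lebesgue_on \<Omega>) p E \<Longrightarrow>
     \<bar>LINT x|lebesgue_on \<Omega>. grad (G x) (weak_grad \<Omega> u x) \<bullet> E x\<bar> \<le> C * Lp_norm (lebesgue_on \<Omega>) p E" by blast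
  note C = this
  have "\<bar>\<Psi> v + \<Lambda> (Tr e b1 b2 p v)\<bar> \<le> C * hom_seminorm \<Omega> p v" if v: "v \<in> hom_sobolev \<Omega> p" for v
  proof -
    have "\<Psi> v + \<Lambda> (Tr e b1 b2 p v) = (LINT x|lebesgue_on \<Omega>. grad (G x) (weak_grad \<Omega> u x) \<bullet> weak_grad \<Omega> v x)"
      using u v by (simp add: neumann_weak_solution_def)
    then show ?thesis using C(2)[OF weak_grad_in_Lp[OF v]] by (simp add: hom_seminorm_def)
  qed
  then show ?thesis using C(1) by blast
qed

lemma hom_seminorm_scale:
  assumes "v \<in> hom_sobolev \<Omega> p"
  shows "(\<lambda>x. a * v x) \<in> hom_sobolev \<Omega> p" "hom_seminorm \<Omega> p (\<lambda>x. a * v x) = \<bar>a\<bar> * hom_seminorm \<Omega> p v"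
    "AE x in lebesgue_on \<Omega>. weak_grad \<Omega> (\<lambda>x. a * v x) x = a *\<^sub>R weak_grad \<Omega> v x"
proof -
  show av: "(\<lambda>x. a * v x) \<in> hom_sobolev \<Omega> p" using hom_sobolev_linear(1)[OF assms assms, of a 0] by simp
  show ae: "AE x in lebesgue_on \<Omega>. weak_grad \<Omega> (\<lambda>x. a * v x) x = a *\<^sub>R weak_grad \<Omega> v x"
    using hom_sobolev_linear(2)[OF assms assms, of a 0] by simp
  note [measurable] = in_LpD(1)[OF weak_grad_in_Lp[OF av]] in_LpD(1)[OF weak_grad_in_Lp[OF assms]]
  have "hom_seminorm \<Omega> p (\<lambda>x. a * v x) = Lp_norm (lebesgue_on \<Omega>) p (\<lambda>x. a *\<^sub>R weak_grad \<Omega> v x)"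
    unfolding hom_seminorm_def by (rule Lp_norm_cong_AE[OF _ _ ae]) measurable
  then show "hom_seminorm \<Omega> p (\<lambda>x. a * v x) = \<bar>a\<bar> * hom_seminorm \<Omega> p v"
    using p by (simp add: Lp_norm_scaleR hom_seminorm_def)
qed

text \<open>\<open>dual_norm\<close> is a supremum of reals, so boundedness by some \<open>C\<close>
  must come first. The bound by \<open>C\<close> also settles the case of seminorm 0, where
  normalising is impossible.\<close>

lemma dual_norm_bound:
  assumes C: "\<And>v. v \<in> hom_sobolev \<Omega> p \<Longrightarrow> \<bar>T v\<bar> \<le> C * hom_seminorm \<Omega> p v" and "0 < C"
    and T: "\<And>a v. v \<in> hom_sobolev \<Omega> p \<Longrightarrow> T (\<lambda>x. a * v x) = a * T v"
    and u: "u \<in> hom_sobolev \<Omega> p"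
  shows "T u \<le> dual_norm \<Omega> p T * hom_seminorm \<Omega> p u" "0 \<le> dual_norm \<Omega> p T"
proof -
  let ?S = "{v \<in> hom_sobolev \<Omega> p. hom_seminorm \<Omega> p v \<le> 1}"
  have bdd: "bdd_above ((\<lambda>v. \<bar>T v\<bar>) ` ?S)"
  proof (rule bdd_aboveI2)
    fix v assume v: "v \<in> ?S"
    then have "\<bar>T v\<bar> \<le> C * hom_seminorm \<Omega> p v" using C by blast
    also have "\<dots> \<le> C * 1" using v \<open>0 < C\<close> by (intro mult_left_mono) auto
    finally show "\<bar>T v\<bar> \<le> C * 1" .
  qed
  have le: "\<bar>T v\<bar> \<le> dual_norm \<Omega> p T" if "v \<in> ?S" for v
    unfolding dual_norm_def using bdd that by (intro cSUP_upper)
  \<comment> \<open>A member of the unit ball is needed so that the supremum dominates some absolute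
    value and is therefore nonnegative.\<close>
  have "(\<lambda>x. 0 * u x) \<in> ?S" using hom_seminorm_scale(1,2)[OF u, of 0] by simp
  from order_trans[OF abs_ge_zero le[OF this]] show "0 \<le> dual_norm \<Omega> p T" .
  define s where "s = hom_seminorm \<Omega> p u"
  have "0 \<le> s" by (simp add: s_def hom_seminorm_def Lp_norm_def)
  show "T u \<le> dual_norm \<Omega> p T * hom_seminorm \<Omega> p u"
  proof (cases "s = 0")
    case True
    then show ?thesis using C[OF u] by (simp add: s_def)
  next
    case False
    then have s: "0 < s" using \<open>0 \<le> s\<close> by simp
    have "(\<lambda>x. (1/s) * u x) \<in> ?S"
      using hom_seminorm_scale(1,2)[OF u, of "1/s"] s by (simp add: s_def[symmetric])
    from le[OF this, unfolded T[OF u]] have "\<bar>T u\<bar> / s \<le> dual_norm \<Omega> p T"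
      using s by (simp add: abs_mult)
    then show ?thesis using s by (simp add: field_simps s_def[symmetric])
  qed
qed

text \<open>Testing with the solution turns the gradient integral of
  \<open>gradient_energy_bound\<close> into the functional at the solution; Young's inequality with
  \<open>A / 2\<close> absorbs it, and multiplication by \<open>2 / A\<close> gives both
  constants.\<close>

lemma weak_solution_estimate:
  assumes adm: "admissible_Lagrangian \<Omega> p G A \<psi>" and u: "neumann_weak_solution e b1 b2 p G \<Psi> \<Lambda> u"
  shows "(LINT x|lebesgue_on \<Omega>. norm (weak_grad \<Omega> u x) powr p)
    \<le> 2 / A * (LINT x|lebesgue_on \<Omega>. \<bar>G x 0\<bar> + \<bar>\<psi> x\<bar>)
      + 2 / A * (1 / (A / 2)) powr (1 / (p - 1)) * dual_norm \<Omega> p (\<lambda>v. \<Psi> v + \<Lambda> (Tr e b1 b2 p v)) powr conj_exp p"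
proof -
  obtain B \<psi>' where "Lagrangian (lebesgue_on \<Omega>) p G A B \<psi> \<psi>'"
    by (rule admissible_Lagrangian_imp_Lagrangian[OF adm]) (rule that)
  then interpret Lagrangian "lebesgue_on \<Omega>" p G A B \<psi> \<psi>' .
  define T where "T v = \<Psi> v + \<Lambda> (Tr e b1 b2 p v)" for v
  have uH: "u \<in> hom_sobolev \<Omega> p" and weak: "\<And>v. v \<in> hom_sobolev \<Omega> p \<Longrightarrow>
      T v = (LINT x|lebesgue_on \<Omega>. grad (G x) (weak_grad \<Omega> u x) \<bullet> weak_grad \<Omega> v x)"
    using u by (auto simp: neumann_weak_solution_def T_def)
  note uL = weak_grad_in_Lp[OF uH]
  obtain C where C: "0 < C" "\<And>v. v \<in> hom_sobolev \<Omega> p \<Longrightarrow> \<bar>T v\<bar> \<le> C * hom_seminorm \<Omega> p v"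
    using weak_solution_bounded[OF adm u] unfolding T_def by blast
  \<comment> \<open>Homogeneity is read off the weak formulation, whose left side is linear in the
    weak gradient of the test function.\<close>
  have hom: "T (\<lambda>x. a * v x) = a * T v" if v: "v \<in> hom_sobolev \<Omega> p" for a v
  proof -
    note av = hom_seminorm_scale(1,3)[OF v, of a]
    have "T (\<lambda>x. a * v x) = (LINT x|lebesgue_on \<Omega>. a * (grad (G x) (weak_grad \<Omega> u x) \<bullet> weak_grad \<Omega> v x))"
      unfolding weak[OF av(1)]
      using grad_inner_integrable[OF uL weak_grad_in_Lp[OF v]] grad_inner_integrable[OF uL weak_grad_in_Lp[OF av(1)]] av(2)
      by (intro integral_cong_AE) (auto elim: eventually_mono)
    then show ?thesis using weak[OF v] by simp
  qed
  define K where "K = dual_norm \<Omega> p T"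
  define s where "s = hom_seminorm \<Omega> p u"
  define I where "I = (LINT x|lebesgue_on \<Omega>. \<bar>G x 0\<bar> + \<bar>\<psi> x\<bar>)"
  have K: "T u \<le> K * s" "0 \<le> K" unfolding K_def s_def using dual_norm_bound[OF C(2,1) hom uH] by auto
  have s: "0 \<le> s" "s powr p = (LINT x|lebesgue_on \<Omega>. norm (weak_grad \<Omega> u x) powr p)"
    using p by (simp_all add: s_def hom_seminorm_def Lp_norm_powr) (simp add: Lp_norm_def)
  have "A * s powr p \<le> I + T u"
    using gradient_energy_bound[OF uL] weak[OF uH] by (simp add: s(2) I_def)
  also have "\<dots> \<le> I + (A / 2 * s powr p + (1 / (A / 2)) powr (1 / (p - 1)) * K powr conj_exp p)"
    using K(1) Young_absorb[of "A / 2" p s K] A p s(1) K(2) by simp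
  finally have "A / 2 * s powr p \<le> I + (1 / (A / 2)) powr (1 / (p - 1)) * K powr conj_exp p" by simp
  then have "2 / A * (A / 2 * s powr p) \<le> 2 / A * (I + (1 / (A / 2)) powr (1 / (p - 1)) * K powr conj_exp p)"
    using A by (intro mult_left_mono) auto
  moreover have "2 / A * (A / 2 * s powr p) = s powr p" using A by simp
  ultimately show ?thesis
    unfolding s(2)[symmetric] I_def[symmetric] T_def[symmetric] K_def[symmetric] by (simp only: distrib_left mult.assoc)
qed

lemma weak_solution_minimizes:
  assumes adm: "admissible_Lagrangian \<Omega> p G A \<psi>" and u: "neumann_weak_solution e b1 b2 p G \<Psi> \<Lambda> u"
    and v: "v \<in> hom_sobolev \<Omega> p"
  shows "energy e b1 b2 p G \<Psi> \<Lambda> u \<le> energy e b1 b2 p G \<Psi> \<Lambda> v"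
proof -
  obtain B \<psi>' where "Lagrangian (lebesgue_on \<Omega>) p G A B \<psi> \<psi>'"
    by (rule admissible_Lagrangian_imp_Lagrangian[OF adm]) (rule that)
  then interpret Lagrangian "lebesgue_on \<Omega>" p G A B \<psi> \<psi>' .
  have uH: "u \<in> hom_sobolev \<Omega> p" using u by (simp add: neumann_weak_solution_def)
  show ?thesis
    using integral_above_tangent[OF weak_grad_in_Lp[OF uH] weak_grad_in_Lp[OF v]] u uH v
    by (simp add: neumann_weak_solution_def energy_def)
qed

text \<open>The functional is transported to the space \<open>V\<close> of gradients, where the
  abstract existence theorem applies; a function with the resulting gradient solves the
  problem.\<close>

lemma weak_solution_exists:
  assumes adm: "admissible_Lagrangian \<Omega> p G A \<psi>"
    and \<Psi>: "linear_functional (lebesgue_on \<Omega>) (hom_sobolev \<Omega> p) \<Psi>"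
    and \<Lambda>: "linear_functional (slab_surface e b1 b2) (trace_space e b1 b2 p) \<Lambda>"
    and C: "\<And>v. v \<in> hom_sobolev \<Omega> p \<Longrightarrow> \<bar>\<Psi> v + \<Lambda> (Tr e b1 b2 p v)\<bar> \<le> C * hom_seminorm \<Omega> p v"
  shows "\<exists>u. neumann_weak_solution e b1 b2 p G \<Psi> \<Lambda> u"
proof -
  let ?M = "lebesgue_on \<Omega>" and ?H = "hom_sobolev \<Omega> p"
  define T where "T v = \<Psi> v + \<Lambda> (Tr e b1 b2 p v)" for v
  have T_lin: "T (\<lambda>x. s * u x + t * v x) = s * T u + t * T v" if "u \<in> ?H" "v \<in> ?H" for s t u v
    unfolding T_def by (rule functional_linear[OF \<Psi> \<Lambda> that])
  have T_bd: "\<bar>T v\<bar> \<le> C * hom_seminorm \<Omega> p v" if "v \<in> ?H" for v using C[OF that] by (simp add: T_def)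
  define V where "V = {D. in_Lp ?M p D \<and> (\<exists>u\<in>?H. AE x in ?M. D x = weak_grad \<Omega> u x)}"
  \<comment> \<open>Evaluates the functional at some function with gradient \<open>D\<close>; by
    \<open>T_eq\<close> the choice does not matter.\<close>
  define S where "S D = T (SOME u. u \<in> ?H \<and> (AE x in ?M. D x = weak_grad \<Omega> u x))" for D
  \<comment> \<open>The difference of two functions with the same gradient has seminorm 0, so the
    assumed bound makes the functional vanish on it.\<close>
  have T_eq: "T u = T v" if u: "u \<in> ?H" and v: "v \<in> ?H" and ae: "AE x in ?M. weak_grad \<Omega> u x = weak_grad \<Omega> v x" for u v
  proof -
    note w = hom_sobolev_linear[OF u v, of 1 "-1"]
    have "AE x in ?M. weak_grad \<Omega> (\<lambda>x. 1 * u x + (-1) * v x) x = 0"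
      using w(2) ae by eventually_elim simp
    then have "hom_seminorm \<Omega> p (\<lambda>x. 1 * u x + (-1) * v x) = Lp_norm ?M p (\<lambda>x. 0 :: 'a)"
      unfolding hom_seminorm_def by (intro Lp_norm_cong_AE in_LpD(1)[OF weak_grad_in_Lp[OF w(1)]]) auto
    then show ?thesis using T_bd[OF w(1)] T_lin[OF u v, of 1 "-1"] p by (simp add: Lp_norm_def)
  qed
  have S_eq: "S D = T u" if u: "u \<in> ?H" and ae: "AE x in ?M. D x = weak_grad \<Omega> u x" for D u
  proof -
    define w where "w = (SOME u. u \<in> ?H \<and> (AE x in ?M. D x = weak_grad \<Omega> u x))"
    have "w \<in> ?H \<and> (AE x in ?M. D x = weak_grad \<Omega> w x)"
      unfolding w_def by (rule someI[of "\<lambda>u. u \<in> ?H \<and> (AE x in ?M. D x = weak_grad \<Omega> u x)" u]) (use u ae in blast)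
    then have w: "w \<in> ?H" "AE x in ?M. D x = weak_grad \<Omega> w x" by auto
    have "AE x in ?M. weak_grad \<Omega> w x = weak_grad \<Omega> u x" using w(2) ae by eventually_elim simp
    from T_eq[OF w(1) u this] show ?thesis by (simp add: S_def w_def)
  qed
  have lin: "\<exists>w\<in>?H. (AE x in ?M. s *\<^sub>R D x + t *\<^sub>R E x = weak_grad \<Omega> w x) \<and> T w = s * S D + t * S E"
    if D: "D \<in> V" and E: "E \<in> V" for D E s t
  proof -
    obtain u v where u: "u \<in> ?H" "AE x in ?M. D x = weak_grad \<Omega> u x" and v: "v \<in> ?H" "AE x in ?M. E x = weak_grad \<Omega> v x"
      using D E by (auto simp: V_def)
    note w = hom_sobolev_linear[OF u(1) v(1), of s t]
    have "AE x in ?M. s *\<^sub>R D x + t *\<^sub>R E x = weak_grad \<Omega> (\<lambda>x. s * u x + t * v x) x"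
      using w(2) u(2) v(2) by eventually_elim simp
    then show ?thesis using w(1) T_lin[OF u(1) v(1), of s t] S_eq[OF u] S_eq[OF v] by auto
  qed
  obtain B \<psi>' where "Lagrangian ?M p G A B \<psi> \<psi>'"
    by (rule admissible_Lagrangian_imp_Lagrangian[OF adm]) (rule that)
  then interpret Lagrangian ?M p G A B \<psi> \<psi>' .
  interpret Lagrangian_on_subspace ?M p G A B \<psi> \<psi>' V S C
  proof
    show "in_Lp ?M p D" if "D \<in> V" for D using that by (simp add: V_def)
    have "weak_grad \<Omega> (\<lambda>_. 0) \<in> V"
      using zero_in_hom_sobolev weak_grad_in_Lp[OF zero_in_hom_sobolev] by (auto simp: V_def intro!: bexI[of _ "\<lambda>_. 0"])
    then show "V \<noteq> {}" by blast
    show "(\<lambda>x. s *\<^sub>R D x + t *\<^sub>R E x) \<in> V" if "D \<in> V" "E \<in> V" for D E s t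
      using lin[OF that, of s t] that p in_Lp_add_scaleR[of p ?M D E s t] by (auto simp: V_def)
    show "S (\<lambda>x. s *\<^sub>R D x + t *\<^sub>R E x) = s * S D + t * S E" if "D \<in> V" "E \<in> V" for D E s t
      using lin[OF that, of s t] S_eq by metis
    show "\<bar>S D\<bar> \<le> C * Lp_norm ?M p D" if D: "D \<in> V" for D
    proof -
      obtain u where u: "u \<in> ?H" "AE x in ?M. D x = weak_grad \<Omega> u x" and DL: "in_Lp ?M p D" using D by (auto simp: V_def)
      have "Lp_norm ?M p D = hom_seminorm \<Omega> p u"
        unfolding hom_seminorm_def by (rule Lp_norm_cong_AE[OF in_LpD(1)[OF DL] in_LpD(1)[OF weak_grad_in_Lp[OF u(1)]] u(2)])
      then show ?thesis using T_bd[OF u(1)] S_eq[OF u] by simp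
    qed
    show "E \<in> V" if D: "\<And>n::nat. D n \<in> V" and E: "in_Lp ?M p E"
      and lim: "(\<lambda>n. \<integral>\<^sup>+x. ennreal (norm (D n x - E x) powr p) \<partial>?M) \<longlonglongrightarrow> 0" for D E
    proof -
      have "\<forall>n. \<exists>u. u \<in> ?H \<and> (AE x in ?M. D n x = weak_grad \<Omega> u x)" using D by (auto simp: V_def)
      from choice[OF this] obtain u where u: "\<And>n. u n \<in> ?H" "\<And>n. AE x in ?M. D n x = weak_grad \<Omega> (u n) x" by blast
      have "(\<integral>\<^sup>+x. ennreal (norm (weak_grad \<Omega> (u n) x - E x) powr p) \<partial>?M) = (\<integral>\<^sup>+x. ennreal (norm (D n x - E x) powr p) \<partial>?M)" for n
        using u(2)[of n] by (intro nn_integral_cong_AE) (auto elim: eventually_mono)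
      with lim have "(\<lambda>n. \<integral>\<^sup>+x. ennreal (norm (weak_grad \<Omega> (u n) x - E x) powr p) \<partial>?M) \<longlonglongrightarrow> 0" by simp
      from hom_sobolev_complete[OF u(1) E this] show ?thesis using E by (simp add: V_def)
    qed
  qed
  obtain D where D: "D \<in> V" and EL: "\<And>E. E \<in> V \<Longrightarrow> (LINT x|?M. grad (G x) (D x) \<bullet> E x) = S E"
    using Euler_Lagrange_solution_exists by blast
  have "in_Lp ?M p D \<and> (\<exists>u\<in>?H. AE x in ?M. D x = weak_grad \<Omega> u x)" using D by (simp add: V_def)
  then obtain u where u: "u \<in> ?H" "AE x in ?M. D x = weak_grad \<Omega> u x" and DL: "in_Lp ?M p D" by blast
  have "(LINT x|?M. grad (G x) (weak_grad \<Omega> u x) \<bullet> weak_grad \<Omega> v x) = \<Psi> v + \<Lambda> (Tr e b1 b2 p v)" if v: "v \<in> ?H" for v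
  proof -
    note vL = weak_grad_in_Lp[OF v]
    have "(LINT x|?M. grad (G x) (weak_grad \<Omega> u x) \<bullet> weak_grad \<Omega> v x) = (LINT x|?M. grad (G x) (D x) \<bullet> weak_grad \<Omega> v x)"
      using grad_inner_integrable[OF DL vL] grad_inner_integrable[OF weak_grad_in_Lp[OF u(1)] vL] u(2)
      by (intro integral_cong_AE) (auto elim: eventually_mono)
    also have "\<dots> = S (weak_grad \<Omega> v)" using v vL by (intro EL) (auto simp: V_def)
    also have "\<dots> = T v" by (rule S_eq[OF v]) simp
    finally show ?thesis by (simp add: T_def)
  qed
  then show ?thesis using u(1) by (auto simp: neumann_weak_solution_def)
qed

end

theorem theorem6p5:
  fixes p A :: real
  assumes "DIM('a::euclidean_space) \<ge> 2" and "1 < p" and "0 < A"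
  shows "\<exists>c>0. \<forall>(e::'a) b1 b2 \<Psi> \<Lambda> G \<psi>.
    e \<in> Basis \<longrightarrow> b1 < b2 \<longrightarrow>
    linear_functional (lebesgue_on (slab e b1 b2)) (hom_sobolev (slab e b1 b2) p) \<Psi> \<longrightarrow>
    linear_functional (slab_surface e b1 b2) (trace_space e b1 b2 p) \<Lambda> \<longrightarrow>
    (\<forall>k::real. \<Psi> (\<lambda>_. k) + \<Lambda> (\<lambda>_. k) = 0) \<longrightarrow>
    admissible_Lagrangian (slab e b1 b2) p G A \<psi> \<longrightarrow>
    ((\<exists>u. neumann_weak_solution e b1 b2 p G \<Psi> \<Lambda> u) \<longleftrightarrow>
     (\<exists>C>0. \<forall>v\<in>hom_sobolev (slab e b1 b2) p.
        \<bar>\<Psi> v + \<Lambda> (Tr e b1 b2 p v)\<bar> \<le> C * hom_seminorm (slab e b1 b2) p v)) \<and>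
    (\<forall>u. neumann_weak_solution e b1 b2 p G \<Psi> \<Lambda> u \<longrightarrow>
      (LINT x|lebesgue_on (slab e b1 b2). norm (weak_grad (slab e b1 b2) u x) powr p)
        \<le> c * (LINT x|lebesgue_on (slab e b1 b2). \<bar>G x 0\<bar> + \<bar>\<psi> x\<bar>)
          + c * dual_norm (slab e b1 b2) p (\<lambda>v. \<Psi> v + \<Lambda> (Tr e b1 b2 p v)) powr conj_exp p \<and>
      (\<forall>v\<in>hom_sobolev (slab e b1 b2) p.
        energy e b1 b2 p G \<Psi> \<Lambda> u \<le> energy e b1 b2 p G \<Psi> \<Lambda> v))"
proof -
  \<comment> \<open>The two constants of the a priori estimate; their sum dominates both and depends
    only on \<open>A\<close> and \<open>p\<close>, so it can be fixed before all other data.\<close>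
  define c1 c2 c where "c1 = 2 / A" and "c2 = 2 / A * (1 / (A / 2)) powr (1 / (p - 1))" and "c = c1 + c2"
  have c: "0 < c1" "0 \<le> c2" "0 < c" "c1 \<le> c" "c2 \<le> c"
    using \<open>0 < A\<close> by (auto simp: c1_def c2_def c_def intro!: add_pos_nonneg)
  show ?thesis
  proof (rule exI[of _ c], intro conjI[OF c(3)] allI impI)
    fix e :: 'a and b1 b2 :: real and \<Psi> \<Lambda> :: "('a \<Rightarrow> real) \<Rightarrow> real" and G :: "'a \<Rightarrow> 'a \<Rightarrow> real" and \<psi> :: "'a \<Rightarrow> real"
    assume e: "e \<in> Basis" "b1 < b2"
      and \<Psi>: "linear_functional (lebesgue_on (slab e b1 b2)) (hom_sobolev (slab e b1 b2) p) \<Psi>"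
      and \<Lambda>: "linear_functional (slab_surface e b1 b2) (trace_space e b1 b2 p) \<Lambda>"
      and adm: "admissible_Lagrangian (slab e b1 b2) p G A \<psi>"
    interpret slab_data e b1 b2 p using e \<open>1 < p\<close> by unfold_locales
    show "((\<exists>u. neumann_weak_solution e b1 b2 p G \<Psi> \<Lambda> u) \<longleftrightarrow>
     (\<exists>C>0. \<forall>v\<in>hom_sobolev \<Omega> p. \<bar>\<Psi> v + \<Lambda> (Tr e b1 b2 p v)\<bar> \<le> C * hom_seminorm \<Omega> p v)) \<and>
    (\<forall>u. neumann_weak_solution e b1 b2 p G \<Psi> \<Lambda> u \<longrightarrow>
      (LINT x|lebesgue_on \<Omega>. norm (weak_grad \<Omega> u x) powr p)
        \<le> c * (LINT x|lebesgue_on \<Omega>. \<bar>G x 0\<bar> + \<bar>\<psi> x\<bar>)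
          + c * dual_norm \<Omega> p (\<lambda>v. \<Psi> v + \<Lambda> (Tr e b1 b2 p v)) powr conj_exp p \<and>
      (\<forall>v\<in>hom_sobolev \<Omega> p. energy e b1 b2 p G \<Psi> \<Lambda> u \<le> energy e b1 b2 p G \<Psi> \<Lambda> v))"
    proof (intro conjI iffI allI impI ballI)
      assume "\<exists>u. neumann_weak_solution e b1 b2 p G \<Psi> \<Lambda> u"
      then show "\<exists>C>0. \<forall>v\<in>hom_sobolev \<Omega> p. \<bar>\<Psi> v + \<Lambda> (Tr e b1 b2 p v)\<bar> \<le> C * hom_seminorm \<Omega> p v"
        using weak_solution_bounded[OF adm] by blast
    next
      assume "\<exists>C>0. \<forall>v\<in>hom_sobolev \<Omega> p. \<bar>\<Psi> v + \<Lambda> (Tr e b1 b2 p v)\<bar> \<le> C * hom_seminorm \<Omega> p v"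
      then show "\<exists>u. neumann_weak_solution e b1 b2 p G \<Psi> \<Lambda> u"
        using weak_solution_exists[OF adm \<Psi> \<Lambda>] by blast
    next
      fix u assume u: "neumann_weak_solution e b1 b2 p G \<Psi> \<Lambda> u"
      let ?I = "LINT x|lebesgue_on \<Omega>. \<bar>G x 0\<bar> + \<bar>\<psi> x\<bar>"
      let ?K = "dual_norm \<Omega> p (\<lambda>v. \<Psi> v + \<Lambda> (Tr e b1 b2 p v)) powr conj_exp p"
      have "(LINT x|lebesgue_on \<Omega>. norm (weak_grad \<Omega> u x) powr p) \<le> c1 * ?I + c2 * ?K"
        using weak_solution_estimate[OF adm u] by (simp add: c1_def c2_def)
      also have "\<dots> \<le> c * ?I + c * ?K" using c by (intro add_mono mult_right_mono) auto
      finally show "(LINT x|lebesgue_on \<Omega>. norm (weak_grad \<Omega> u x) powr p) \<le> c * ?I + c * ?K" .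
      show "energy e b1 b2 p G \<Psi> \<Lambda> u \<le> energy e b1 b2 p G \<Psi> \<Lambda> v" if "v \<in> hom_sobolev \<Omega> p" for v
        by (rule weak_solution_minimizes[OF adm u that])
    qed
  qed
qed

end
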